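(* Let $\mathcal{A}$ be an essentially small hereditary abelian category, linear over the finite field $\mathbf{k}=\mathbb{F}_q$, with finite morphism and extension spaces. For any objects $A,B,C,M\in\mathcal{A}$, the $\Delta$-Hall numbers satisfy $$\sum_{[X]\in\mathrm{Iso}(\mathcal{A})}\widehat{F}_{AB}^X\,\widehat{F}_{XC}^M=\sum_{[Y]\in\mathrm{Iso}(\mathcal{A})}\widehat{F}_{AY}^M\,\widehat{F}_{BC}^Y .$$
   Context: $\mathbf{k}=\mathbb{F}_q$ is a finite field with $q$ elements and $\mathbf{v}=\sqrt{q}$. $\mathcal{A}$ is an essentially small hereditary $\mathbf{k}$-linear abelian category with $|\mathrm{Hom}_{\mathcal{A}}(M,N)|<\infty$ and $|\mathrm{Ext}^1_{\mathcal{A}}(M,N)|<\infty$ for all $M,N$. $\mathrm{Iso}(\mathcal{A})$ is the set of isomorphism classes $[M]$ of objects; $a_M=|\mathrm{Aut}(M)|$. Hall number: $F_{AB}^M=|\{X\subseteq M\mid X\cong B,\ M/X\cong A\}|$. Euler form: $\langle M,N\rangle=\dim_{\mathbf{k}}\mathrm{Hom}_{\mathcal{A}}(M,N)-\dim_{\mathbf{k}}\mathrm{Ext}^1_{\mathcal{A}}(M,N)$. For $L,I,N\in\mathcal{A}$ put $\langle L,I,N\rangle=\langle L,I\rangle+\langle I,I\rangle+\langle I,N\rangle-\langle L,N\rangle$. The $\Delta$-Hall number of $A,B,M\in\mathcal{A}$ is $$\widehat{F}^M_{AB}=\sum_{[L],[I],[N]\in\mathrm{Iso}(\mathcal{A})}\mathbf{v}^{\langle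 L,I,N\rangle}\cdot\frac{a_La_Ia_N}{a_M}\cdot F_{LI}^B\,F_{NL}^M\,F_{IN}^A .$$ *)

theory Defs
  imports "HOL-Analysis.Infinite_Sum" "Jordan_Normal_Form.Missing_VectorSpace"
begin

section \<open>Linear abelian categories\<close>

text \<open>A category is given by a set of objects and a set of arrows, each arrow having one domain and
  one codomain, so that distinct hom-sets are disjoint.  Values outside these sets are irrelevant.
  As the objects form a set of some type, such a category is small; conversely an essentially small
  category is equivalent to one of this form.\<close>

record ('o, 'm, 'k) lin_cat =
  Ob :: "'o set"
  Arr :: "'m set"
  Dom :: "'m \<Rightarrow> 'o"
  Cod :: "'m \<Rightarrow> 'o"
  Id :: "'o \<Rightarrow> 'm"
  Comp :: "'m \<Rightarrow> 'm \<Rightarrow> 'm"  (infixr "\<odot>\<index>" 70)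
  Add :: "'m \<Rightarrow> 'm \<Rightarrow> 'm"
  Zero :: "'o \<Rightarrow> 'o \<Rightarrow> 'm"
  Scal :: "'k \<Rightarrow> 'm \<Rightarrow> 'm"

definition homset :: "('o, 'm, 'k, 'z) lin_cat_scheme \<Rightarrow> 'o \<Rightarrow> 'o \<Rightarrow> 'm set" where
  "homset C A B = {f \<in> Arr C. Dom C f = A \<and> Cod C f = B}"

text \<open>The ring multiplication and unit of a module record play no role for the module.\<close>

definition homspace :: "('o, 'm, 'k, 'z) lin_cat_scheme \<Rightarrow> 'o \<Rightarrow> 'o \<Rightarrow> ('k, 'm) module" where
  "homspace C A B =
     \<lparr>carrier = homset C A B, mult = undefined, one = undefined,
      zero = Zero C A B, add = Add C, smult = Scal C\<rparr>"

locale linear_category = field K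
  for K :: "('k, 'r) ring_scheme" (structure)
  and C :: "('o, 'm, 'k, 'z) lin_cat_scheme" (structure) +
  assumes dom_in_Ob: "f \<in> Arr C \<Longrightarrow> Dom C f \<in> Ob C"
    and cod_in_Ob: "f \<in> Arr C \<Longrightarrow> Cod C f \<in> Ob C"
    and id_in_hom: "A \<in> Ob C \<Longrightarrow> Id C A \<in> homset C A A"
    and comp_in_hom: "\<lbrakk>f \<in> homset C A B; g \<in> homset C B D\<rbrakk> \<Longrightarrow> g \<odot>\<^bsub>C\<^esub> f \<in> homset C A D"
    and comp_id: "f \<in> homset C A B \<Longrightarrow> f \<odot>\<^bsub>C\<^esub> Id C A = f"
    and id_comp: "f \<in> homset C A B \<Longrightarrow> Id C B \<odot>\<^bsub>C\<^esub> f = f"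
    and comp_assoc: "\<lbrakk>f \<in> homset C A B; g \<in> homset C B D; h \<in> homset C D E\<rbrakk>
          \<Longrightarrow> (h \<odot>\<^bsub>C\<^esub> g) \<odot>\<^bsub>C\<^esub> f = h \<odot>\<^bsub>C\<^esub> (g \<odot>\<^bsub>C\<^esub> f)"
    and hom_module: "\<lbrakk>A \<in> Ob C; B \<in> Ob C\<rbrakk> \<Longrightarrow> Module.module K (homspace C A B)"
    and comp_add: "\<lbrakk>f \<in> homset C A B; f' \<in> homset C A B; g \<in> homset C B D\<rbrakk>
          \<Longrightarrow> g \<odot>\<^bsub>C\<^esub> Add C f f' = Add C (g \<odot>\<^bsub>C\<^esub> f) (g \<odot>\<^bsub>C\<^esub> f')"
    and add_comp: "\<lbrakk>f \<in> homset C A B; g \<in> homset C B D; g' \<in> homset C B D\<rbrakk>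
          \<Longrightarrow> Add C g g' \<odot>\<^bsub>C\<^esub> f = Add C (g \<odot>\<^bsub>C\<^esub> f) (g' \<odot>\<^bsub>C\<^esub> f)"
    and comp_scal: "\<lbrakk>c \<in> carrier K; f \<in> homset C A B; g \<in> homset C B D\<rbrakk>
          \<Longrightarrow> g \<odot>\<^bsub>C\<^esub> Scal C c f = Scal C c (g \<odot>\<^bsub>C\<^esub> f)"
    and scal_comp: "\<lbrakk>c \<in> carrier K; f \<in> homset C A B; g \<in> homset C B D\<rbrakk>
          \<Longrightarrow> Scal C c g \<odot>\<^bsub>C\<^esub> f = Scal C c (g \<odot>\<^bsub>C\<^esub> f)"

definition monic :: "('o, 'm, 'k, 'z) lin_cat_scheme \<Rightarrow> 'm \<Rightarrow> bool" where
  "monic C f \<longleftrightarrow> f \<in> Arr C \<and>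
     (\<forall>A. \<forall>g \<in> homset C A (Dom C f). \<forall>h \<in> homset C A (Dom C f).
        f \<odot>\<^bsub>C\<^esub> g = f \<odot>\<^bsub>C\<^esub> h \<longrightarrow> g = h)"

definition epic :: "('o, 'm, 'k, 'z) lin_cat_scheme \<Rightarrow> 'm \<Rightarrow> bool" where
  "epic C f \<longleftrightarrow> f \<in> Arr C \<and>
     (\<forall>A. \<forall>g \<in> homset C (Cod C f) A. \<forall>h \<in> homset C (Cod C f) A.
        g \<odot>\<^bsub>C\<^esub> f = h \<odot>\<^bsub>C\<^esub> f \<longrightarrow> g = h)"

definition isos :: "('o, 'm, 'k, 'z) lin_cat_scheme \<Rightarrow> 'o \<Rightarrow> 'o \<Rightarrow> 'm set" where
  "isos C A B =
     {f \<in> homset C A B. \<exists>g \<in> homset C B A. g \<odot>\<^bsub>C\<^esub> f = Id C A \<and> f \<odot>\<^bsub>C\<^esub> g = Id C B}"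

definition isomorphic :: "('o, 'm, 'k, 'z) lin_cat_scheme \<Rightarrow> 'o \<Rightarrow> 'o \<Rightarrow> bool" where
  "isomorphic C A B \<longleftrightarrow> isos C A B \<noteq> {}"

definition zero_object :: "('o, 'm, 'k, 'z) lin_cat_scheme \<Rightarrow> 'o \<Rightarrow> bool" where
  "zero_object C Z \<longleftrightarrow> Z \<in> Ob C \<and>
     (\<forall>A \<in> Ob C. (\<exists>!f. f \<in> homset C A Z) \<and> (\<exists>!f. f \<in> homset C Z A))"

definition is_kernel :: "('o, 'm, 'k, 'z) lin_cat_scheme \<Rightarrow> 'm \<Rightarrow> 'm \<Rightarrow> bool" where
  "is_kernel C k f \<longleftrightarrow> k \<in> Arr C \<and> f \<in> Arr C \<and> Cod C k = Dom C f \<and>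
     f \<odot>\<^bsub>C\<^esub> k = Zero C (Dom C k) (Cod C f) \<and>
     (\<forall>A. \<forall>h \<in> homset C A (Dom C f). f \<odot>\<^bsub>C\<^esub> h = Zero C A (Cod C f) \<longrightarrow>
        (\<exists>!u. u \<in> homset C A (Dom C k) \<and> k \<odot>\<^bsub>C\<^esub> u = h))"

definition is_cokernel :: "('o, 'm, 'k, 'z) lin_cat_scheme \<Rightarrow> 'm \<Rightarrow> 'm \<Rightarrow> bool" where
  "is_cokernel C p f \<longleftrightarrow> p \<in> Arr C \<and> f \<in> Arr C \<and> Dom C p = Cod C f \<and>
     p \<odot>\<^bsub>C\<^esub> f = Zero C (Dom C f) (Cod C p) \<and>
     (\<forall>A. \<forall>h \<in> homset C (Cod C f) A. h \<odot>\<^bsub>C\<^esub> f = Zero C (Dom C f) A \<longrightarrow>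
        (\<exists>!u. u \<in> homset C (Cod C p) A \<and> u \<odot>\<^bsub>C\<^esub> p = h))"

text \<open>A biproduct of \<open>A\<close> and \<open>B\<close> consists of the two injections followed by the two projections.\<close>

definition biproducts ::
    "('o, 'm, 'k, 'z) lin_cat_scheme \<Rightarrow> 'o \<Rightarrow> 'o \<Rightarrow> 'o \<Rightarrow> ('m \<times> 'm \<times> 'm \<times> 'm) set" where
  "biproducts C A B S = {(i, j, p, r).
     i \<in> homset C A S \<and> j \<in> homset C B S \<and> p \<in> homset C S A \<and> r \<in> homset C S B \<and>
     p \<odot>\<^bsub>C\<^esub> i = Id C A \<and> r \<odot>\<^bsub>C\<^esub> j = Id C B \<and>
     p \<odot>\<^bsub>C\<^esub> j = Zero C B A \<and> r \<odot>\<^bsub>C\<^esub> i = Zero C A B \<and>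
     Add C (i \<odot>\<^bsub>C\<^esub> p) (j \<odot>\<^bsub>C\<^esub> r) = Id C S}"

locale linear_abelian_category = linear_category K C
  for K :: "('k, 'r) ring_scheme" (structure)
  and C :: "('o, 'm, 'k, 'z) lin_cat_scheme" (structure) +
  assumes has_zero_object: "\<exists>Z. zero_object C Z"
    and has_biproducts: "\<lbrakk>A \<in> Ob C; B \<in> Ob C\<rbrakk> \<Longrightarrow> \<exists>S \<in> Ob C. biproducts C A B S \<noteq> {}"
    and has_kernels: "f \<in> Arr C \<Longrightarrow> \<exists>k. is_kernel C k f"
    and has_cokernels: "f \<in> Arr C \<Longrightarrow> \<exists>p. is_cokernel C p f"
    and monic_is_kernel: "monic C f \<Longrightarrow> \<exists>g. is_kernel C f g"
    and epic_is_cokernel: "epic C f \<Longrightarrow> \<exists>g. is_cokernel C f g"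


section \<open>Yoneda extensions\<close>

text \<open>Exactness at the middle object: the image of \<open>f\<close> is the kernel of \<open>g\<close>.\<close>

definition exact_at :: "('o, 'm, 'k, 'z) lin_cat_scheme \<Rightarrow> 'm \<Rightarrow> 'm \<Rightarrow> bool" where
  "exact_at C f g \<longleftrightarrow>
     (\<exists>e k. epic C e \<and> is_kernel C k g \<and> Cod C e = Dom C k \<and> f = k \<odot>\<^bsub>C\<^esub> e)"

text \<open>Extensions \<open>0 \<rightarrow> N \<rightarrow> E \<rightarrow> M \<rightarrow> 0\<close> of \<open>M\<close> by \<open>N\<close>, represented by their two inner arrows.\<close>

definition extensions :: "('o, 'm, 'k, 'z) lin_cat_scheme \<Rightarrow> 'o \<Rightarrow> 'o \<Rightarrow> ('m \<times> 'm) set" where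
  "extensions C M N = {(f, g). monic C f \<and> epic C g \<and> exact_at C f g \<and>
     Dom C f = N \<and> Cod C f = Dom C g \<and> Cod C g = M}"

definition ext_morphism ::
    "('o, 'm, 'k, 'z) lin_cat_scheme \<Rightarrow> 'm \<Rightarrow> 'm \<Rightarrow> 'm \<Rightarrow> 'm \<times> 'm \<Rightarrow> 'm \<times> 'm \<Rightarrow> bool" where
  "ext_morphism C \<alpha> \<beta> \<gamma> E F \<longleftrightarrow>
     \<alpha> \<in> homset C (Dom C (fst E)) (Dom C (fst F)) \<and>
     \<beta> \<in> homset C (Cod C (fst E)) (Cod C (fst F)) \<and>
     \<gamma> \<in> homset C (Cod C (snd E)) (Cod C (snd F)) \<and>
     \<beta> \<odot>\<^bsub>C\<^esub> fst E = fst F \<odot>\<^bsub>C\<^esub> \<alpha> \<and> \<gamma> \<odot>\<^bsub>C\<^esub> snd E = snd F \<odot>\<^bsub>C\<^esub> \<beta>"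

definition ext_rel :: "('o, 'm, 'k, 'z) lin_cat_scheme \<Rightarrow> 'o \<Rightarrow> 'o \<Rightarrow> (('m \<times> 'm) \<times> ('m \<times> 'm)) set" where
  "ext_rel C M N = {(E, F). E \<in> extensions C M N \<and> F \<in> extensions C M N \<and>
     (\<exists>\<beta> \<in> isos C (Cod C (fst E)) (Cod C (fst F)). ext_morphism C (Id C N) \<beta> (Id C M) E F)}"

text \<open>Pullback of a class of extensions of \<open>M\<close> by \<open>N\<close> along \<open>\<gamma> : M' \<rightarrow> M\<close>, and pushout along
  \<open>\<alpha> : N \<rightarrow> N'\<close>.  A morphism of extensions which is the identity on the left (right) end exhibits its
  source (target) as the pullback (pushout), up to equivalence.\<close>

definition ext_pullback ::
    "('o, 'm, 'k, 'z) lin_cat_scheme \<Rightarrow> 'o \<Rightarrow> 'm \<Rightarrow> ('m \<times> 'm) set \<Rightarrow> ('m \<times> 'm) set" where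
  "ext_pullback C N \<gamma> X =
     {F \<in> extensions C (Dom C \<gamma>) N. \<exists>E \<in> X. \<exists>\<beta>. ext_morphism C (Id C N) \<beta> \<gamma> F E}"

definition ext_pushout ::
    "('o, 'm, 'k, 'z) lin_cat_scheme \<Rightarrow> 'o \<Rightarrow> 'm \<Rightarrow> ('m \<times> 'm) set \<Rightarrow> ('m \<times> 'm) set" where
  "ext_pushout C M \<alpha> X =
     {F \<in> extensions C M (Cod C \<alpha>). \<exists>E \<in> X. \<exists>\<beta>. ext_morphism C \<alpha> \<beta> (Id C M) E F}"

definition dsum_map :: "('o, 'm, 'k, 'z) lin_cat_scheme \<Rightarrow>
    'm \<times> 'm \<times> 'm \<times> 'm \<Rightarrow> 'm \<times> 'm \<times> 'm \<times> 'm \<Rightarrow> 'm \<Rightarrow> 'm \<Rightarrow> 'm" where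
  "dsum_map C = (\<lambda>(i, j, p, r) (i', j', p', r') f g.
     Add C (i' \<odot>\<^bsub>C\<^esub> f \<odot>\<^bsub>C\<^esub> p) (j' \<odot>\<^bsub>C\<^esub> g \<odot>\<^bsub>C\<^esub> r))"

definition diagonal :: "('o, 'm, 'k, 'z) lin_cat_scheme \<Rightarrow> 'm \<times> 'm \<times> 'm \<times> 'm \<Rightarrow> 'm" where
  "diagonal C = (\<lambda>(i, j, p, r). Add C i j)"

definition codiagonal :: "('o, 'm, 'k, 'z) lin_cat_scheme \<Rightarrow> 'm \<times> 'm \<times> 'm \<times> 'm \<Rightarrow> 'm" where
  "codiagonal C = (\<lambda>(i, j, p, r). Add C p r)"

text \<open>The Baer sum \<open>\<nabla>(E \<oplus> E')\<Delta>\<close>, where the biproducts \<open>a\<close>, \<open>b\<close>, \<open>d\<close> of \<open>N\<close> with itself, of the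
  middle objects, and of \<open>M\<close> with itself are arbitrary.\<close>

definition baer_sum :: "('o, 'm, 'k, 'z) lin_cat_scheme \<Rightarrow> 'o \<Rightarrow> 'o \<Rightarrow>
    ('m \<times> 'm) set \<Rightarrow> ('m \<times> 'm) set \<Rightarrow> ('m \<times> 'm) set" where
  "baer_sum C M N X Y = {F. \<exists>(f, g) \<in> X. \<exists>(f', g') \<in> Y. \<exists>NN EE MM.
     \<exists>a \<in> biproducts C N N NN. \<exists>b \<in> biproducts C (Cod C f) (Cod C f') EE. \<exists>d \<in> biproducts C M M MM.
       F \<in> ext_pushout C M (codiagonal C a)
             (ext_pullback C NN (diagonal C d) {(dsum_map C a b f f', dsum_map C b d g g')})}"

definition split_extensions :: "('o, 'm, 'k, 'z) lin_cat_scheme \<Rightarrow> 'o \<Rightarrow> 'o \<Rightarrow> ('m \<times> 'm) set" where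
  "split_extensions C M N =
     {(i, r) \<in> extensions C M N. \<exists>j p. (i, j, p, r) \<in> biproducts C N M (Cod C i)}"

definition Ext1 :: "('o, 'm, 'k, 'z) lin_cat_scheme \<Rightarrow> 'o \<Rightarrow> 'o \<Rightarrow> ('k, ('m \<times> 'm) set) module" where
  "Ext1 C M N =
     \<lparr>carrier = extensions C M N // ext_rel C M N, mult = undefined, one = undefined,
      zero = split_extensions C M N, add = baer_sum C M N,
      smult = (\<lambda>c. ext_pushout C M (Scal C c (Id C N)))\<rparr>"

text \<open>2-extensions \<open>0 \<rightarrow> N \<rightarrow> E \<rightarrow> E' \<rightarrow> M \<rightarrow> 0\<close>.  Morphisms fixing both ends do not in general form an
  equivalence relation here, but generate the Yoneda equivalence.\<close>

definition extensions2 :: "('o, 'm, 'k, 'z) lin_cat_scheme \<Rightarrow> 'o \<Rightarrow> 'o \<Rightarrow> ('m \<times> 'm \<times> 'm) set" where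
  "extensions2 C M N = {(f, g, h). monic C f \<and> g \<in> Arr C \<and> epic C h \<and>
     exact_at C f g \<and> exact_at C g h \<and>
     Dom C f = N \<and> Cod C f = Dom C g \<and> Cod C g = Dom C h \<and> Cod C h = M}"

definition ext2_step ::
    "('o, 'm, 'k, 'z) lin_cat_scheme \<Rightarrow> 'o \<Rightarrow> 'o \<Rightarrow> (('m \<times> 'm \<times> 'm) \<times> ('m \<times> 'm \<times> 'm)) set" where
  "ext2_step C M N = {((f, g, h), (f', g', h')).
     (f, g, h) \<in> extensions2 C M N \<and> (f', g', h') \<in> extensions2 C M N \<and>
     (\<exists>\<alpha> \<in> homset C (Dom C g) (Dom C g'). \<exists>\<beta> \<in> homset C (Cod C g) (Cod C g').
        \<alpha> \<odot>\<^bsub>C\<^esub> f = f' \<and> \<beta> \<odot>\<^bsub>C\<^esub> g = g' \<odot>\<^bsub>C\<^esub> \<alpha> \<and> h' \<odot>\<^bsub>C\<^esub> \<beta> = h)}"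

definition ext2_rel ::
    "('o, 'm, 'k, 'z) lin_cat_scheme \<Rightarrow> 'o \<Rightarrow> 'o \<Rightarrow> (('m \<times> 'm \<times> 'm) \<times> ('m \<times> 'm \<times> 'm)) set" where
  "ext2_rel C M N = (ext2_step C M N \<union> (ext2_step C M N)\<inverse>)\<^sup>*"

definition Ext2 :: "('o, 'm, 'k, 'z) lin_cat_scheme \<Rightarrow> 'o \<Rightarrow> 'o \<Rightarrow> ('m \<times> 'm \<times> 'm) set set" where
  "Ext2 C M N = extensions2 C M N // ext2_rel C M N"

text \<open>The zero class is that of \<open>0 \<rightarrow> N = N \<rightarrow> M = M \<rightarrow> 0\<close> with zero middle arrow.\<close>

definition Ext2_zero :: "('o, 'm, 'k, 'z) lin_cat_scheme \<Rightarrow> 'o \<Rightarrow> 'o \<Rightarrow> ('m \<times> 'm \<times> 'm) set" where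
  "Ext2_zero C M N = ext2_rel C M N `` {(Id C N, Zero C N M, Id C M)}"

locale finitary_hereditary_category = linear_abelian_category K C
  for K :: "('k, 'r) ring_scheme" (structure)
  and C :: "('o, 'm, 'k, 'z) lin_cat_scheme" (structure) +
  assumes finite_field: "finite (carrier K)"
    and hereditary: "\<lbrakk>M \<in> Ob C; N \<in> Ob C\<rbrakk> \<Longrightarrow> Ext2 C M N = {Ext2_zero C M N}"
    and finite_Hom: "\<lbrakk>M \<in> Ob C; N \<in> Ob C\<rbrakk> \<Longrightarrow> finite (homset C M N)"
    and finite_Ext1: "\<lbrakk>M \<in> Ob C; N \<in> Ob C\<rbrakk> \<Longrightarrow> finite (carrier (Ext1 C M N))"


section \<open>Hall numbers\<close>

definition Iso :: "('o, 'm, 'k, 'z) lin_cat_scheme \<Rightarrow> 'o set set" where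
  "Iso C = Ob C // {(X, Y). X \<in> Ob C \<and> Y \<in> Ob C \<and> isomorphic C X Y}"

text \<open>Sums over isomorphism classes evaluate isomorphism-invariant expressions at a chosen
  representative.\<close>

definition rep :: "'o set \<Rightarrow> 'o" where
  "rep c = (SOME X. X \<in> c)"

definition aut_card :: "('o, 'm, 'k, 'z) lin_cat_scheme \<Rightarrow> 'o \<Rightarrow> nat" where
  "aut_card C M = card (isos C M M)"

text \<open>A subobject of \<open>M\<close> is an equivalence class of monic arrows into \<open>M\<close>.\<close>

definition subobjects :: "('o, 'm, 'k, 'z) lin_cat_scheme \<Rightarrow> 'o \<Rightarrow> 'm set set" where
  "subobjects C M = {m. monic C m \<and> Cod C m = M} //
     {(m, n). monic C m \<and> monic C n \<and> Cod C m = M \<and> Cod C n = M \<and>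
        (\<exists>u \<in> isos C (Dom C m) (Dom C n). n \<odot>\<^bsub>C\<^esub> u = m)}"

text \<open>\<open>hall C A B M\<close> is $F_{AB}^M$: the quotient is \<open>A\<close>, the subobject is \<open>B\<close>.\<close>

definition hall :: "('o, 'm, 'k, 'z) lin_cat_scheme \<Rightarrow> 'o \<Rightarrow> 'o \<Rightarrow> 'o \<Rightarrow> nat" where
  "hall C A B M = card {X \<in> subobjects C M.
     \<exists>m \<in> X. isomorphic C (Dom C m) B \<and> (\<exists>p. is_cokernel C p m \<and> isomorphic C (Cod C p) A)}"

definition euler_form ::
    "('k, 'r) ring_scheme \<Rightarrow> ('o, 'm, 'k, 'z) lin_cat_scheme \<Rightarrow> 'o \<Rightarrow> 'o \<Rightarrow> int" where
  "euler_form K C M N =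
     int (vectorspace.dim K (homspace C M N)) - int (vectorspace.dim K (Ext1 C M N))"

definition euler_form3 ::
    "('k, 'r) ring_scheme \<Rightarrow> ('o, 'm, 'k, 'z) lin_cat_scheme \<Rightarrow> 'o \<Rightarrow> 'o \<Rightarrow> 'o \<Rightarrow> int" where
  "euler_form3 K C L I N =
     euler_form K C L I + euler_form K C I I + euler_form K C I N - euler_form K C L N"

text \<open>\<open>delta_hall K C A B M\<close> is $\widehat{F}_{AB}^M$.  All but finitely many terms vanish: a nonzero
  term makes \<open>I\<close> the image, \<open>L\<close> the cokernel and \<open>N\<close> the kernel of an arrow from \<open>A\<close> to \<open>B\<close>.\<close>

definition delta_hall ::
    "('k, 'r) ring_scheme \<Rightarrow> ('o, 'm, 'k, 'z) lin_cat_scheme \<Rightarrow> 'o \<Rightarrow> 'o \<Rightarrow> 'o \<Rightarrow> real" where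
  "delta_hall K C A B M =
     (\<Sum>\<^sub>\<infinity>(l, i, n) \<in> Iso C \<times> Iso C \<times> Iso C.
        let L = rep l; I = rep i; N = rep n in
          sqrt (real (card (carrier K))) powi euler_form3 K C L I N *
          (real (aut_card C L) * real (aut_card C I) * real (aut_card C N) / real (aut_card C M)) *
          real (hall C L I B) * real (hall C N L M) * real (hall C I N A))"

end

theory Submission
  imports Defs
begin

text \<open>Write $\langle L,I,N\rangle$ for the exponent in the definition. Combining the factors
  $F^B_{LI}$ and $F^A_{IN}$ turns $\widehat F^M_{AB}$ into a sum over arrows $f : A \to B$ of
  $\mathbf{v}^{\langle L,I,N\rangle}/a_M$ times the number of short exact sequences $L \to M \to N$, where $L$, $I$, $N$ are the
  cokernel, image and kernel of $f$; grouping other pairs of factors gives similar sums over arrows $B \to M$ and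
  $M \to A$. Hence both sides of the associativity law are sums over 4-periodic complexes
  $A \to B \to C \to M \to A$, the intermediate object $X$ or $Y$ carrying two short exact sequences which cross each
  other. Heredity allows these crosses to be counted (weighted by $1/a_X$): if $Z$, $Q$ denote the
  homologies at $B$ and $C$, the count is $q^{-\langle Q,Z\rangle}$ times the number of pairs of isomorphisms between
  opposite homologies. Replacing $X$ by $Y$ rotates the complex, and biadditivity of the Euler form shows that
  the power of $\mathbf{v}$ attached to a complex is invariant under this rotation.\<close>

section \<open>Linear categories and their opposites\<close>

text \<open>Weighted counts are orbit counts: when the data over X are permuted simply transitively
  by the isomorphisms Y -> X, dividing by \<open>aut_card\<close> counts each such family once
  (\<open>groupoid_count\<close>). The obstacle is that the category need not have projectives, so
  neither Ext nor the number of crosses can be read off a resolution. Finiteness replaces them: up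
  to isomorphism only finitely many extensions matter at a time, and successive pullbacks give one
  epic that lifts through all of them (\<open>common_lift\<close>). Heredity enters only as the
  existence of completions, obtained by carrying one along a chain of elementary Yoneda equivalences
  starting at the zero class. Biadditivity of the Euler form is likewise a counting result and not
  taken from a long exact sequence: \<open>chi Q Z\<close>, the weighted number of extensions of Q
  by Z, equals |Ext1(Q,Z)| / |Hom(Q,Z)|, and a double count of filtrations makes it multiplicative.
  All of this is self-dual, so dual statements are read off in \<open>opp C\<close>.\<close>

definition opp :: "('o, 'm, 'k, 'z) lin_cat_scheme \<Rightarrow> ('o, 'm, 'k) lin_cat" where
  "opp C = \<lparr>Ob = Ob C, Arr = Arr C, Dom = Cod C, Cod = Dom C, Id = Id C, Comp = (\<lambda>g f. Comp C f g),
     Add = Add C, Zero = (\<lambda>A B. Zero C B A), Scal = Scal C\<rparr>"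

lemma opp_simps [simp]:
  "Ob (opp C) = Ob C" "Arr (opp C) = Arr C" "Dom (opp C) = Cod C" "Cod (opp C) = Dom C"
  "Id (opp C) = Id C" "Comp (opp C) g f = Comp C f g" "Add (opp C) = Add C"
  "Zero (opp C) A B = Zero C B A" "Scal (opp C) = Scal C"
  by (simp_all add: opp_def)

lemma homset_opp [simp]: "homset (opp C) A B = homset C B A"
  by (auto simp: homset_def)

lemma homspace_opp [simp]: "homspace (opp C) A B = homspace C B A"
  by (simp add: homspace_def)

lemma monic_opp [simp]: "monic (opp C) f = epic C f"
  by (simp add: monic_def epic_def)

lemma epic_opp [simp]: "epic (opp C) f = monic C f"
  by (simp add: monic_def epic_def)

lemma isos_opp [simp]: "isos (opp C) A B = isos C B A"
  by (auto simp: isos_def)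

lemma isomorphic_opp [simp]: "isomorphic (opp C) A B = isomorphic C B A"
  by (simp add: isomorphic_def)

lemma zero_object_opp [simp]: "zero_object (opp C) Z = zero_object C Z"
  by (auto simp: zero_object_def)

lemma is_kernel_opp [simp]: "is_kernel (opp C) k f = is_cokernel C k f"
  by (simp add: is_kernel_def is_cokernel_def)

lemma is_cokernel_opp [simp]: "is_cokernel (opp C) k f = is_kernel C k f"
  by (simp add: is_kernel_def is_cokernel_def)

lemma biproducts_opp [simp]: "(i, j, p, r) \<in> biproducts (opp C) A B S \<longleftrightarrow> (p, r, i, j) \<in> biproducts C A B S"
  by (auto simp: biproducts_def)

section \<open>Calculus of arrows in a linear category\<close>

context linear_category
begin

abbreviation cmp :: "'m \<Rightarrow> 'm \<Rightarrow> 'm" (infixr "\<cdot>" 70) where "g \<cdot> f \<equiv> Comp C g f"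

abbreviation nul :: "'o \<Rightarrow> 'o \<Rightarrow> 'm" where "nul \<equiv> Zero C"

abbreviation pls :: "'m \<Rightarrow> 'm \<Rightarrow> 'm" (infixl "\<boxplus>" 65) where "f \<boxplus> g \<equiv> Add C f g"

text \<open>Scaling by -1 makes negation depend on the arrow alone, whereas the inverse supplied by
  a module structure carries the two objects of its hom space along.\<close>

definition neg :: "'m \<Rightarrow> 'm" where "neg f = Scal C (\<ominus>\<^bsub>K\<^esub> \<one>\<^bsub>K\<^esub>) f"

abbreviation mns :: "'m \<Rightarrow> 'm \<Rightarrow> 'm" (infixl "\<boxminus>" 65) where "f \<boxminus> g \<equiv> f \<boxplus> neg g"

lemma opp_linear_category: "linear_category K (opp C)"
proof -
  have "linear_category_axioms K (opp C)"
    unfolding linear_category_axioms_def opp_simps homset_opp homspace_opp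
  proof (intro conjI allI impI)
    fix f A B g D h E
    assume "f \<in> homset C B A" "g \<in> homset C D B" "h \<in> homset C E D"
    then show "f \<cdot> g \<cdot> h = (f \<cdot> g) \<cdot> h" using comp_assoc[of h E D g B f A] by simp
  qed ((rule comp_in_hom; assumption) | (rule dom_in_Ob; assumption) | (rule cod_in_Ob; assumption) | (rule id_in_hom; assumption) | (rule comp_id; assumption) | (rule id_comp; assumption) | (rule hom_module; assumption) | (rule comp_add; assumption) | (rule add_comp; assumption) | (rule comp_scal; assumption) | (rule scal_comp; assumption))+
  then show ?thesis by (simp add: linear_category_def field_axioms)
qed

text \<open>Typing becomes equations on \<open>Dom\<close> and \<open>Cod\<close>, which the
  simplifier can discharge as side conditions. Cardinality arguments switch the rule off in order to
  keep hom-sets as finite sets.\<close>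

lemma hom_iff [simp]: "f \<in> homset C A B \<longleftrightarrow> f \<in> Arr C \<and> Dom C f = A \<and> Cod C f = B"
  by (simp add: homset_def)

declare dom_in_Ob [simp, intro] cod_in_Ob [simp, intro]

lemma Ob_of_arr: "\<lbrakk>f \<in> Arr C; Dom C f = A\<rbrakk> \<Longrightarrow> A \<in> Ob C" "\<lbrakk>f \<in> Arr C; Cod C f = A\<rbrakk> \<Longrightarrow> A \<in> Ob C"
  by auto

lemma comp_arr [simp]:
  assumes "f \<in> Arr C" "g \<in> Arr C" "Dom C g = Cod C f"
  shows "g \<cdot> f \<in> Arr C" "Dom C (g \<cdot> f) = Dom C f" "Cod C (g \<cdot> f) = Cod C g"
  using comp_in_hom[of f "Dom C f" "Cod C f" g "Cod C g"] assms by auto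

lemma id_arr [simp]:
  assumes "A \<in> Ob C"
  shows "Id C A \<in> Arr C" "Dom C (Id C A) = A" "Cod C (Id C A) = A"
  using id_in_hom[OF assms] by auto

lemma comp_id' [simp]: "\<lbrakk>f \<in> Arr C; Dom C f = A\<rbrakk> \<Longrightarrow> f \<cdot> Id C A = f"
  using comp_id[of f A "Cod C f"] by auto

lemma id_comp' [simp]: "\<lbrakk>f \<in> Arr C; Cod C f = A\<rbrakk> \<Longrightarrow> Id C A \<cdot> f = f"
  using id_comp[of f "Dom C f" A] by auto

lemma assoc [simp]:
  "\<lbrakk>f \<in> Arr C; g \<in> Arr C; h \<in> Arr C; Dom C g = Cod C f; Dom C h = Cod C g\<rbrakk> \<Longrightarrow> (h \<cdot> g) \<cdot> f = h \<cdot> g \<cdot> f"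
  using comp_assoc[of f "Dom C f" "Cod C f" g "Cod C g" h "Cod C h"] by auto

text \<open>Equations \<open>g \<cdot> f = \<dots>\<close> are used to rewrite under a right-nested composition through this rule.\<close>

lemma comp_under:
  assumes "g \<cdot> f = h" "f \<in> Arr C" "g \<in> Arr C" "Dom C g = Cod C f"
  shows "\<lbrakk>x \<in> Arr C; Cod C x = Dom C f\<rbrakk> \<Longrightarrow> g \<cdot> f \<cdot> x = h \<cdot> x"
  using assms assoc[of x f g] by auto

lemma homspace_sel [simp]:
  "carrier (homspace C A B) = homset C A B" "add (homspace C A B) = Add C"
  "zero (homspace C A B) = nul A B" "smult (homspace C A B) = Scal C"
  by (simp_all add: homspace_def)

lemma zero_arr [simp]:
  assumes "A \<in> Ob C" "B \<in> Ob C"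
  shows "nul A B \<in> Arr C" "Dom C (nul A B) = A" "Cod C (nul A B) = B"
proof -
  interpret M: module K "homspace C A B" using hom_module assms .
  show "nul A B \<in> Arr C" "Dom C (nul A B) = A" "Cod C (nul A B) = B"
    using M.zero_closed by auto
qed

lemma add_arr [simp]:
  assumes "f \<in> Arr C" "g \<in> Arr C" "Dom C g = Dom C f" "Cod C g = Cod C f"
  shows "f \<boxplus> g \<in> Arr C" "Dom C (f \<boxplus> g) = Dom C f" "Cod C (f \<boxplus> g) = Cod C f"
proof -
  interpret M: module K "homspace C (Dom C f) (Cod C f)" using hom_module assms by auto
  show "f \<boxplus> g \<in> Arr C" "Dom C (f \<boxplus> g) = Dom C f" "Cod C (f \<boxplus> g) = Cod C f"
    using M.add.m_closed[of f g] assms by auto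
qed

lemma scal_arr [simp]:
  assumes "c \<in> carrier K" "f \<in> Arr C"
  shows "Scal C c f \<in> Arr C" "Dom C (Scal C c f) = Dom C f" "Cod C (Scal C c f) = Cod C f"
proof -
  interpret M: module K "homspace C (Dom C f) (Cod C f)" using hom_module assms by auto
  show "Scal C c f \<in> Arr C" "Dom C (Scal C c f) = Dom C f" "Cod C (Scal C c f) = Cod C f"
    using M.smult_closed[of c f] assms by auto
qed

lemma neg_arr [simp]:
  assumes "f \<in> Arr C"
  shows "neg f \<in> Arr C" "Dom C (neg f) = Dom C f" "Cod C (neg f) = Cod C f"
  using assms by (simp_all add: neg_def)

lemma add_assoc':
  assumes "f \<in> Arr C" "g \<in> Arr C" "h \<in> Arr C" "Dom C g = Dom C f" "Cod C g = Cod C f"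
    "Dom C h = Dom C f" "Cod C h = Cod C f"
  shows "f \<boxplus> g \<boxplus> h = f \<boxplus> (g \<boxplus> h)"
proof -
  interpret M: module K "homspace C (Dom C f) (Cod C f)" using hom_module assms by auto
  show ?thesis using M.add.m_assoc[of f g h] assms by auto
qed

lemma add_comm':
  assumes "f \<in> Arr C" "g \<in> Arr C" "Dom C g = Dom C f" "Cod C g = Cod C f"
  shows "f \<boxplus> g = g \<boxplus> f"
proof -
  interpret M: module K "homspace C (Dom C f) (Cod C f)" using hom_module assms by auto
  show ?thesis using M.add.m_comm[of f g] assms by auto
qed

lemma add_zero [simp]:
  assumes "f \<in> Arr C" "Dom C f = A" "Cod C f = B"
  shows "f \<boxplus> nul A B = f" "nul A B \<boxplus> f = f"
proof -
  interpret M: module K "homspace C (Dom C f) (Cod C f)" using hom_module assms by auto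
  show "f \<boxplus> nul A B = f" "nul A B \<boxplus> f = f" using M.add.r_one[of f] M.add.l_one[of f] assms by auto
qed

lemma neg_eq_a_inv:
  assumes "f \<in> Arr C"
  shows "neg f = a_inv (homspace C (Dom C f) (Cod C f)) f"
proof -
  interpret M: module K "homspace C (Dom C f) (Cod C f)" using hom_module assms by auto
  show ?thesis using M.smult_l_minus[of "\<one>\<^bsub>K\<^esub>" f] M.smult_one[of f] assms by (simp add: neg_def)
qed

lemma add_neg [simp]:
  assumes "f \<in> Arr C"
  shows "f \<boxminus> f = nul (Dom C f) (Cod C f)"
proof -
  interpret M: module K "homspace C (Dom C f) (Cod C f)" using hom_module assms by auto
  show ?thesis using M.r_neg[of f] assms by (simp add: neg_eq_a_inv)
qed

lemma add_neg_cancel [simp]: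
  assumes "f \<in> Arr C" "g \<in> Arr C" "Dom C g = Dom C f" "Cod C g = Cod C f"
  shows "f \<boxminus> g \<boxplus> g = f" "f \<boxplus> g \<boxminus> g = f" "g \<boxplus> (f \<boxminus> g) = f"
proof -
  have 1: "neg g \<boxplus> g = nul (Dom C f) (Cod C f)" using assms add_comm'[of "neg g" g] by simp
  show 2: "f \<boxminus> g \<boxplus> g = f" "f \<boxplus> g \<boxminus> g = f" using assms by (simp_all add: add_assoc' 1)
  show "g \<boxplus> (f \<boxminus> g) = f" using add_comm'[of g "f \<boxminus> g"] 2 assms by simp
qed

lemma sub_eq_zero_iff:
  assumes "f \<in> Arr C" "g \<in> Arr C" "Dom C g = Dom C f" "Cod C g = Cod C f"
  shows "f \<boxminus> g = nul (Dom C f) (Cod C f) \<longleftrightarrow> f = g"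
proof
  assume "f \<boxminus> g = nul (Dom C f) (Cod C f)"
  then show "f = g" using add_neg_cancel(1)[OF assms] assms by simp
next
  assume "f = g"
  then show "f \<boxminus> g = nul (Dom C f) (Cod C f)" using assms by simp
qed

lemma add_left_cancel':
  assumes "f \<in> Arr C" "g \<in> Arr C" "h \<in> Arr C" "Dom C g = Dom C f" "Cod C g = Cod C f"
    "Dom C h = Dom C f" "Cod C h = Cod C f" "f \<boxplus> g = f \<boxplus> h"
  shows "g = h"
proof -
  have "g = g \<boxplus> f \<boxminus> f" "h = h \<boxplus> f \<boxminus> f" using assms by simp_all
  moreover have "g \<boxplus> f = h \<boxplus> f" using assms add_comm' by metis
  ultimately show ?thesis by metis
qed

lemma comp_add' [simp]:
  "\<lbrakk>f \<in> Arr C; f' \<in> Arr C; Dom C f' = Dom C f; Cod C f' = Cod C f; g \<in> Arr C; Dom C g = Cod C f\<rbrakk>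
    \<Longrightarrow> g \<cdot> (f \<boxplus> f') = g \<cdot> f \<boxplus> g \<cdot> f'"
  using comp_add[of f "Dom C f" "Cod C f" f' g "Cod C g"] by auto

lemma add_comp' [simp]:
  "\<lbrakk>g \<in> Arr C; g' \<in> Arr C; Dom C g' = Dom C g; Cod C g' = Cod C g; f \<in> Arr C; Dom C g = Cod C f\<rbrakk>
    \<Longrightarrow> (g \<boxplus> g') \<cdot> f = g \<cdot> f \<boxplus> g' \<cdot> f"
  using add_comp[of f "Dom C f" "Cod C f" g "Cod C g" g'] by auto

lemma comp_scal' [simp]:
  "\<lbrakk>c \<in> carrier K; f \<in> Arr C; g \<in> Arr C; Dom C g = Cod C f\<rbrakk> \<Longrightarrow> g \<cdot> Scal C c f = Scal C c (g \<cdot> f)"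
  using comp_scal[of c f "Dom C f" "Cod C f" g "Cod C g"] by auto

lemma scal_comp' [simp]:
  "\<lbrakk>c \<in> carrier K; f \<in> Arr C; g \<in> Arr C; Dom C g = Cod C f\<rbrakk> \<Longrightarrow> Scal C c g \<cdot> f = Scal C c (g \<cdot> f)"
  using scal_comp[of c f "Dom C f" "Cod C f" g "Cod C g"] by auto

lemma comp_neg [simp]: "\<lbrakk>f \<in> Arr C; g \<in> Arr C; Dom C g = Cod C f\<rbrakk> \<Longrightarrow> g \<cdot> neg f = neg (g \<cdot> f)"
  by (simp add: neg_def)

lemma neg_comp [simp]: "\<lbrakk>f \<in> Arr C; g \<in> Arr C; Dom C g = Cod C f\<rbrakk> \<Longrightarrow> neg g \<cdot> f = neg (g \<cdot> f)"
  by (simp add: neg_def)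

lemma comp_zero [simp]:
  assumes "g \<in> Arr C" "Dom C g = B" "A \<in> Ob C"
  shows "g \<cdot> nul A B = nul A (Cod C g)"
proof -
  have B: "B \<in> Ob C" using assms by auto
  have "g \<cdot> nul A B \<boxplus> g \<cdot> nul A B = g \<cdot> nul A B"
    using comp_add'[of "nul A B" "nul A B" g] assms B by simp
  then show ?thesis
    using add_neg_cancel(2)[of "g \<cdot> nul A B" "g \<cdot> nul A B"] assms B by simp
qed

lemma zero_comp [simp]:
  assumes "f \<in> Arr C" "Cod C f = B" "D \<in> Ob C"
  shows "nul B D \<cdot> f = nul (Dom C f) D"
proof -
  have B: "B \<in> Ob C" using assms by auto
  have "nul B D \<cdot> f \<boxplus> nul B D \<cdot> f = nul B D \<cdot> f"
    using add_comp'[of "nul B D" "nul B D" f] assms B by simp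
  then show ?thesis
    using add_neg_cancel(2)[of "nul B D \<cdot> f" "nul B D \<cdot> f"] assms B by simp
qed

lemma neg_zero [simp]: "\<lbrakk>A \<in> Ob C; B \<in> Ob C\<rbrakk> \<Longrightarrow> neg (nul A B) = nul A B"
  using add_neg[of "nul A B"] add_zero(2)[of "neg (nul A B)" A B] by simp

end

section \<open>Kernels, cokernels and short exact sequences\<close>

definition ses :: "('o, 'm, 'k, 'z) lin_cat_scheme \<Rightarrow> 'm \<Rightarrow> 'm \<Rightarrow> bool" where
  "ses C i p \<longleftrightarrow> is_kernel C i p \<and> is_cokernel C p i"

lemma ses_opp [simp]: "ses (opp C) i p = ses C p i"
  by (auto simp: ses_def)

lemmas opp_rules = opp_simps homset_opp homspace_opp monic_opp epic_opp isos_opp isomorphic_opp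
  is_kernel_opp is_cokernel_opp ses_opp

context linear_category
begin

lemma monicI:
  assumes "m \<in> Arr C"
    and "\<And>x. \<lbrakk>x \<in> Arr C; Cod C x = Dom C m; m \<cdot> x = nul (Dom C x) (Cod C m)\<rbrakk> \<Longrightarrow> x = nul (Dom C x) (Dom C m)"
  shows "monic C m"
  unfolding monic_def
proof (intro conjI allI ballI impI)
  fix A g h assume gh: "g \<in> homset C A (Dom C m)" "h \<in> homset C A (Dom C m)" and eq: "m \<cdot> g = m \<cdot> h"
  then have "m \<cdot> (g \<boxminus> h) = nul A (Cod C m)" using assms(1) by simp
  then have "g \<boxminus> h = nul A (Dom C m)" using assms(2)[of "g \<boxminus> h"] gh assms(1) by simp
  then show "g = h" using sub_eq_zero_iff[of g h] gh by auto
qed (fact assms)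

lemma monic_arr: "monic C m \<Longrightarrow> m \<in> Arr C"
  by (simp add: monic_def)

lemma epic_arr: "epic C m \<Longrightarrow> m \<in> Arr C"
  by (simp add: epic_def)

lemma monic_cancel:
  "\<lbrakk>monic C m; m \<cdot> x = m \<cdot> y; x \<in> Arr C; y \<in> Arr C; Cod C x = Dom C m; Cod C y = Dom C m; Dom C x = Dom C y\<rbrakk>
    \<Longrightarrow> x = y"
  by (auto simp: monic_def)

lemma epic_cancel:
  "\<lbrakk>epic C m; x \<cdot> m = y \<cdot> m; x \<in> Arr C; y \<in> Arr C; Dom C x = Cod C m; Dom C y = Cod C m; Cod C x = Cod C y\<rbrakk>
    \<Longrightarrow> x = y"
  by (auto simp: epic_def)

lemma monic_zero:
  assumes "monic C m" "x \<in> Arr C" "Cod C x = Dom C m" "m \<cdot> x = nul (Dom C x) (Cod C m)"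
  shows "x = nul (Dom C x) (Dom C m)"
  using monic_cancel[OF assms(1), of x "nul (Dom C x) (Dom C m)"] assms monic_arr[OF assms(1)] by simp

lemma epic_zero:
  assumes "epic C m" "x \<in> Arr C" "Dom C x = Cod C m" "x \<cdot> m = nul (Dom C m) (Cod C x)"
  shows "x = nul (Cod C m) (Cod C x)"
  using epic_cancel[OF assms(1), of x "nul (Cod C m) (Cod C x)"] assms epic_arr[OF assms(1)] by simp

lemma monic_comp:
  assumes "monic C f" "monic C g" "Dom C g = Cod C f"
  shows "monic C (g \<cdot> f)"
proof (rule monicI)
  note [simp] = monic_arr[OF assms(1)] monic_arr[OF assms(2)] assms(3)
  show "g \<cdot> f \<in> Arr C" by simp
  fix x assume x: "x \<in> Arr C" "Cod C x = Dom C (g \<cdot> f)" "(g \<cdot> f) \<cdot> x = nul (Dom C x) (Cod C (g \<cdot> f))"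
  then have "f \<cdot> x = nul (Dom C x) (Cod C f)" using monic_zero[OF assms(2), of "f \<cdot> x"] by simp
  then show "x = nul (Dom C x) (Dom C (g \<cdot> f))" using monic_zero[OF assms(1), of x] x by simp
qed

lemma monic_right:
  assumes "monic C (g \<cdot> f)" "f \<in> Arr C" "g \<in> Arr C" "Dom C g = Cod C f"
  shows "monic C f"
proof (rule monicI)
  fix x assume "x \<in> Arr C" "Cod C x = Dom C f" "f \<cdot> x = nul (Dom C x) (Cod C f)"
  then show "x = nul (Dom C x) (Dom C f)" using monic_zero[OF assms(1), of x] assms by simp
qed (use assms in simp)

lemma kerD:
  "is_kernel C k f \<Longrightarrow> k \<in> Arr C \<and> f \<in> Arr C \<and> Cod C k = Dom C f \<and> f \<cdot> k = nul (Dom C k) (Cod C f)"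
  by (simp add: is_kernel_def)

lemma ker_lift:
  assumes "is_kernel C k f" "h \<in> Arr C" "Cod C h = Dom C f" "f \<cdot> h = nul (Dom C h) (Cod C f)"
  obtains u where "u \<in> Arr C" "Dom C u = Dom C h" "Cod C u = Dom C k" "k \<cdot> u = h"
proof -
  have "h \<in> homset C (Dom C h) (Dom C f)" using assms by simp
  then have "\<exists>u. u \<in> homset C (Dom C h) (Dom C k) \<and> k \<cdot> u = h"
    using assms(1,4) unfolding is_kernel_def by blast
  then show ?thesis using that by auto
qed

text \<open>The uniqueness clause of the kernel, applied to the zero arrow, suffices, because
  \<open>monicI\<close> only asks about arrows that become zero.\<close>

lemma ker_monic:
  assumes "is_kernel C k f"
  shows "monic C k"
proof (rule monicI)
  note [simp] = kerD[OF assms]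
  show "k \<in> Arr C" by simp
  fix x assume x: "x \<in> Arr C" "Cod C x = Dom C k" "k \<cdot> x = nul (Dom C x) (Cod C k)"
  have "nul (Dom C x) (Dom C f) \<in> homset C (Dom C x) (Dom C f)"
    "f \<cdot> nul (Dom C x) (Dom C f) = nul (Dom C x) (Cod C f)" using x by simp_all
  then have "\<exists>!u. u \<in> homset C (Dom C x) (Dom C k) \<and> k \<cdot> u = nul (Dom C x) (Dom C f)"
    using assms unfolding is_kernel_def by blast
  moreover have "x \<in> homset C (Dom C x) (Dom C k) \<and> k \<cdot> x = nul (Dom C x) (Dom C f)"
    "nul (Dom C x) (Dom C k) \<in> homset C (Dom C x) (Dom C k) \<and> k \<cdot> nul (Dom C x) (Dom C k) = nul (Dom C x) (Dom C f)"
    using x by simp_all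
  ultimately show "x = nul (Dom C x) (Dom C k)" by blast
qed

lemma is_kernelI:
  assumes "monic C k" "f \<in> Arr C" "Cod C k = Dom C f" "f \<cdot> k = nul (Dom C k) (Cod C f)"
    and "\<And>h. \<lbrakk>h \<in> Arr C; Cod C h = Dom C f; f \<cdot> h = nul (Dom C h) (Cod C f)\<rbrakk>
      \<Longrightarrow> \<exists>u. u \<in> Arr C \<and> Dom C u = Dom C h \<and> Cod C u = Dom C k \<and> k \<cdot> u = h"
  shows "is_kernel C k f"
  unfolding is_kernel_def
proof (intro conjI allI ballI impI)
  fix A h assume h: "h \<in> homset C A (Dom C f)" "f \<cdot> h = nul A (Cod C f)"
  then obtain u where "u \<in> Arr C" "Dom C u = Dom C h" "Cod C u = Dom C k" "k \<cdot> u = h"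
    using assms(5)[of h] by auto
  then show "\<exists>!u. u \<in> homset C A (Dom C k) \<and> k \<cdot> u = h"
    using h monic_cancel[OF assms(1)] by (intro ex1I[of _ u]) auto
qed (use assms monic_arr in auto)

lemma isosI:
  assumes "f \<in> Arr C" "g \<in> Arr C" "Dom C f = A" "Cod C f = B" "Dom C g = B" "Cod C g = A"
    "g \<cdot> f = Id C A" "f \<cdot> g = Id C B"
  shows "f \<in> isos C A B"
  using assms unfolding isos_def by (auto intro!: bexI[of _ g])

lemma isosD:
  assumes "f \<in> isos C A B"
  shows "f \<in> Arr C \<and> Dom C f = A \<and> Cod C f = B"
  using assms by (auto simp: isos_def)

lemma isosE:
  assumes "f \<in> isos C A B"
  obtains g where "g \<in> isos C B A" "g \<in> Arr C" "Dom C g = B" "Cod C g = A" "g \<cdot> f = Id C A" "f \<cdot> g = Id C B"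
  using assms by (fastforce simp: isos_def)

lemma iso_monic: "f \<in> isos C A B \<Longrightarrow> monic C f"
proof -
  assume f: "f \<in> isos C A B"
  then obtain g where g: "g \<in> Arr C" "Dom C g = B" "Cod C g = A" "g \<cdot> f = Id C A" by (blast elim: isosE)
  have [simp]: "f \<in> Arr C" "Dom C f = A" "Cod C f = B" using isosD[OF f] by auto
  show ?thesis
  proof (rule monicI)
    fix x assume x: "x \<in> Arr C" "Cod C x = Dom C f" "f \<cdot> x = nul (Dom C x) (Cod C f)"
    have "x = (g \<cdot> f) \<cdot> x" using g x by simp
    also have "\<dots> = g \<cdot> f \<cdot> x" using x g(1-3) by (intro assoc) auto
    finally show "x = nul (Dom C x) (Dom C f)" using x g by simp
  qed simp
qed

lemma iso_comp:
  assumes f: "f \<in> isos C A B" and g: "g \<in> isos C B D"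
  shows "g \<cdot> f \<in> isos C A D"
proof -
  obtain f' where f': "f' \<in> Arr C" "Dom C f' = B" "Cod C f' = A" "f' \<cdot> f = Id C A" "f \<cdot> f' = Id C B"
    using f by (blast elim: isosE)
  obtain g' where g': "g' \<in> Arr C" "Dom C g' = D" "Cod C g' = B" "g' \<cdot> g = Id C B" "g \<cdot> g' = Id C D"
    using g by (blast elim: isosE)
  note [simp] = isosD[OF f] isosD[OF g]
  show ?thesis
    using f' g' comp_under[OF f'(5), of g'] comp_under[OF g'(4), of f] Ob_of_arr
    by (intro isosI[of _ "f' \<cdot> g'"]) auto
qed

lemma iso_id: "A \<in> Ob C \<Longrightarrow> Id C A \<in> isos C A A"
  by (intro isosI[of _ "Id C A"]) auto

lemma isomorphic_refl: "A \<in> Ob C \<Longrightarrow> isomorphic C A A"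
  using iso_id unfolding isomorphic_def by blast

lemma isomorphic_sym: "isomorphic C A B \<Longrightarrow> isomorphic C B A"
  unfolding isomorphic_def by (blast elim: isosE)

lemma isomorphic_trans: "\<lbrakk>isomorphic C A B; isomorphic C B D\<rbrakk> \<Longrightarrow> isomorphic C A D"
  unfolding isomorphic_def by (metis equals0D equals0I iso_comp)

end

context linear_abelian_category
begin

text \<open>With this, a lemma proved for every linear abelian category yields its dual by
  instantiation at \<open>opp C\<close> and rewriting with \<open>opp_rules\<close>.\<close>

lemma opp_lac: "linear_abelian_category K (opp C)"
proof -
  interpret op: linear_category K "opp C" by (rule opp_linear_category)
  show ?thesis
  proof
    show "\<exists>Z. zero_object (opp C) Z" using has_zero_object by simp
  next
    fix A B assume "A \<in> Ob (opp C)" "B \<in> Ob (opp C)"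
    then obtain S i j p r where "S \<in> Ob C" "(i, j, p, r) \<in> biproducts C A B S"
      using has_biproducts[of A B] by auto
    then show "\<exists>S\<in>Ob (opp C). biproducts (opp C) A B S \<noteq> {}"
      using biproducts_opp[of p r i j C A B S] opp_simps(1) by (metis emptyE)
  qed (use has_kernels has_cokernels monic_is_kernel epic_is_cokernel in auto)
qed

lemmas epicI = linear_category.monicI[OF opp_linear_category, unfolded opp_rules]
lemmas epic_comp = linear_category.monic_comp[OF opp_linear_category, unfolded opp_rules]
lemmas epic_left = linear_category.monic_right[OF opp_linear_category, unfolded opp_rules]
lemmas cokD = linear_category.kerD[OF opp_linear_category, unfolded opp_rules]
lemmas cok_lift = linear_category.ker_lift[OF opp_linear_category, unfolded opp_rules]
lemmas cok_epic = linear_category.ker_monic[OF opp_linear_category, unfolded opp_rules]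
lemmas is_cokernelI = linear_category.is_kernelI[OF opp_linear_category, unfolded opp_rules]
lemmas iso_epic = linear_category.iso_monic[OF opp_linear_category, unfolded opp_rules]

text \<open>A monic is the kernel of some \<open>g\<close>; since f is also epic, \<open>g\<close>
  vanishes, and the identity of the codomain factors through f.\<close>

lemma mono_epi_iso:
  assumes "monic C f" "epic C f"
  shows "f \<in> isos C (Dom C f) (Cod C f)"
proof -
  obtain g where g: "is_kernel C f g" using monic_is_kernel assms by blast
  note [simp] = kerD[OF g]
  have g0: "g = nul (Cod C f) (Cod C g)" using epic_zero[OF assms(2), of g] by simp
  have "g \<cdot> Id C (Cod C f) = nul (Cod C f) (Cod C g)" by (subst g0) simp
  then obtain u where u: "u \<in> Arr C" "Dom C u = Cod C f" "Cod C u = Dom C f" "f \<cdot> u = Id C (Cod C f)"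
    using ker_lift[OF g, of "Id C (Cod C f)"] by auto
  moreover have "u \<cdot> f = Id C (Dom C f)"
    using monic_cancel[OF assms(1), of "u \<cdot> f" "Id C (Dom C f)"] comp_under[OF u(4), of f] u by simp
  ultimately show ?thesis by (intro isosI[of f u]) auto
qed

text \<open>The monic is a kernel of some \<open>g\<close>, and \<open>g\<close> factors through the
  cokernel \<open>c\<close>; hence whatever \<open>c\<close> kills is killed by \<open>g\<close> as
  well.\<close>

lemma monic_ker_of_cok:
  assumes "monic C m" "is_cokernel C c m"
  shows "is_kernel C m c"
proof -
  note [simp] = cokD[OF assms(2)]
  obtain g where g: "is_kernel C m g" using monic_is_kernel assms by blast
  note [simp] = kerD[OF g]
  obtain g' where g': "g' \<in> Arr C" "Cod C g' = Cod C g" "Dom C g' = Cod C c" "g' \<cdot> c = g"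
    using cok_lift[OF assms(2), of g] by auto
  show ?thesis
  proof (rule is_kernelI[OF assms(1)])
    fix h assume h: "h \<in> Arr C" "Cod C h = Dom C c" "c \<cdot> h = nul (Dom C h) (Cod C c)"
    have "g \<cdot> h = nul (Dom C h) (Cod C g)" using comp_under[OF g'(4), of h] h g' by simp
    then show "\<exists>u. u \<in> Arr C \<and> Dom C u = Dom C h \<and> Cod C u = Dom C m \<and> m \<cdot> u = h"
      using ker_lift[OF g, of h] h kerD[OF g] cokD[OF assms(2)] by metis
  qed auto
qed

lemmas epic_cok_of_ker = linear_abelian_category.monic_ker_of_cok[OF opp_lac, unfolded opp_rules]

lemma sesI1: "\<lbrakk>monic C i; is_cokernel C p i\<rbrakk> \<Longrightarrow> ses C i p"
  unfolding ses_def using monic_ker_of_cok by blast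

lemma sesI2: "\<lbrakk>epic C p; is_kernel C i p\<rbrakk> \<Longrightarrow> ses C i p"
  unfolding ses_def using epic_cok_of_ker by blast

lemma sesD:
  assumes "ses C i p"
  shows "i \<in> Arr C \<and> p \<in> Arr C \<and> Dom C p = Cod C i \<and> p \<cdot> i = nul (Dom C i) (Cod C p)"
  using assms kerD cokD unfolding ses_def by blast

lemma ses_monic: "ses C i p \<Longrightarrow> monic C i"
  and ses_epic: "ses C i p \<Longrightarrow> epic C p"
  using ker_monic cok_epic unfolding ses_def by auto

lemma ses_lift:
  assumes "ses C i p" "h \<in> Arr C" "Cod C h = Cod C i" "p \<cdot> h = nul (Dom C h) (Cod C p)"
  obtains u where "u \<in> Arr C" "Dom C u = Dom C h" "Cod C u = Dom C i" "i \<cdot> u = h"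
  using ker_lift[of i p h] assms sesD[OF assms(1)] unfolding ses_def by auto

lemmas ses_desc = linear_abelian_category.ses_lift[OF opp_lac, unfolded opp_rules]

lemma ex_ses_monic:
  assumes "monic C i"
  obtains p where "ses C i p"
  using has_cokernels sesI1 assms monic_arr by blast

lemma ex_ses_epic:
  assumes "epic C p"
  obtains i where "ses C i p"
  using has_kernels sesI2 assms epic_arr by blast

text \<open>The monic part is the kernel of the cokernel of f. What needs an argument is that the
  induced \<open>e\<close> is epic, that is, the minimality of the image.\<close>

lemma image_factorization:
  assumes "f \<in> Arr C"
  obtains e m where "epic C e" "monic C m" "Dom C m = Cod C e" "m \<cdot> e = f"
proof -
  obtain c where c: "is_cokernel C c f" using has_cokernels assms by blast
  note [simp] = cokD[OF c]
  obtain m where m: "is_kernel C m c" using has_kernels cokD[OF c] by blast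
  note [simp] = kerD[OF m]
  obtain e where e: "e \<in> Arr C" "Dom C e = Dom C f" "Cod C e = Dom C m" "m \<cdot> e = f"
    using ker_lift[OF m, of f] by auto
  have "epic C e"
  proof (rule epicI)
    fix g assume g: "g \<in> Arr C" "Dom C g = Cod C e" "g \<cdot> e = nul (Dom C e) (Cod C g)"
    obtain k where k: "is_kernel C k g" using has_kernels g by blast
    note [simp] = kerD[OF k]
    obtain e' where e': "e' \<in> Arr C" "Dom C e' = Dom C e" "Cod C e' = Dom C k" "k \<cdot> e' = e"
      using ker_lift[OF k, of e] e g by auto
    \<comment> \<open>If \<open>g\<close> kills \<open>e\<close>, then f factors through the smaller
      subobject \<open>m \<cdot> k\<close>. This is a kernel of some \<open>h\<close>, which kills
      f, hence factors through \<open>c\<close> and kills \<open>m\<close> too. So \<open>m\<close>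
      factors through \<open>m \<cdot> k\<close>, the arrow \<open>k\<close> has a right inverse,
      and \<open>g\<close> is zero.\<close>
    have mk: "monic C (m \<cdot> k)" using monic_comp ker_monic[OF m] ker_monic[OF k] e g by simp
    then obtain h where h: "is_kernel C (m \<cdot> k) h" using monic_is_kernel by blast
    have hD: "h \<in> Arr C" "Dom C h = Cod C m" "h \<cdot> m \<cdot> k = nul (Dom C k) (Cod C h)"
      using kerD[OF h] e g by auto
    have "h \<cdot> f = nul (Dom C f) (Cod C h)"
    proof -
      have "h \<cdot> f = h \<cdot> m \<cdot> k \<cdot> e'" using e e' by simp
      also have "\<dots> = (h \<cdot> m \<cdot> k) \<cdot> e'" using hD(1,2) e' e g by simp
      finally show ?thesis using hD e' e by simp
    qed
    then obtain h' where h': "h' \<in> Arr C" "Cod C h' = Cod C h" "Dom C h' = Cod C c" "h' \<cdot> c = h"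
      using cok_lift[OF c, of h] hD by auto
    have "h \<cdot> m = nul (Dom C m) (Cod C h)" using comp_under[OF h'(4), of m] h' by simp
    then obtain u where u: "u \<in> Arr C" "Dom C u = Dom C m" "Cod C u = Dom C k" "(m \<cdot> k) \<cdot> u = m"
      using ker_lift[OF h, of m] hD e g by auto
    have "m \<cdot> k \<cdot> u = m \<cdot> Id C (Dom C m)" using u e g by simp
    then have ku: "k \<cdot> u = Id C (Dom C m)"
      using monic_cancel[OF ker_monic[OF m], of "k \<cdot> u" "Id C (Dom C m)"] u e g by simp
    have "g = g \<cdot> k \<cdot> u" using ku g e by simp
    also have "\<dots> = (g \<cdot> k) \<cdot> u" using u g by (intro assoc[symmetric]) auto
    finally show "g = nul (Cod C e) (Cod C g)" using u g e by simp
  qed (use e in simp)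
  then show ?thesis using that[of e m] ker_monic[OF m] e by simp
qed

text \<open>A chase with generalized elements: if \<open>a\<close> kills \<open>z\<close>, monicity
  of \<open>y\<close> moves \<open>z\<close> into the subobject \<open>i\<close>, where monicity of
  \<open>x\<close> makes it zero.\<close>

lemma four_monic:
  assumes s: "ses C i p" and s': "ses C i' p'" and "monic C x" "monic C y"
    and "Dom C x = Dom C i" "Cod C x = Dom C i'" "Dom C y = Cod C p" "Cod C y = Cod C p'"
    and "a \<in> Arr C" "Dom C a = Cod C i" "Cod C a = Cod C i'" "a \<cdot> i = i' \<cdot> x" "p' \<cdot> a = y \<cdot> p"
  shows "monic C a"
proof (rule monicI)
  note [simp] = sesD[OF s] sesD[OF s'] assms(5-11) monic_arr[OF assms(3)] monic_arr[OF assms(4)]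
  show "a \<in> Arr C" by simp
  fix z assume z [simp]: "z \<in> Arr C" "Cod C z = Dom C a" and az: "a \<cdot> z = nul (Dom C z) (Cod C a)"
  have "y \<cdot> p \<cdot> z = nul (Dom C z) (Cod C p')"
    using comp_under[OF assms(13), of z] az by simp
  then have "p \<cdot> z = nul (Dom C z) (Cod C p)" using monic_zero[OF assms(4), of "p \<cdot> z"] by simp
  then obtain u where u: "u \<in> Arr C" "Dom C u = Dom C z" "Cod C u = Dom C i" "i \<cdot> u = z"
    using ses_lift[OF s, of z] by auto
  note [simp] = u(1-3)
  have "(i' \<cdot> x) \<cdot> u = nul (Dom C z) (Cod C i')"
    using comp_under[OF assms(12), of u] u(4) az by simp
  then have "x \<cdot> u = nul (Dom C z) (Dom C i')" using monic_zero[OF ses_monic[OF s'], of "x \<cdot> u"] by simp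
  then have "u = nul (Dom C z) (Dom C i)" using monic_zero[OF assms(3), of u] by simp
  then show "z = nul (Dom C z) (Dom C a)" using u(4) by simp
qed

lemmas four_epic = linear_abelian_category.four_monic[OF opp_lac, unfolded opp_rules]

lemma five_iso:
  assumes s: "ses C i p" and s': "ses C i' p'" and x: "x \<in> isos C (Dom C i) (Dom C i')"
    and y: "y \<in> isos C (Cod C p) (Cod C p')"
    and a: "a \<in> Arr C" "Dom C a = Cod C i" "Cod C a = Cod C i'" "a \<cdot> i = i' \<cdot> x" "p' \<cdot> a = y \<cdot> p"
  shows "a \<in> isos C (Cod C i) (Cod C i')"
proof -
  have "monic C a" using four_monic[OF s s' iso_monic[OF x] iso_monic[OF y]] isosD[OF x] isosD[OF y] a by simp
  moreover have "epic C a"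
    using four_epic[OF s' s iso_epic[OF y] iso_epic[OF x]] isosD[OF x] isosD[OF y] a sesD[OF s] sesD[OF s'] by simp
  ultimately show ?thesis using mono_epi_iso[of a] a by simp
qed

text \<open>The form in which comparison arrows produced by universal properties are recognized as
  isomorphisms.\<close>

lemma five:
  assumes s: "ses C i p" and s': "ses C i' p'" and eq: "Dom C i' = Dom C i" "Cod C p' = Cod C p"
    and a: "a \<in> Arr C" "Dom C a = Cod C i" "Cod C a = Cod C i'" "a \<cdot> i = i'" "p' \<cdot> a = p"
  shows "a \<in> isos C (Cod C i) (Cod C i')"
proof -
  note [simp] = sesD[OF s] sesD[OF s']
  show ?thesis
    by (rule five_iso[OF s s', of "Id C (Dom C i)" "Id C (Cod C p)"]) (use a eq iso_id in auto)
qed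

end

section \<open>Pushouts and completions\<close>

text \<open>For \<open>\<gamma> : S \<rightarrow> T\<close> with kernel \<open>k\<close> and cokernel \<open>c\<close>, a completion at \<open>X\<close> factors \<open>\<gamma>\<close> as a monic \<open>U\<close>
  followed by an epic \<open>W\<close> such that the square formed by \<open>S\<close>, \<open>X\<close>, the image of \<open>\<gamma>\<close> and \<open>T\<close> is bicartesian.
  Every arrow has a completion exactly when the category is hereditary.\<close>

definition completions :: "('o, 'm, 'k, 'z) lin_cat_scheme \<Rightarrow> 'm \<Rightarrow> 'm \<Rightarrow> 'm \<Rightarrow> 'o \<Rightarrow> ('m \<times> 'm) set" where
  "completions C \<gamma> k c X = {(U, W). U \<in> Arr C \<and> W \<in> Arr C \<and> Dom C U = Dom C \<gamma> \<and> Cod C U = X \<and> Dom C W = X \<and>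
     Cod C W = Cod C \<gamma> \<and> W \<odot>\<^bsub>C\<^esub> U = \<gamma> \<and> is_kernel C (U \<odot>\<^bsub>C\<^esub> k) W \<and> is_cokernel C (c \<odot>\<^bsub>C\<^esub> W) U}"

lemma completions_opp [simp]: "(W, U) \<in> completions (opp C) \<gamma> c k X \<longleftrightarrow> (U, W) \<in> completions C \<gamma> k c X"
  by (auto simp: completions_def)

definition short_exacts :: "('o, 'm, 'k, 'z) lin_cat_scheme \<Rightarrow> 'o \<Rightarrow> 'o \<Rightarrow> 'o \<Rightarrow> ('m \<times> 'm) set" where
  "short_exacts C A X B = {(i, p). ses C i p \<and> Dom C i = A \<and> Cod C i = X \<and> Cod C p = B}"

context linear_abelian_category
begin

lemma short_exacts_iff: "(i, p) \<in> short_exacts C A X B \<longleftrightarrow> ses C i p \<and> Dom C i = A \<and> Cod C i = X \<and> Cod C p = B"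
  by (simp add: short_exacts_def)

lemma short_exacts_opp [simp]: "(p, i) \<in> short_exacts (opp C) B X A \<longleftrightarrow> (i, p) \<in> short_exacts C A X B"
  using sesD by (auto simp: short_exacts_def)

lemma biprodD:
  assumes "(i, j, p, r) \<in> biproducts C A B S"
  shows "i \<in> Arr C \<and> j \<in> Arr C \<and> p \<in> Arr C \<and> r \<in> Arr C \<and>
    Dom C i = A \<and> Dom C j = B \<and> Dom C p = S \<and> Dom C r = S \<and>
    Cod C i = S \<and> Cod C j = S \<and> Cod C p = A \<and> Cod C r = B \<and>
    p \<cdot> i = Id C A \<and> r \<cdot> j = Id C B \<and> p \<cdot> j = nul B A \<and> r \<cdot> i = nul A B \<and> i \<cdot> p \<boxplus> j \<cdot> r = Id C S"
  using assms by (simp add: biproducts_def)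

lemma biprodE:
  assumes "A \<in> Ob C" "B \<in> Ob C"
  obtains S i j p r where "(i, j, p, r) \<in> biproducts C A B S"
  using has_biproducts[OF assms] by fast

lemma biprod_under:
  assumes "(i, j, p, r) \<in> biproducts C A B S" "x \<in> Arr C"
  shows "Cod C x = A \<Longrightarrow> p \<cdot> i \<cdot> x = x" "Cod C x = B \<Longrightarrow> r \<cdot> j \<cdot> x = x"
    "Cod C x = B \<Longrightarrow> p \<cdot> j \<cdot> x = nul (Dom C x) A" "Cod C x = A \<Longrightarrow> r \<cdot> i \<cdot> x = nul (Dom C x) B"
  using comp_under[of p i _ x] comp_under[of r j _ x] comp_under[of p j _ x] comp_under[of r i _ x]
    biprodD[OF assms(1)] assms(2) Ob_of_arr by auto

lemma biprod_ext:
  assumes b: "(i, j, p, r) \<in> biproducts C A B S"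
    and "f \<in> Arr C" "f' \<in> Arr C" "Dom C f = S" "Dom C f' = S" "f \<cdot> i = f' \<cdot> i" "f \<cdot> j = f' \<cdot> j" "Cod C f = Cod C f'"
  shows "f = f'"
proof -
  note [simp] = biprodD[OF b] assms(2-5)
  have *: "g = (g \<cdot> i) \<cdot> p \<boxplus> (g \<cdot> j) \<cdot> r" if "g \<in> Arr C" "Dom C g = S" for g
  proof -
    have "i \<cdot> p \<boxplus> j \<cdot> r = Id C S" by simp
    then have "g \<cdot> (i \<cdot> p \<boxplus> j \<cdot> r) = g" using that by (metis comp_id')
    moreover have "g \<cdot> (i \<cdot> p \<boxplus> j \<cdot> r) = g \<cdot> i \<cdot> p \<boxplus> g \<cdot> j \<cdot> r" using that biprodD[OF b] by (intro comp_add') auto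
    ultimately show ?thesis using that by simp
  qed
  show ?thesis using *[of f] *[of f'] assms by metis
qed

text \<open>The pushout is the cokernel \<open>q\<close> of (\<sigma>, -\<iota>) into the direct
  sum. The second component is monic, so this arrow is monic and \<open>q\<close> belongs to a short
  exact sequence.\<close>

lemma pushout_construction:
  assumes s: "ses C \<iota> c" and \<sigma>: "\<sigma> \<in> Arr C" "Dom C \<sigma> = Dom C \<iota>"
  obtains U \<rho> \<eta> where "ses C U \<eta>" "Dom C U = Cod C \<sigma>" "\<rho> \<in> Arr C" "Dom C \<rho> = Cod C \<iota>" "Cod C \<rho> = Cod C U"
    "Cod C \<eta> = Cod C c" "U \<cdot> \<sigma> = \<rho> \<cdot> \<iota>" "\<eta> \<cdot> \<rho> = c"
    "\<And>g g'. \<lbrakk>g \<in> Arr C; g' \<in> Arr C; Dom C g = Cod C \<sigma>; Dom C g' = Cod C \<iota>; Cod C g = Cod C g'; g \<cdot> \<sigma> = g' \<cdot> \<iota>\<rbrakk>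
      \<Longrightarrow> \<exists>v. v \<in> Arr C \<and> Dom C v = Cod C U \<and> Cod C v = Cod C g \<and> v \<cdot> U = g \<and> v \<cdot> \<rho> = g'"
proof -
  note [simp] = sesD[OF s] \<sigma>
  obtain B i j p r where b: "(i, j, p, r) \<in> biproducts C (Cod C \<sigma>) (Cod C \<iota>) B"
    by (rule biprodE[OF cod_in_Ob[OF \<sigma>(1)] cod_in_Ob[OF sesD[OF s, THEN conjunct1]]])
  note [simp] = biprodD[OF b] biprod_under[OF b]
  define d where "d = i \<cdot> \<sigma> \<boxminus> j \<cdot> \<iota>"
  have d [simp]: "d \<in> Arr C" "Dom C d = Dom C \<iota>" "Cod C d = B" by (simp_all add: d_def)
  have rd: "r \<cdot> d = neg \<iota>" by (simp add: d_def)
  have neg0: "x = nul (Dom C x) (Dom C \<iota>)"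
    if "x \<in> Arr C" "Cod C x = Dom C \<iota>" "neg (\<iota> \<cdot> x) = nul (Dom C x) (Cod C \<iota>)" for x
  proof -
    have "\<iota> \<cdot> x = nul (Dom C x) (Cod C \<iota>)" using sub_eq_zero_iff[of "nul (Dom C x) (Cod C \<iota>)" "\<iota> \<cdot> x"] that by simp
    then show ?thesis using monic_zero[OF ses_monic[OF s], of x] that by simp
  qed
  have "monic C d"
  proof (rule monicI)
    fix x assume x: "x \<in> Arr C" "Cod C x = Dom C d" "d \<cdot> x = nul (Dom C x) (Cod C d)"
    then have "neg (\<iota> \<cdot> x) = nul (Dom C x) (Cod C \<iota>)" using comp_under[OF rd, of x] by simp
    then show "x = nul (Dom C x) (Dom C d)" using neg0[of x] x by simp
  qed simp
  then obtain q where q: "ses C d q" by (rule ex_ses_monic)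
  note [simp] = sesD[OF q]
  have qd: "q \<cdot> i \<cdot> \<sigma> = q \<cdot> j \<cdot> \<iota>"
    using sub_eq_zero_iff[of "q \<cdot> i \<cdot> \<sigma>" "q \<cdot> j \<cdot> \<iota>"] sesD[OF q] by (simp add: d_def)
  have "(c \<cdot> r) \<cdot> d = nul (Dom C d) (Cod C c)" by (simp add: rd)
  then obtain \<eta> where \<eta>: "\<eta> \<in> Arr C" "Cod C \<eta> = Cod C c" "Dom C \<eta> = Cod C q" "\<eta> \<cdot> q = c \<cdot> r"
    using ses_desc[OF q, of "c \<cdot> r"] by auto
  note [simp] = \<eta>(1-3)
  define U where "U = q \<cdot> i"
  define \<rho> where "\<rho> = q \<cdot> j"
  have [simp]: "U \<in> Arr C" "Dom C U = Cod C \<sigma>" "Cod C U = Cod C q" "\<rho> \<in> Arr C" "Dom C \<rho> = Cod C \<iota>" "Cod C \<rho> = Cod C q"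
    by (simp_all add: U_def \<rho>_def)
  have \<eta>\<rho>: "\<eta> \<cdot> \<rho> = c" using comp_under[OF \<eta>(4), of j] by (simp add: \<rho>_def)
  have \<eta>U: "\<eta> \<cdot> U = nul (Dom C U) (Cod C c)" using comp_under[OF \<eta>(4), of i] by (simp add: U_def)
  have U\<sigma>: "U \<cdot> \<sigma> = \<rho> \<cdot> \<iota>" using qd by (simp add: U_def \<rho>_def)
  \<comment> \<open>If \<open>U\<close> kills \<open>x\<close>, then \<open>i \<cdot> x\<close>
    comes from the common source through \<open>d\<close>, and its vanishing second component forces
    that preimage to be zero.\<close>
  have mU: "monic C U"
  proof (rule monicI)
    fix x assume x: "x \<in> Arr C" "Cod C x = Dom C U" "U \<cdot> x = nul (Dom C x) (Cod C U)"
    then obtain y where y: "y \<in> Arr C" "Dom C y = Dom C x" "Cod C y = Dom C d" "d \<cdot> y = i \<cdot> x"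
      using ses_lift[OF q, of "i \<cdot> x"] by (auto simp: U_def)
    have "neg (\<iota> \<cdot> y) = nul (Dom C y) (Cod C \<iota>)" using comp_under[OF rd, of y] y x by simp
    then have "y = nul (Dom C y) (Dom C \<iota>)" using neg0[of y] y by simp
    then have "i \<cdot> x = nul (Dom C x) B" using y by (metis comp_zero d(1,2,3) Ob_of_arr(1))
    then have "p \<cdot> i \<cdot> x = nul (Dom C x) (Cod C \<sigma>)" using x by simp
    then show "x = nul (Dom C x) (Dom C U)" using x by simp
  qed simp
  have eU: "epic C \<eta>" using epic_left[of \<eta> \<rho>] ses_epic[OF s] \<eta>\<rho> by simp
  have "is_cokernel C \<eta> U"
  proof (rule is_cokernelI[OF eU])
    fix g assume g: "g \<in> Arr C" "Dom C g = Cod C U" "g \<cdot> U = nul (Dom C U) (Cod C g)"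
    have "g \<cdot> \<rho> \<cdot> \<iota> = nul (Dom C \<iota>) (Cod C g)" using comp_under[OF g(3), of \<sigma>] U\<sigma> g by simp
    then obtain g' where g': "g' \<in> Arr C" "Cod C g' = Cod C g" "Dom C g' = Cod C c" "g' \<cdot> c = g \<cdot> \<rho>"
      using ses_desc[OF s, of "g \<cdot> \<rho>"] g by auto
    have "g' \<cdot> c \<cdot> r = g \<cdot> q"
      by (rule biprod_ext[OF b]) (use comp_under[OF g'(4), of r] g g' in \<open>simp_all add: U_def \<rho>_def\<close>)
    then have "(g' \<cdot> \<eta>) \<cdot> q = g \<cdot> q" using g g' \<eta>(4) by simp
    then have "g' \<cdot> \<eta> = g" using epic_cancel[OF ses_epic[OF q], of "g' \<cdot> \<eta>" g] g g' by simp
    then show "\<exists>u. u \<in> Arr C \<and> Cod C u = Cod C g \<and> Dom C u = Cod C \<eta> \<and> u \<cdot> \<eta> = g" using g' by auto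
  qed (simp_all add: \<eta>U)
  then have sU: "ses C U \<eta>" using sesI1 mU by blast
  show ?thesis
  proof (rule that[OF sU])
    fix g g' assume g: "g \<in> Arr C" "g' \<in> Arr C" "Dom C g = Cod C \<sigma>" "Dom C g' = Cod C \<iota>" "Cod C g = Cod C g'"
      "g \<cdot> \<sigma> = g' \<cdot> \<iota>"
    then have "(g \<cdot> p \<boxplus> g' \<cdot> r) \<cdot> d = nul (Dom C d) (Cod C g)" by (simp add: d_def)
    then obtain v where v: "v \<in> Arr C" "Cod C v = Cod C g" "Dom C v = Cod C q" "v \<cdot> q = g \<cdot> p \<boxplus> g' \<cdot> r"
      using ses_desc[OF q, of "g \<cdot> p \<boxplus> g' \<cdot> r"] g by auto
    have "v \<cdot> U = g" "v \<cdot> \<rho> = g'" using comp_under[OF v(4), of i] comp_under[OF v(4), of j] g v Ob_of_arr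
      by (simp_all add: U_def \<rho>_def)
    then show "\<exists>v. v \<in> Arr C \<and> Dom C v = Cod C U \<and> Cod C v = Cod C g \<and> v \<cdot> U = g \<and> v \<cdot> \<rho> = g'"
      using v by (intro exI[of _ v]) simp
  qed (use \<eta>\<rho> U\<sigma> in simp_all)
qed

text \<open>The universal property is left out because \<open>pushout_desc\<close> recovers it from
  the morphism of sequences alone; this shorter form dualizes by rewriting.\<close>

lemma pushout_exists:
  assumes "ses C \<iota> c" "\<sigma> \<in> Arr C" "Dom C \<sigma> = Dom C \<iota>"
  obtains U \<rho> \<eta> where "ses C U \<eta>" "Dom C U = Cod C \<sigma>" "\<rho> \<in> Arr C" "Dom C \<rho> = Cod C \<iota>" "Cod C \<rho> = Cod C U"
    "Cod C \<eta> = Cod C c" "U \<cdot> \<sigma> = \<rho> \<cdot> \<iota>" "\<eta> \<cdot> \<rho> = c"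
  by (rule pushout_construction[OF assms])

text \<open>\<open>U\<close> and \<rho> are jointly epic: a difference killed by \<open>U\<close>
  descends along \<eta>, and as \<rho> kills it too, the descended arrow is killed by the epic
  \<open>c\<close>.\<close>

lemma pushout_ext:
  assumes s: "ses C \<iota> c" and s': "ses C U \<eta>" and \<rho>: "\<rho> \<in> Arr C" "Dom C \<rho> = Cod C \<iota>" "Cod C \<rho> = Cod C U"
    "Cod C \<eta> = Cod C c" "\<eta> \<cdot> \<rho> = c"
    and v: "v \<in> Arr C" "v' \<in> Arr C" "Dom C v = Cod C U" "Dom C v' = Cod C U" "Cod C v = Cod C v'"
    and eq: "v \<cdot> U = v' \<cdot> U" "v \<cdot> \<rho> = v' \<cdot> \<rho>"
  shows "v = v'"
proof -
  note [simp] = sesD[OF s] sesD[OF s'] \<rho>(1-4) v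
  have "(v \<boxminus> v') \<cdot> U = nul (Dom C U) (Cod C v')" by (simp add: eq)
  then obtain d where d: "d \<in> Arr C" "Cod C d = Cod C v'" "Dom C d = Cod C \<eta>" "d \<cdot> \<eta> = v \<boxminus> v'"
    using ses_desc[OF s', of "v \<boxminus> v'"] by auto
  have "d \<cdot> c = d \<cdot> \<eta> \<cdot> \<rho>" by (simp add: \<rho>(5))
  also have "\<dots> = nul (Dom C c) (Cod C d)" using d comp_under[OF d(4), of \<rho>] by (simp add: eq)
  finally have "d = nul (Cod C c) (Cod C d)" using epic_zero[OF ses_epic[OF s], of d] d by simp
  then have "v \<boxminus> v' = nul (Cod C U) (Cod C v')" using d by (metis sesD[OF s'] zero_comp \<rho>(4) cod_in_Ob v(2))
  then show ?thesis using sub_eq_zero_iff[of v v'] by simp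
qed

text \<open>A morphism of short exact sequences which is the identity on the right end is a pushout.\<close>

lemma pushout_desc:
  assumes s: "ses C \<iota> c" and s': "ses C U \<eta>" and \<rho>: "\<rho> \<in> Arr C" "Dom C \<rho> = Cod C \<iota>" "Cod C \<rho> = Cod C U"
    "Cod C \<eta> = Cod C c" "\<eta> \<cdot> \<rho> = c"
    and \<sigma>: "\<sigma> \<in> Arr C" "Dom C \<sigma> = Dom C \<iota>" "Cod C \<sigma> = Dom C U" "U \<cdot> \<sigma> = \<rho> \<cdot> \<iota>"
    and g: "g \<in> Arr C" "g' \<in> Arr C" "Dom C g = Dom C U" "Dom C g' = Cod C \<iota>" "Cod C g = Cod C g'" "g \<cdot> \<sigma> = g' \<cdot> \<iota>"
  obtains v where "v \<in> Arr C" "Dom C v = Cod C U" "Cod C v = Cod C g" "v \<cdot> U = g" "v \<cdot> \<rho> = g'"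
proof -
  note [simp] = sesD[OF s] sesD[OF s'] \<rho>(1-4) \<sigma>(1-3) g(1-5)
  obtain U0 \<rho>0 \<eta>0 where s0: "ses C U0 \<eta>0" and p0 [simp]: "Dom C U0 = Cod C \<sigma>" "\<rho>0 \<in> Arr C" "Dom C \<rho>0 = Cod C \<iota>"
      "Cod C \<rho>0 = Cod C U0" "Cod C \<eta>0 = Cod C c" and p0': "U0 \<cdot> \<sigma> = \<rho>0 \<cdot> \<iota>" "\<eta>0 \<cdot> \<rho>0 = c"
    and univ: "\<And>g g'. \<lbrakk>g \<in> Arr C; g' \<in> Arr C; Dom C g = Cod C \<sigma>; Dom C g' = Cod C \<iota>; Cod C g = Cod C g'; g \<cdot> \<sigma> = g' \<cdot> \<iota>\<rbrakk>
      \<Longrightarrow> \<exists>v. v \<in> Arr C \<and> Dom C v = Cod C U0 \<and> Cod C v = Cod C g \<and> v \<cdot> U0 = g \<and> v \<cdot> \<rho>0 = g'"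
    using pushout_construction[OF s \<sigma>(1,2)] by metis
  note [simp] = sesD[OF s0]
  \<comment> \<open>The constructed pushout maps to the given sequence; by the five lemma this
    comparison is invertible, and its inverse transports the universal property.\<close>
  obtain a where a: "a \<in> Arr C" "Dom C a = Cod C U0" "Cod C a = Cod C U" "a \<cdot> U0 = U" "a \<cdot> \<rho>0 = \<rho>"
    using univ[of U \<rho>] \<sigma>(4) by auto
  have "\<eta> \<cdot> a = \<eta>0"
    by (rule pushout_ext[OF s s0, of \<rho>0]) (use a p0' \<rho> in simp_all)
  then have "a \<in> isos C (Cod C U0) (Cod C U)" using five[OF s0 s', of a] a by simp
  then obtain b where b: "b \<in> Arr C" "Dom C b = Cod C U" "Cod C b = Cod C U0" "b \<cdot> a = Id C (Cod C U0)"
    by (blast elim: isosE)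
  have bU: "b \<cdot> U = U0" "b \<cdot> \<rho> = \<rho>0"
    using comp_under[OF b(4), of U0] comp_under[OF b(4), of \<rho>0] a b by auto
  obtain w where w: "w \<in> Arr C" "Dom C w = Cod C U0" "Cod C w = Cod C g" "w \<cdot> U0 = g" "w \<cdot> \<rho>0 = g'"
    using univ[of g g'] g by auto
  show ?thesis using that[of "w \<cdot> b"] w b bU by simp
qed

lemmas pullback_exists = linear_abelian_category.pushout_exists[OF opp_lac, unfolded opp_rules]
lemmas pullback_ext = linear_abelian_category.pushout_ext[OF opp_lac, unfolded opp_rules]
lemmas pullback_lift = linear_abelian_category.pushout_desc[OF opp_lac, unfolded opp_rules]

lemma kernel_of_monic_comp:
  assumes "monic C m" "e \<in> Arr C" "Dom C m = Cod C e"
  shows "is_kernel C k (m \<cdot> e) \<longleftrightarrow> is_kernel C k e"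
proof
  note [simp] = monic_arr[OF assms(1)] assms(2,3)
  assume k: "is_kernel C k (m \<cdot> e)"
  have kD [simp]: "k \<in> Arr C" "Cod C k = Dom C e" and mek: "m \<cdot> e \<cdot> k = nul (Dom C k) (Cod C m)" using kerD[OF k] by auto
  have "e \<cdot> k = nul (Dom C k) (Cod C e)" using monic_zero[OF assms(1), of "e \<cdot> k"] mek by simp
  show "is_kernel C k e"
  proof (intro is_kernelI[OF ker_monic[OF k]])
    fix h assume h: "h \<in> Arr C" "Cod C h = Dom C e" "e \<cdot> h = nul (Dom C h) (Cod C e)"
    then obtain u where "u \<in> Arr C" "Dom C u = Dom C h" "Cod C u = Dom C k" "k \<cdot> u = h"
      using ker_lift[OF k, of h] by auto
    then show "\<exists>u. u \<in> Arr C \<and> Dom C u = Dom C h \<and> Cod C u = Dom C k \<and> k \<cdot> u = h" by blast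
  qed (simp_all add: \<open>e \<cdot> k = _\<close>)
next
  note [simp] = monic_arr[OF assms(1)] assms(2,3)
  assume k: "is_kernel C k e"
  note [simp] = kerD[OF k]
  show "is_kernel C k (m \<cdot> e)"
  proof (intro is_kernelI[OF ker_monic[OF k]])
    fix h assume h: "h \<in> Arr C" "Cod C h = Dom C (m \<cdot> e)" "(m \<cdot> e) \<cdot> h = nul (Dom C h) (Cod C (m \<cdot> e))"
    then have "e \<cdot> h = nul (Dom C h) (Cod C e)" using monic_zero[OF assms(1), of "e \<cdot> h"] by simp
    then show "\<exists>u. u \<in> Arr C \<and> Dom C u = Dom C h \<and> Cod C u = Dom C k \<and> k \<cdot> u = h"
      using ker_lift[OF k, of h] h by (metis comp_arr(2) monic_arr assms)
  qed simp_all
qed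

lemmas cokernel_of_comp_epic = linear_abelian_category.kernel_of_monic_comp[OF opp_lac, unfolded opp_rules]

lemma kernel_comp_iso:
  assumes k: "is_kernel C k f" and x: "x \<in> isos C A (Dom C k)"
  shows "is_kernel C (k \<cdot> x) f"
proof -
  note [simp] = kerD[OF k] isosD[OF x]
  obtain y where y: "y \<in> Arr C" "Dom C y = Dom C k" "Cod C y = A" "x \<cdot> y = Id C (Dom C k)"
    using x by (blast elim: isosE)
  show ?thesis
  proof (rule is_kernelI)
    show "monic C (k \<cdot> x)" using monic_comp iso_monic[OF x] ker_monic[OF k] by simp
    show "f \<cdot> k \<cdot> x = nul (Dom C (k \<cdot> x)) (Cod C f)" using comp_under[of f k _ x] kerD[OF k] by simp
    fix h assume h: "h \<in> Arr C" "Cod C h = Dom C f" "f \<cdot> h = nul (Dom C h) (Cod C f)"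
    then obtain u where u: "u \<in> Arr C" "Dom C u = Dom C h" "Cod C u = Dom C k" "k \<cdot> u = h"
      using ker_lift[OF k] by metis
    then have "(k \<cdot> x) \<cdot> y \<cdot> u = h" using y comp_under[OF y(4), of u] by simp
    then show "\<exists>u. u \<in> Arr C \<and> Dom C u = Dom C h \<and> Cod C u = Dom C (k \<cdot> x) \<and> (k \<cdot> x) \<cdot> u = h"
      using u y by (intro exI[of _ "y \<cdot> u"]) simp
  qed simp_all
qed

lemmas iso_comp_cokernel = linear_abelian_category.kernel_comp_iso[OF opp_lac, unfolded opp_rules]

lemma biprod_ses:
  assumes b: "(i, j, p, r) \<in> biproducts C A B S"
  shows "ses C i r"
proof -
  note [simp] = biprodD[OF b] biprod_under[OF b]
  have Ob [simp]: "A \<in> Ob C" "B \<in> Ob C" using Ob_of_arr biprodD[OF b] by blast+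
  have "monic C (p \<cdot> i)" using iso_monic[OF iso_id] by simp
  then have "monic C i" using monic_right[of p i] by simp
  moreover have "epic C r" using epic_left[of r j] iso_epic[OF iso_id[of B]] by simp
  moreover have "is_cokernel C r i"
  proof (rule is_cokernelI[OF \<open>epic C r\<close>])
    fix g assume g: "g \<in> Arr C" "Dom C g = Cod C i" "g \<cdot> i = nul (Dom C i) (Cod C g)"
    have "(g \<cdot> j) \<cdot> r = g" by (rule biprod_ext[OF b]) (use g in simp_all)
    then show "\<exists>u. u \<in> Arr C \<and> Cod C u = Cod C g \<and> Dom C u = Cod C r \<and> u \<cdot> r = g"
      using g by (intro exI[of _ "g \<cdot> j"]) simp
  qed simp_all
  ultimately show ?thesis using sesI1 by blast
qed

section \<open>Recognizing completions and moving them along Yoneda equivalences\<close>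

lemma completionsD:
  assumes "(U, W) \<in> completions C \<gamma> k c X"
  shows "U \<in> Arr C \<and> W \<in> Arr C \<and> Dom C U = Dom C \<gamma> \<and> Cod C U = X \<and> Dom C W = X \<and> Cod C W = Cod C \<gamma> \<and> W \<cdot> U = \<gamma>"
  using assms by (simp add: completions_def)

text \<open>\<open>U\<close> is monic because whatever it kills is killed by \<gamma>, hence factors
  through \<open>k\<close>, while \<open>U \<cdot> k\<close> is monic as a kernel of
  \<open>W\<close>.\<close>

lemma completion_ses1:
  assumes k: "is_kernel C k \<gamma>" and UW: "(U, W) \<in> completions C \<gamma> k c X" and c: "is_cokernel C c \<gamma>"
  shows "ses C U (c \<cdot> W)"
proof -
  note [simp] = completionsD[OF UW] kerD[OF k]
  have K: "is_kernel C (U \<cdot> k) W" and cW: "is_cokernel C (c \<cdot> W) U" using UW by (simp_all add: completions_def)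
  have "monic C U"
  proof (rule monicI)
    fix y assume y: "y \<in> Arr C" "Cod C y = Dom C U" "U \<cdot> y = nul (Dom C y) (Cod C U)"
    then have "\<gamma> \<cdot> y = nul (Dom C y) (Cod C \<gamma>)" using comp_under[of W U \<gamma> y] by simp
    then obtain z where z: "z \<in> Arr C" "Dom C z = Dom C y" "Cod C z = Dom C k" "k \<cdot> z = y"
      using ker_lift[OF k, of y] y by auto
    have "z = nul (Dom C z) (Dom C (U \<cdot> k))" using monic_zero[OF ker_monic[OF K], of z] z y by simp
    then show "y = nul (Dom C y) (Dom C U)" using z by (metis kerD[OF k] Ob_of_arr(1) comp_arr(2) completionsD[OF UW] comp_zero)
  qed simp
  then show ?thesis using sesI1 cW by blast
qed

lemmas completion_ses2 = linear_abelian_category.completion_ses1[OF opp_lac, unfolded opp_rules completions_opp]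

text \<open>One of the two exactness conditions implies the other: an arrow killed by
  \<open>W\<close> is killed by \<open>c \<cdot> W\<close>, so it factors through \<open>U\<close>,
  and the factor is killed by \<gamma>, so it factors through \<open>k\<close>.\<close>

lemma completionI1:
  assumes k: "is_kernel C k \<gamma>" and c: "is_cokernel C c \<gamma>"
    and [simp]: "U \<in> Arr C" "W \<in> Arr C" "Dom C U = Dom C \<gamma>" "Cod C U = X" "Dom C W = X" "Cod C W = Cod C \<gamma>"
    and WU: "W \<cdot> U = \<gamma>" and s: "ses C U (c \<cdot> W)"
  shows "(U, W) \<in> completions C \<gamma> k c X"
proof -
  note [simp] = kerD[OF k] cokD[OF c]
  have K: "is_kernel C (U \<cdot> k) W"
  proof (rule is_kernelI)
    show "monic C (U \<cdot> k)" using monic_comp ker_monic[OF k] ses_monic[OF s] by simp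
    show "W \<cdot> U \<cdot> k = nul (Dom C (U \<cdot> k)) (Cod C W)" using comp_under[OF WU, of k] by simp
    fix x assume x: "x \<in> Arr C" "Cod C x = Dom C W" "W \<cdot> x = nul (Dom C x) (Cod C W)"
    then obtain y where y: "y \<in> Arr C" "Dom C y = Dom C x" "Cod C y = Dom C U" "U \<cdot> y = x"
      using ses_lift[OF s, of x] by auto
    have "\<gamma> \<cdot> y = nul (Dom C y) (Cod C \<gamma>)" using comp_under[OF WU, of y] x y by simp
    then obtain z where "z \<in> Arr C" "Dom C z = Dom C y" "Cod C z = Dom C k" "k \<cdot> z = y"
      using ker_lift[OF k, of y] y by auto
    then show "\<exists>u. u \<in> Arr C \<and> Dom C u = Dom C x \<and> Cod C u = Dom C (U \<cdot> k) \<and> (U \<cdot> k) \<cdot> u = x"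
      using y by (intro exI[of _ z]) simp
  qed simp_all
  then show ?thesis using s by (simp add: completions_def WU ses_def)
qed

lemmas completionI2 = linear_abelian_category.completionI1[OF opp_lac, unfolded opp_rules completions_opp]

text \<open>Transport forwards along an elementary step of the Yoneda equivalence: \<open>U'\<close>
  is the pushout of \<open>U\<close> along \<alpha>, and \<open>W'\<close> is induced by
  \<open>g'\<close> and \<open>\<beta> \<cdot> W\<close>. The dual \<open>completion_pull\<close>
  transports backwards.\<close>

lemma completion_push:
  assumes UW: "(U, W) \<in> completions C g f h X"
    and f: "is_kernel C f g" and h: "is_cokernel C h g" and f': "is_kernel C f' g'" and h': "is_cokernel C h' g'"
    and \<alpha>: "\<alpha> \<in> Arr C" "Dom C \<alpha> = Dom C g" "Cod C \<alpha> = Dom C g'"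
    and \<beta>: "\<beta> \<in> Arr C" "Dom C \<beta> = Cod C g" "Cod C \<beta> = Cod C g'"
    and eq: "\<beta> \<cdot> g = g' \<cdot> \<alpha>" "h' \<cdot> \<beta> = h"
  shows "\<exists>X' U' W'. (U', W') \<in> completions C g' f' h' X'"
proof -
  note [simp] = kerD[OF f] kerD[OF f'] cokD[OF h] cokD[OF h'] \<alpha> \<beta>
  have UWD: "U \<in> Arr C" "W \<in> Arr C" "Dom C U = Dom C g" "Cod C U = X" "Dom C W = X" "Cod C W = Cod C g" and WU: "W \<cdot> U = g"
    using completionsD[OF UW] by auto
  note [simp] = UWD
  have Cod_h: "Cod C h = Cod C h'" using eq(2) by (metis \<beta> comp_arr(3) cokD[OF h'])
  note s = completion_ses1[OF f UW h]
  have Dom_\<alpha>: "Dom C \<alpha> = Dom C U" by simp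
  obtain U' \<rho> \<eta> where s': "ses C U' \<eta>" and p: "Dom C U' = Cod C \<alpha>" "\<rho> \<in> Arr C" "Dom C \<rho> = Cod C U" "Cod C \<rho> = Cod C U'"
    "Cod C \<eta> = Cod C (h \<cdot> W)" and p': "U' \<cdot> \<alpha> = \<rho> \<cdot> U" "\<eta> \<cdot> \<rho> = h \<cdot> W"
    by (rule pushout_exists[OF s \<alpha>(1) Dom_\<alpha>])
  have [simp]: "Dom C U' = Dom C g'" "\<rho> \<in> Arr C" "Dom C \<rho> = X" "Cod C \<rho> = Cod C U'" "Cod C \<eta> = Cod C h'"
    using p Cod_h by simp_all
  note [simp] = sesD[OF s']
  have g: "g' \<in> Arr C" "\<beta> \<cdot> W \<in> Arr C" "Dom C g' = Dom C U'" "Dom C (\<beta> \<cdot> W) = Cod C U" "Cod C g' = Cod C (\<beta> \<cdot> W)"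
    "g' \<cdot> \<alpha> = (\<beta> \<cdot> W) \<cdot> U" using eq WU by simp_all
  obtain W' where W': "W' \<in> Arr C" "Dom C W' = Cod C U'" "Cod C W' = Cod C g'" "W' \<cdot> U' = g'" "W' \<cdot> \<rho> = \<beta> \<cdot> W"
    by (rule pushout_desc[OF s s' p(2-5) p'(2) \<alpha>(1) Dom_\<alpha> p(1)[symmetric] p'(1) g])
  note [simp] = W'(1-3)
  have "h' \<cdot> W' = \<eta>"
    using pushout_ext[OF s s', of \<rho> "h' \<cdot> W'" \<eta>] p' W' Cod_h comp_under[OF eq(2), of W] by simp
  then have "(U', W') \<in> completions C g' f' h' (Cod C U')"
    using s' W' by (intro completionI1[OF f' h']) simp_all
  then show ?thesis by blast
qed

lemmas completion_pull = linear_abelian_category.completion_push[OF opp_lac, unfolded opp_rules completions_opp]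

text \<open>The biproduct of \<open>N\<close> and \<open>M\<close> serves; this is the starting
  point of the transport along Yoneda equivalences.\<close>

lemma zero_completion:
  assumes [simp]: "M \<in> Ob C" "N \<in> Ob C"
  shows "\<exists>X U W. (U, W) \<in> completions C (nul N M) (Id C N) (Id C M) X"
proof -
  obtain S i j p r where b: "(i, j, p, r) \<in> biproducts C N M S" by (rule biprodE[OF assms(2,1)])
  note [simp] = biprodD[OF b]
  have "is_kernel C (Id C N) (nul N M)" by (rule is_kernelI) (use iso_monic[OF iso_id] in auto)
  moreover have "is_cokernel C (Id C M) (nul N M)" by (rule is_cokernelI) (use iso_epic[OF iso_id] in auto)
  ultimately have "(i, r) \<in> completions C (nul N M) (Id C N) (Id C M) S"
    using biprod_ses[OF b] by (intro completionI1) simp_all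
  then show ?thesis by blast
qed

section \<open>Exactness of Yoneda extensions in terms of kernels and cokernels\<close>

lemma monic_exact_at:
  assumes "monic C f" "exact_at C f g"
  shows "is_kernel C f g"
proof -
  obtain e k where ek: "epic C e" "is_kernel C k g" "Cod C e = Dom C k" "f = k \<cdot> e" using assms by (auto simp: exact_at_def)
  have "monic C e" using monic_right[of k e] assms ek kerD epic_arr by auto
  then have "e \<in> isos C (Dom C e) (Dom C k)" using mono_epi_iso ek by metis
  then show ?thesis using kernel_comp_iso ek by blast
qed

lemma exact_at_epic:
  assumes "epic C h" "exact_at C g h"
  shows "is_cokernel C h g"
proof -
  obtain e k where ek: "epic C e" "is_kernel C k h" "Cod C e = Dom C k" "g = k \<cdot> e" using assms by (auto simp: exact_at_def)
  then show ?thesis using epic_cok_of_ker[OF assms(1) ek(2)] cokernel_of_comp_epic[of e k h] kerD by auto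
qed

lemma kernel_exact_at: "is_kernel C f g \<Longrightarrow> exact_at C f g"
  unfolding exact_at_def using kerD[of f g] iso_epic[OF iso_id[of "Dom C f"]]
  by (intro exI[of _ "Id C (Dom C f)"] exI[of _ f]) auto

lemma cokernel_exact_at:
  assumes h: "is_cokernel C h g"
  shows "exact_at C g h"
proof -
  obtain e m where em: "epic C e" "monic C m" "Dom C m = Cod C e" "m \<cdot> e = g"
    using image_factorization[of g] cokD[OF h] by auto
  then have "is_cokernel C h m" using cokernel_of_comp_epic[of e m h] h monic_arr by auto
  then show ?thesis unfolding exact_at_def using monic_ker_of_cok[OF em(2)] em by metis
qed

lemma extensions2_iff:
  "(f, g, h) \<in> extensions2 C M N \<longleftrightarrow> is_kernel C f g \<and> is_cokernel C h g \<and> Dom C f = N \<and> Cod C h = M"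
proof
  assume "(f, g, h) \<in> extensions2 C M N"
  then show "is_kernel C f g \<and> is_cokernel C h g \<and> Dom C f = N \<and> Cod C h = M"
    using monic_exact_at exact_at_epic unfolding extensions2_def by auto
next
  assume "is_kernel C f g \<and> is_cokernel C h g \<and> Dom C f = N \<and> Cod C h = M"
  then show "(f, g, h) \<in> extensions2 C M N"
    using kernel_exact_at cokernel_exact_at ker_monic cok_epic kerD cokD unfolding extensions2_def by auto
qed

lemma extensions_eq: "extensions C M N = {(f, g). ses C f g \<and> Dom C f = N \<and> Cod C g = M}"
proof safe
  fix f g assume "(f, g) \<in> extensions C M N"
  then show "ses C f g" "Dom C f = N" "Cod C g = M"
    using monic_exact_at[of f g] sesI2[of g f] unfolding extensions_def by blast+
next
  fix f g assume s: "ses C f g" and "N = Dom C f" "M = Cod C g"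
  then show "(f, g) \<in> extensions C (Cod C g) (Dom C f)"
    using kernel_exact_at[of f g] sesD[OF s] ses_monic[OF s] ses_epic[OF s] unfolding extensions_def ses_def by auto
qed

end

text \<open>The kernel, the arrow and the cokernel form a 2-extension. Heredity puts it into the
  zero class, so a finite chain of elementary steps, each in one of the two directions, joins it to
  the zero 2-extension; a completion exists there and is carried along the chain.\<close>

lemma (in finitary_hereditary_category) completion_exists:
  assumes k: "is_kernel C k \<gamma>" and c: "is_cokernel C c \<gamma>"
  shows "\<exists>X U W. (U, W) \<in> completions C \<gamma> k c X"
proof -
  define M N where "M = Cod C c" and "N = Dom C k"
  have Ob: "M \<in> Ob C" "N \<in> Ob C" using kerD[OF k] cokD[OF c] by (auto simp: M_def N_def)
  have "(k, \<gamma>, c) \<in> extensions2 C M N" using k c by (simp add: extensions2_iff M_def N_def)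
  then have "ext2_rel C M N `` {(k, \<gamma>, c)} \<in> Ext2 C M N" unfolding Ext2_def by (rule quotientI)
  then have eq: "ext2_rel C M N `` {(k, \<gamma>, c)} = Ext2_zero C M N" using hereditary[OF Ob] by simp
  have "((k, \<gamma>, c), (k, \<gamma>, c)) \<in> ext2_rel C M N" by (simp add: ext2_rel_def)
  then have "((Id C N, nul N M, Id C M), (k, \<gamma>, c)) \<in> (ext2_step C M N \<union> (ext2_step C M N)\<inverse>)\<^sup>*"
    using eq unfolding Ext2_zero_def ext2_rel_def by blast
  then show ?thesis
  proof (induction "(k, \<gamma>, c)" arbitrary: k \<gamma> c rule: rtrancl_induct)
    case base
    then show ?case using zero_completion[OF Ob] by simp
  next
    case (step y)
    obtain f g h where y: "y = (f, g, h)" by (cases y)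
    obtain X U W where UW: "(U, W) \<in> completions C g f h X" using step.hyps(3) y by blast
    consider "((f, g, h), (k, \<gamma>, c)) \<in> ext2_step C M N" | "((k, \<gamma>, c), (f, g, h)) \<in> ext2_step C M N"
      using step.hyps(2) y by blast
    then show ?case
    proof cases
      case 1
      then obtain \<alpha> \<beta> where "\<alpha> \<in> homset C (Dom C g) (Dom C \<gamma>)" "\<beta> \<in> homset C (Cod C g) (Cod C \<gamma>)"
        "\<beta> \<cdot> g = \<gamma> \<cdot> \<alpha>" "c \<cdot> \<beta> = h"
        and "is_kernel C f g" "is_cokernel C h g" "is_kernel C k \<gamma>" "is_cokernel C c \<gamma>"
        unfolding ext2_step_def by (auto simp: extensions2_iff)
      then show ?thesis by (intro completion_push[OF UW]) auto
    next
      case 2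
      then obtain \<alpha> \<beta> where "\<alpha> \<in> homset C (Dom C \<gamma>) (Dom C g)" "\<beta> \<in> homset C (Cod C \<gamma>) (Cod C g)"
        "\<alpha> \<cdot> k = f" "\<beta> \<cdot> \<gamma> = g \<cdot> \<alpha>"
        and "is_kernel C f g" "is_cokernel C h g" "is_kernel C k \<gamma>" "is_cokernel C c \<gamma>"
        unfolding ext2_step_def by (auto simp: extensions2_iff)
      then have "\<exists>X' W' U'. (U', W') \<in> completions C \<gamma> k c X'"
        by (intro completion_pull[OF UW, where \<alpha> = \<beta> and \<beta> = \<alpha>]) auto
      then show ?thesis by blast
    qed
  qed
qed

section \<open>Isomorphism classes\<close>

text \<open>Bijections below pair objects with arrows given by universal properties. Stating them as
  relations avoids defining the maps explicitly in either direction.\<close>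

lemma card_eq_by_relation:
  assumes "\<And>x. x \<in> A \<Longrightarrow> \<exists>y\<in>B. R x y" "\<And>y. y \<in> B \<Longrightarrow> \<exists>x\<in>A. R x y"
    and inj: "\<And>x x' y. \<lbrakk>x \<in> A; x' \<in> A; y \<in> B; R x y; R x' y\<rbrakk> \<Longrightarrow> x = x'"
    and fn: "\<And>x y y'. \<lbrakk>x \<in> A; y \<in> B; y' \<in> B; R x y; R x y'\<rbrakk> \<Longrightarrow> y = y'"
  shows "card A = card B"
proof -
  define f where "f x = (SOME y. y \<in> B \<and> R x y)" for x
  have f: "f x \<in> B" "R x (f x)" if "x \<in> A" for x
    using someI_ex[of "\<lambda>y. y \<in> B \<and> R x y"] assms(1)[OF that] unfolding f_def by blast+
  have "bij_betw f A B"
    unfolding bij_betw_def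
  proof
    show "inj_on f A" using f inj by (metis inj_onI)
    show "f ` A = B"
    proof
      show "f ` A \<subseteq> B" using f by blast
      show "B \<subseteq> f ` A"
      proof
        fix y assume y: "y \<in> B"
        then obtain x where "x \<in> A" "R x y" using assms(2) by blast
        then show "y \<in> f ` A" using f[of x] fn[of x y "f x"] y by blast
      qed
    qed
  qed
  then show ?thesis by (rule bij_betw_same_card)
qed

lemma has_sum_finite_support:
  fixes f :: "'a \<Rightarrow> real"
  assumes "finite F" "F \<subseteq> A" "\<And>x. x \<in> A - F \<Longrightarrow> f x = 0"
  shows "(f has_sum s) A \<longleftrightarrow> s = sum f F"
proof -
  have "(f has_sum s) A \<longleftrightarrow> (f has_sum s) F"
    using assms(2,3) by (intro has_sum_cong_neutral) auto
  then show ?thesis using has_sum_finite[OF assms(1), of f] has_sum_unique by metis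
qed

lemma card_Collect_pair:
  assumes "finite A" "\<And>a. a \<in> A \<Longrightarrow> finite {b. P a b}"
  shows "card {(a, b). a \<in> A \<and> P a b} = (\<Sum>a\<in>A. card {b. P a b})"
proof -
  have "{(a, b). a \<in> A \<and> P a b} = Sigma A (\<lambda>a. {b. P a b})" by auto
  then show ?thesis using assms by simp
qed

context linear_category
begin

definition cls :: "'o \<Rightarrow> 'o set" where
  "cls X = {(X, Y). X \<in> Ob C \<and> Y \<in> Ob C \<and> isomorphic C X Y} `` {X}"

lemma equiv_isomorphic: "equiv (Ob C) {(X, Y). X \<in> Ob C \<and> Y \<in> Ob C \<and> isomorphic C X Y}"
  by (rule equivI) (auto intro!: refl_onI symI transI isomorphic_refl intro: isomorphic_sym isomorphic_trans)

lemma cls_Iso: "X \<in> Ob C \<Longrightarrow> cls X \<in> Iso C"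
  unfolding Iso_def cls_def by (rule quotientI)

lemma cls_eq_iff: "\<lbrakk>X \<in> Ob C; Y \<in> Ob C\<rbrakk> \<Longrightarrow> cls X = cls Y \<longleftrightarrow> isomorphic C X Y"
  unfolding cls_def using eq_equiv_class_iff[OF equiv_isomorphic] by auto

lemma rep_Iso:
  assumes "x \<in> Iso C"
  shows "rep x \<in> Ob C" "cls (rep x) = x"
proof -
  obtain X where X: "X \<in> Ob C" "x = cls X" using assms unfolding Iso_def cls_def by (auto elim: quotientE)
  then have "X \<in> x" using isomorphic_refl by (auto simp: cls_def)
  then have "rep x \<in> x" unfolding rep_def by (rule someI)
  then show 1: "rep x \<in> Ob C" using X by (auto simp: cls_def)
  show "cls (rep x) = x" using \<open>rep x \<in> x\<close> X cls_eq_iff[OF X(1) 1] by (auto simp: cls_def)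
qed

lemma isomorphic_rep: "X \<in> Ob C \<Longrightarrow> isomorphic C X (rep (cls X))"
  using cls_eq_iff[of X "rep (cls X)"] rep_Iso[OF cls_Iso] by simp

lemma isomorphic_rep_iff: "\<lbrakk>X \<in> Ob C; x \<in> Iso C\<rbrakk> \<Longrightarrow> isomorphic C X (rep x) \<longleftrightarrow> x = cls X"
  using cls_eq_iff[of X "rep x"] rep_Iso[of x] by auto

lemma Iso_opp [simp]: "Iso (opp C) = Iso C"
proof -
  have "{(X, Y). X \<in> Ob C \<and> Y \<in> Ob C \<and> isomorphic C Y X} = {(X, Y). X \<in> Ob C \<and> Y \<in> Ob C \<and> isomorphic C X Y}"
    using isomorphic_sym by auto
  then show ?thesis by (simp add: Iso_def)
qed

lemma aut_card_opp [simp]: "aut_card (opp C) X = aut_card C X"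
  by (simp add: aut_card_def)

lemma card_isos:
  assumes "isomorphic C Y X"
  shows "card (isos C Y X) = aut_card C X"
proof -
  obtain g where g: "g \<in> isos C Y X" using assms unfolding isomorphic_def by blast
  obtain g' where g': "g' \<in> isos C X Y" "g' \<cdot> g = Id C Y" "g \<cdot> g' = Id C X" using g by (blast elim: isosE)
  note [simp] = isosD[OF g] isosD[OF g'(1)]
  show ?thesis unfolding aut_card_def
  proof (rule card_eq_by_relation[where R = "\<lambda>a b. a = b \<cdot> g"])
    fix a assume a: "a \<in> isos C Y X"
    then have "a = (a \<cdot> g') \<cdot> g" using g'(2) isosD[OF a] by simp
    then show "\<exists>b\<in>isos C X X. a = b \<cdot> g" using iso_comp[OF g'(1) a] by blast
  next
    fix b b' a assume b: "b \<in> isos C X X" "b' \<in> isos C X X" and eq: "a = b \<cdot> g" "a = b' \<cdot> g"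
    have "b = (b \<cdot> g) \<cdot> g'" "b' = (b' \<cdot> g) \<cdot> g'" using g'(3) isosD[OF b(1)] isosD[OF b(2)] by simp_all
    then show "b = b'" using eq by simp
  qed (use iso_comp[OF g] in auto)
qed

lemma card_isos_not: "\<not> isomorphic C Y X \<Longrightarrow> card (isos C Y X) = 0"
  unfolding isomorphic_def by simp

lemma card_isos_sym: "card (isos C X Y) = card (isos C Y X)"
proof (rule card_eq_by_relation[where R = "\<lambda>a b. b \<cdot> a = Id C X \<and> a \<cdot> b = Id C Y"])
  fix x x' y assume "x \<in> isos C X Y" "x' \<in> isos C X Y" "y \<in> isos C Y X"
    and eq: "y \<cdot> x = Id C X \<and> x \<cdot> y = Id C Y" "y \<cdot> x' = Id C X \<and> x' \<cdot> y = Id C Y"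
  note [simp] = isosD[OF this(1)] isosD[OF this(2)] isosD[OF this(3)]
  have "x = x \<cdot> y \<cdot> x'" using eq by simp
  also have "\<dots> = (x \<cdot> y) \<cdot> x'" by simp
  also have "\<dots> = x'" using eq by (simp del: assoc)
  finally show "x = x'" .
next
  fix x y y' assume "x \<in> isos C X Y" "y \<in> isos C Y X" "y' \<in> isos C Y X"
    and eq: "y \<cdot> x = Id C X \<and> x \<cdot> y = Id C Y" "y' \<cdot> x = Id C X \<and> x \<cdot> y' = Id C Y"
  note [simp] = isosD[OF this(1)] isosD[OF this(2)] isosD[OF this(3)]
  have "y = y \<cdot> x \<cdot> y'" using eq by simp
  also have "\<dots> = (y \<cdot> x) \<cdot> y'" by simp
  also have "\<dots> = y'" using eq by (simp del: assoc)
  finally show "y = y'" .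
qed (auto elim: isosE)

end

context linear_abelian_category
begin

text \<open>Once a lift \<rho>0 exists, all lifts form its coset under arrows into the kernel of
  \<open>W\<close>.\<close>

lemma card_lifts:
  assumes \<kappa>: "is_kernel C \<kappa> W" and \<pi>: "\<pi> \<in> Arr C" "Dom C \<pi> = P"
    and \<rho>0: "\<rho>0 \<in> homset C P (Dom C W)" "W \<cdot> \<rho>0 = \<pi>"
  shows "card {\<rho> \<in> homset C P (Dom C W). W \<cdot> \<rho> = \<pi>} = card (homset C P (Dom C \<kappa>))"
proof (rule card_eq_by_relation[where R = "\<lambda>\<rho> \<zeta>. \<rho> = \<rho>0 \<boxplus> \<kappa> \<cdot> \<zeta>"])
  have \<rho>0': "\<rho>0 \<in> Arr C" "Dom C \<rho>0 = P" "Cod C \<rho>0 = Dom C W" using \<rho>0 by auto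
  note [simp] = kerD[OF \<kappa>] \<pi> \<rho>0'
  {
    fix \<rho> assume "\<rho> \<in> {\<rho> \<in> homset C P (Dom C W). W \<cdot> \<rho> = \<pi>}"
    then have \<rho>: "\<rho> \<in> Arr C" "Dom C \<rho> = P" "Cod C \<rho> = Dom C W" "W \<cdot> \<rho> = \<pi>" by auto
    have "W \<cdot> (\<rho> \<boxminus> \<rho>0) = nul P (Cod C W)" using \<rho> \<rho>0(2) by auto
    then obtain \<zeta> where "\<zeta> \<in> Arr C" "Dom C \<zeta> = P" "Cod C \<zeta> = Dom C \<kappa>" "\<kappa> \<cdot> \<zeta> = \<rho> \<boxminus> \<rho>0"
      using ker_lift[OF \<kappa>, of "\<rho> \<boxminus> \<rho>0"] \<rho> by auto
    then show "\<exists>\<zeta>\<in>homset C P (Dom C \<kappa>). \<rho> = \<rho>0 \<boxplus> \<kappa> \<cdot> \<zeta>" using \<rho> by (intro bexI[of _ \<zeta>]) auto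
  next
    fix \<zeta> assume "\<zeta> \<in> homset C P (Dom C \<kappa>)"
    then have \<zeta>: "\<zeta> \<in> Arr C" "Dom C \<zeta> = P" "Cod C \<zeta> = Dom C \<kappa>" by auto
    then have "W \<cdot> (\<rho>0 \<boxplus> \<kappa> \<cdot> \<zeta>) = \<pi>" using \<rho>0(2) comp_under[of W \<kappa> _ \<zeta>] kerD[OF \<kappa>] by auto
    then show "\<exists>\<rho>\<in>{\<rho> \<in> homset C P (Dom C W). W \<cdot> \<rho> = \<pi>}. \<rho> = \<rho>0 \<boxplus> \<kappa> \<cdot> \<zeta>" using \<zeta> by auto
  next
    fix \<rho> \<zeta> \<zeta>' assume "\<zeta> \<in> homset C P (Dom C \<kappa>)" "\<zeta>' \<in> homset C P (Dom C \<kappa>)" "\<rho> = \<rho>0 \<boxplus> \<kappa> \<cdot> \<zeta>" "\<rho> = \<rho>0 \<boxplus> \<kappa> \<cdot> \<zeta>'"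
    then show "\<zeta> = \<zeta>'"
      using add_left_cancel'[of \<rho>0 "\<kappa> \<cdot> \<zeta>" "\<kappa> \<cdot> \<zeta>'"] monic_cancel[OF ker_monic[OF \<kappa>], of \<zeta> \<zeta>'] by auto
  }
qed auto

lemma ses_iso_middle:
  assumes s: "ses C i p" and a: "a \<in> isos C (Cod C i) T" and b: "b \<in> isos C T (Cod C i)" "b \<cdot> a = Id C (Cod C i)"
  shows "ses C (a \<cdot> i) (p \<cdot> b)"
proof -
  note [simp] = sesD[OF s] isosD[OF a] isosD[OF b(1)]
  have "monic C (a \<cdot> i)" using monic_comp iso_monic[OF a] ses_monic[OF s] by simp
  moreover have "is_cokernel C (p \<cdot> b) (a \<cdot> i)"
  proof (rule is_cokernelI)
    show "epic C (p \<cdot> b)" using epic_comp iso_epic[OF b(1)] ses_epic[OF s] by simp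
    show "(p \<cdot> b) \<cdot> a \<cdot> i = nul (Dom C (a \<cdot> i)) (Cod C (p \<cdot> b))" using comp_under[OF b(2), of i] by simp
    fix g assume g: "g \<in> Arr C" "Dom C g = Cod C (a \<cdot> i)" "g \<cdot> a \<cdot> i = nul (Dom C (a \<cdot> i)) (Cod C g)"
    then obtain u where u: "u \<in> Arr C" "Cod C u = Cod C g" "Dom C u = Cod C p" "u \<cdot> p = g \<cdot> a"
      using ses_desc[OF s, of "g \<cdot> a"] by auto
    have "(u \<cdot> p \<cdot> b) \<cdot> a = g \<cdot> a" using u b(2) g by simp
    then have "u \<cdot> p \<cdot> b = g" using epic_cancel[OF iso_epic[OF a], of "u \<cdot> p \<cdot> b" g] u g by simp
    then show "\<exists>u. u \<in> Arr C \<and> Cod C u = Cod C g \<and> Dom C u = Cod C (p \<cdot> b) \<and> u \<cdot> p \<cdot> b = g"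
      using u by auto
  qed simp_all
  ultimately show ?thesis by (rule sesI1)
qed

lemma completion_iso_middle:
  assumes k: "is_kernel C k \<gamma>" and c: "is_cokernel C c \<gamma>" and UW: "(U, W) \<in> completions C \<gamma> k c X"
    and a: "a \<in> isos C X Y" and b: "b \<in> isos C Y X" "b \<cdot> a = Id C X"
  shows "(a \<cdot> U, W \<cdot> b) \<in> completions C \<gamma> k c Y"
proof -
  have UWD [simp]: "U \<in> Arr C" "W \<in> Arr C" "Dom C U = Dom C \<gamma>" "Cod C U = X" "Dom C W = X" "Cod C W = Cod C \<gamma>" and WU: "W \<cdot> U = \<gamma>"
    using completionsD[OF UW] by auto
  note [simp] = cokD[OF c] isosD[OF a] isosD[OF b(1)]
  have "ses C (a \<cdot> U) ((c \<cdot> W) \<cdot> b)" using ses_iso_middle[OF completion_ses1[OF k UW c], of a Y b] a b by simp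
  then show ?thesis using WU comp_under[OF b(2), of U] by (intro completionI1[OF k c]) simp_all
qed

text \<open>Extensions are thus the completions of a zero arrow, and general facts on completions
  specialize to extensions.\<close>

lemma zero_completions:
  assumes "Z \<in> Ob C" "Q \<in> Ob C"
  shows "completions C (nul Z Q) (Id C Z) (Id C Q) X = short_exacts C Z X Q"
proof safe
  fix U W assume UW: "(U, W) \<in> completions C (nul Z Q) (Id C Z) (Id C Q) X"
  note [simp] = completionsD[OF UW]
  have "ses C U W" using UW assms by (simp add: completions_def ses_def)
  then show "(U, W) \<in> short_exacts C Z X Q" using completionsD[OF UW] assms by (simp add: short_exacts_iff)
next
  fix U W assume "(U, W) \<in> short_exacts C Z X Q"
  then have s: "ses C U W" and [simp]: "Dom C U = Z" "Cod C U = X" "Cod C W = Q" by (simp_all add: short_exacts_iff)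
  show "(U, W) \<in> completions C (nul Z Q) (Id C Z) (Id C Q) X"
    using s sesD[OF s] assms by (simp add: completions_def ses_def)
qed

lemma zero_kernel: "\<lbrakk>Z \<in> Ob C; Q \<in> Ob C\<rbrakk> \<Longrightarrow> is_kernel C (Id C Z) (nul Z Q)"
  by (rule is_kernelI) (use iso_monic[OF iso_id] in auto)

lemmas zero_cokernel = linear_abelian_category.zero_kernel[OF opp_lac, unfolded opp_rules]

text \<open>A finite substitute for lifting from a projective object: the source of \<pi> is
  enlarged by one pullback for each epic in \<open>F\<close>.\<close>

lemma common_lift:
  assumes "finite F" "\<And>g. g \<in> F \<Longrightarrow> epic C g \<and> Cod C g = Cod C \<pi>" and \<pi>: "epic C \<pi>"
  shows "\<exists>\<epsilon>. epic C \<epsilon> \<and> Cod C \<epsilon> = Dom C \<pi> \<and>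
    (\<forall>g\<in>F. \<exists>\<rho>. \<rho> \<in> Arr C \<and> Dom C \<rho> = Dom C \<epsilon> \<and> Cod C \<rho> = Dom C g \<and> g \<cdot> \<rho> = \<pi> \<cdot> \<epsilon>)"
  using assms(1,2)
proof (induction F)
  case empty
  then show ?case using iso_epic[OF iso_id[of "Dom C \<pi>"]] epic_arr[OF \<pi>] by (intro exI[of _ "Id C (Dom C \<pi>)"]) auto
next
  case (insert g F)
  then obtain \<epsilon> where \<epsilon>: "epic C \<epsilon>" "Cod C \<epsilon> = Dom C \<pi>"
    and l: "\<forall>g\<in>F. \<exists>\<rho>. \<rho> \<in> Arr C \<and> Dom C \<rho> = Dom C \<epsilon> \<and> Cod C \<rho> = Dom C g \<and> g \<cdot> \<rho> = \<pi> \<cdot> \<epsilon>"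
    by auto
  have g: "epic C g" "Cod C g = Cod C \<pi>" using insert.prems by auto
  note [simp] = epic_arr[OF \<pi>] epic_arr[OF \<epsilon>(1)] epic_arr[OF g(1)] \<epsilon>(2) g(2)
  obtain i where s: "ses C i g" using ex_ses_epic[OF g(1)] .
  have x: "\<pi> \<cdot> \<epsilon> \<in> Arr C" "Cod C (\<pi> \<cdot> \<epsilon>) = Cod C g" by simp_all
  obtain U \<rho> \<eta> where s': "ses C \<eta> U" and U: "Cod C U = Dom C (\<pi> \<cdot> \<epsilon>)" and \<rho>: "\<rho> \<in> Arr C" "Cod C \<rho> = Dom C g" "Dom C \<rho> = Dom C U"
    and "Dom C \<eta> = Dom C i" and eq: "(\<pi> \<cdot> \<epsilon>) \<cdot> U = g \<cdot> \<rho>" and "\<rho> \<cdot> \<eta> = i"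
    by (rule pullback_exists[OF s x])
  have [simp]: "U \<in> Arr C" "Cod C U = Dom C \<epsilon>" using sesD[OF s'] U by auto
  have "\<exists>\<rho>. \<rho> \<in> Arr C \<and> Dom C \<rho> = Dom C (\<epsilon> \<cdot> U) \<and> Cod C \<rho> = Dom C h \<and> h \<cdot> \<rho> = \<pi> \<cdot> \<epsilon> \<cdot> U" if "h \<in> insert g F" for h
  proof (cases "h = g")
    case True
    then show ?thesis using \<rho> eq by (intro exI[of _ \<rho>]) simp
  next
    case False
    then obtain \<rho>' where r: "\<rho>' \<in> Arr C" "Dom C \<rho>' = Dom C \<epsilon>" "Cod C \<rho>' = Dom C h" "h \<cdot> \<rho>' = \<pi> \<cdot> \<epsilon>" using l \<open>h \<in> _\<close> by auto
    have "h \<in> Arr C" using insert.prems[OF that] epic_arr by blast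
    then show ?thesis using r comp_under[OF r(4), of U] by (intro exI[of _ "\<rho>' \<cdot> U"]) simp
  qed
  then show ?case using epic_comp[of \<epsilon> U] \<epsilon> ses_epic[OF s'] by (intro exI[of _ "\<epsilon> \<cdot> U"]) simp
qed

text \<open>The third isomorphism theorem, phrased for the pushout along \<open>e\<close> of the quotient of \<open>Cod U\<close> by \<open>Dom U\<close>.\<close>

lemma pushout_is_cokernel:
  assumes s: "ses C U p" and s': "ses C i e" and eq: "Cod C i = Dom C U"
    and t: "ses C j c" and \<rho>: "\<rho> \<in> Arr C" "Dom C \<rho> = Cod C U" "Cod C \<rho> = Cod C j" "Cod C c = Cod C p" "c \<cdot> \<rho> = p"
    and j: "Dom C j = Cod C e" "j \<cdot> e = \<rho> \<cdot> U"
  shows "is_cokernel C \<rho> (U \<cdot> i)"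
proof (rule is_cokernelI)
  note [simp] = sesD[OF s] sesD[OF s'] sesD[OF t] eq \<rho>(1-4) j(1)
  show "epic C \<rho>"
  proof (rule epicI)
    fix g assume g: "g \<in> Arr C" "Dom C g = Cod C \<rho>" "g \<cdot> \<rho> = nul (Dom C \<rho>) (Cod C g)"
    have "g \<cdot> j \<cdot> e = nul (Dom C e) (Cod C g)" using comp_under[OF g(3), of U] g j(2) by simp
    then have "g \<cdot> j = nul (Dom C j) (Cod C g)" using epic_zero[OF ses_epic[OF s'], of "g \<cdot> j"] g by simp
    then show "g = nul (Cod C \<rho>) (Cod C g)"
      using pushout_ext[OF s t \<rho>, of g "nul (Cod C \<rho>) (Cod C g)"] g by simp
  qed simp
  have "\<rho> \<cdot> U \<cdot> i = (j \<cdot> e) \<cdot> i" using j(2) by simp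
  then show "\<rho> \<cdot> U \<cdot> i = nul (Dom C (U \<cdot> i)) (Cod C \<rho>)" by simp
  fix g assume g: "g \<in> Arr C" "Dom C g = Cod C (U \<cdot> i)" "g \<cdot> U \<cdot> i = nul (Dom C (U \<cdot> i)) (Cod C g)"
  then obtain h where h: "h \<in> Arr C" "Cod C h = Cod C g" "Dom C h = Cod C e" "h \<cdot> e = g \<cdot> U"
    using ses_desc[OF s', of "g \<cdot> U"] by auto
  have x: "e \<in> Arr C" "Dom C e = Dom C U" "Cod C e = Dom C j" "Dom C h = Dom C j" "Dom C g = Cod C U"
    using h g by simp_all
  obtain v where v: "v \<in> Arr C" "Dom C v = Cod C j" "Cod C v = Cod C h" "v \<cdot> j = h" "v \<cdot> \<rho> = g"
    by (rule pushout_desc[OF s t \<rho> x(1-3) j(2) h(1) g(1) x(4,5) h(2,4)])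
  then show "\<exists>u. u \<in> Arr C \<and> Cod C u = Cod C g \<and> Dom C u = Cod C \<rho> \<and> u \<cdot> \<rho> = g" using h by auto
qed (use sesD[OF s] sesD[OF s'] eq \<rho> in simp_all)

end

section \<open>Counting completions\<close>

text \<open>The consequences of finiteness and heredity needed for the counting arguments, in a form which is evidently
  self-dual.\<close>

locale hereditary_counting_category = linear_abelian_category K C
  for K :: "('k, 'r) ring_scheme" (structure)
  and C :: "('o, 'm, 'k, 'z) lin_cat_scheme" (structure) +
  assumes finite_hom: "\<lbrakk>A \<in> Ob C; B \<in> Ob C\<rbrakk> \<Longrightarrow> finite (homset C A B)"
    and completion_ex: "\<lbrakk>is_kernel C k \<gamma>; is_cokernel C c \<gamma>\<rbrakk> \<Longrightarrow> \<exists>X U W. (U, W) \<in> completions C \<gamma> k c X"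
    and finite_middle: "\<lbrakk>A \<in> Ob C; B \<in> Ob C\<rbrakk> \<Longrightarrow> finite {x \<in> Iso C. short_exacts C A (rep x) B \<noteq> {}}"
begin

lemma opp_hcc: "hereditary_counting_category K (opp C)"
proof -
  interpret op: linear_abelian_category K "opp C" by (rule opp_lac)
  have se: "short_exacts (opp C) A X B = {} \<longleftrightarrow> short_exacts C B X A = {}" for A B X
    using short_exacts_opp by (metis (no_types) all_not_in_conv surj_pair)
  show ?thesis
  proof
    fix k \<gamma> c assume "is_kernel (opp C) k \<gamma>" "is_cokernel (opp C) c \<gamma>"
    then obtain X U W where "(U, W) \<in> completions C \<gamma> c k X" using completion_ex[of c \<gamma> k] by auto
    then have "(W, U) \<in> completions (opp C) \<gamma> k c X" by simp
    then show "\<exists>X U W. (U, W) \<in> completions (opp C) \<gamma> k c X" by blast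
  qed (use finite_hom finite_middle se in auto)
qed

lemma finite_homset_any [simp, intro]: "finite (homset C A B)"
proof (cases "A \<in> Ob C \<and> B \<in> Ob C")
  case False
  then have "homset C A B = {}" by (auto simp: homset_def)
  then show ?thesis by simp
qed (use finite_hom in auto)

lemma finite_isos [simp, intro]: "finite (isos C A B)"
  by (rule finite_subset[of _ "homset C A B"]) (auto simp: isos_def)

lemma aut_card_pos: "A \<in> Ob C \<Longrightarrow> aut_card C A > 0"
  unfolding aut_card_def using iso_id[of A] by (auto simp: card_gt_0_iff)

lemma finite_short_exacts [simp, intro]: "finite (short_exacts C A X B)"
proof (rule finite_subset)
  show "short_exacts C A X B \<subseteq> homset C A X \<times> homset C X B"
    using sesD by (fastforce simp: short_exacts_def)
qed auto

lemma finite_completions [simp, intro]: "finite (completions C \<gamma> k c X)"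
proof (rule finite_subset)
  show "completions C \<gamma> k c X \<subseteq> homset C (Dom C \<gamma>) X \<times> homset C X (Cod C \<gamma>)"
    by (auto simp: completions_def)
qed auto

text \<open>The number of isomorphisms from \<open>Y\<close> to \<open>X\<close> is
  \<open>aut_card\<close> of \<open>X\<close> if the two are isomorphic and zero otherwise. Hence
  every invariant e in \<open>E\<close> contributes exactly 1, at the class of its object
  \<open>Y\<close>.\<close>

lemma groupoid_count:
  assumes E: "finite E" and D: "\<And>X. X \<in> Ob C \<Longrightarrow> finite (D X)"
    and F: "\<And>X d. \<lbrakk>X \<in> Ob C; d \<in> D X\<rbrakk> \<Longrightarrow> F X d \<in> E"
    and fib: "\<And>e. e \<in> E \<Longrightarrow> \<exists>Y\<in>Ob C. \<forall>X\<in>Ob C. card {d \<in> D X. F X d = e} = card (isos C Y X)"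
  shows "((\<lambda>x. real (card (D (rep x))) / real (aut_card C (rep x))) has_sum real (card E)) (Iso C)"
proof -
  obtain Y where Y: "\<And>e. e \<in> E \<Longrightarrow> Y e \<in> Ob C"
    "\<And>e X. \<lbrakk>e \<in> E; X \<in> Ob C\<rbrakk> \<Longrightarrow> card {d \<in> D X. F X d = e} = card (isos C (Y e) X)"
    using fib by metis
  have one: "real (card {d \<in> D (rep x). F (rep x) d = e}) / real (aut_card C (rep x)) = (if x = cls (Y e) then 1 else 0)"
    if "e \<in> E" "x \<in> Iso C" for e x
    using Y[OF that(1)] rep_Iso[OF that(2)] isomorphic_rep_iff[OF Y(1)[OF that(1)] that(2)]
      card_isos card_isos_not aut_card_pos by auto
  have sum: "real (card (D (rep x))) / real (aut_card C (rep x)) = (\<Sum>e\<in>E. if x = cls (Y e) then 1 else 0)"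
    if x: "x \<in> Iso C" for x
  proof -
    have "D (rep x) = (\<Union>e\<in>E. {d \<in> D (rep x). F (rep x) d = e})" using F rep_Iso[OF x] by auto
    then have "card (D (rep x)) = (\<Sum>e\<in>E. card {d \<in> D (rep x). F (rep x) d = e})"
      using D[of "rep x"] rep_Iso[OF x] E by (subst \<open>D (rep x) = _\<close>, subst card_UN_disjoint) auto
    then show ?thesis using one x by (simp add: sum_divide_distrib)
  qed
  have "(\<Sum>x\<in>(\<lambda>e. cls (Y e)) ` E. \<Sum>e\<in>E. if x = cls (Y e) then 1 else 0 :: real) = real (card E)"
  proof -
    have "(\<Sum>x\<in>(\<lambda>e. cls (Y e)) ` E. \<Sum>e\<in>E. if x = cls (Y e) then 1 else 0 :: real)
        = (\<Sum>e\<in>E. \<Sum>x\<in>(\<lambda>e. cls (Y e)) ` E. if x = cls (Y e) then 1 else 0)" by (rule sum.swap)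
    also have "\<dots> = (\<Sum>e\<in>E. 1)" using E by (intro sum.cong) (auto simp: sum.delta)
    finally show ?thesis by simp
  qed
  moreover have "(\<lambda>e. cls (Y e)) ` E \<subseteq> Iso C" using Y cls_Iso by auto
  ultimately have "((\<lambda>x. \<Sum>e\<in>E. if x = cls (Y e) then 1 else 0) has_sum real (card E)) (Iso C)"
    using E by (subst has_sum_finite_support[of "(\<lambda>e. cls (Y e)) ` E"]) (auto intro!: sum.neutral)
  then show ?thesis using sum by (subst has_sum_cong) auto
qed

text \<open>The quotient is the first argument and the subobject the second, as in Ext1(Q,Z). By
  Riedtmann's formula the value is |Ext1(Q,Z)| / |Hom(Q,Z)|, which is proved later, when it becomes
  a power of q given by the Euler form.\<close>

definition chi :: "'o \<Rightarrow> 'o \<Rightarrow> real" where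
  "chi Q Z = (\<Sum>\<^sub>\<infinity>x\<in>Iso C. real (card (short_exacts C Z (rep x) Q)) / real (aut_card C (rep x)))"

text \<open>All completions receive a lift of a suitable epic \<open>\<pi> : P \<rightarrow> T\<close>, and a completion
  together with a lift is the same as a factorization through \<open>\<gamma>\<close> of the restriction of \<open>\<pi>\<close> to the preimage of
  the image of \<open>\<gamma>\<close>.\<close>

lemma count_completions_lift:
  assumes k: "is_kernel C k \<gamma>" and c: "is_cokernel C c \<gamma>" and \<pi>: "epic C \<pi>" "Cod C \<pi> = Cod C \<gamma>"
    and \<iota>: "is_kernel C \<iota> (c \<cdot> \<pi>)"
    and lift: "\<And>X U W. (U, W) \<in> completions C \<gamma> k c X \<Longrightarrow> \<exists>\<rho>. \<rho> \<in> Arr C \<and> Dom C \<rho> = Dom C \<pi> \<and> Cod C \<rho> = X \<and> W \<cdot> \<rho> = \<pi>"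
  shows "((\<lambda>x. real (card (completions C \<gamma> k c (rep x))) / real (aut_card C (rep x))) has_sum
     real (card (homset C (Dom C \<iota>) (Dom C k))) / real (card (homset C (Dom C \<pi>) (Dom C k)))) (Iso C)"
proof -
  note [simp] = kerD[OF k] cokD[OF c] epic_arr[OF \<pi>(1)] \<pi>(2)
  have [simp]: "\<iota> \<in> Arr C" "Cod C \<iota> = Dom C \<pi>" "c \<cdot> \<pi> \<cdot> \<iota> = nul (Dom C \<iota>) (Cod C c)" using kerD[OF \<iota>] by auto
  define P where "P = Dom C \<pi>"
  \<comment> \<open>Completions decorated with a lift \<rho> of \<pi>. The decoration multiplies
    their number by a constant, and decorated completions are classified up to unique isomorphism by
    the elements of \<open>E\<close>.\<close>
  define D where "D X = {(U, W, \<rho>). (U, W) \<in> completions C \<gamma> k c X \<and> \<rho> \<in> homset C P X \<and> W \<cdot> \<rho> = \<pi>}" for X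
  define E where "E = {\<sigma> \<in> homset C (Dom C \<iota>) (Dom C \<gamma>). \<gamma> \<cdot> \<sigma> = \<pi> \<cdot> \<iota>}"
  define F :: "'o \<Rightarrow> 'm \<times> 'm \<times> 'm \<Rightarrow> 'm" where "F X = (\<lambda>(U, W, \<rho>). SOME \<sigma>. \<sigma> \<in> homset C (Dom C \<iota>) (Dom C \<gamma>) \<and> U \<cdot> \<sigma> = \<rho> \<cdot> \<iota>)" for X
  have sP: "ses C \<iota> (c \<cdot> \<pi>)" using sesI2 epic_comp[OF cok_epic[OF c] \<pi>(1)] \<iota> by simp
  have Dsub: "D X \<subseteq> (\<lambda>((U, W), \<rho>). (U, W, \<rho>)) ` (completions C \<gamma> k c X \<times> homset C P X)" for X
    by (force simp: D_def)
  then have finD: "finite (D X)" for X by (rule finite_subset) simp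
  have cardD: "card (D X) = card (completions C \<gamma> k c X) * card (homset C P (Dom C k))" for X
  proof -
    have "card (D X) = card {(UW, \<rho>). UW \<in> completions C \<gamma> k c X \<and> (\<rho> \<in> homset C P X \<and> snd UW \<cdot> \<rho> = \<pi>)}"
      by (rule bij_betw_same_card[of "\<lambda>(U, W, \<rho>). ((U, W), \<rho>)"])
        (auto simp: D_def bij_betw_def inj_on_def image_iff simp del: hom_iff)
    also have "\<dots> = (\<Sum>UW\<in>completions C \<gamma> k c X. card {\<rho>. \<rho> \<in> homset C P X \<and> snd UW \<cdot> \<rho> = \<pi>})"
      by (rule card_Collect_pair[OF finite_completions], rule finite_subset[of _ "homset C P X"]) auto
    also have "\<dots> = (\<Sum>UW\<in>completions C \<gamma> k c X. card (homset C P (Dom C k)))"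
    proof (rule sum.cong[OF refl])
      fix UW assume UW: "UW \<in> completions C \<gamma> k c X"
      obtain U W where eq: "UW = (U, W)" by (cases UW)
      note [simp] = completionsD[OF UW[unfolded eq]]
      have K: "is_kernel C (U \<cdot> k) W" using UW eq by (simp add: completions_def)
      obtain \<rho>0 where "\<rho>0 \<in> Arr C" "Dom C \<rho>0 = P" "Cod C \<rho>0 = X" "W \<cdot> \<rho>0 = \<pi>"
        using lift[OF UW[unfolded eq]] by (auto simp: P_def)
      then show "card {\<rho>. \<rho> \<in> homset C P X \<and> snd UW \<cdot> \<rho> = \<pi>} = card (homset C P (Dom C k))"
        using card_lifts[OF K, of \<pi> P \<rho>0] eq by (simp add: P_def)
    qed
    finally show ?thesis by simp
  qed
  have Fprop: "F X (U, W, \<rho>) \<in> homset C (Dom C \<iota>) (Dom C \<gamma>)" "U \<cdot> F X (U, W, \<rho>) = \<rho> \<cdot> \<iota>"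
    if d: "(U, W, \<rho>) \<in> D X" for X U W \<rho>
  proof -
    have UW: "(U, W) \<in> completions C \<gamma> k c X" and \<rho>: "\<rho> \<in> Arr C" "Dom C \<rho> = Dom C \<pi>" "Cod C \<rho> = X" "W \<cdot> \<rho> = \<pi>"
      using d by (auto simp: D_def P_def)
    note [simp] = completionsD[OF UW] \<rho>(1-3)
    have "(c \<cdot> W) \<cdot> \<rho> \<cdot> \<iota> = nul (Dom C \<iota>) (Cod C c)" using comp_under[OF \<rho>(4), of \<iota>] by simp
    then obtain \<sigma> where "\<sigma> \<in> Arr C" "Dom C \<sigma> = Dom C \<iota>" "Cod C \<sigma> = Dom C U" "U \<cdot> \<sigma> = \<rho> \<cdot> \<iota>"
      using ses_lift[OF completion_ses1[OF k UW c], of "\<rho> \<cdot> \<iota>"] by auto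
    then have "\<exists>\<sigma>. \<sigma> \<in> homset C (Dom C \<iota>) (Dom C \<gamma>) \<and> U \<cdot> \<sigma> = \<rho> \<cdot> \<iota>" by auto
    from someI_ex[OF this] show "F X (U, W, \<rho>) \<in> homset C (Dom C \<iota>) (Dom C \<gamma>)" "U \<cdot> F X (U, W, \<rho>) = \<rho> \<cdot> \<iota>"
      by (simp_all add: F_def)
  qed
  have FE: "F X d \<in> E" if dD: "d \<in> D X" for X d
  proof -
    obtain U W \<rho> where d: "d = (U, W, \<rho>)" by (cases d)
    have UW: "(U, W) \<in> completions C \<gamma> k c X" and \<rho>: "\<rho> \<in> Arr C" "Dom C \<rho> = Dom C \<pi>" "Cod C \<rho> = X" "W \<cdot> \<rho> = \<pi>"
      using dD d by (auto simp: D_def P_def)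
    have UWD [simp]: "U \<in> Arr C" "W \<in> Arr C" "Dom C U = Dom C \<gamma>" "Cod C U = X" "Dom C W = X" "Cod C W = Cod C \<gamma>"
      and WU: "W \<cdot> U = \<gamma>" using completionsD[OF UW] by auto
    note f = Fprop[OF dD[unfolded d]]
    have "\<gamma> \<cdot> F X d = W \<cdot> U \<cdot> F X d" using comp_under[OF WU, of "F X d"] f d by simp
    also have "\<dots> = \<pi> \<cdot> \<iota>" using f d comp_under[OF \<rho>(4), of \<iota>] \<rho> by simp
    finally show ?thesis using f d by (simp add: E_def)
  qed
  \<comment> \<open>Heredity is used here: some completion exists, so \<open>E\<close> has an
    element and is a coset of the arrows from \<open>Dom \<iota>\<close> to
    \<open>Dom k\<close>.\<close>
  have cardE: "card E = card (homset C (Dom C \<iota>) (Dom C k))"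
  proof -
    obtain X U W where UW: "(U, W) \<in> completions C \<gamma> k c X" using completion_ex[OF k c] by blast
    then obtain \<rho> where "(U, W, \<rho>) \<in> D X" using lift[OF UW] by (auto simp: D_def P_def)
    then obtain \<sigma> where "\<sigma> \<in> E" using FE by blast
    then show ?thesis using card_lifts[OF k, of "\<pi> \<cdot> \<iota>" "Dom C \<iota>" \<sigma>] unfolding E_def by simp
  qed
  have fib: "\<exists>Y\<in>Ob C. \<forall>X\<in>Ob C. card {d \<in> D X. F X d = \<sigma>} = card (isos C Y X)" if \<sigma>E: "\<sigma> \<in> E" for \<sigma>
  proof -
    have \<sigma>: "\<sigma> \<in> Arr C" "Dom C \<sigma> = Dom C \<iota>" "Cod C \<sigma> = Dom C \<gamma>" "\<gamma> \<cdot> \<sigma> = \<pi> \<cdot> \<iota>" using \<sigma>E by (auto simp: E_def)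
    note [simp] = \<sigma>(1-3)
    \<comment> \<open>Pushing out \<iota> along \<sigma> rebuilds a decorated completion with
      invariant \<sigma>; every other one is reached from it by exactly one isomorphism of middle
      objects.\<close>
    obtain U0 \<rho>0 \<eta> where s0: "ses C U0 \<eta>" and U0: "Dom C U0 = Cod C \<sigma>"
      and \<rho>0: "\<rho>0 \<in> Arr C" "Dom C \<rho>0 = Cod C \<iota>" "Cod C \<rho>0 = Cod C U0" "Cod C \<eta> = Cod C (c \<cdot> \<pi>)"
      and eq0: "U0 \<cdot> \<sigma> = \<rho>0 \<cdot> \<iota>" and \<eta>0: "\<eta> \<cdot> \<rho>0 = c \<cdot> \<pi>"
      by (rule pushout_exists[OF sP \<sigma>(1,2)])
    note [simp] = sesD[OF s0]
    have [simp]: "Dom C U0 = Dom C \<gamma>" "\<rho>0 \<in> Arr C" "Dom C \<rho>0 = Dom C \<pi>" "Cod C \<rho>0 = Cod C U0" "Cod C \<eta> = Cod C c"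
      using U0 \<rho>0 by simp_all
    have g: "\<gamma> \<in> Arr C" "\<pi> \<in> Arr C" "Dom C \<gamma> = Dom C U0" "Dom C \<pi> = Cod C \<iota>" "Cod C \<gamma> = Cod C \<pi>" by simp_all
    obtain W0 where W0: "W0 \<in> Arr C" "Dom C W0 = Cod C U0" "Cod C W0 = Cod C \<gamma>" "W0 \<cdot> U0 = \<gamma>" "W0 \<cdot> \<rho>0 = \<pi>"
      by (rule pushout_desc[OF sP s0 \<rho>0 \<eta>0 \<sigma>(1,2) U0[symmetric] eq0 g \<sigma>(4)])
    note [simp] = W0(1-3)
    have "c \<cdot> W0 = \<eta>" using pushout_ext[OF sP s0 \<rho>0 \<eta>0, of "c \<cdot> W0" \<eta>] W0 \<eta>0 by simp
    then have UW0: "(U0, W0) \<in> completions C \<gamma> k c (Cod C U0)" using W0 s0 by (intro completionI1[OF k c]) simp_all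
    let ?R = "\<lambda>d a. case d of (U, W, \<rho>) \<Rightarrow> a \<cdot> U0 = U \<and> a \<cdot> \<rho>0 = \<rho> \<and> W \<cdot> a = W0"
    have "card {d \<in> D X. F X d = \<sigma>} = card (isos C (Cod C U0) X)" if X: "X \<in> Ob C" for X
    proof (rule card_eq_by_relation[where R = ?R])
      fix d assume d: "d \<in> {d \<in> D X. F X d = \<sigma>}"
      obtain U W \<rho> where deq: "d = (U, W, \<rho>)" by (cases d)
      have dD: "(U, W, \<rho>) \<in> D X" and "F X (U, W, \<rho>) = \<sigma>" using d deq by auto
      then have U\<sigma>: "U \<cdot> \<sigma> = \<rho> \<cdot> \<iota>" using Fprop(2)[OF dD] by simp
      have UW: "(U, W) \<in> completions C \<gamma> k c X" and \<rho>: "\<rho> \<in> Arr C" "Dom C \<rho> = Dom C \<pi>" "Cod C \<rho> = X" "W \<cdot> \<rho> = \<pi>"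
        using dD by (auto simp: D_def P_def)
      have UWD [simp]: "U \<in> Arr C" "W \<in> Arr C" "Dom C U = Dom C \<gamma>" "Cod C U = X" "Dom C W = X" "Cod C W = Cod C \<gamma>"
        and WU: "W \<cdot> U = \<gamma>" using completionsD[OF UW] by auto
      have h: "Dom C U = Dom C U0" "Dom C \<rho> = Cod C \<iota>" "Cod C U = Cod C \<rho>" using \<rho> by simp_all
      obtain a where a: "a \<in> Arr C" "Dom C a = Cod C U0" "Cod C a = Cod C U" "a \<cdot> U0 = U" "a \<cdot> \<rho>0 = \<rho>"
        by (rule pushout_desc[OF sP s0 \<rho>0 \<eta>0 \<sigma>(1,2) U0[symmetric] eq0 UWD(1) \<rho>(1) h U\<sigma>])
      have "W \<cdot> a = W0" using pushout_ext[OF sP s0 \<rho>0 \<eta>0, of "W \<cdot> a" W0] a W0 WU \<rho> by simp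
      moreover from this have "a \<in> isos C (Cod C U0) X"
        using five[OF s0 completion_ses1[OF k UW c], of a] a \<open>c \<cdot> W0 = \<eta>\<close> by simp
      ultimately show "\<exists>a\<in>isos C (Cod C U0) X. ?R d a"
        using a deq by auto
    next
      fix a assume a: "a \<in> isos C (Cod C U0) X"
      then obtain b where b: "b \<in> isos C X (Cod C U0)" "b \<cdot> a = Id C (Cod C U0)" by (blast elim: isosE)
      note [simp] = isosD[OF a] isosD[OF b(1)]
      have UW: "(a \<cdot> U0, W0 \<cdot> b) \<in> completions C \<gamma> k c X" by (rule completion_iso_middle[OF k c UW0 a b])
      have d: "(a \<cdot> U0, W0 \<cdot> b, a \<cdot> \<rho>0) \<in> D X" using UW W0 comp_under[OF b(2), of \<rho>0] by (simp add: D_def P_def)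
      have "(a \<cdot> U0) \<cdot> F X (a \<cdot> U0, W0 \<cdot> b, a \<cdot> \<rho>0) = (a \<cdot> U0) \<cdot> \<sigma>" using Fprop(2)[OF d] eq0 by simp
      then have "F X (a \<cdot> U0, W0 \<cdot> b, a \<cdot> \<rho>0) = \<sigma>"
        by (rule monic_cancel[OF ses_monic[OF completion_ses1[OF k UW c]]]) (use Fprop(1)[OF d] in simp_all)
      then show "\<exists>d\<in>{d \<in> D X. F X d = \<sigma>}. ?R d a"
        using d b(2) by (intro bexI[of _ "(a \<cdot> U0, W0 \<cdot> b, a \<cdot> \<rho>0)"]) simp_all
    next
      fix d d' a assume "d \<in> {d \<in> D X. F X d = \<sigma>}" "d' \<in> {d \<in> D X. F X d = \<sigma>}" and a: "a \<in> isos C (Cod C U0) X"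
        and eq: "?R d a"
        "?R d' a"
      obtain U W \<rho> U' W' \<rho>' where deq: "d = (U, W, \<rho>)" "d' = (U', W', \<rho>')" by (cases d, cases d')
      have "(U, W) \<in> completions C \<gamma> k c X" "(U', W') \<in> completions C \<gamma> k c X"
        using \<open>d \<in> _\<close> \<open>d' \<in> _\<close> deq by (auto simp: D_def)
      then have "W = W'" using epic_cancel[OF iso_epic[OF a], of W W'] eq deq completionsD isosD[OF a] by auto
      then show "d = d'" using eq deq by auto
    next
      fix d a a' assume "a \<in> isos C (Cod C U0) X" "a' \<in> isos C (Cod C U0) X"
        "?R d a"
        "?R d a'"
      then show "a = a'" using pushout_ext[OF sP s0 \<rho>0 \<eta>0, of a a'] isosD[of a] isosD[of a'] by (cases d) auto
    qed
    then show ?thesis by (intro bexI[of _ "Cod C U0"]) auto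
  qed
  have E: "finite E" by (rule finite_subset[of _ "homset C (Dom C \<iota>) (Dom C \<gamma>)"]) (auto simp: E_def simp del: hom_iff)
  have "nul P (Dom C k) \<in> homset C P (Dom C k)" by (simp add: P_def)
  then have pos: "homset C (Dom C \<pi>) (Dom C k) \<noteq> {}" unfolding P_def by blast
  have "((\<lambda>x. (real (card (D (rep x))) / real (aut_card C (rep x))) * (1 / real (card (homset C P (Dom C k))))) has_sum
      real (card E) * (1 / real (card (homset C P (Dom C k))))) (Iso C)"
    by (intro has_sum_cmult_left groupoid_count[OF E finD FE fib])
  then show ?thesis using pos cardE by (simp add: cardD P_def)
qed

lemma chi_has_sum_support:
  assumes "A \<in> Ob C" "B \<in> Ob C"
  shows "((\<lambda>x. real (card (short_exacts C A (rep x) B)) / real (aut_card C (rep x))) has_sum chi B A) (Iso C)"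
proof -
  have "((\<lambda>x. real (card (short_exacts C A (rep x) B)) / real (aut_card C (rep x))) summable_on (Iso C))"
    using finite_middle[OF assms] by (rule finite_nonzero_values_imp_summable_on[OF rev_finite_subset]) auto
  then show ?thesis unfolding chi_def by (rule has_sum_infsum)
qed

end

lemma has_sum_finite_sum:
  fixes f :: "'i \<Rightarrow> 'a \<Rightarrow> real"
  assumes "finite I" "\<And>i. i \<in> I \<Longrightarrow> (f i has_sum s i) A"
  shows "((\<lambda>x. \<Sum>i\<in>I. f i x) has_sum (\<Sum>i\<in>I. s i)) A"
  using assms by (induction I) (auto intro: has_sum_add)

section \<open>Universal epics and the weighted number of completions\<close>

context hereditary_counting_category
begin

text \<open>Each exactness condition implies the other, and each mentions only one of
  \<open>k\<close> and \<open>c\<close>; so \<open>k\<close> is exchanged while \<open>c\<close> is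
  held fixed, and then \<open>c\<close>.\<close>

lemma completions_indep:
  assumes k: "is_kernel C k \<gamma>" "is_kernel C k' \<gamma>" and c: "is_cokernel C c \<gamma>" "is_cokernel C c' \<gamma>"
  shows "completions C \<gamma> k c X = completions C \<gamma> k' c' X"
proof -
  have "completions C \<gamma> k c X \<subseteq> completions C \<gamma> k' c' X"
    if k: "is_kernel C k \<gamma>" "is_kernel C k' \<gamma>" and c: "is_cokernel C c \<gamma>" "is_cokernel C c' \<gamma>" for k k' c c'
  proof clarify
    fix U W assume UW: "(U, W) \<in> completions C \<gamma> k c X"
    note D = completionsD[OF UW]
    have "(U, W) \<in> completions C \<gamma> k' c X"
      by (rule completionI1[OF k(2) c(1)]) (use D completion_ses1[OF k(1) UW c(1)] in auto)
    then show "(U, W) \<in> completions C \<gamma> k' c' X"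
      by (intro completionI2[OF c(2) k(2)]) (use D completion_ses2[OF c(1) _ k(2)] in auto)
  qed
  then show ?thesis using assms by (meson subset_antisym)
qed

lemma lift_completions_from_reps:
  assumes k: "is_kernel C k \<gamma>" and c: "is_cokernel C c \<gamma>" and \<pi>: "\<pi> \<in> Arr C"
    and reps: "\<And>x U W. \<lbrakk>x \<in> Iso C; (U, W) \<in> completions C \<gamma> k c (rep x)\<rbrakk>
      \<Longrightarrow> \<exists>\<rho>. \<rho> \<in> Arr C \<and> Dom C \<rho> = Dom C \<pi> \<and> Cod C \<rho> = Dom C W \<and> W \<cdot> \<rho> = \<pi>"
    and UW: "(U, W) \<in> completions C \<gamma> k c X"
  shows "\<exists>\<rho>. \<rho> \<in> Arr C \<and> Dom C \<rho> = Dom C \<pi> \<and> Cod C \<rho> = X \<and> W \<cdot> \<rho> = \<pi>"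
proof -
  have UWD: "U \<in> Arr C" "W \<in> Arr C" "Dom C W = X" "Cod C U = X" using completionsD[OF UW] by auto
  then have X: "X \<in> Ob C" by auto
  obtain a where a: "a \<in> isos C X (rep (cls X))" using isomorphic_rep[OF X] unfolding isomorphic_def by blast
  then obtain b where b: "b \<in> isos C (rep (cls X)) X" "b \<cdot> a = Id C X" by (blast elim: isosE)
  note [simp] = isosD[OF a] isosD[OF b(1)] UWD
  have "(a \<cdot> U, W \<cdot> b) \<in> completions C \<gamma> k c (rep (cls X))" by (rule completion_iso_middle[OF k c UW a b])
  then obtain \<rho> where "\<rho> \<in> Arr C" "Dom C \<rho> = Dom C \<pi>" "Cod C \<rho> = Dom C (W \<cdot> b)" "(W \<cdot> b) \<cdot> \<rho> = \<pi>"
    using reps[OF cls_Iso[OF X]] by blast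
  then show ?thesis by (intro exI[of _ "b \<cdot> \<rho>"]) simp
qed

text \<open>The middle object of a completion is also the middle of an extension of the cokernel by
  the source of \<gamma>, which leaves finitely many representatives and finitely many arrows out of
  each.\<close>

lemma finite_completion_epics:
  assumes k: "is_kernel C k \<gamma>" and c: "is_cokernel C c \<gamma>"
  shows "finite {W. \<exists>x\<in>Iso C. \<exists>U. (U, W) \<in> completions C \<gamma> k c (rep x)}"
proof (rule finite_subset)
  note [simp] = kerD[OF k] cokD[OF c]
  let ?S = "{x \<in> Iso C. short_exacts C (Dom C \<gamma>) (rep x) (Cod C c) \<noteq> {}}"
  show "{W. \<exists>x\<in>Iso C. \<exists>U. (U, W) \<in> completions C \<gamma> k c (rep x)} \<subseteq> (\<Union>x\<in>?S. homset C (rep x) (Cod C \<gamma>))"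
  proof clarify
    fix x U W assume x: "x \<in> Iso C" and UW: "(U, W) \<in> completions C \<gamma> k c (rep x)"
    have D: "U \<in> Arr C \<and> W \<in> Arr C \<and> Dom C U = Dom C \<gamma> \<and> Cod C U = rep x \<and> Dom C W = rep x \<and> Cod C W = Cod C \<gamma>"
      using completionsD[OF UW] by blast
    then have "(U, c \<cdot> W) \<in> short_exacts C (Dom C \<gamma>) (rep x) (Cod C c)"
      using completion_ses1[OF k UW c] by (simp add: short_exacts_iff)
    then show "W \<in> (\<Union>x\<in>?S. homset C (rep x) (Cod C \<gamma>))" using x D by (intro UN_I[of x]) auto
  qed
  show "finite (\<Union>x\<in>?S. homset C (rep x) (Cod C \<gamma>))" using finite_middle[of "Dom C \<gamma>" "Cod C c"] by simp
qed

text \<open>One \<epsilon> serves all completions, because lifts need only be arranged on the chosen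
  representatives and are then transported along isomorphisms.\<close>

lemma universal_epic:
  assumes k: "is_kernel C k \<gamma>" and c: "is_cokernel C c \<gamma>" and \<pi>: "epic C \<pi>" "Cod C \<pi> = Cod C \<gamma>"
  obtains \<epsilon> where "epic C \<epsilon>" "Cod C \<epsilon> = Dom C \<pi>"
    "\<forall>X U W. (U, W) \<in> completions C \<gamma> k c X \<longrightarrow> (\<exists>\<rho>. \<rho> \<in> Arr C \<and> Dom C \<rho> = Dom C \<epsilon> \<and> Cod C \<rho> = X \<and> W \<cdot> \<rho> = \<pi> \<cdot> \<epsilon>)"
proof -
  let ?F = "{W. \<exists>x\<in>Iso C. \<exists>U. (U, W) \<in> completions C \<gamma> k c (rep x)}"
  have F: "epic C W \<and> Cod C W = Cod C \<pi>" if "W \<in> ?F" for W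
  proof -
    obtain x U where UW: "(U, W) \<in> completions C \<gamma> k c (rep x)" using \<open>W \<in> ?F\<close> by blast
    show ?thesis using ses_epic[OF completion_ses2[OF c UW k]] completionsD[OF UW] \<pi> by simp
  qed
  obtain \<epsilon> where \<epsilon>: "epic C \<epsilon>" "Cod C \<epsilon> = Dom C \<pi>"
    and l: "\<forall>g\<in>?F. \<exists>\<rho>. \<rho> \<in> Arr C \<and> Dom C \<rho> = Dom C \<epsilon> \<and> Cod C \<rho> = Dom C g \<and> g \<cdot> \<rho> = \<pi> \<cdot> \<epsilon>"
    using common_lift[OF finite_completion_epics[OF k c] F \<pi>(1)] by blast
  note [simp] = epic_arr[OF \<epsilon>(1)] epic_arr[OF \<pi>(1)] \<epsilon>(2)
  show ?thesis
  proof (rule that[OF \<epsilon>], intro allI impI)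
    fix X U W assume UW: "(U, W) \<in> completions C \<gamma> k c X"
    have \<pi>\<epsilon>: "\<pi> \<cdot> \<epsilon> \<in> Arr C" by simp
    have r: "\<exists>\<rho>. \<rho> \<in> Arr C \<and> Dom C \<rho> = Dom C (\<pi> \<cdot> \<epsilon>) \<and> Cod C \<rho> = Dom C W' \<and> W' \<cdot> \<rho> = \<pi> \<cdot> \<epsilon>"
      if "x \<in> Iso C" "(U', W') \<in> completions C \<gamma> k c (rep x)" for x U' W'
      using l that by auto
    show "\<exists>\<rho>. \<rho> \<in> Arr C \<and> Dom C \<rho> = Dom C \<epsilon> \<and> Cod C \<rho> = X \<and> W \<cdot> \<rho> = \<pi> \<cdot> \<epsilon>"
      using lift_completions_from_reps[OF k c \<pi>\<epsilon> r UW] by simp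
  qed
qed

text \<open>This is the case \<gamma> = 0: every extension of \<open>Q\<close> by \<open>Z\<close>
  splits after pullback along \<pi>. With its kernel, \<pi> does the work of a projective
  presentation of \<open>Q\<close>, for coefficients in \<open>Z\<close>.\<close>

lemma universal_extension:
  assumes "Q \<in> Ob C" "Z \<in> Ob C"
  obtains \<pi> where "epic C \<pi>" "Cod C \<pi> = Q"
    "\<forall>i p. ses C i p \<and> Dom C i = Z \<and> Cod C p = Q \<longrightarrow> (\<exists>\<rho>. \<rho> \<in> Arr C \<and> Dom C \<rho> = Dom C \<pi> \<and> Cod C \<rho> = Cod C i \<and> p \<cdot> \<rho> = \<pi>)"
    "\<forall>\<iota>. is_kernel C \<iota> \<pi> \<longrightarrow> chi Q Z * card (homset C (Dom C \<pi>) Z) = card (homset C (Dom C \<iota>) Z)"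
proof -
  note k = zero_kernel[OF assms(2,1)] and c = zero_cokernel[OF assms(1,2)]
  have idQ: "epic C (Id C Q)" "Cod C (Id C Q) = Cod C (nul Z Q)" using iso_epic[OF iso_id] assms by simp_all
  obtain \<epsilon> where \<epsilon>: "epic C \<epsilon>" "Cod C \<epsilon> = Dom C (Id C Q)" and
    l: "\<forall>X U W. (U, W) \<in> completions C (nul Z Q) (Id C Z) (Id C Q) X \<longrightarrow>
      (\<exists>\<rho>. \<rho> \<in> Arr C \<and> Dom C \<rho> = Dom C \<epsilon> \<and> Cod C \<rho> = X \<and> W \<cdot> \<rho> = Id C Q \<cdot> \<epsilon>)"
    by (rule universal_epic[OF k c idQ])
  note [simp] = epic_arr[OF \<epsilon>(1)] assms
  have [simp]: "Cod C \<epsilon> = Q" using \<epsilon> by simp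
  have l': "\<exists>\<rho>. \<rho> \<in> Arr C \<and> Dom C \<rho> = Dom C \<epsilon> \<and> Cod C \<rho> = X \<and> W \<cdot> \<rho> = \<epsilon>"
    if "(U, W) \<in> completions C (nul Z Q) (Id C Z) (Id C Q) X" for X U W using l that by simp
  show ?thesis
  proof (rule that[OF \<epsilon>(1)]; (intro allI impI)?)
    fix i p assume "ses C i p \<and> Dom C i = Z \<and> Cod C p = Q"
    then show "\<exists>\<rho>. \<rho> \<in> Arr C \<and> Dom C \<rho> = Dom C \<epsilon> \<and> Cod C \<rho> = Cod C i \<and> p \<cdot> \<rho> = \<epsilon>"
      using l'[of i p "Cod C i"] by (simp add: zero_completions short_exacts_iff)
  next
    fix \<iota> assume \<iota>: "is_kernel C \<iota> \<epsilon>"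
    have "((\<lambda>x. real (card (short_exacts C Z (rep x) Q)) / real (aut_card C (rep x))) has_sum
      real (card (homset C (Dom C \<iota>) Z)) / real (card (homset C (Dom C \<epsilon>) Z))) (Iso C)"
      using count_completions_lift[OF k c \<epsilon>(1) _ _ l', of \<iota>] \<iota> by (simp add: zero_completions del: hom_iff)
    then have "chi Q Z = real (card (homset C (Dom C \<iota>) Z)) / real (card (homset C (Dom C \<epsilon>) Z))"
      unfolding chi_def by (rule infsumI)
    moreover have "nul (Dom C \<epsilon>) Z \<in> homset C (Dom C \<epsilon>) Z" by simp
    then have "card (homset C (Dom C \<epsilon>) Z) \<noteq> 0" using finite_homset_any by (auto simp only: card_eq_0_iff)
    ultimately show "chi Q Z * card (homset C (Dom C \<epsilon>) Z) = card (homset C (Dom C \<iota>) Z)" by simp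
  qed simp
qed

text \<open>The epic onto the target is refined twice, so that extensions of the cokernel by the
  kernel lift along \<open>c \<cdot> \<pi>\<close> and completions of \<gamma> lift along \<pi>.
  Both counts then equal |Hom(Dom \<iota>, Z)| / |Hom(Dom \<pi>, Z)| with the same \<iota>, so the
  answer depends on \<gamma> only through its kernel and cokernel.\<close>

theorem count_completions:
  assumes k: "is_kernel C k \<gamma>" and c: "is_cokernel C c \<gamma>"
  shows "((\<lambda>x. real (card (completions C \<gamma> k c (rep x))) / real (aut_card C (rep x))) has_sum chi (Cod C c) (Dom C k)) (Iso C)"
proof -
  define Q Z where "Q = Cod C c" and "Z = Dom C k"
  note [simp] = kerD[OF k] cokD[OF c]
  have Ob [simp]: "Q \<in> Ob C" "Z \<in> Ob C" by (simp_all add: Q_def Z_def)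
  note k0 = zero_kernel[OF Ob(2,1)] and c0 = zero_cokernel[OF Ob]
  have cQ: "Cod C c = Cod C (nul Z Q)" by (simp add: Q_def)
  obtain \<epsilon>1 where \<epsilon>1: "epic C \<epsilon>1" "Cod C \<epsilon>1 = Dom C c" and
    l1: "\<forall>X U W. (U, W) \<in> completions C (nul Z Q) (Id C Z) (Id C Q) X \<longrightarrow>
      (\<exists>\<rho>. \<rho> \<in> Arr C \<and> Dom C \<rho> = Dom C \<epsilon>1 \<and> Cod C \<rho> = X \<and> W \<cdot> \<rho> = c \<cdot> \<epsilon>1)"
    by (rule universal_epic[OF k0 c0 cok_epic[OF c] cQ])
  have e1: "Cod C \<epsilon>1 = Cod C \<gamma>" using \<epsilon>1 by simp
  obtain \<epsilon>2 where \<epsilon>2: "epic C \<epsilon>2" "Cod C \<epsilon>2 = Dom C \<epsilon>1" and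
    l2: "\<forall>X U W. (U, W) \<in> completions C \<gamma> k c X \<longrightarrow>
      (\<exists>\<rho>. \<rho> \<in> Arr C \<and> Dom C \<rho> = Dom C \<epsilon>2 \<and> Cod C \<rho> = X \<and> W \<cdot> \<rho> = \<epsilon>1 \<cdot> \<epsilon>2)"
    by (rule universal_epic[OF k c \<epsilon>1(1) e1])
  note [simp] = epic_arr[OF \<epsilon>1(1)] epic_arr[OF \<epsilon>2(1)] \<epsilon>2(2) e1
  define \<pi> where "\<pi> = \<epsilon>1 \<cdot> \<epsilon>2"
  have \<pi>: "epic C \<pi>" "Cod C \<pi> = Cod C \<gamma>" "\<pi> \<in> Arr C" "Dom C \<pi> = Dom C \<epsilon>2"
    using epic_comp[OF \<epsilon>1(1) \<epsilon>2(1)] by (simp_all add: \<pi>_def)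
  have c\<pi>: "epic C (c \<cdot> \<pi>)" using epic_comp[OF cok_epic[OF c] \<pi>(1)] \<pi> by simp
  have l2': "\<exists>\<rho>. \<rho> \<in> Arr C \<and> Dom C \<rho> = Dom C \<pi> \<and> Cod C \<rho> = X \<and> W \<cdot> \<rho> = \<pi>"
    if "(U, W) \<in> completions C \<gamma> k c X" for X U W using l2 that \<pi>(4) by (simp add: \<pi>_def)
  have l1': "\<exists>\<rho>. \<rho> \<in> Arr C \<and> Dom C \<rho> = Dom C (c \<cdot> \<pi>) \<and> Cod C \<rho> = X \<and> W \<cdot> \<rho> = c \<cdot> \<pi>"
    if UW: "(U, W) \<in> completions C (nul Z Q) (Id C Z) (Id C Q) X" for X U W
  proof -
    obtain \<rho> where \<rho>: "\<rho> \<in> Arr C" "Dom C \<rho> = Dom C \<epsilon>1" "Cod C \<rho> = X" "W \<cdot> \<rho> = c \<cdot> \<epsilon>1" using l1 UW by blast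
    then show ?thesis using comp_under[OF \<rho>(4), of \<epsilon>2] completionsD[OF UW]
      by (intro exI[of _ "\<rho> \<cdot> \<epsilon>2"]) (simp add: \<pi>_def)
  qed
  obtain \<iota> where \<iota>: "is_kernel C \<iota> (c \<cdot> \<pi>)" using has_kernels[of "c \<cdot> \<pi>"] \<pi> by auto
  have \<iota>0: "is_kernel C \<iota> (Id C Q \<cdot> (c \<cdot> \<pi>))" using \<iota> \<pi> by (simp add: Q_def)
  have cQ': "Cod C (c \<cdot> \<pi>) = Cod C (nul Z Q)" using \<pi> by (simp add: Q_def)
  have "((\<lambda>x. real (card (short_exacts C Z (rep x) Q)) / real (aut_card C (rep x))) has_sum
      real (card (homset C (Dom C \<iota>) (Dom C (Id C Z)))) / real (card (homset C (Dom C (c \<cdot> \<pi>)) (Dom C (Id C Z))))) (Iso C)"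
    using count_completions_lift[OF k0 c0 c\<pi> cQ' \<iota>0 l1'] by (simp add: zero_completions del: hom_iff)
  then have "chi Q Z = real (card (homset C (Dom C \<iota>) Z)) / real (card (homset C (Dom C \<pi>) Z))"
    using \<pi> unfolding chi_def by (intro infsumI) simp
  then show ?thesis using count_completions_lift[OF k c \<pi>(1,2) \<iota> l2'] by (simp add: Q_def Z_def)
qed

text \<open>Both sides count filtrations with subquotients \<open>Dom i\<close>, \<open>Cod e\<close> and \<open>Q\<close>.\<close>

lemma chi_mult_right:
  assumes s: "ses C i e" and Q: "Q \<in> Ob C"
  shows "chi Q (Cod C i) = chi Q (Dom C i) * chi Q (Cod C e)"
proof -
  define Z S L where "Z = Dom C i" and "S = Cod C i" and "L = Cod C e"
  note sD = sesD[OF s]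
  have Ob [simp]: "Z \<in> Ob C" "S \<in> Ob C" "L \<in> Ob C" "Q \<in> Ob C" using sD Q by (auto simp: Z_def S_def L_def)
  have [simp]: "i \<in> Arr C" "e \<in> Arr C" "Dom C i = Z" "Cod C i = S" "Dom C e = S" "Cod C e = L" "e \<cdot> i = nul Z L"
    using sD by (simp_all add: Z_def S_def L_def)
  \<comment> \<open>For an extension \<open>T\<close> of \<open>Q\<close> by \<open>L\<close>, the
    composite S -> L -> T has kernel \<open>Z\<close> and cokernel \<open>Q\<close>. Its completions
    are the extensions of \<open>Q\<close> by \<open>S\<close> lying above \<open>T\<close>, and
    their weighted number is known.\<close>
  have kc: "is_kernel C i (j \<cdot> e)" "is_cokernel C c (j \<cdot> e)" if "(j, c) \<in> short_exacts C L T Q" for j c T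
  proof -
    have jc: "ses C j c" "Dom C j = L" using that by (simp_all add: short_exacts_iff)
    show "is_kernel C i (j \<cdot> e)" using s jc kernel_of_monic_comp[OF ses_monic[OF jc(1)], of e i] by (simp add: ses_def)
    show "is_cokernel C c (j \<cdot> e)"
      using jc cokernel_of_comp_epic[OF ses_epic[OF s], of j c] sesD[OF jc(1)] by (simp add: ses_def)
  qed
  define D where "D X T = {((j, c), (U, W)). (j, c) \<in> short_exacts C L T Q \<and> (U, W) \<in> completions C (j \<cdot> e) i c X}" for X T
  have finD: "finite (D X T)" for X T
  proof (rule finite_subset)
    show "D X T \<subseteq> short_exacts C L T Q \<times> (homset C S X \<times> homset C X T)"
      unfolding D_def using completionsD sesD by (fastforce simp: short_exacts_iff)
  qed (simp del: hom_iff)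
  have cardD: "card (D X T) = (\<Sum>jc\<in>short_exacts C L T Q. card (completions C (fst jc \<cdot> e) i (snd jc) X))" for X T
  proof -
    have "D X T = {(jc, UW). jc \<in> short_exacts C L T Q \<and> UW \<in> completions C (fst jc \<cdot> e) i (snd jc) X}"
      by (auto simp: D_def)
    then show ?thesis using card_Collect_pair[of "short_exacts C L T Q" "\<lambda>jc UW. UW \<in> completions C (fst jc \<cdot> e) i (snd jc) X"]
      by simp
  qed
  define F :: "('m \<times> 'm) \<times> ('m \<times> 'm) \<Rightarrow> 'm \<times> 'm" where "F = (\<lambda>((j, c), (U, W)). (U, c \<cdot> W))"
  have F: "F d \<in> short_exacts C S X Q" if "d \<in> D X T" for d X T
  proof -
    obtain j c U W where d: "d = ((j, c), (U, W))" by (metis prod.exhaust)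
    have jc: "(j, c) \<in> short_exacts C L T Q" and UW: "(U, W) \<in> completions C (j \<cdot> e) i c X" using that d by (auto simp: D_def)
    have "j \<in> Arr C" "Dom C j = L" "c \<in> Arr C" "Cod C c = Q" "Dom C c = Cod C j" using jc sesD by (auto simp: short_exacts_iff)
    then show ?thesis using completion_ses1[OF kc(1)[OF jc] UW kc(2)[OF jc]] completionsD[OF UW]
      by (simp add: F_def d short_exacts_iff)
  qed
  \<comment> \<open>With \<open>X\<close> fixed, an extension of \<open>Q\<close> by
    \<open>S\<close> determines the one by \<open>L\<close> as its pushout along \<open>e\<close>,
    up to unique isomorphism.\<close>
  have inner: "((\<lambda>t. real (card (D X (rep t))) / real (aut_card C (rep t))) has_sum real (card (short_exacts C S X Q))) (Iso C)" for X
  proof (rule groupoid_count[where F = "\<lambda>_. F"])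
    fix Up assume "Up \<in> short_exacts C S X Q"
    moreover obtain U p where Up: "Up = (U, p)" by (cases Up)
    ultimately have sU: "ses C U p" and [simp]: "Dom C U = S" "Cod C U = X" "Cod C p = Q" by (simp_all add: short_exacts_iff)
    note [simp] = sesD[OF sU]
    have e': "e \<in> Arr C" "Dom C e = Dom C U" by simp_all
    obtain j0 \<rho>0 c0 where s0: "ses C j0 c0" and j0: "Dom C j0 = Cod C e" and \<rho>0: "\<rho>0 \<in> Arr C" "Dom C \<rho>0 = Cod C U" "Cod C \<rho>0 = Cod C j0"
      "Cod C c0 = Cod C p" and eq0: "j0 \<cdot> e = \<rho>0 \<cdot> U" and c\<rho>: "c0 \<cdot> \<rho>0 = p"
      by (rule pushout_exists[OF sU e'])
    have [simp]: "Dom C j0 = L" "\<rho>0 \<in> Arr C" "Dom C \<rho>0 = X" "Cod C \<rho>0 = Cod C j0" "Cod C c0 = Q" using j0 \<rho>0 by simp_all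
    note [simp] = sesD[OF s0]
    have cok0: "is_cokernel C \<rho>0 (U \<cdot> i)" by (rule pushout_is_cokernel[OF sU s _ s0 \<rho>0 c\<rho> j0 eq0]) simp
    have ex: "\<exists>a\<in>isos C (Cod C j0) T. a \<cdot> \<rho>0 = W \<and> j = a \<cdot> j0 \<and> c \<cdot> a = c0"
      if d: "((j, c), (V, W)) \<in> D X T" "F ((j, c), (V, W)) = (U, p)" for j c V W T
    proof -
      have VU: "V = U" and cW: "c \<cdot> W = p" using d(2) by (simp_all add: F_def)
      have jc: "(j, c) \<in> short_exacts C L T Q" and UW: "(U, W) \<in> completions C (j \<cdot> e) i c X" using d(1) VU by (auto simp: D_def)
      have sj: "ses C j c" and [simp]: "Dom C j = L" "Cod C j = T" "Cod C c = Q" using jc by (simp_all add: short_exacts_iff)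
      note [simp] = sesD[OF sj]
      have [simp]: "W \<in> Arr C" "Dom C W = X" "Cod C W = T" and WU: "W \<cdot> U = j \<cdot> e" using completionsD[OF UW] by auto
      have "is_kernel C (U \<cdot> i) W" using UW by (simp add: completions_def)
      have h: "j \<in> Arr C" "W \<in> Arr C" "Dom C j = Dom C j0" "Dom C W = Cod C U" "Cod C j = Cod C W" by simp_all
      obtain a where a: "a \<in> Arr C" "Dom C a = Cod C j0" "Cod C a = Cod C j" "a \<cdot> j0 = j" "a \<cdot> \<rho>0 = W"
        by (rule pushout_desc[OF sU s0 \<rho>0 c\<rho> e' j0[symmetric] eq0 h WU[symmetric]])
      have ca: "c \<cdot> a = c0"
        using pushout_ext[OF sU s0 \<rho>0 c\<rho>, of "c \<cdot> a" c0] a sesD[OF sj] sesD[OF s0] c\<rho> cW by simp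
      have "a \<in> isos C (Cod C j0) T" using five[OF s0 sj, of a] a ca by simp
      then show ?thesis using a ca by auto
    qed
    let ?R = "\<lambda>d a. a \<cdot> \<rho>0 = snd (snd d) \<and> fst (fst d) = a \<cdot> j0 \<and> snd (fst d) \<cdot> a = c0"
    have "card {d \<in> D X T. F d = Up} = card (isos C (Cod C j0) T)" if T: "T \<in> Ob C" for T
    proof (rule card_eq_by_relation[where R = ?R])
      fix d assume "d \<in> {d \<in> D X T. F d = Up}"
      then show "\<exists>a\<in>isos C (Cod C j0) T. ?R d a"
        using ex Up by (cases d) auto
    next
      fix a assume a: "a \<in> isos C (Cod C j0) T"
      then obtain b where b: "b \<in> isos C T (Cod C j0)" "b \<cdot> a = Id C (Cod C j0)" by (blast elim: isosE)
      note [simp] = isosD[OF a] isosD[OF b(1)]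
      have "ses C (a \<cdot> j0) (c0 \<cdot> b)" by (rule ses_iso_middle[OF s0 a b])
      then have jc: "(a \<cdot> j0, c0 \<cdot> b) \<in> short_exacts C L T Q" by (simp add: short_exacts_iff)
      have "(c0 \<cdot> b) \<cdot> a \<cdot> \<rho>0 = p" using comp_under[OF b(2), of \<rho>0] c\<rho> by simp
      then have "(U, a \<cdot> \<rho>0) \<in> completions C ((a \<cdot> j0) \<cdot> e) i (c0 \<cdot> b) X"
        using sU eq0 by (intro completionI1[OF kc[OF jc]]) simp_all
      then have "((a \<cdot> j0, c0 \<cdot> b), (U, a \<cdot> \<rho>0)) \<in> {d \<in> D X T. F d = Up}"
        using jc \<open>(c0 \<cdot> b) \<cdot> a \<cdot> \<rho>0 = p\<close> by (simp add: D_def F_def Up)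
      then show "\<exists>d\<in>{d \<in> D X T. F d = Up}. ?R d a"
        using b(2) by (intro bexI) auto
    next
      fix d d' a assume dD: "d \<in> {d \<in> D X T. F d = Up}" "d' \<in> {d \<in> D X T. F d = Up}" and a: "a \<in> isos C (Cod C j0) T"
        and R: "?R d a"
          "?R d' a"
      obtain j c U1 W j' c' U1' W' where d: "d = ((j, c), (U1, W))" "d' = ((j', c'), (U1', W'))" by (metis prod.exhaust)
      have "ses C j c" "Cod C j = T" "ses C j' c'" "Cod C j' = T" "Cod C c = Q" "Cod C c' = Q"
        using dD unfolding d by (auto simp: D_def short_exacts_iff)
      moreover from this have "c = c'"
        using epic_cancel[OF iso_epic[OF a], of c c'] R d isosD[OF a] sesD by auto
      ultimately show "d = d'" using R d dD Up by (auto simp: F_def)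
    next
      fix d a a' assume "a \<in> isos C (Cod C j0) T" "a' \<in> isos C (Cod C j0) T"
        "?R d a"
        "?R d a'"
      then show "a = a'" using epic_cancel[OF cok_epic[OF cok0], of a a'] isosD[of a] isosD[of a'] by auto
    qed
    then show "\<exists>Y\<in>Ob C. \<forall>T\<in>Ob C. card {d \<in> D X T. F d = Up} = card (isos C Y T)"
      by (intro bexI[of _ "Cod C j0"]) auto
  qed (use finD F in auto)
  \<comment> \<open>Outside these finite sets all terms vanish, so the two summations can be
    interchanged.\<close>
  define SX ST where "SX = {x \<in> Iso C. short_exacts C S (rep x) Q \<noteq> {}}" and "ST = {x \<in> Iso C. short_exacts C L (rep x) Q \<noteq> {}}"
  have fin: "finite SX" "finite ST" "SX \<subseteq> Iso C" "ST \<subseteq> Iso C" using finite_middle by (auto simp: SX_def ST_def)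
  have DT: "card (D X (rep t)) = 0" if "t \<in> Iso C - ST" for X t
  proof -
    have "D X (rep t) = {}" using that by (auto simp: D_def ST_def)
    then show ?thesis by simp
  qed
  have DX: "card (D (rep x) T) = 0" if x: "x \<in> Iso C - SX" for x T
  proof -
    have "short_exacts C S (rep x) Q = {}" using x by (simp add: SX_def)
    then have "D (rep x) T = {}" using F[of _ "rep x" T] by blast
    then show ?thesis by simp
  qed
  have XX: "real (card (short_exacts C S (rep x) Q)) = (\<Sum>t\<in>ST. real (card (D (rep x) (rep t))) / real (aut_card C (rep t)))" for x
    using inner[of "rep x"] fin DT has_sum_finite_support[of ST "Iso C"] by simp
  \<comment> \<open>With \<open>T\<close> fixed, each extension of \<open>Q\<close> by
    \<open>L\<close> contributes the same value \<open>chi Q Z\<close>, by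
    \<open>count_completions\<close>.\<close>
  have TT: "(\<Sum>x\<in>SX. real (card (D (rep x) (rep t))) / real (aut_card C (rep x))) = real (card (short_exacts C L (rep t) Q)) * chi Q Z" for t
  proof -
    have "((\<lambda>x. \<Sum>jc\<in>short_exacts C L (rep t) Q. real (card (completions C (fst jc \<cdot> e) i (snd jc) (rep x))) / real (aut_card C (rep x)))
        has_sum (\<Sum>jc\<in>short_exacts C L (rep t) Q. chi Q Z)) (Iso C)"
    proof (rule has_sum_finite_sum[OF finite_short_exacts])
      fix jc assume jc: "jc \<in> short_exacts C L (rep t) Q"
      then have jc': "(fst jc, snd jc) \<in> short_exacts C L (rep t) Q" and "Cod C (snd jc) = Q" by (auto simp: short_exacts_def)
      then show "((\<lambda>x. real (card (completions C (fst jc \<cdot> e) i (snd jc) (rep x))) / real (aut_card C (rep x))) has_sum chi Q Z) (Iso C)"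
        using count_completions[OF kc(1)[OF jc'] kc(2)[OF jc']] by simp
    qed
    then have "((\<lambda>x. real (card (D (rep x) (rep t))) / real (aut_card C (rep x))) has_sum real (card (short_exacts C L (rep t) Q)) * chi Q Z) (Iso C)"
      by (simp add: cardD sum_divide_distrib)
    then show ?thesis using has_sum_finite_support[of SX "Iso C"] fin DX by simp
  qed
  have "chi Q S = (\<Sum>x\<in>SX. real (card (short_exacts C S (rep x) Q)) / real (aut_card C (rep x)))"
    using chi_has_sum_support[of S Q] has_sum_finite_support[of SX "Iso C"] fin by (auto simp: SX_def)
  also have "\<dots> = (\<Sum>x\<in>SX. \<Sum>t\<in>ST. real (card (D (rep x) (rep t))) / real (aut_card C (rep x)) / real (aut_card C (rep t)))"
    by (simp add: XX sum_divide_distrib mult.commute)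
  also have "\<dots> = (\<Sum>t\<in>ST. \<Sum>x\<in>SX. real (card (D (rep x) (rep t))) / real (aut_card C (rep x)) / real (aut_card C (rep t)))"
    by (rule sum.swap)
  also have "\<dots> = (\<Sum>t\<in>ST. real (card (short_exacts C L (rep t) Q)) / real (aut_card C (rep t)) * chi Q Z)"
    by (intro sum.cong[OF refl]) (simp only: sum_divide_distrib[symmetric] TT, simp)
  also have "\<dots> = (\<Sum>t\<in>ST. real (card (short_exacts C L (rep t) Q)) / real (aut_card C (rep t))) * chi Q Z"
    by (rule sum_distrib_right[symmetric])
  also have "\<dots> = chi Q L * chi Q Z"
    using chi_has_sum_support[of L Q] has_sum_finite_support[of ST "Iso C"] fin by (auto simp: ST_def)
  finally show ?thesis by (simp add: mult.commute)
qed

lemma chi_opp: "hereditary_counting_category.chi (opp C) Z Q = chi Q Z"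
proof -
  interpret op: hereditary_counting_category K "opp C" by (rule opp_hcc)
  have "card (short_exacts (opp C) Q X Z) = card (short_exacts C Z X Q)" for X
    by (rule bij_betw_same_card[of "\<lambda>(p, i). (i, p)"]) (auto simp: bij_betw_def inj_on_def image_iff)
  then show ?thesis by (simp add: chi_def op.chi_def)
qed

lemma chi_mult_left:
  assumes s: "ses C i e" and Z: "Z \<in> Ob C"
  shows "chi (Cod C i) Z = chi (Dom C i) Z * chi (Cod C e) Z"
proof -
  interpret op: hereditary_counting_category K "opp C" by (rule opp_hcc)
  have "op.chi Z (Cod (opp C) e) = op.chi Z (Dom (opp C) e) * op.chi Z (Cod (opp C) i)"
    using op.chi_mult_right[of e i Z] s Z by simp
  then show ?thesis using sesD[OF s] by (simp add: chi_opp mult.commute)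
qed

text \<open>A zero arrow has the identities as kernel and cokernel, but equally their composites
  with isomorphisms from Z' and to Q'. The set of completions is the same for either choice, and
  \<open>count_completions\<close> evaluates it in both ways.\<close>

lemma chi_iso:
  assumes "isomorphic C Q Q'" "isomorphic C Z Z'"
  shows "chi Q Z = chi Q' Z'"
proof -
  obtain a where a: "a \<in> isos C Q Q'" using assms unfolding isomorphic_def by blast
  obtain b where b: "b \<in> isos C Z Z'" using assms unfolding isomorphic_def by blast
  note [simp] = isosD[OF a] isosD[OF b]
  have Ob [simp]: "Q \<in> Ob C" "Q' \<in> Ob C" "Z \<in> Ob C" "Z' \<in> Ob C" using isosD[OF a] isosD[OF b] Ob_of_arr by blast+
  obtain b' where b': "b' \<in> isos C Z' Z" using b by (blast elim: isosE)
  have k: "is_kernel C (Id C Z \<cdot> b') (nul Z Q)" by (rule kernel_comp_iso[OF zero_kernel]) (use b' in simp_all)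
  have c: "is_cokernel C (a \<cdot> Id C Q) (nul Z Q)" by (rule iso_comp_cokernel[OF zero_cokernel]) (use a in simp_all)
  have "completions C (nul Z Q) (Id C Z \<cdot> b') (a \<cdot> Id C Q) X = completions C (nul Z Q) (Id C Z) (Id C Q) X" for X
    by (rule completions_indep[OF k zero_kernel c zero_cokernel]) simp_all
  then have "((\<lambda>x. real (card (completions C (nul Z Q) (Id C Z) (Id C Q) (rep x))) / real (aut_card C (rep x))) has_sum chi Q' Z') (Iso C)"
    using count_completions[OF k c] isosD[OF b'] by simp
  then show ?thesis
    using count_completions[OF zero_kernel[of Z Q] zero_cokernel[of Q Z]] has_sum_unique by fastforce
qed

end

section \<open>Yoneda extensions and the Euler form\<close>

lemma (in vectorspace) card_carrier_eq_power_dim: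
  assumes "finite (carrier V)"
  shows "card (carrier V) = card (carrier K) ^ dim"
proof -
  have "fin_dim" unfolding fin_dim_def
    using assms in_own_span[of "carrier V"] span_is_subset2[of "carrier V"] by (intro exI[of _ "carrier V"]) auto
  then obtain B where B: "finite B" "basis B" using finite_basis_exists by blast
  then have sub: "B \<subseteq> carrier V" by (simp add: basis_def)
  have crit: "\<forall>v. v \<in> carrier V \<longrightarrow> (\<exists>!a. a \<in> B \<rightarrow>\<^sub>E carrier K \<and> lincomb a B = v)"
    using basis_criterion[OF B(1) sub] B(2) by blast
  have cl: "lincomb a B \<in> carrier V" if "a \<in> B \<rightarrow>\<^sub>E carrier K" for a
    using that sub B(1) by (intro lincomb_closed) auto
  have "bij_betw (\<lambda>a. lincomb a B) (B \<rightarrow>\<^sub>E carrier K) (carrier V)"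
    unfolding bij_betw_def
  proof
    show "inj_on (\<lambda>a. lincomb a B) (B \<rightarrow>\<^sub>E carrier K)" using crit cl unfolding inj_on_def by blast
    show "(\<lambda>a. lincomb a B) ` (B \<rightarrow>\<^sub>E carrier K) = carrier V" using crit cl by blast
  qed
  then have "card (carrier V) = card (B \<rightarrow>\<^sub>E carrier K)" using bij_betw_same_card by metis
  also have "\<dots> = card (carrier K) ^ card B" using B(1) by (simp add: card_PiE)
  finally show ?thesis using dim_basis[OF B] by simp
qed

text \<open>The operations of \<open>W\<close> are only assumed to correspond under \<delta>; all
  module axioms are then inherited from \<open>V\<close>, without separate proofs for Baer
  sums.\<close>

lemma module_surjective_image:
  fixes R (structure) and V :: "('a, 'b, 'c) module_scheme" and W :: "('a, 'd, 'e) module_scheme"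
  assumes V: "module R V" and surj: "\<delta> ` carrier V = carrier W"
    and add: "\<And>x y. \<lbrakk>x \<in> carrier V; y \<in> carrier V\<rbrakk> \<Longrightarrow> \<delta> x \<oplus>\<^bsub>W\<^esub> \<delta> y = \<delta> (x \<oplus>\<^bsub>V\<^esub> y)"
    and smult: "\<And>c x. \<lbrakk>c \<in> carrier R; x \<in> carrier V\<rbrakk> \<Longrightarrow> c \<odot>\<^bsub>W\<^esub> \<delta> x = \<delta> (c \<odot>\<^bsub>V\<^esub> x)"
    and zero: "\<zero>\<^bsub>W\<^esub> = \<delta> \<zero>\<^bsub>V\<^esub>"
  shows "module R W"
proof -
  interpret V: module R V by (rule V)
  have ex: "\<exists>x\<in>carrier V. w = \<delta> x" if "w \<in> carrier W" for w using surj that by blast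
  have cl: "\<delta> x \<in> carrier W" if "x \<in> carrier V" for x using surj that by blast
  show ?thesis
  proof (rule moduleI)
    show "abelian_group W"
    proof (rule abelian_groupI)
      fix x assume "x \<in> carrier W"
      then obtain a where a: "a \<in> carrier V" "x = \<delta> a" using ex by blast
      then have "\<delta> (\<ominus>\<^bsub>V\<^esub> a) \<oplus>\<^bsub>W\<^esub> x = \<zero>\<^bsub>W\<^esub>" using add zero by (simp add: V.l_neg)
      then show "\<exists>y\<in>carrier W. y \<oplus>\<^bsub>W\<^esub> x = \<zero>\<^bsub>W\<^esub>" using a cl by blast
    qed (use ex in \<open>auto simp: add zero cl V.a_ac dest!: ex\<close>)
    show "cring R" using V by (simp add: module_def)
  qed (auto simp: add smult cl V.smult_l_distr V.smult_r_distr V.smult_assoc1 dest!: ex)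
qed

section \<open>Split sequences, direct sums, and Baer sums of pushouts\<close>

context linear_abelian_category
begin

lemma ses_comp_zero:
  assumes s: "ses C f g" and x: "x \<in> Arr C" "Cod C x = Dom C f"
  shows "g \<cdot> f \<cdot> x = nul (Dom C x) (Cod C g)"
  using comp_under[of g f _ x] sesD[OF s] x by simp

lemma biprod_into_ext:
  assumes b: "(i, j, p, r) \<in> biproducts C A B S"
    and "f \<in> Arr C" "f' \<in> Arr C" "Cod C f = S" "Cod C f' = S" "p \<cdot> f = p \<cdot> f'" "r \<cdot> f = r \<cdot> f'" "Dom C f = Dom C f'"
  shows "f = f'"
  using linear_abelian_category.biprod_ext[OF opp_lac, of p r i j A B S f f'] assms by simp

text \<open>The missing projection is the lift of \<open>Id - j \<cdot> g\<close> through
  \<open>f\<close>.\<close>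

lemma section_biproduct:
  assumes s: "ses C f g" and [simp]: "j \<in> Arr C" "Dom C j = Cod C g" "Cod C j = Cod C f" and gj: "g \<cdot> j = Id C (Cod C g)"
  shows "\<exists>p. (f, j, p, g) \<in> biproducts C (Dom C f) (Cod C g) (Cod C f)"
proof -
  note [simp] = sesD[OF s]
  have gjx: "g \<cdot> j \<cdot> x = x" if "x \<in> Arr C" "Cod C x = Cod C g" for x using comp_under[OF gj, of x] that by simp
  have "g \<cdot> (Id C (Cod C f) \<boxminus> j \<cdot> g) = nul (Cod C f) (Cod C g)" by (simp add: gjx)
  then obtain p where p: "p \<in> Arr C" "Dom C p = Cod C f" "Cod C p = Dom C f" "f \<cdot> p = Id C (Cod C f) \<boxminus> j \<cdot> g"
    using ses_lift[OF s, of "Id C (Cod C f) \<boxminus> j \<cdot> g"] by auto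
  note [simp] = p(1-3)
  have "f \<cdot> p \<cdot> f = f \<cdot> Id C (Dom C f)" using comp_under[OF p(4), of f] by simp
  then have pf: "p \<cdot> f = Id C (Dom C f)" using monic_cancel[OF ses_monic[OF s], of "p \<cdot> f" "Id C (Dom C f)"] by simp
  have "f \<cdot> p \<cdot> j = nul (Cod C g) (Cod C f)" using comp_under[OF p(4), of j] gj by simp
  then have pj: "p \<cdot> j = nul (Cod C g) (Dom C f)" using monic_zero[OF ses_monic[OF s], of "p \<cdot> j"] by simp
  have "(f, j, p, g) \<in> biproducts C (Dom C f) (Cod C g) (Cod C f)"
    unfolding biproducts_def using pf pj gj p(4) by simp
  then show ?thesis by blast
qed

lemma dsum_ses:
  assumes s: "ses C f g" and s': "ses C f' g'"
    and a: "(i1, j1, p1, r1) \<in> biproducts C (Dom C f) (Dom C f') NN"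
    and b: "(i2, j2, p2, r2) \<in> biproducts C (Cod C f) (Cod C f') EE"
    and d: "(i3, j3, p3, r3) \<in> biproducts C (Cod C g) (Cod C g') MM"
  shows "ses C (i2 \<cdot> f \<cdot> p1 \<boxplus> j2 \<cdot> f' \<cdot> r1) (i3 \<cdot> g \<cdot> p2 \<boxplus> j3 \<cdot> g' \<cdot> r2)"
proof -
  note [simp] = sesD[OF s] sesD[OF s'] biprodD[OF a] biprodD[OF b] biprodD[OF d] biprod_under[OF a] biprod_under[OF b] biprod_under[OF d]
  define F G where "F = i2 \<cdot> f \<cdot> p1 \<boxplus> j2 \<cdot> f' \<cdot> r1" and "G = i3 \<cdot> g \<cdot> p2 \<boxplus> j3 \<cdot> g' \<cdot> r2"
  have [simp]: "F \<in> Arr C" "Dom C F = NN" "Cod C F = EE" "G \<in> Arr C" "Dom C G = EE" "Cod C G = MM"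
    by (simp_all add: F_def G_def)
  have NN: "NN \<in> Ob C" "EE \<in> Ob C" "MM \<in> Ob C" "Dom C f \<in> Ob C" "Dom C f' \<in> Ob C" "Cod C f \<in> Ob C" "Cod C f' \<in> Ob C" "Cod C g \<in> Ob C" "Cod C g' \<in> Ob C"
    using Ob_of_arr biprodD[OF a] biprodD[OF b] biprodD[OF d] by blast+
  note [simp] = NN
  have p2F: "p2 \<cdot> F = f \<cdot> p1" "r2 \<cdot> F = f' \<cdot> r1" by (simp_all add: F_def)
  have Gi: "G \<cdot> i2 = i3 \<cdot> g" "G \<cdot> j2 = j3 \<cdot> g'" by (simp_all add: G_def)
  have p3G: "p3 \<cdot> G = g \<cdot> p2" "r3 \<cdot> G = g' \<cdot> r2" by (simp_all add: G_def)
  have fpx: "g \<cdot> f \<cdot> x = nul (Dom C x) (Cod C g)" if "x \<in> Arr C" "Cod C x = Dom C f" for x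
    using comp_under[of g f _ x] that by simp
  have fpx': "g' \<cdot> f' \<cdot> x = nul (Dom C x) (Cod C g')" if "x \<in> Arr C" "Cod C x = Dom C f'" for x
    using comp_under[of g' f' _ x] that by simp
  have "monic C F"
  proof (rule monicI)
    fix x assume x: "x \<in> Arr C" "Cod C x = Dom C F" "F \<cdot> x = nul (Dom C x) (Cod C F)"
    have "f \<cdot> p1 \<cdot> x = nul (Dom C x) (Cod C f)" "f' \<cdot> r1 \<cdot> x = nul (Dom C x) (Cod C f')"
      using comp_under[OF p2F(1), of x] comp_under[OF p2F(2), of x] x by simp_all
    then have "p1 \<cdot> x = nul (Dom C x) (Dom C f)" "r1 \<cdot> x = nul (Dom C x) (Dom C f')"
      using monic_zero[OF ses_monic[OF s], of "p1 \<cdot> x"] monic_zero[OF ses_monic[OF s'], of "r1 \<cdot> x"] x by simp_all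
    note * = this
    show "x = nul (Dom C x) (Dom C F)" by (rule biprod_into_ext[OF a]) (use x * in simp_all)
  qed simp
  moreover have "epic C G"
  proof (rule epicI)
    fix x assume x: "x \<in> Arr C" "Dom C x = Cod C G" "x \<cdot> G = nul (Dom C G) (Cod C x)"
    have "x \<cdot> i3 \<cdot> g = nul (Dom C g) (Cod C x)" "x \<cdot> j3 \<cdot> g' = nul (Dom C g') (Cod C x)"
      using comp_under[OF x(3), of i2] comp_under[OF x(3), of j2] x Gi by simp_all
    then have "x \<cdot> i3 = nul (Cod C g) (Cod C x)" "x \<cdot> j3 = nul (Cod C g') (Cod C x)"
      using epic_zero[OF ses_epic[OF s], of "x \<cdot> i3"] epic_zero[OF ses_epic[OF s'], of "x \<cdot> j3"] x by simp_all
    note * = this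
    show "x = nul (Cod C G) (Cod C x)" by (rule biprod_ext[OF d]) (use x * in simp_all)
  qed simp
  moreover have "is_kernel C F G"
  proof (rule is_kernelI[OF \<open>monic C F\<close>])
    show "G \<cdot> F = nul (Dom C F) (Cod C G)"
      by (rule biprod_into_ext[OF d]) (use comp_under[OF p3G(1), of F] comp_under[OF p3G(2), of F] p2F fpx fpx' in simp_all)
    fix h assume h: "h \<in> Arr C" "Cod C h = Dom C G" "G \<cdot> h = nul (Dom C h) (Cod C G)"
    have "g \<cdot> p2 \<cdot> h = nul (Dom C h) (Cod C g)" "g' \<cdot> r2 \<cdot> h = nul (Dom C h) (Cod C g')"
      using comp_under[OF p3G(1), of h] comp_under[OF p3G(2), of h] h by simp_all
    note gh = this
    obtain x where x: "x \<in> Arr C" "Dom C x = Dom C h" "Cod C x = Dom C f" "f \<cdot> x = p2 \<cdot> h"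
      using ses_lift[OF s, of "p2 \<cdot> h"] gh(1) h(1,2) by auto
    obtain y where y: "y \<in> Arr C" "Dom C y = Dom C h" "Cod C y = Dom C f'" "f' \<cdot> y = r2 \<cdot> h"
      using ses_lift[OF s', of "r2 \<cdot> h"] gh(2) h(1,2) by auto
    define z where "z = i1 \<cdot> x \<boxplus> j1 \<cdot> y"
    have z: "z \<in> Arr C" "Dom C z = Dom C h" "Cod C z = NN" "p1 \<cdot> z = x" "r1 \<cdot> z = y"
      using x(1-3) y(1-3) by (simp_all add: z_def)
    have "F \<cdot> z = h"
    proof (rule biprod_into_ext[OF b])
      show "p2 \<cdot> F \<cdot> z = p2 \<cdot> h" using comp_under[OF p2F(1), of z] z x(4) by simp
      show "r2 \<cdot> F \<cdot> z = r2 \<cdot> h" using comp_under[OF p2F(2), of z] z y(4) by simp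
    qed (use z(1-3) h in simp_all)
    then show "\<exists>u. u \<in> Arr C \<and> Dom C u = Dom C h \<and> Cod C u = Dom C F \<and> F \<cdot> u = h"
      using z(1-3) by (intro exI[of _ z]) simp
  qed simp_all
  ultimately show ?thesis unfolding F_def G_def using sesI2 by blast
qed

text \<open>If every extension of \<open>Cod \<pi>\<close> by \<open>N\<close> splits over \<open>\<pi>\<close>, the map \<open>pushouts \<iota> \<pi>\<close> is surjective onto \<open>Ext1\<close>, so
  that the vector space axioms for \<open>Ext1\<close> are inherited from a hom space.\<close>

definition pushouts :: "'m \<Rightarrow> 'm \<Rightarrow> 'm \<Rightarrow> ('m \<times> 'm) set" where
  "pushouts \<iota> \<pi> \<phi> = {(f, g). ses C f g \<and> Dom C f = Cod C \<phi> \<and> Cod C g = Cod C \<pi> \<and>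
     (\<exists>\<beta>. \<beta> \<in> Arr C \<and> Dom C \<beta> = Cod C \<iota> \<and> Cod C \<beta> = Cod C f \<and> \<beta> \<cdot> \<iota> = f \<cdot> \<phi> \<and> g \<cdot> \<beta> = \<pi>)}"

lemma pushoutsE:
  assumes "(f, g) \<in> pushouts \<iota> \<pi> \<phi>"
  obtains \<beta> where "ses C f g" "Dom C f = Cod C \<phi>" "Cod C g = Cod C \<pi>"
     "\<beta> \<in> Arr C" "Dom C \<beta> = Cod C \<iota>" "Cod C \<beta> = Cod C f" "\<beta> \<cdot> \<iota> = f \<cdot> \<phi>" "g \<cdot> \<beta> = \<pi>"
  using assms unfolding pushouts_def by auto

lemma ext_morphism_right_id:
  assumes s: "ses C f g" and s': "ses C f' g'" and "Cod C g = M" "Cod C g' = M"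
  shows "ext_morphism C \<alpha> \<beta> (Id C M) (f, g) (f', g') \<longleftrightarrow>
    \<alpha> \<in> Arr C \<and> Dom C \<alpha> = Dom C f \<and> Cod C \<alpha> = Dom C f' \<and>
    \<beta> \<in> Arr C \<and> Dom C \<beta> = Cod C f \<and> Cod C \<beta> = Cod C f' \<and> \<beta> \<cdot> f = f' \<cdot> \<alpha> \<and> g' \<cdot> \<beta> = g"
  using sesD[OF s] sesD[OF s'] assms(3,4) unfolding ext_morphism_def by auto

lemma pushouts_nonempty:
  assumes s: "ses C \<iota> \<pi>" and \<phi>: "\<phi> \<in> Arr C" "Dom C \<phi> = Dom C \<iota>"
  obtains f g where "(f, g) \<in> pushouts \<iota> \<pi> \<phi>"
proof -
  obtain U \<rho> \<eta> where p: "ses C U \<eta>" "Dom C U = Cod C \<phi>" "\<rho> \<in> Arr C" "Dom C \<rho> = Cod C \<iota>" "Cod C \<rho> = Cod C U"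
    "Cod C \<eta> = Cod C \<pi>" "U \<cdot> \<phi> = \<rho> \<cdot> \<iota>" "\<eta> \<cdot> \<rho> = \<pi>"
    by (rule pushout_exists[OF s \<phi>])
  then have "(U, \<eta>) \<in> pushouts \<iota> \<pi> \<phi>" unfolding pushouts_def by auto
  then show ?thesis by (rule that)
qed

text \<open>With \<open>pushouts_trans\<close>, this reduces equivalence, scalar multiplication and
  the codiagonal step of the Baer sum to one computation, in which \<alpha> is the identity, a
  scalar, or the codiagonal.\<close>

lemma pushouts_map:
  assumes s: "ses C \<iota> \<pi>" and \<phi>: "\<phi> \<in> Arr C" "Dom C \<phi> = Dom C \<iota>" and \<alpha>: "\<alpha> \<in> Arr C" "Dom C \<alpha> = Cod C \<phi>"
    and F: "(f, g) \<in> pushouts \<iota> \<pi> \<phi>" and F': "(f', g') \<in> pushouts \<iota> \<pi> (\<alpha> \<cdot> \<phi>)"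
  shows "\<exists>\<beta>. ext_morphism C \<alpha> \<beta> (Id C (Cod C \<pi>)) (f, g) (f', g')"
proof -
  obtain \<beta> where \<beta>: "ses C f g" "Dom C f = Cod C \<phi>" "Cod C g = Cod C \<pi>"
     "\<beta> \<in> Arr C" "Dom C \<beta> = Cod C \<iota>" "Cod C \<beta> = Cod C f" "\<beta> \<cdot> \<iota> = f \<cdot> \<phi>" "g \<cdot> \<beta> = \<pi>"
    by (rule pushoutsE[OF F])
  obtain \<beta>' where \<beta>': "ses C f' g'" "Dom C f' = Cod C (\<alpha> \<cdot> \<phi>)" "Cod C g' = Cod C \<pi>"
     "\<beta>' \<in> Arr C" "Dom C \<beta>' = Cod C \<iota>" "Cod C \<beta>' = Cod C f'" "\<beta>' \<cdot> \<iota> = f' \<cdot> \<alpha> \<cdot> \<phi>" "g' \<cdot> \<beta>' = \<pi>"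
    by (rule pushoutsE[OF F'])
  note [simp] = sesD[OF s] sesD[OF \<beta>(1)] sesD[OF \<beta>'(1)] \<phi> \<alpha> \<beta>(2-6) \<beta>'(3-6)
  have [simp]: "Dom C f' = Cod C \<alpha>" using \<beta>'(2) by simp
  have g: "f' \<cdot> \<alpha> \<in> Arr C" "\<beta>' \<in> Arr C" "Dom C (f' \<cdot> \<alpha>) = Dom C f" "Dom C \<beta>' = Cod C \<iota>" "Cod C (f' \<cdot> \<alpha>) = Cod C \<beta>'"
    "(f' \<cdot> \<alpha>) \<cdot> \<phi> = \<beta>' \<cdot> \<iota>" using \<beta>'(7) by simp_all
  obtain v where v: "v \<in> Arr C" "Dom C v = Cod C f" "Cod C v = Cod C (f' \<cdot> \<alpha>)" "v \<cdot> f = f' \<cdot> \<alpha>" "v \<cdot> \<beta> = \<beta>'"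
    by (rule pushout_desc[OF s \<beta>(1,4,5,6,3,8) \<phi> \<beta>(2)[symmetric] \<beta>(7)[symmetric] g])
  have "g' \<cdot> v = g"
  proof (rule pushout_ext[OF s \<beta>(1,4,5,6,3,8)])
    have "g' \<cdot> f' \<cdot> \<alpha> = nul (Dom C \<alpha>) (Cod C g')"
      by (rule ses_comp_zero[OF \<beta>'(1)]) simp_all
    then show "(g' \<cdot> v) \<cdot> f = g \<cdot> f" using v(1-4) by simp
    show "(g' \<cdot> v) \<cdot> \<beta> = g \<cdot> \<beta>" using v(5) \<beta>(8) \<beta>'(8) v(1-3) assoc[of \<beta> v g'] by simp
  qed (use v(1-3) in simp_all)
  then show ?thesis
    using v ext_morphism_right_id[OF \<beta>(1) \<beta>'(1) \<beta>(3) \<beta>'(3)] by (intro exI[of _ v]) simp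
qed

lemma pushouts_trans:
  assumes s: "ses C \<iota> \<pi>" and \<phi>: "\<phi> \<in> Arr C" "Dom C \<phi> = Dom C \<iota>"
    and F: "(f, g) \<in> pushouts \<iota> \<pi> \<phi>" and s': "ses C f' g'" "Cod C g' = Cod C \<pi>"
    and m: "ext_morphism C \<alpha> \<beta> (Id C (Cod C \<pi>)) (f, g) (f', g')"
  shows "(f', g') \<in> pushouts \<iota> \<pi> (\<alpha> \<cdot> \<phi>)"
proof -
  obtain \<rho> where \<rho>: "ses C f g" "Dom C f = Cod C \<phi>" "Cod C g = Cod C \<pi>"
     "\<rho> \<in> Arr C" "Dom C \<rho> = Cod C \<iota>" "Cod C \<rho> = Cod C f" "\<rho> \<cdot> \<iota> = f \<cdot> \<phi>" "g \<cdot> \<rho> = \<pi>"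
    by (rule pushoutsE[OF F])
  have M: "\<alpha> \<in> Arr C" "Dom C \<alpha> = Dom C f" "Cod C \<alpha> = Dom C f'"
    "\<beta> \<in> Arr C" "Dom C \<beta> = Cod C f" "Cod C \<beta> = Cod C f'" "\<beta> \<cdot> f = f' \<cdot> \<alpha>" "g' \<cdot> \<beta> = g"
    using m ext_morphism_right_id[OF \<rho>(1) s'(1) \<rho>(3) s'(2)] by auto
  note [simp] = sesD[OF s] sesD[OF \<rho>(1)] sesD[OF s'(1)] \<phi> \<rho>(2-6) M(1-6) s'
  have "(\<beta> \<cdot> \<rho>) \<cdot> \<iota> = f' \<cdot> \<alpha> \<cdot> \<phi>" "g' \<cdot> \<beta> \<cdot> \<rho> = \<pi>"
    using \<rho>(7,8) comp_under[OF M(7), of \<phi>] comp_under[OF M(8), of \<rho>] by simp_all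
  then show ?thesis unfolding pushouts_def by (simp, intro exI[of _ "\<beta> \<cdot> \<rho>"]) simp
qed

lemma pushouts_class:
  assumes s: "ses C \<iota> \<pi>" and \<phi>: "\<phi> \<in> homset C (Dom C \<iota>) N" and F: "F \<in> pushouts \<iota> \<pi> \<phi>"
  shows "ext_rel C (Cod C \<pi>) N `` {F} = pushouts \<iota> \<pi> \<phi>"
proof -
  have \<phi>': "\<phi> \<in> Arr C" "Dom C \<phi> = Dom C \<iota>" and [simp]: "Cod C \<phi> = N" using \<phi> by auto
  have N [simp]: "N \<in> Ob C" using \<phi> Ob_of_arr(2)[of \<phi> N] by simp
  have id: "Id C N \<in> Arr C" "Dom C (Id C N) = Cod C \<phi>" "Id C N \<cdot> \<phi> = \<phi>" using \<phi>' by simp_all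
  obtain f g where F_eq: "F = (f, g)" by (cases F)
  have fg: "ses C f g" "Dom C f = N" "Cod C g = Cod C \<pi>" using F F_eq by (auto simp: pushouts_def)
  have fgE: "(f, g) \<in> extensions C (Cod C \<pi>) N" using fg by (simp add: extensions_eq)
  show ?thesis
  proof (intro Set.set_eqI iffI)
    fix G assume "G \<in> ext_rel C (Cod C \<pi>) N `` {F}"
    moreover obtain f' g' where G: "G = (f', g')" by (cases G)
    ultimately obtain \<beta> where "ses C f' g'" "Cod C g' = Cod C \<pi>" "ext_morphism C (Id C N) \<beta> (Id C (Cod C \<pi>)) (f, g) (f', g')"
      by (auto simp: ext_rel_def extensions_eq F_eq)
    then show "G \<in> pushouts \<iota> \<pi> \<phi>" using pushouts_trans[OF s \<phi>' F[unfolded F_eq]] id(3) G by metis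
  next
    fix G assume GP: "G \<in> pushouts \<iota> \<pi> \<phi>"
    obtain f' g' where G: "G = (f', g')" by (cases G)
    have fg': "ses C f' g'" "Dom C f' = N" "Cod C g' = Cod C \<pi>" using GP G by (auto simp: pushouts_def)
    obtain \<beta> where \<beta>: "ext_morphism C (Id C N) \<beta> (Id C (Cod C \<pi>)) (f, g) (f', g')"
      using pushouts_map[OF s \<phi>' id(1,2) F[unfolded F_eq]] GP G id(3) by metis
    then have "\<beta> \<in> isos C (Cod C f) (Cod C f')"
      using ext_morphism_right_id[OF fg(1) fg'(1) fg(3) fg'(3)] five[OF fg(1) fg'(1), of \<beta>] fg fg' sesD[OF fg'(1)] by simp
    then show "G \<in> ext_rel C (Cod C \<pi>) N `` {F}" using \<beta> fgE fg' G F_eq by (auto simp: ext_rel_def extensions_eq)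
  qed
qed

lemma pushouts_smult:
  assumes s: "ses C \<iota> \<pi>" and \<phi>: "\<phi> \<in> homset C (Dom C \<iota>) N" and c: "c \<in> carrier K"
  shows "ext_pushout C (Cod C \<pi>) (Scal C c (Id C N)) (pushouts \<iota> \<pi> \<phi>) = pushouts \<iota> \<pi> (Scal C c \<phi>)"
proof -
  have \<phi>': "\<phi> \<in> Arr C" "Dom C \<phi> = Dom C \<iota>" and [simp]: "Cod C \<phi> = N" using \<phi> by auto
  have N [simp]: "N \<in> Ob C" using \<phi> Ob_of_arr(2)[of \<phi> N] by simp
  let ?\<alpha> = "Scal C c (Id C N)"
  have \<alpha>: "?\<alpha> \<in> Arr C" "Dom C ?\<alpha> = Cod C \<phi>" "Cod C ?\<alpha> = N" "?\<alpha> \<cdot> \<phi> = Scal C c \<phi>" using \<phi>' c by simp_all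
  show ?thesis
  proof (intro Set.set_eqI iffI)
    fix G assume "G \<in> ext_pushout C (Cod C \<pi>) ?\<alpha> (pushouts \<iota> \<pi> \<phi>)"
    moreover obtain f' g' where G: "G = (f', g')" by (cases G)
    ultimately obtain f g \<beta> where "ses C f' g'" "Cod C g' = Cod C \<pi>" "(f, g) \<in> pushouts \<iota> \<pi> \<phi>"
      "ext_morphism C ?\<alpha> \<beta> (Id C (Cod C \<pi>)) (f, g) (f', g')"
      by (auto simp: ext_pushout_def extensions_eq)
    then show "G \<in> pushouts \<iota> \<pi> (Scal C c \<phi>)" using pushouts_trans[OF s \<phi>'] \<alpha>(4) G by metis
  next
    fix G assume GP: "G \<in> pushouts \<iota> \<pi> (Scal C c \<phi>)"
    obtain f' g' where G: "G = (f', g')" by (cases G)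
    obtain f g where F: "(f, g) \<in> pushouts \<iota> \<pi> \<phi>" by (rule pushouts_nonempty[OF s \<phi>'])
    obtain \<beta> where "ext_morphism C ?\<alpha> \<beta> (Id C (Cod C \<pi>)) (f, g) (f', g')"
      using pushouts_map[OF s \<phi>' \<alpha>(1,2) F] GP G \<alpha>(4) by metis
    moreover have "(f', g') \<in> extensions C (Cod C \<pi>) N" using GP G c \<phi>' by (auto simp: pushouts_def extensions_eq)
    ultimately show "G \<in> ext_pushout C (Cod C \<pi>) ?\<alpha> (pushouts \<iota> \<pi> \<phi>)"
      using F G \<alpha>(3) by (auto simp: ext_pushout_def)
  qed
qed

text \<open>An arrow \<beta> that kills \<iota> descends along \<pi>, and the descended arrow is a
  section of the extension; conversely, a section composed with \<pi> is such a \<beta>.\<close>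

lemma pushouts_zero:
  assumes s: "ses C \<iota> \<pi>" and N: "N \<in> Ob C"
  shows "pushouts \<iota> \<pi> (nul (Dom C \<iota>) N) = split_extensions C (Cod C \<pi>) N"
proof (rule Set.set_eqI, rule iffI)
  note [simp] = sesD[OF s] N
  fix G assume GP: "G \<in> pushouts \<iota> \<pi> (nul (Dom C \<iota>) N)"
  obtain f g where G: "G = (f, g)" by (cases G)
  obtain \<beta> where \<beta>: "ses C f g" "Dom C f = Cod C (nul (Dom C \<iota>) N)" "Cod C g = Cod C \<pi>"
     "\<beta> \<in> Arr C" "Dom C \<beta> = Cod C \<iota>" "Cod C \<beta> = Cod C f" "\<beta> \<cdot> \<iota> = f \<cdot> nul (Dom C \<iota>) N" "g \<cdot> \<beta> = \<pi>"
    by (rule pushoutsE[OF GP[unfolded G]])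
  have [simp]: "Dom C f = N" using \<beta>(2) by simp
  note [simp] = sesD[OF \<beta>(1)] \<beta>(3-6)
  obtain j where j: "j \<in> Arr C" "Cod C j = Cod C f" "Dom C j = Cod C \<pi>" "j \<cdot> \<pi> = \<beta>"
    using ses_desc[OF s, of \<beta>] \<beta>(7) by auto
  have "(g \<cdot> j) \<cdot> \<pi> = Id C (Cod C \<pi>) \<cdot> \<pi>" using j \<beta>(8) by simp
  then have "g \<cdot> j = Id C (Cod C \<pi>)" using epic_cancel[OF ses_epic[OF s], of "g \<cdot> j" "Id C (Cod C \<pi>)"] j by simp
  then obtain p where "(f, j, p, g) \<in> biproducts C N (Cod C \<pi>) (Cod C f)" using section_biproduct[OF \<beta>(1), of j] j by auto
  then show "G \<in> split_extensions C (Cod C \<pi>) N" using \<beta>(1) G by (auto simp: split_extensions_def extensions_eq)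
next
  note [simp] = sesD[OF s] N
  fix G assume GP: "G \<in> split_extensions C (Cod C \<pi>) N"
  obtain f g where G: "G = (f, g)" by (cases G)
  obtain j p where sf: "ses C f g" "Dom C f = N" "Cod C g = Cod C \<pi>" and b: "(f, j, p, g) \<in> biproducts C N (Cod C \<pi>) (Cod C f)"
    using GP G by (auto simp: split_extensions_def extensions_eq)
  have j [simp]: "j \<in> Arr C" "Dom C j = Cod C \<pi>" "Cod C j = Cod C f" using biprodD[OF b] by blast+
  have f [simp]: "f \<in> Arr C" "Dom C f = N" "g \<in> Arr C" using biprodD[OF b] by blast+
  have "(j \<cdot> \<pi>) \<cdot> \<iota> = f \<cdot> nul (Dom C \<iota>) N" by simp
  moreover have "g \<cdot> j \<cdot> \<pi> = \<pi>" by (rule biprod_under(2)[OF b]) simp_all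
  moreover have "j \<cdot> \<pi> \<in> Arr C \<and> Dom C (j \<cdot> \<pi>) = Cod C \<iota> \<and> Cod C (j \<cdot> \<pi>) = Cod C f" by simp
  ultimately show "G \<in> pushouts \<iota> \<pi> (nul (Dom C \<iota>) N)"
    unfolding pushouts_def G using sf by (intro CollectI case_prodI conjI exI[of _ "j \<cdot> \<pi>"]) simp_all
qed

text \<open>Here \<open>(u, v)\<close> is the pullback along the diagonal of the direct sum of the two pushouts, the intermediate
  step of their Baer sum.\<close>

lemma pushouts_pair:
  assumes s: "ses C \<iota> \<pi>" and \<phi>: "\<phi> \<in> homset C (Dom C \<iota>) N" and \<psi>: "\<psi> \<in> homset C (Dom C \<iota>) N"
    and F: "(f, g) \<in> pushouts \<iota> \<pi> \<phi>" and F': "(f', g') \<in> pushouts \<iota> \<pi> \<psi>"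
    and a: "(i1, j1, p1, r1) \<in> biproducts C N N NN"
    and b: "(i2, j2, p2, r2) \<in> biproducts C (Cod C f) (Cod C f') EE"
    and d: "(i3, j3, p3, r3) \<in> biproducts C (Cod C \<pi>) (Cod C \<pi>) MM"
    and G: "ses C u v" "Dom C u = NN" "Cod C v = Cod C \<pi>"
    and \<gamma>: "\<gamma> \<in> Arr C" "Dom C \<gamma> = Cod C u" "Cod C \<gamma> = EE"
      "\<gamma> \<cdot> u = i2 \<cdot> f \<cdot> p1 \<boxplus> j2 \<cdot> f' \<cdot> r1" "(i3 \<cdot> g \<cdot> p2 \<boxplus> j3 \<cdot> g' \<cdot> r2) \<cdot> \<gamma> = (i3 \<boxplus> j3) \<cdot> v"
  shows "(u, v) \<in> pushouts \<iota> \<pi> (i1 \<cdot> \<phi> \<boxplus> j1 \<cdot> \<psi>)"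
proof -
  have \<phi>\<psi> [simp]: "\<phi> \<in> Arr C" "Dom C \<phi> = Dom C \<iota>" "Cod C \<phi> = N" "\<psi> \<in> Arr C" "Dom C \<psi> = Dom C \<iota>" "Cod C \<psi> = N"
    using \<phi> \<psi> by auto
  obtain \<beta> where \<beta>: "ses C f g" "Dom C f = Cod C \<phi>" "Cod C g = Cod C \<pi>"
     "\<beta> \<in> Arr C" "Dom C \<beta> = Cod C \<iota>" "Cod C \<beta> = Cod C f" "\<beta> \<cdot> \<iota> = f \<cdot> \<phi>" "g \<cdot> \<beta> = \<pi>"
    by (rule pushoutsE[OF F])
  obtain \<beta>' where \<beta>': "ses C f' g'" "Dom C f' = Cod C \<psi>" "Cod C g' = Cod C \<pi>"
     "\<beta>' \<in> Arr C" "Dom C \<beta>' = Cod C \<iota>" "Cod C \<beta>' = Cod C f'" "\<beta>' \<cdot> \<iota> = f' \<cdot> \<psi>" "g' \<cdot> \<beta>' = \<pi>"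
    by (rule pushoutsE[OF F'])
  have Df [simp]: "Dom C f = N" "Dom C f' = N" using \<beta>(2) \<beta>'(2) by simp_all
  define D1 D2 where "D1 = i2 \<cdot> f \<cdot> p1 \<boxplus> j2 \<cdot> f' \<cdot> r1" and "D2 = i3 \<cdot> g \<cdot> p2 \<boxplus> j3 \<cdot> g' \<cdot> r2"
  have D: "ses C D1 D2" unfolding D1_def D2_def
    by (rule dsum_ses[OF \<beta>(1) \<beta>'(1) _ b]) (use a d \<beta>(3) \<beta>'(3) in simp_all)
  note [simp] = sesD[OF s] sesD[OF \<beta>(1)] sesD[OF \<beta>'(1)] sesD[OF G(1)] \<beta>(3-6) \<beta>'(3-6) G(2,3) \<gamma>(1-3)
    biprodD[OF a] biprodD[OF b] biprodD[OF d] biprod_under[OF a] biprod_under[OF b] biprod_under[OF d]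
  have [simp]: "N \<in> Ob C" "NN \<in> Ob C" "EE \<in> Ob C" "MM \<in> Ob C" "Cod C f \<in> Ob C" "Cod C f' \<in> Ob C" "Cod C \<pi> \<in> Ob C"
    using Ob_of_arr biprodD[OF a] biprodD[OF b] biprodD[OF d] by blast+
  have [simp]: "D1 \<in> Arr C" "Dom C D1 = NN" "Cod C D1 = EE" "D2 \<in> Arr C" "Dom C D2 = EE" "Cod C D2 = MM"
    by (simp_all add: D1_def D2_def)
  define pr where "pr = i1 \<cdot> \<phi> \<boxplus> j1 \<cdot> \<psi>"
  define \<beta>2 where "\<beta>2 = i2 \<cdot> \<beta> \<boxplus> j2 \<cdot> \<beta>'"
  have [simp]: "pr \<in> Arr C" "Dom C pr = Dom C \<iota>" "Cod C pr = NN" "\<beta>2 \<in> Arr C" "Dom C \<beta>2 = Cod C \<iota>" "Cod C \<beta>2 = EE"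
    by (simp_all add: pr_def \<beta>2_def)
  have p1pr: "p1 \<cdot> pr = \<phi>" "r1 \<cdot> pr = \<psi>" by (simp_all add: pr_def)
  have D1pr: "D1 \<cdot> pr = \<beta>2 \<cdot> \<iota>"
    unfolding D1_def \<beta>2_def using p1pr \<beta>(7) \<beta>'(7) by simp
  have p2\<beta>2: "p2 \<cdot> \<beta>2 = \<beta>" "r2 \<cdot> \<beta>2 = \<beta>'" by (simp_all add: \<beta>2_def)
  have D2\<beta>2: "D2 \<cdot> \<beta>2 = (i3 \<boxplus> j3) \<cdot> \<pi>"
    unfolding D2_def using p2\<beta>2 \<beta>(8) \<beta>'(8) by simp
  have G\<gamma>: "\<gamma> \<cdot> u = D1" "D2 \<cdot> \<gamma> = (i3 \<boxplus> j3) \<cdot> v" using \<gamma>(4,5) by (simp_all only: D1_def D2_def)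
  have di [simp]: "i3 \<boxplus> j3 \<in> Arr C" "Cod C (i3 \<boxplus> j3) = MM" "Dom C (i3 \<boxplus> j3) = Cod C \<pi>" by simp_all
  have x: "Dom C \<gamma> = Dom C v" "Cod C \<gamma> = Dom C D2" "Dom C u = Dom C D1" "Cod C (i3 \<boxplus> j3) = Cod C D2"
    "Dom C (i3 \<boxplus> j3) = Cod C v" "Cod C \<pi> = Cod C v" "Cod C \<beta>2 = Dom C D2" "Dom C \<pi> = Dom C \<beta>2" by simp_all
  have \<pi>\<beta>2: "\<pi> \<in> Arr C" "\<beta>2 \<in> Arr C" by simp_all
  \<comment> \<open>The required arrow into the middle of (u, v) has components \<pi> and \<beta>2
    in the pullback; it exists because both agree after mapping to the double of
    \<open>Cod \<pi>\<close>.\<close>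
  obtain w where w: "w \<in> Arr C" "Cod C w = Dom C v" "Dom C w = Dom C \<pi>" "v \<cdot> w = \<pi>" "\<gamma> \<cdot> w = \<beta>2"
    by (rule pullback_lift[OF D G(1) \<gamma>(1) x(2) x(1) x(3) G\<gamma>(1) di(1) x(4) x(5) G\<gamma>(2)[symmetric] \<pi>\<beta>2 x(6-8) D2\<beta>2[symmetric]])
  have "w \<cdot> \<iota> = u \<cdot> pr"
  proof (rule pullback_ext[OF D G(1) \<gamma>(1) x(2) x(1) x(3) G\<gamma>(1)])
    show "v \<cdot> w \<cdot> \<iota> = v \<cdot> u \<cdot> pr" using ses_comp_zero[OF G(1), of pr] w(1-3) comp_under[OF w(4), of \<iota>] by simp
    show "\<gamma> \<cdot> w \<cdot> \<iota> = \<gamma> \<cdot> u \<cdot> pr" using comp_under[OF G\<gamma>(1), of pr] comp_under[OF w(5), of \<iota>] w(1-3) D1pr by simp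
  qed (use w(1-3) in simp_all)
  then show ?thesis
    unfolding pushouts_def pr_def[symmetric] using G w by (intro CollectI case_prodI conjI exI[of _ w]) simp_all
qed

text \<open>Pulling the direct sum back along the diagonal gives the pushout along the pair (\<phi>,
  \<psi>) into N + N, and the codiagonal composed with this pair is the sum of \<phi> and
  \<psi>.\<close>

lemma pushouts_baer_sum:
  assumes s: "ses C \<iota> \<pi>" and \<phi>: "\<phi> \<in> homset C (Dom C \<iota>) N" and \<psi>: "\<psi> \<in> homset C (Dom C \<iota>) N"
  shows "baer_sum C (Cod C \<pi>) N (pushouts \<iota> \<pi> \<phi>) (pushouts \<iota> \<pi> \<psi>) = pushouts \<iota> \<pi> (\<phi> \<boxplus> \<psi>)"
proof (intro Set.set_eqI iffI)
  have \<phi>\<psi> [simp]: "\<phi> \<in> Arr C" "Dom C \<phi> = Dom C \<iota>" "Cod C \<phi> = N" "\<psi> \<in> Arr C" "Dom C \<psi> = Dom C \<iota>" "Cod C \<psi> = N"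
    using \<phi> \<psi> by auto
  note [simp] = sesD[OF s]
  have codiag: "p1 \<boxplus> r1 \<in> Arr C \<and> Dom C (p1 \<boxplus> r1) = NN \<and> Cod C (p1 \<boxplus> r1) = N \<and>
      (p1 \<boxplus> r1) \<cdot> (i1 \<cdot> \<phi> \<boxplus> j1 \<cdot> \<psi>) = \<phi> \<boxplus> \<psi> \<and>
      i1 \<cdot> \<phi> \<boxplus> j1 \<cdot> \<psi> \<in> Arr C \<and> Dom C (i1 \<cdot> \<phi> \<boxplus> j1 \<cdot> \<psi>) = Dom C \<iota> \<and> Cod C (i1 \<cdot> \<phi> \<boxplus> j1 \<cdot> \<psi>) = NN"
    if a: "(i1, j1, p1, r1) \<in> biproducts C N N NN" for i1 j1 p1 r1 NN
  proof -
    have "N \<in> Ob C" using Ob_of_arr biprodD[OF a] by blast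
    then show ?thesis using biprodD[OF a] biprod_under[OF a] by simp
  qed
  {
    fix X assume "X \<in> baer_sum C (Cod C \<pi>) N (pushouts \<iota> \<pi> \<phi>) (pushouts \<iota> \<pi> \<psi>)"
    then obtain f g f' g' NN EE MM a b d where F: "(f, g) \<in> pushouts \<iota> \<pi> \<phi>" "(f', g') \<in> pushouts \<iota> \<pi> \<psi>"
      and abd: "a \<in> biproducts C N N NN" "b \<in> biproducts C (Cod C f) (Cod C f') EE" "d \<in> biproducts C (Cod C \<pi>) (Cod C \<pi>) MM"
      and X: "X \<in> ext_pushout C (Cod C \<pi>) (codiagonal C a)
             (ext_pullback C NN (diagonal C d) {(dsum_map C a b f f', dsum_map C b d g g')})"
      unfolding baer_sum_def by blast
    obtain i1 j1 p1 r1 i2 j2 p2 r2 i3 j3 p3 r3 where abd_eq: "a = (i1, j1, p1, r1)" "b = (i2, j2, p2, r2)" "d = (i3, j3, p3, r3)"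
      by (metis prod.exhaust)
    note a = abd(1)[unfolded abd_eq] and b = abd(2)[unfolded abd_eq] and d = abd(3)[unfolded abd_eq]
    obtain h k where X_eq: "X = (h, k)" by (cases X)
    obtain u v \<beta> \<gamma> where hk: "(h, k) \<in> extensions C (Cod C \<pi>) (Cod C (p1 \<boxplus> r1))"
      and uv: "(u, v) \<in> extensions C (Dom C (i3 \<boxplus> j3)) NN"
      and m: "ext_morphism C (p1 \<boxplus> r1) \<beta> (Id C (Cod C \<pi>)) (u, v) (h, k)"
      and m': "ext_morphism C (Id C NN) \<gamma> (i3 \<boxplus> j3) (u, v) (i2 \<cdot> f \<cdot> p1 \<boxplus> j2 \<cdot> f' \<cdot> r1, i3 \<cdot> g \<cdot> p2 \<boxplus> j3 \<cdot> g' \<cdot> r2)"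
      using X unfolding X_eq abd_eq ext_pushout_def ext_pullback_def codiagonal_def diagonal_def dsum_map_def by auto
    note [simp] = biprodD[OF a] biprodD[OF b] biprodD[OF d]
    have s': "ses C h k" "Dom C h = N" "Cod C k = Cod C \<pi>" "ses C u v" "Dom C u = NN" "Cod C v = Cod C \<pi>"
      using hk uv by (auto simp: extensions_eq)
    have fD: "ses C f g" "Dom C f = N" "Cod C g = Cod C \<pi>" "ses C f' g'" "Dom C f' = N" "Cod C g' = Cod C \<pi>"
      using F by (auto simp: pushouts_def)
    note [simp] = sesD[OF s'(1)] sesD[OF s'(4)] sesD[OF fD(1)] sesD[OF fD(4)] s'(2,3,5,6) fD(2,3,5,6)
    have "NN \<in> Ob C" using Ob_of_arr biprodD[OF a] by blast
    then have \<gamma>: "\<gamma> \<in> Arr C" "Dom C \<gamma> = Cod C u" "Cod C \<gamma> = EE" "\<gamma> \<cdot> u = i2 \<cdot> f \<cdot> p1 \<boxplus> j2 \<cdot> f' \<cdot> r1"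
      "(i3 \<cdot> g \<cdot> p2 \<boxplus> j3 \<cdot> g' \<cdot> r2) \<cdot> \<gamma> = (i3 \<boxplus> j3) \<cdot> v"
      using m' unfolding ext_morphism_def by auto
    have P: "(u, v) \<in> pushouts \<iota> \<pi> (i1 \<cdot> \<phi> \<boxplus> j1 \<cdot> \<psi>)"
      by (rule pushouts_pair[OF s \<phi> \<psi> F a b d s'(4-6) \<gamma>])
    show "X \<in> pushouts \<iota> \<pi> (\<phi> \<boxplus> \<psi>)"
      using pushouts_trans[OF s _ _ P s'(1,3) m] codiag[OF a] X_eq by metis
  }
  {
    fix X assume XP: "X \<in> pushouts \<iota> \<pi> (\<phi> \<boxplus> \<psi>)"
    obtain h k where X_eq: "X = (h, k)" by (cases X)
    obtain f g where F: "(f, g) \<in> pushouts \<iota> \<pi> \<phi>" by (rule pushouts_nonempty[OF s \<phi>\<psi>(1,2)])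
    obtain f' g' where F': "(f', g') \<in> pushouts \<iota> \<pi> \<psi>" by (rule pushouts_nonempty[OF s \<phi>\<psi>(4,5)])
    have fD: "ses C f g" "Dom C f = N" "Cod C g = Cod C \<pi>" "ses C f' g'" "Dom C f' = N" "Cod C g' = Cod C \<pi>"
      using F F' by (auto simp: pushouts_def)
    note [simp] = sesD[OF fD(1)] sesD[OF fD(4)] fD(2,3,5,6)
    have Ob: "N \<in> Ob C" "Cod C f \<in> Ob C" "Cod C f' \<in> Ob C" "Cod C \<pi> \<in> Ob C"
      using cod_in_Ob[of \<phi>] cod_in_Ob[of f] cod_in_Ob[of f'] cod_in_Ob[of \<pi>] by simp_all
    obtain NN i1 j1 p1 r1 where a: "(i1, j1, p1, r1) \<in> biproducts C N N NN" by (rule biprodE[OF Ob(1,1)])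
    obtain EE i2 j2 p2 r2 where b: "(i2, j2, p2, r2) \<in> biproducts C (Cod C f) (Cod C f') EE" by (rule biprodE[OF Ob(2,3)])
    obtain MM i3 j3 p3 r3 where d: "(i3, j3, p3, r3) \<in> biproducts C (Cod C \<pi>) (Cod C \<pi>) MM" by (rule biprodE[OF Ob(4,4)])
    let ?D1 = "i2 \<cdot> f \<cdot> p1 \<boxplus> j2 \<cdot> f' \<cdot> r1" and ?D2 = "i3 \<cdot> g \<cdot> p2 \<boxplus> j3 \<cdot> g' \<cdot> r2"
    have D: "ses C ?D1 ?D2"
      by (rule dsum_ses[OF fD(1,4) _ b]) (use a d in simp_all)
    note [simp] = biprodD[OF a] biprodD[OF b] biprodD[OF d]
    have di: "i3 \<boxplus> j3 \<in> Arr C" "Cod C (i3 \<boxplus> j3) = Cod C ?D2" by simp_all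
    obtain v \<gamma> u where G: "ses C u v" "Cod C v = Dom C (i3 \<boxplus> j3)" "\<gamma> \<in> Arr C" "Cod C \<gamma> = Dom C ?D2" "Dom C \<gamma> = Dom C v"
      "Dom C u = Dom C ?D1" "(i3 \<boxplus> j3) \<cdot> v = ?D2 \<cdot> \<gamma>" "\<gamma> \<cdot> u = ?D1"
      by (rule pullback_exists[OF D di])
    note [simp] = sesD[OF G(1)]
    have G': "Dom C u = NN" "Cod C v = Cod C \<pi>" and \<gamma>: "\<gamma> \<in> Arr C" "Dom C \<gamma> = Cod C u" "Cod C \<gamma> = EE" "\<gamma> \<cdot> u = ?D1" "?D2 \<cdot> \<gamma> = (i3 \<boxplus> j3) \<cdot> v"
      using G by (simp_all del: assoc add_comp' comp_add')
    have P: "(u, v) \<in> pushouts \<iota> \<pi> (i1 \<cdot> \<phi> \<boxplus> j1 \<cdot> \<psi>)"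
      by (rule pushouts_pair[OF s \<phi> \<psi> F F' a b d G(1) G' \<gamma>])
    have "\<exists>\<beta>. ext_morphism C (p1 \<boxplus> r1) \<beta> (Id C (Cod C \<pi>)) (u, v) (h, k)"
      using pushouts_map[OF s _ _ _ _ P] codiag[OF a] XP[unfolded X_eq] by metis
    then obtain \<beta> where m: "ext_morphism C (p1 \<boxplus> r1) \<beta> (Id C (Cod C \<pi>)) (u, v) (h, k)" by blast
    have "(h, k) \<in> extensions C (Cod C \<pi>) (Cod C (p1 \<boxplus> r1))"
      using XP X_eq by (simp add: pushouts_def extensions_eq)
    moreover have "(u, v) \<in> extensions C (Dom C (i3 \<boxplus> j3)) NN" using G(1) G' by (simp add: extensions_eq)
    moreover have "NN \<in> Ob C" using Ob_of_arr biprodD[OF a] by blast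
    then have "ext_morphism C (Id C NN) \<gamma> (i3 \<boxplus> j3) (u, v) (?D1, ?D2)"
      using G' \<gamma> unfolding ext_morphism_def by (simp del: assoc add_comp' comp_add')
    ultimately have "X \<in> ext_pushout C (Cod C \<pi>) (codiagonal C (i1, j1, p1, r1))
       (ext_pullback C NN (diagonal C (i3, j3, p3, r3)) {(dsum_map C (i1, j1, p1, r1) (i2, j2, p2, r2) f f', dsum_map C (i2, j2, p2, r2) (i3, j3, p3, r3) g g')})"
      using m unfolding X_eq ext_pushout_def ext_pullback_def codiagonal_def diagonal_def dsum_map_def by auto
    then show "X \<in> baer_sum C (Cod C \<pi>) N (pushouts \<iota> \<pi> \<phi>) (pushouts \<iota> \<pi> \<psi>)"
      unfolding baer_sum_def using F F' a b d by blast
  }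
qed

end

lemma (in linear_abelian_category) card_factorizations:
  assumes s: "ses C \<iota> \<pi>" and \<zeta>: "\<zeta> \<in> homset C (Cod C \<iota>) N"
  shows "card {\<zeta>' \<in> homset C (Cod C \<iota>) N. \<zeta>' \<cdot> \<iota> = \<zeta> \<cdot> \<iota>} = card (homset C (Cod C \<pi>) N)"
  using linear_abelian_category.card_lifts[OF opp_lac, of \<pi> \<iota> "\<zeta> \<cdot> \<iota>" N \<zeta>] s \<zeta> sesD[OF s]
  by (simp add: ses_def del: hom_iff) auto

section \<open>Ext1 as a vector space and biadditivity of the Euler form\<close>

context finitary_hereditary_category
begin

lemma ext_rel_equiv_refl: "F \<in> extensions C M N \<Longrightarrow> (F, F) \<in> ext_rel C M N"
proof -
  assume F: "F \<in> extensions C M N"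
  obtain f g where fg: "F = (f, g)" by (cases F)
  have s: "ses C f g" "Dom C f = N" "Cod C g = M" using F fg by (auto simp: extensions_eq)
  note [simp] = sesD[OF s(1)] s(2,3)
  have "N \<in> Ob C" "M \<in> Ob C" "Cod C f \<in> Ob C" using s sesD[OF s(1)] dom_in_Ob[of f] cod_in_Ob[of g] by auto
  then have "ext_morphism C (Id C N) (Id C (Cod C f)) (Id C M) F F" unfolding ext_morphism_def fg by simp
  then show "(F, F) \<in> ext_rel C M N" using F iso_id[OF \<open>Cod C f \<in> Ob C\<close>] fg unfolding ext_rel_def by auto
qed

text \<open>Equivalent extensions have isomorphic middles, so choosing one extension for each middle
  class embeds these classes into the finite set Ext1.\<close>

lemma finite_extension_middles:
  assumes "A \<in> Ob C" "B \<in> Ob C"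
  shows "finite {x \<in> Iso C. short_exacts C A (rep x) B \<noteq> {}}"
proof -
  let ?S = "{x \<in> Iso C. short_exacts C A (rep x) B \<noteq> {}}"
  define e where "e x = (SOME F. F \<in> short_exacts C A (rep x) B)" for x
  have e: "e x \<in> short_exacts C A (rep x) B" if "x \<in> ?S" for x
    using that unfolding e_def by (auto intro: someI)
  then have ex: "e x \<in> extensions C B A" "Cod C (fst (e x)) = rep x" if "x \<in> ?S" for x
    using that unfolding short_exacts_def extensions_eq by fastforce+
  define h where "h x = ext_rel C B A `` {e x}" for x
  have "h ` ?S \<subseteq> carrier (Ext1 C B A)" using ex by (auto simp: h_def Ext1_def intro: quotientI)
  moreover have "inj_on h ?S"
  proof (rule inj_onI)
    fix x y assume x: "x \<in> ?S" and y: "y \<in> ?S" and "h x = h y"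
    then have "(e x, e y) \<in> ext_rel C B A" using ext_rel_equiv_refl[OF ex(1)[OF y]] by (auto simp: h_def)
    then have "isomorphic C (rep x) (rep y)" using ex(2)[OF x] ex(2)[OF y] by (auto simp: ext_rel_def isomorphic_def)
    then show "x = y" using x y cls_eq_iff[of "rep x" "rep y"] rep_Iso[of x] rep_Iso[of y] by simp
  qed
  ultimately show ?thesis using inj_on_finite[OF _ _ finite_Ext1[OF assms(2,1)]] by blast
qed

sublocale hereditary_counting_category K C
  by unfold_locales (use finite_Hom completion_exists finite_extension_middles in auto)

lemma hom_vectorspace: "\<lbrakk>M \<in> Ob C; N \<in> Ob C\<rbrakk> \<Longrightarrow> vectorspace K (homspace C M N)"
  using hom_module field_axioms by (simp add: vectorspace_def)

lemma Ext1_sel [simp]: "add (Ext1 C M N) = baer_sum C M N" "zero (Ext1 C M N) = split_extensions C M N"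
  "smult (Ext1 C M N) c = ext_pushout C M (Scal C c (Id C N))" "carrier (Ext1 C M N) = extensions C M N // ext_rel C M N"
  by (simp_all add: Ext1_def)

text \<open>With \<Omega> the kernel of a universal \<pi> : P -> M, the connecting map
  \<open>pushouts \<iota> \<pi>\<close> from Hom(\<Omega>,N) onto Ext1(M,N) transports the vector
  space structure, and its fibres give the order.\<close>

lemma Ext1_vectorspace_card:
  assumes M: "M \<in> Ob C" and N: "N \<in> Ob C"
  shows "vectorspace K (Ext1 C M N)" "chi M N * card (homset C M N) = card (carrier (Ext1 C M N))"
proof -
  obtain \<pi> where \<pi>: "epic C \<pi>" "Cod C \<pi> = M" and
    lift: "\<forall>i p. ses C i p \<and> Dom C i = N \<and> Cod C p = M \<longrightarrow> (\<exists>\<rho>. \<rho> \<in> Arr C \<and> Dom C \<rho> = Dom C \<pi> \<and> Cod C \<rho> = Cod C i \<and> p \<cdot> \<rho> = \<pi>)"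
    and chi: "\<forall>\<iota>. is_kernel C \<iota> \<pi> \<longrightarrow> chi M N * card (homset C (Dom C \<pi>) N) = card (homset C (Dom C \<iota>) N)"
    using universal_extension[OF M N] by metis
  obtain \<iota> where s: "ses C \<iota> \<pi>" using ex_ses_epic[OF \<pi>(1)] .
  note [simp] = sesD[OF s] \<pi>(2) M N
  define \<Omega> P where "\<Omega> = Dom C \<iota>" and "P = Cod C \<iota>"
  have [simp]: "\<Omega> \<in> Ob C" "P \<in> Ob C" by (simp_all add: \<Omega>_def P_def)
  let ?\<delta> = "pushouts \<iota> \<pi>" and ?H = "homset C \<Omega> N"
  have cls: "ext_rel C M N `` {F} = ?\<delta> \<phi>" if "\<phi> \<in> ?H" "F \<in> ?\<delta> \<phi>" for F \<phi>
    using pushouts_class[OF s, of \<phi> N F] that \<pi>(2) by (simp add: \<Omega>_def)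
  have sub: "F \<in> extensions C M N" if "\<phi> \<in> ?H" "F \<in> ?\<delta> \<phi>" for F \<phi>
    using that by (auto simp: pushouts_def extensions_eq)
  have ne: "\<exists>F. F \<in> ?\<delta> \<phi>" if "\<phi> \<in> ?H" for \<phi>
  proof -
    have "\<phi> \<in> Arr C" "Dom C \<phi> = Dom C \<iota>" using that by (auto simp: \<Omega>_def)
    then obtain f g where "(f, g) \<in> ?\<delta> \<phi>" using pushouts_nonempty[OF s] by metis
    then show ?thesis by blast
  qed
  have im: "?\<delta> ` ?H = carrier (Ext1 C M N)"
  proof
    show "?\<delta> ` ?H \<subseteq> carrier (Ext1 C M N)"
    proof
      fix X assume "X \<in> ?\<delta> ` ?H"
      then obtain \<phi> where \<phi>: "\<phi> \<in> ?H" "X = ?\<delta> \<phi>" by blast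
      then obtain F where F: "F \<in> ?\<delta> \<phi>" using ne by blast
      show "X \<in> carrier (Ext1 C M N)" using cls[OF \<phi>(1) F] sub[OF \<phi>(1) F] \<phi>(2) quotientI[of F "extensions C M N" "ext_rel C M N"] by simp
    qed
    show "carrier (Ext1 C M N) \<subseteq> ?\<delta> ` ?H"
    proof
      fix X assume "X \<in> carrier (Ext1 C M N)"
      then obtain F where F: "F \<in> extensions C M N" "X = ext_rel C M N `` {F}" by (auto elim: quotientE)
      obtain f g where F_eq: "F = (f, g)" by (cases F)
      have fg: "ses C f g" "Dom C f = N" "Cod C g = M" using F F_eq by (auto simp: extensions_eq)
      note [simp] = sesD[OF fg(1)] fg(2,3)
      \<comment> \<open>The lift of \<pi> restricted to \<Omega> lands in \<open>N\<close>; pushing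
        out along that restriction returns the given extension.\<close>
      obtain \<rho> where \<rho>: "\<rho> \<in> Arr C" "Dom C \<rho> = Dom C \<pi>" "Cod C \<rho> = Cod C f" "g \<cdot> \<rho> = \<pi>" using lift fg by blast
      have "g \<cdot> \<rho> \<cdot> \<iota> = nul (Dom C \<iota>) (Cod C g)" using comp_under[OF \<rho>(4), of \<iota>] \<rho>(1-3) by simp
      then obtain \<phi> where \<phi>: "\<phi> \<in> Arr C" "Dom C \<phi> = \<Omega>" "Cod C \<phi> = N" "f \<cdot> \<phi> = \<rho> \<cdot> \<iota>"
        using ses_lift[OF fg(1), of "\<rho> \<cdot> \<iota>"] \<rho>(1-3) by (auto simp: \<Omega>_def)
      then have "F \<in> ?\<delta> \<phi>" using \<rho> fg unfolding pushouts_def F_eq by auto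
      then show "X \<in> ?\<delta> ` ?H" using cls[of \<phi> F] \<phi> F by auto
    qed
  qed
  have "module K (Ext1 C M N)"
  proof (rule module_surjective_image[OF hom_module[of \<Omega> N], where \<delta> = ?\<delta>])
    show "?\<delta> ` carrier (homspace C \<Omega> N) = carrier (Ext1 C M N)" using im by simp
    fix x y assume "x \<in> carrier (homspace C \<Omega> N)" "y \<in> carrier (homspace C \<Omega> N)"
    then show "?\<delta> x \<oplus>\<^bsub>Ext1 C M N\<^esub> ?\<delta> y = ?\<delta> (x \<oplus>\<^bsub>homspace C \<Omega> N\<^esub> y)"
      using pushouts_baer_sum[OF s, of x N y] \<pi>(2) by (simp add: \<Omega>_def)
  next
    fix c x assume "c \<in> carrier K" "x \<in> carrier (homspace C \<Omega> N)"
    then show "c \<odot>\<^bsub>Ext1 C M N\<^esub> ?\<delta> x = ?\<delta> (c \<odot>\<^bsub>homspace C \<Omega> N\<^esub> x)"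
      using pushouts_smult[OF s, of x N c] \<pi>(2) by (simp add: \<Omega>_def)
  next
    show "\<zero>\<^bsub>Ext1 C M N\<^esub> = ?\<delta> \<zero>\<^bsub>homspace C \<Omega> N\<^esub>" using pushouts_zero[OF s N] by (simp add: \<Omega>_def)
  qed simp_all
  then show "vectorspace K (Ext1 C M N)" using field_axioms by (simp add: vectorspace_def)
  \<comment> \<open>\<open>R\<close> is the image of restriction from Hom(P,N) to Hom(\<Omega>,N).
    Its order cancels between the next two counts, which together express exactness of 0 -> Hom(M,N)
    -> Hom(P,N) -> Hom(\<Omega>,N) -> Ext1(M,N) -> 0.\<close>
  define R where "R = (\<lambda>\<zeta>. \<zeta> \<cdot> \<iota>) ` homset C P N"
  have finR: "finite R" unfolding R_def by (rule finite_imageI) (rule finite_homset_any)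
  have "card (homset C P N) = card R * card (homset C M N)"
  proof -
    have "card (homset C P N) = card {(r, \<zeta>). r \<in> R \<and> (\<zeta> \<in> homset C P N \<and> \<zeta> \<cdot> \<iota> = r)}"
      by (rule bij_betw_same_card[of "\<lambda>\<zeta>. (\<zeta> \<cdot> \<iota>, \<zeta>)"])
        (auto simp: bij_betw_def inj_on_def R_def image_iff simp del: hom_iff)
    also have "\<dots> = (\<Sum>r\<in>R. card {\<zeta>. \<zeta> \<in> homset C P N \<and> \<zeta> \<cdot> \<iota> = r})"
      by (rule card_Collect_pair[OF finR], rule finite_subset[OF _ finite_homset_any[of P N]]) auto
    also have "\<dots> = (\<Sum>r\<in>R. card (homset C M N))"
    proof (rule sum.cong[OF refl])
      fix r assume "r \<in> R"
      then obtain \<zeta> where "\<zeta> \<in> homset C (Cod C \<iota>) N" "r = \<zeta> \<cdot> \<iota>" by (auto simp: R_def P_def simp del: hom_iff)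
      then show "card {\<zeta>. \<zeta> \<in> homset C P N \<and> \<zeta> \<cdot> \<iota> = r} = card (homset C M N)"
        using card_factorizations[OF s, of \<zeta> N] by (simp add: P_def del: hom_iff)
    qed
    finally show ?thesis by simp
  qed
  moreover have "card ?H = card (carrier (Ext1 C M N)) * card R"
  proof -
    have finE: "finite (carrier (Ext1 C M N))" using finite_Ext1 by simp
    have "card ?H = card {(X, \<phi>). X \<in> carrier (Ext1 C M N) \<and> (\<phi> \<in> ?H \<and> ?\<delta> \<phi> = X)}"
      by (rule bij_betw_same_card[of "\<lambda>\<phi>. (?\<delta> \<phi>, \<phi>)"])
        (use im in \<open>auto simp: bij_betw_def inj_on_def image_iff simp del: hom_iff Ext1_sel\<close>)
    also have "\<dots> = (\<Sum>X\<in>carrier (Ext1 C M N). card {\<phi>. \<phi> \<in> ?H \<and> ?\<delta> \<phi> = X})"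
      by (rule card_Collect_pair[OF finE], rule finite_subset[OF _ finite_homset_any[of \<Omega> N]]) auto
    also have "\<dots> = (\<Sum>X\<in>carrier (Ext1 C M N). card R)"
    proof (rule sum.cong[OF refl])
      fix X assume "X \<in> carrier (Ext1 C M N)"
      then obtain \<phi>0 where \<phi>0: "\<phi>0 \<in> ?H" "X = ?\<delta> \<phi>0" using im by blast
      have \<phi>0' [simp]: "\<phi>0 \<in> Arr C" "Dom C \<phi>0 = Dom C \<iota>" "Cod C \<phi>0 = N" using \<phi>0 by (auto simp: \<Omega>_def)
      obtain F where F: "F \<in> ?\<delta> \<phi>0" using ne[OF \<phi>0(1)] by blast
      obtain f g where F_eq: "F = (f, g)" by (cases F)
      obtain \<beta> where \<beta>: "ses C f g" "Dom C f = Cod C \<phi>0" "Cod C g = Cod C \<pi>"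
        "\<beta> \<in> Arr C" "Dom C \<beta> = Cod C \<iota>" "Cod C \<beta> = Cod C f" "\<beta> \<cdot> \<iota> = f \<cdot> \<phi>0" "g \<cdot> \<beta> = \<pi>"
        by (rule pushoutsE[OF F[unfolded F_eq]])
      note [simp] = sesD[OF \<beta>(1)] \<beta>(2-6)
      \<comment> \<open>Two arrows on \<Omega> give the same class exactly when their difference
        extends to \<open>P\<close>, so each fibre is a coset of \<open>R\<close>.\<close>
      show "card {\<phi>. \<phi> \<in> ?H \<and> ?\<delta> \<phi> = X} = card R"
      proof (rule card_eq_by_relation[where R = "\<lambda>\<phi> r. \<phi> = \<phi>0 \<boxplus> r"])
        fix \<phi> assume \<phi>: "\<phi> \<in> {\<phi>. \<phi> \<in> ?H \<and> ?\<delta> \<phi> = X}"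
        then have \<phi>' [simp]: "\<phi> \<in> Arr C" "Dom C \<phi> = Dom C \<iota>" "Cod C \<phi> = N" by (auto simp: \<Omega>_def)
        have "(f, g) \<in> ?\<delta> \<phi>" using \<phi> F F_eq \<phi>0 by auto
        then obtain \<beta>' where \<beta>': "\<beta>' \<in> Arr C" "Dom C \<beta>' = Cod C \<iota>" "Cod C \<beta>' = Cod C f" "\<beta>' \<cdot> \<iota> = f \<cdot> \<phi>" "g \<cdot> \<beta>' = \<pi>"
          by (auto simp: pushouts_def)
        have "g \<cdot> (\<beta>' \<boxminus> \<beta>) = nul P M" using \<beta>' \<beta>(8) by (simp add: P_def)
        then obtain \<zeta> where \<zeta>: "\<zeta> \<in> Arr C" "Dom C \<zeta> = P" "Cod C \<zeta> = N" "f \<cdot> \<zeta> = \<beta>' \<boxminus> \<beta>"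
          using ses_lift[OF \<beta>(1), of "\<beta>' \<boxminus> \<beta>"] \<beta>' by (auto simp: P_def)
        have "f \<cdot> (\<phi>0 \<boxplus> \<zeta> \<cdot> \<iota>) = f \<cdot> \<phi>"
          using \<zeta> \<beta>' \<beta>(7) comp_under[OF \<zeta>(4), of \<iota>] by (simp add: P_def)
        then have "\<phi> = \<phi>0 \<boxplus> \<zeta> \<cdot> \<iota>"
          using monic_cancel[OF ses_monic[OF \<beta>(1)], of "\<phi>0 \<boxplus> \<zeta> \<cdot> \<iota>" \<phi>] \<zeta>(1-3) by (simp add: P_def)
        moreover have "\<zeta> \<cdot> \<iota> \<in> R" using \<zeta>(1-3) by (simp add: R_def)
        ultimately show "\<exists>r\<in>R. \<phi> = \<phi>0 \<boxplus> r" by blast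
      next
        fix r assume "r \<in> R"
        then obtain \<zeta> where \<zeta>: "\<zeta> \<in> Arr C" "Dom C \<zeta> = Cod C \<iota>" "Cod C \<zeta> = N" "r = \<zeta> \<cdot> \<iota>" by (auto simp: R_def P_def)
        note [simp] = \<zeta>(1-3)
        have gf: "g \<cdot> f \<cdot> \<zeta> = nul (Cod C \<iota>) M" using ses_comp_zero[OF \<beta>(1), of \<zeta>] by simp
        define \<phi> \<beta>' where "\<phi> = \<phi>0 \<boxplus> \<zeta> \<cdot> \<iota>" and "\<beta>' = \<beta> \<boxplus> f \<cdot> \<zeta>"
        have \<phi>: "\<phi> \<in> Arr C" "Dom C \<phi> = \<Omega>" "Cod C \<phi> = N" by (simp_all add: \<phi>_def \<Omega>_def)
        have \<beta>': "\<beta>' \<in> Arr C" "Dom C \<beta>' = Cod C \<iota>" "Cod C \<beta>' = Cod C f" "\<beta>' \<cdot> \<iota> = f \<cdot> \<phi>" "g \<cdot> \<beta>' = \<pi>"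
          using \<beta>(7,8) gf by (simp_all add: \<phi>_def \<beta>'_def)
        have "(f, g) \<in> ?\<delta> \<phi>"
          unfolding pushouts_def using \<beta>' \<beta>(1) \<phi> by (intro CollectI case_prodI conjI exI[of _ \<beta>']) simp_all
        then have "?\<delta> \<phi> = X" using cls[of \<phi> F] cls[OF \<phi>0(1) F] \<phi> F_eq \<phi>0(2) by simp
        then show "\<exists>\<phi>\<in>{\<phi>. \<phi> \<in> ?H \<and> ?\<delta> \<phi> = X}. \<phi> = \<phi>0 \<boxplus> r" using \<phi> \<zeta>(4) \<phi>_def by auto
      next
        fix \<phi> r r' assume "r \<in> R" "r' \<in> R" "\<phi> = \<phi>0 \<boxplus> r" "\<phi> = \<phi>0 \<boxplus> r'"
        then show "r = r'" using add_left_cancel'[of \<phi>0 r r'] by (auto simp: R_def P_def)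
      qed auto
    qed
    finally show ?thesis by simp
  qed
  moreover have "is_kernel C \<iota> \<pi>" using s by (simp add: ses_def)
  then have "chi M N * card (homset C P N) = card ?H" using chi by (simp add: \<Omega>_def P_def del: hom_iff)
  moreover have "card R > 0"
  proof -
    have "nul P N \<in> homset C P N" by simp
    then have "R \<noteq> {}" unfolding R_def by blast
    then show ?thesis using finR by (simp add: card_gt_0_iff)
  qed
  ultimately show "chi M N * card (homset C M N) = card (carrier (Ext1 C M N))" by (simp del: Ext1_sel)
qed

lemma card_field_gt_1: "card (carrier K) > 1"
proof -
  have "{\<zero>\<^bsub>K\<^esub>, \<one>\<^bsub>K\<^esub>} \<subseteq> carrier K" by simp
  then have "card {\<zero>\<^bsub>K\<^esub>, \<one>\<^bsub>K\<^esub>} \<le> card (carrier K)" using finite_field by (rule card_mono[rotated])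
  then show ?thesis using zero_not_one by simp
qed

text \<open>The orders of Hom and Ext1 are powers of q; the minus sign appears because Ext1 stands
  in the numerator of \<open>chi\<close>.\<close>

lemma chi_eq_euler_form:
  assumes M: "M \<in> Ob C" and N: "N \<in> Ob C"
  shows "chi M N = real (card (carrier K)) powi (- euler_form K C M N)"
proof -
  let ?q = "real (card (carrier K))"
  have q: "?q > 0" using card_field_gt_1 by simp
  have "card (homset C M N) = card (carrier K) ^ vectorspace.dim K (homspace C M N)"
    using vectorspace.card_carrier_eq_power_dim[OF hom_vectorspace[OF M N]] by (simp del: hom_iff)
  moreover have "card (carrier (Ext1 C M N)) = card (carrier K) ^ vectorspace.dim K (Ext1 C M N)"
    using vectorspace.card_carrier_eq_power_dim[OF Ext1_vectorspace_card(1)[OF M N]] finite_Ext1[OF M N] by simp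
  ultimately have "chi M N * ?q powi int (vectorspace.dim K (homspace C M N)) = ?q powi int (vectorspace.dim K (Ext1 C M N))"
    using Ext1_vectorspace_card(2)[OF M N] by (simp del: Ext1_sel)
  then show ?thesis using q by (simp add: euler_form_def power_int_diff field_simps)
qed

lemma powi_inject:
  assumes "(1 :: real) < q" "q powi m = q powi n"
  shows "m = n"
  using assms by (metis less_irrefl linorder_neqE_linordered_idom power_int_strict_increasing)

text \<open>These are the logarithms of \<open>chi_mult_right\<close> and
  \<open>chi_mult_left\<close>, legitimate because q > 1 makes integer powers injective.\<close>

lemma euler_form_ses:
  assumes s: "ses C i p" and D: "D \<in> Ob C"
  shows "euler_form K C D (Cod C i) = euler_form K C D (Dom C i) + euler_form K C D (Cod C p)"
    "euler_form K C (Cod C i) D = euler_form K C (Dom C i) D + euler_form K C (Cod C p) D"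
proof -
  let ?q = "real (card (carrier K))"
  have q: "?q > 1" using card_field_gt_1 by simp
  have Ob: "Dom C i \<in> Ob C" "Cod C i \<in> Ob C" "Cod C p \<in> Ob C" using sesD[OF s] by auto
  have "?q powi (- euler_form K C D (Cod C i)) = ?q powi (- euler_form K C D (Dom C i) - euler_form K C D (Cod C p))"
    using chi_mult_right[OF s D] Ob D q by (simp add: chi_eq_euler_form power_int_diff power_int_minus field_simps)
  then show "euler_form K C D (Cod C i) = euler_form K C D (Dom C i) + euler_form K C D (Cod C p)"
    using powi_inject[OF q] by fastforce
  have "?q powi (- euler_form K C (Cod C i) D) = ?q powi (- euler_form K C (Dom C i) D - euler_form K C (Cod C p) D)"
    using chi_mult_left[OF s D] Ob D q by (simp add: chi_eq_euler_form power_int_diff power_int_minus field_simps)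
  then show "euler_form K C (Cod C i) D = euler_form K C (Dom C i) D + euler_form K C (Cod C p) D"
    using powi_inject[OF q] by fastforce
qed

lemma isomorphic_Ob: "isomorphic C A B \<Longrightarrow> A \<in> Ob C \<and> B \<in> Ob C"
  unfolding isomorphic_def by (metis equals0I Ob_of_arr isosD)

lemma euler_form_iso:
  assumes "isomorphic C M M'" "isomorphic C N N'"
  shows "euler_form K C M N = euler_form K C M' N'"
proof -
  have q: "real (card (carrier K)) > 1" using card_field_gt_1 by simp
  show ?thesis
    using chi_iso[OF assms] isomorphic_Ob[OF assms(1)] isomorphic_Ob[OF assms(2)] powi_inject[OF q]
    by (simp add: chi_eq_euler_form) fastforce
qed

end

section \<open>Hall numbers\<close>

lemma card_eq_sum_fibers:
  assumes "finite E" "finite S" "F ` E \<subseteq> S"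
  shows "card E = (\<Sum>s\<in>S. card {e \<in> E. F e = s})"
  using sum.group[OF assms, of "\<lambda>_. 1 :: nat"] by simp

context linear_abelian_category
begin

lemma kernel_unique:
  assumes k: "is_kernel C k f" and k': "is_kernel C k' f"
  shows "\<exists>z\<in>isos C (Dom C k) (Dom C k'). k' \<cdot> z = k"
proof -
  note [simp] = kerD[OF k] kerD[OF k']
  obtain z where z: "z \<in> Arr C" "Dom C z = Dom C k" "Cod C z = Dom C k'" "k' \<cdot> z = k" using ker_lift[OF k', of k] by auto
  obtain w where w: "w \<in> Arr C" "Dom C w = Dom C k'" "Cod C w = Dom C k" "k \<cdot> w = k'" using ker_lift[OF k, of k'] by auto
  have "k \<cdot> w \<cdot> z = k \<cdot> Id C (Dom C k)" "k' \<cdot> z \<cdot> w = k' \<cdot> Id C (Dom C k')"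
    using comp_under[OF w(4), of z] comp_under[OF z(4), of w] z w by simp_all
  then have "w \<cdot> z = Id C (Dom C k)" "z \<cdot> w = Id C (Dom C k')"
    using monic_cancel[OF ker_monic[OF k], of "w \<cdot> z" "Id C (Dom C k)"] monic_cancel[OF ker_monic[OF k'], of "z \<cdot> w" "Id C (Dom C k')"] z w
    by simp_all
  then have "z \<in> isos C (Dom C k) (Dom C k')" using z w by (intro isosI[of z w]) simp_all
  then show ?thesis using z by blast
qed

lemmas cokernel_unique = linear_abelian_category.kernel_unique[OF opp_lac, unfolded opp_rules]

definition ker_of :: "'m \<Rightarrow> 'm" where "ker_of f = (SOME k. is_kernel C k f)"
definition cok_of :: "'m \<Rightarrow> 'm" where "cok_of f = (SOME p. is_cokernel C p f)"
text \<open>The image is realized as the coimage: the epic part is the chosen one, and the monic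
  part is then determined by it (\<open>image_part\<close>).\<close>

definition coim_of :: "'m \<Rightarrow> 'm" where "coim_of f = cok_of (ker_of f)"
definition ker_ob :: "'m \<Rightarrow> 'o" where "ker_ob f = Dom C (ker_of f)"
definition cok_ob :: "'m \<Rightarrow> 'o" where "cok_ob f = Cod C (cok_of f)"
definition im_ob :: "'m \<Rightarrow> 'o" where "im_ob f = Cod C (coim_of f)"

lemma ker_of: "f \<in> Arr C \<Longrightarrow> is_kernel C (ker_of f) f"
  using has_kernels[of f] unfolding ker_of_def by (metis someI)

lemma cok_of: "f \<in> Arr C \<Longrightarrow> is_cokernel C (cok_of f) f"
  using has_cokernels[of f] unfolding cok_of_def by (metis someI)

lemma coim_of_ses: "f \<in> Arr C \<Longrightarrow> ses C (ker_of f) (coim_of f)"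
  using ker_of[of f] cok_of[of "ker_of f"] sesI1 ker_monic kerD unfolding coim_of_def by metis

lemma ker_cok_ob [simp]:
  assumes "f \<in> Arr C"
  shows "ker_ob f \<in> Ob C" "cok_ob f \<in> Ob C" "im_ob f \<in> Ob C"
  using kerD[OF ker_of[OF assms]] cokD[OF cok_of[OF assms]] sesD[OF coim_of_ses[OF assms]]
  by (auto simp: ker_ob_def cok_ob_def im_ob_def)

lemma ker_cok_of [simp]:
  assumes "f \<in> Arr C"
  shows "ker_of f \<in> Arr C" "Dom C (ker_of f) = ker_ob f" "Cod C (ker_of f) = Dom C f" "f \<cdot> ker_of f = nul (ker_ob f) (Cod C f)"
    "cok_of f \<in> Arr C" "Dom C (cok_of f) = Cod C f" "Cod C (cok_of f) = cok_ob f" "cok_of f \<cdot> f = nul (Dom C f) (cok_ob f)"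
    "coim_of f \<in> Arr C" "Dom C (coim_of f) = Dom C f" "Cod C (coim_of f) = im_ob f"
  using kerD[OF ker_of[OF assms]] cokD[OF cok_of[OF assms]] sesD[OF coim_of_ses[OF assms]]
  by (auto simp: ker_ob_def cok_ob_def im_ob_def)

text \<open>An arbitrary epic-monic factorization has its epic part isomorphic to the coimage, by
  uniqueness of cokernels, so the arrow induced from the coimage is monic.\<close>

lemma image_part:
  assumes f: "f \<in> Arr C"
  obtains i where "ses C i (cok_of f)" "Dom C i = im_ob f" "i \<cdot> coim_of f = f"
proof -
  note [simp] = f
  obtain i where i: "i \<in> Arr C" "Cod C i = Cod C f" "Dom C i = Cod C (coim_of f)" "i \<cdot> coim_of f = f"
    using ses_desc[OF coim_of_ses[OF f], of f] by auto
  obtain e m where em: "epic C e" "monic C m" "Dom C m = Cod C e" "m \<cdot> e = f" using image_factorization[OF f] by blast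
  note [simp] = epic_arr[OF em(1)] monic_arr[OF em(2)] em(3)
  have D: "Dom C e = Dom C f" "Cod C m = Cod C f" using em(4) by (metis comp_arr em(1,2,3) epic_arr monic_arr)+
  have "is_kernel C (ker_of f) e" using ker_of[OF f] kernel_of_monic_comp[OF em(2), of e "ker_of f"] em(4) by simp
  then have "is_cokernel C e (ker_of f)" using epic_cok_of_ker[OF em(1)] by blast
  moreover have "is_cokernel C (coim_of f) (ker_of f)" using coim_of_ses[OF f] by (simp add: ses_def)
  ultimately obtain x where x: "x \<in> isos C (Cod C (coim_of f)) (Cod C e)" "x \<cdot> coim_of f = e" using cokernel_unique by blast
  note [simp] = isosD[OF x(1)]
  have "(m \<cdot> x) \<cdot> coim_of f = i \<cdot> coim_of f" using x em i D by simp
  then have "m \<cdot> x = i" using epic_cancel[OF ses_epic[OF coim_of_ses[OF f]], of "m \<cdot> x" i] i D by simp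
  then have "monic C i" using monic_comp[OF iso_monic[OF x(1)] em(2)] by auto
  moreover have "is_cokernel C (cok_of f) i"
    using cok_of[OF f] cokernel_of_comp_epic[OF ses_epic[OF coim_of_ses[OF f]], of i "cok_of f"] i by simp
  ultimately show ?thesis using that[of i] i sesI1 by simp
qed

end

section \<open>Hall numbers as counts of short exact sequences, and sums over arrows\<close>

context hereditary_counting_category
begin

text \<open>Over a fixed subobject of the right type, the inclusion can be altered by any
  isomorphism from \<open>I\<close>, and the quotient map by any isomorphism to \<open>L\<close>;
  this action is free and transitive.\<close>

lemma card_short_exacts:
  assumes M: "M \<in> Ob C"
  shows "card (short_exacts C I M L) = aut_card C I * aut_card C L * hall C L I M"
proof -
  let ?R = "{(m, n). monic C m \<and> monic C n \<and> Cod C m = M \<and> Cod C n = M \<and> (\<exists>u \<in> isos C (Dom C m) (Dom C n). n \<cdot> u = m)}"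
  let ?S = "{X \<in> subobjects C M. \<exists>m \<in> X. isomorphic C (Dom C m) I \<and> (\<exists>p. is_cokernel C p m \<and> isomorphic C (Cod C p) L)}"
  have eq: "equiv {m. monic C m \<and> Cod C m = M} ?R"
  proof (rule equivI)
    show "refl_on {m. monic C m \<and> Cod C m = M} ?R"
    proof (rule refl_onI)
      fix m assume "m \<in> {m. monic C m \<and> Cod C m = M}"
      then show "(m, m) \<in> ?R" using iso_id[of "Dom C m"] monic_arr[of m] by (auto intro!: bexI[of _ "Id C (Dom C m)"])
    qed
    show "sym ?R"
    proof (rule symI)
      fix m n assume "(m, n) \<in> ?R"
      then obtain u where mn: "monic C m" "monic C n" "Cod C m = M" "Cod C n = M" and u: "u \<in> isos C (Dom C m) (Dom C n)" "n \<cdot> u = m"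
        by blast
      obtain w where w: "w \<in> isos C (Dom C n) (Dom C m)" "u \<cdot> w = Id C (Dom C n)" using u(1) by (blast elim: isosE)
      have "(n \<cdot> u) \<cdot> w = n" using w(2) monic_arr[OF mn(2)] isosD[OF u(1)] isosD[OF w(1)] by simp
      then have "m \<cdot> w = n" by (simp only: u(2))
      then show "(n, m) \<in> ?R" using mn w(1) by blast
    qed
    show "trans ?R"
    proof (rule transI)
      fix x y z assume "(x, y) \<in> ?R" "(y, z) \<in> ?R"
      then obtain u w where m: "monic C x" "monic C z" "Cod C x = M" "Cod C z = M" and u: "u \<in> isos C (Dom C x) (Dom C y)" "y \<cdot> u = x"
        and w: "w \<in> isos C (Dom C y) (Dom C z)" "z \<cdot> w = y" by blast
      have "z \<cdot> w \<cdot> u = x"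
        using comp_under[OF w(2), of u] u(2) monic_arr[OF m(2)] isosD[OF u(1)] isosD[OF w(1)] by simp
      then show "(x, z) \<in> ?R" using m iso_comp[OF u(1) w(1)] by blast
    qed
  qed auto
  have sub_eq: "subobjects C M = {m. monic C m \<and> Cod C m = M} // ?R" by (simp add: subobjects_def)
  define F where "F = (\<lambda>(i, p :: 'm). ?R `` {i})"
  have inR: "i \<in> ?R `` {i}" if "monic C i" "Cod C i = M" for i using equiv_class_self[OF eq] that by simp
  have FS: "F ` short_exacts C I M L \<subseteq> ?S"
  proof
    fix X assume "X \<in> F ` short_exacts C I M L"
    then obtain i p where ip: "(i, p) \<in> short_exacts C I M L" "X = ?R `` {i}" by (auto simp: F_def)
    then have s: "ses C i p" "Dom C i = I" "Cod C i = M" "Cod C p = L" by (auto simp: short_exacts_iff)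
    have "i \<in> {m. monic C m \<and> Cod C m = M}" using s ses_monic[OF s(1)] by simp
    then have "X \<in> subobjects C M" unfolding sub_eq ip(2) by (rule quotientI)
    moreover have "isomorphic C (Dom C i) I" "is_cokernel C p i" "isomorphic C (Cod C p) L"
      using s sesD[OF s(1)] isomorphic_refl[of I] isomorphic_refl[of L] by (auto simp: ses_def)
    moreover have "i \<in> X" unfolding ip(2) by (rule inR[OF ses_monic[OF s(1)] s(3)])
    ultimately show "X \<in> ?S" by (intro CollectI conjI bexI[of _ i] exI[of _ p])
  qed
  have fib: "card {e \<in> short_exacts C I M L. F e = X} = aut_card C I * aut_card C L \<and> X \<in> F ` short_exacts C I M L" if X: "X \<in> ?S" for X
  proof -
    obtain m q where m: "m \<in> X" "isomorphic C (Dom C m) I" "is_cokernel C q m" "isomorphic C (Cod C q) L" using X by blast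
    have mM: "monic C m" "Cod C m = M" and Xm: "X = ?R `` {m}"
    proof -
      have "X \<in> {m. monic C m \<and> Cod C m = M} // ?R" using X sub_eq by simp
      then obtain m' where m': "monic C m'" "Cod C m' = M" "X = ?R `` {m'}" by (auto elim!: quotientE)
      then have mm: "(m', m) \<in> ?R" using m(1) by blast
      then show "monic C m" "Cod C m = M" by auto
      show "X = ?R `` {m}" using equiv_class_eq[OF eq mm] m'(3) by simp
    qed
    have sm: "ses C m q" using sesI1[OF mM(1) m(3)] .
    note [simp] = sesD[OF sm] mM(2)
    have "card {e \<in> short_exacts C I M L. F e = X} = card (isos C I (Dom C m) \<times> isos C (Cod C q) L)"
    proof (rule card_eq_by_relation[where R = "\<lambda>e uv. fst e = m \<cdot> fst uv \<and> snd e = snd uv \<cdot> q"])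
      fix e assume "e \<in> {e \<in> short_exacts C I M L. F e = X}"
      moreover obtain i p where e: "e = (i, p)" by (cases e)
      ultimately have s: "ses C i p" "Dom C i = I" "Cod C i = M" "Cod C p = L" and "?R `` {i} = X" by (auto simp: short_exacts_iff F_def)
      then have "i \<in> X" using inR[OF ses_monic[OF s(1)] s(3)] by blast
      then have "(m, i) \<in> ?R" unfolding Xm by (rule ImageE) simp
      then have "(i, m) \<in> ?R" using eq unfolding equiv_def by (elim conjE) (rule symD)
      then obtain u where u: "u \<in> isos C I (Dom C m)" "m \<cdot> u = i" using s(2) by blast
      note [simp] = isosD[OF u(1)]
      have "is_cokernel C p m" using s(1) cokernel_of_comp_epic[OF iso_epic[OF u(1)], of m p] u(2) by (simp add: ses_def)
      then obtain w where "w \<in> isos C (Cod C q) L" "w \<cdot> q = p" using cokernel_unique[of p m q] m(3) s(4) by blast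
      then show "\<exists>uv\<in>isos C I (Dom C m) \<times> isos C (Cod C q) L. fst e = m \<cdot> fst uv \<and> snd e = snd uv \<cdot> q" using u e by auto
    next
      fix uv assume "uv \<in> isos C I (Dom C m) \<times> isos C (Cod C q) L"
      moreover obtain u w where uv: "uv = (u, w)" by (cases uv)
      ultimately have u: "u \<in> isos C I (Dom C m)" and w: "w \<in> isos C (Cod C q) L" by auto
      note [simp] = isosD[OF u] isosD[OF w]
      have "ses C (m \<cdot> u) (w \<cdot> q)"
      proof (rule sesI2)
        show "epic C (w \<cdot> q)" using epic_comp[OF iso_epic[OF w] ses_epic[OF sm]] by simp
        show "is_kernel C (m \<cdot> u) (w \<cdot> q)"
          using kernel_comp_iso[of m q u I] sm u kernel_of_monic_comp[OF iso_monic[OF w], of q "m \<cdot> u"] by (simp add: ses_def)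
      qed
      then have se: "(m \<cdot> u, w \<cdot> q) \<in> short_exacts C I M L" by (simp add: short_exacts_iff)
      have mu: "(m \<cdot> u, m) \<in> ?R" using mM monic_comp[OF iso_monic[OF u] mM(1)] u by auto
      have "F (m \<cdot> u, w \<cdot> q) = X" unfolding F_def prod.case Xm by (rule equiv_class_eq[OF eq mu])
      then show "\<exists>e\<in>{e \<in> short_exacts C I M L. F e = X}. fst e = m \<cdot> fst uv \<and> snd e = snd uv \<cdot> q" using se uv by auto
    next
      fix e uv uv' assume "uv \<in> isos C I (Dom C m) \<times> isos C (Cod C q) L" "uv' \<in> isos C I (Dom C m) \<times> isos C (Cod C q) L"
        "fst e = m \<cdot> fst uv \<and> snd e = snd uv \<cdot> q" "fst e = m \<cdot> fst uv' \<and> snd e = snd uv' \<cdot> q"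
      then show "uv = uv'"
        using monic_cancel[OF mM(1), of "fst uv" "fst uv'"] epic_cancel[OF ses_epic[OF sm], of "snd uv" "snd uv'"]
          isosD[of "fst uv" I "Dom C m"] isosD[of "fst uv'" I "Dom C m"] isosD[of "snd uv" "Cod C q" L] isosD[of "snd uv'" "Cod C q" L]
        by (auto simp: prod_eq_iff)
    qed (auto simp: prod_eq_iff)
    also have "\<dots> = aut_card C I * aut_card C L"
      using card_isos[OF m(2)] card_isos[OF m(4)] card_isos_sym[of I "Dom C m"] by (simp add: card_cartesian_product)
    finally have c: "card {e \<in> short_exacts C I M L. F e = X} = aut_card C I * aut_card C L" .
    have "I \<in> Ob C" "L \<in> Ob C" using m(2,4) unfolding isomorphic_def by (metis equals0I Ob_of_arr(2) isosD)+
    then have "card {e \<in> short_exacts C I M L. F e = X} > 0" using c aut_card_pos by simp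
    then have "{e \<in> short_exacts C I M L. F e = X} \<noteq> {}" by force
    then show ?thesis using c by blast
  qed
  then have "?S \<subseteq> F ` short_exacts C I M L" by blast
  then have finS: "finite ?S" by (rule finite_subset) simp
  show ?thesis using card_eq_sum_fibers[OF finite_short_exacts finS FS] fib by (simp add: hall_def)
qed

text \<open>Kernel, image and cokernel of \<open>f\<close> are unique up to unique isomorphism, so
  all such data arise from the canonical ones by three independent isomorphisms.\<close>

lemma card_image_data:
  assumes f: "f \<in> homset C A B"
  shows "card {((i, p), (n, e)). (i, p) \<in> short_exacts C I B L \<and> (n, e) \<in> short_exacts C N A I \<and> i \<cdot> e = f}
    = card (isos C (im_ob f) I) * card (isos C (cok_ob f) L) * card (isos C (ker_ob f) N)" (is "card ?D = _")
proof -
  let ?T = "isos C (im_ob f) I \<times> isos C (cok_ob f) L \<times> isos C (ker_ob f) N"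
  have fD [simp]: "f \<in> Arr C" "Dom C f = A" "Cod C f = B" using f by auto
  obtain i0 where i0: "ses C i0 (cok_of f)" "Dom C i0 = im_ob f" "i0 \<cdot> coim_of f = f" by (rule image_part[OF fD(1)])
  have [simp]: "Cod C i0 = B" using sesD[OF i0(1)] by simp
  note [simp] = sesD[OF i0(1)] i0(2)
  note k0 = ker_of[OF fD(1)] and c0 = cok_of[OF fD(1)] and e0 = coim_of_ses[OF fD(1)]
  let ?R = "\<lambda>d t. fst (fst d) \<cdot> fst t = i0 \<and> fst t \<cdot> coim_of f = snd (snd d) \<and>
      fst (snd t) \<cdot> cok_of f = snd (fst d) \<and> fst (snd d) \<cdot> snd (snd t) = ker_of f"
  have "card ?D = card ?T"
  proof (rule card_eq_by_relation[where R = ?R])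
    fix d assume "d \<in> ?D"
    then obtain i p n e where d: "d = ((i, p), (n, e))" and s: "ses C i p" "ses C n e" and ie: "i \<cdot> e = f"
      and [simp]: "Dom C i = I" "Cod C i = B" "Cod C p = L" "Dom C n = N" "Cod C n = A" "Cod C e = I"
      by (auto simp: short_exacts_iff)
    note [simp] = sesD[OF s(1)] sesD[OF s(2)]
    have "is_kernel C n f" using s(2) kernel_of_monic_comp[OF ses_monic[OF s(1)], of e n] ie by (simp add: ses_def)
    then obtain z where z: "z \<in> isos C (ker_ob f) N" "n \<cdot> z = ker_of f" using kernel_unique[OF k0, of n] by auto
    note [simp] = isosD[OF z(1)]
    have "is_cokernel C e (ker_of f)" using s(2) cokernel_of_comp_epic[OF iso_epic[OF z(1)], of n e] z(2) by (simp add: ses_def)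
    then obtain x where x: "x \<in> isos C (im_ob f) I" "x \<cdot> coim_of f = e"
      using cokernel_unique[of e "ker_of f" "coim_of f"] e0 by (auto simp: ses_def)
    note [simp] = isosD[OF x(1)]
    have "(i \<cdot> x) \<cdot> coim_of f = i0 \<cdot> coim_of f" using x ie i0 by simp
    then have ix: "i \<cdot> x = i0" using epic_cancel[OF ses_epic[OF e0], of "i \<cdot> x" i0] by simp
    have "is_cokernel C p f" using s(1) cokernel_of_comp_epic[OF ses_epic[OF s(2)], of i p] ie by (simp add: ses_def)
    then obtain y where y: "y \<in> isos C (cok_ob f) L" "y \<cdot> cok_of f = p" using cokernel_unique[of p f "cok_of f"] c0 by auto
    show "\<exists>t\<in>?T. ?R d t"
      using x y z ix d by (intro bexI[of _ "(x, y, z)"]) auto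
  next
    fix t assume "t \<in> ?T"
    then obtain x y z where t: "t = (x, y, z)" and x: "x \<in> isos C (im_ob f) I" and y: "y \<in> isos C (cok_ob f) L"
      and z: "z \<in> isos C (ker_ob f) N" by auto
    obtain x' where x': "x' \<in> isos C I (im_ob f)" "x' \<cdot> x = Id C (im_ob f)" "x \<cdot> x' = Id C I" using x by (blast elim: isosE)
    obtain z' where z': "z' \<in> isos C N (ker_ob f)" "z' \<cdot> z = Id C (ker_ob f)" using z by (blast elim: isosE)
    note [simp] = isosD[OF x] isosD[OF y] isosD[OF z] isosD[OF x'(1)] isosD[OF z'(1)]
    have "ses C (i0 \<cdot> x') (y \<cdot> cok_of f)"
    proof (rule sesI2)
      show "epic C (y \<cdot> cok_of f)" using epic_comp[OF iso_epic[OF y] cok_epic[OF c0]] by simp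
      show "is_kernel C (i0 \<cdot> x') (y \<cdot> cok_of f)"
        using kernel_comp_iso[of i0 "cok_of f" x' I] i0(1) x'(1) kernel_of_monic_comp[OF iso_monic[OF y], of "cok_of f" "i0 \<cdot> x'"]
        by (simp add: ses_def)
    qed
    then have se: "(i0 \<cdot> x', y \<cdot> cok_of f) \<in> short_exacts C I B L" by (simp add: short_exacts_iff)
    have "ses C (ker_of f \<cdot> z') (x \<cdot> coim_of f)"
    proof (rule sesI2)
      show "epic C (x \<cdot> coim_of f)" using epic_comp[OF iso_epic[OF x] ses_epic[OF e0]] by simp
      show "is_kernel C (ker_of f \<cdot> z') (x \<cdot> coim_of f)"
        using kernel_comp_iso[of "ker_of f" "coim_of f" z' N] e0 z'(1) kernel_of_monic_comp[OF iso_monic[OF x], of "coim_of f" "ker_of f \<cdot> z'"]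
        by (simp add: ses_def)
    qed
    then have se': "(ker_of f \<cdot> z', x \<cdot> coim_of f) \<in> short_exacts C N A I" by (simp add: short_exacts_iff)
    have "(i0 \<cdot> x') \<cdot> x \<cdot> coim_of f = f" using comp_under[OF x'(2), of "coim_of f"] i0(3) by simp
    then show "\<exists>d\<in>?D.
      ?R d t"
      using se se' x'(2) z'(2) t by (intro bexI[of _ "((i0 \<cdot> x', y \<cdot> cok_of f), (ker_of f \<cdot> z', x \<cdot> coim_of f))"]) simp_all
  next
    fix d d' t assume dd: "d \<in> ?D"
      "d' \<in> ?D"
      and t: "t \<in> ?T"
      and R: "?R d t"
      "?R d' t"
    obtain i p n e i' p' n' e' where d: "d = ((i, p), (n, e))" "d' = ((i', p'), (n', e'))" by (metis prod.exhaust)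
    obtain x y z where tt: "t = (x, y, z)" and x: "x \<in> isos C (im_ob f) I" and z: "z \<in> isos C (ker_ob f) N" using t by auto
    have D: "i \<in> Arr C" "Dom C i = I" "Cod C i = B" "n \<in> Arr C" "Dom C n = N" "Cod C n = A"
      "i' \<in> Arr C" "Dom C i' = I" "Cod C i' = B" "n' \<in> Arr C" "Dom C n' = N" "Cod C n' = A"
      using dd unfolding d by (auto simp: short_exacts_iff dest: sesD)
    have "i = i'" using epic_cancel[OF iso_epic[OF x], of i i'] R d tt isosD[OF x] D by simp
    moreover have "n = n'" using epic_cancel[OF iso_epic[OF z], of n n'] R d tt isosD[OF z] D by simp
    ultimately show "d = d'" using R d by simp
  next
    fix d t t' assume dd: "d \<in> ?D"
      and t: "t \<in> ?T"
      and t': "t' \<in> ?T"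
      and R: "?R d t"
      "?R d t'"
    obtain i p n e where d: "d = ((i, p), (n, e))" by (metis prod.exhaust)
    obtain x y z x' y' z' where tt: "t = (x, y, z)" "t' = (x', y', z')" by (metis prod.exhaust)
    have iso: "x \<in> isos C (im_ob f) I" "x' \<in> isos C (im_ob f) I" "y \<in> isos C (cok_ob f) L" "y' \<in> isos C (cok_ob f) L"
      "z \<in> isos C (ker_ob f) N" "z' \<in> isos C (ker_ob f) N" using t t' tt by auto
    note D = isosD[OF iso(1)] isosD[OF iso(2)] isosD[OF iso(3)] isosD[OF iso(4)] isosD[OF iso(5)] isosD[OF iso(6)]
    have n: "monic C n" "Dom C n = N" using dd d ses_monic by (auto simp: short_exacts_iff)
    have "x = x'" using epic_cancel[OF ses_epic[OF e0], of x x'] R d tt D by simp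
    moreover have "y = y'" using epic_cancel[OF cok_epic[OF c0], of y y'] R d tt D by simp
    moreover have "z = z'" using monic_cancel[OF n(1), of z z'] n(2) R d tt D by simp
    ultimately show "t = t'" using tt by simp
  qed
  then show ?thesis by (simp add: card_cartesian_product mult.assoc)
qed

text \<open>Pairs are sorted by their composite A -> I -> B.\<close>

lemma card_short_exacts_pair:
  "card (short_exacts C I B L) * card (short_exacts C N A I)
    = (\<Sum>f\<in>homset C A B. card (isos C (im_ob f) I) * card (isos C (cok_ob f) L) * card (isos C (ker_ob f) N))"
proof -
  let ?E = "short_exacts C I B L \<times> short_exacts C N A I"
  define F where "F = (\<lambda>((i, p :: 'm), (n :: 'm, e)). i \<cdot> e)"
  have "F ` ?E \<subseteq> homset C A B"
  proof
    fix f assume "f \<in> F ` ?E"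
    then obtain i p n e where "(i, p) \<in> short_exacts C I B L" "(n, e) \<in> short_exacts C N A I" "f = i \<cdot> e" by (auto simp: F_def)
    then show "f \<in> homset C A B" using sesD[of i p] sesD[of n e] by (auto simp: short_exacts_iff)
  qed
  then have "card ?E = (\<Sum>f\<in>homset C A B. card {e \<in> ?E. F e = f})" by (intro card_eq_sum_fibers) auto
  also have "\<dots> = (\<Sum>f\<in>homset C A B. card (isos C (im_ob f) I) * card (isos C (cok_ob f) L) * card (isos C (ker_ob f) N))"
  proof (rule sum.cong[OF refl])
    fix f assume f: "f \<in> homset C A B"
    have "{e \<in> ?E. F e = f} = {((i, p), (n, e)). (i, p) \<in> short_exacts C I B L \<and> (n, e) \<in> short_exacts C N A I \<and> i \<cdot> e = f}"
      by (auto simp: F_def)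
    then show "card {e \<in> ?E. F e = f} = card (isos C (im_ob f) I) * card (isos C (cok_ob f) L) * card (isos C (ker_ob f) N)"
      using card_image_data[OF f] by simp
  qed
  finally show ?thesis by (simp add: card_cartesian_product)
qed

lemma card_short_exacts_iso:
  assumes "isomorphic C A A'" "isomorphic C B B'" "X \<in> Ob C"
  shows "card (short_exacts C A X B) = card (short_exacts C A' X B')"
proof -
  have h: "hall C B A X = hall C B' A' X"
    unfolding hall_def using assms isomorphic_trans isomorphic_sym by (metis (no_types, lifting))
  have "aut_card C A = aut_card C A'" if "isomorphic C A A'" for A A'
    using card_isos[OF that] card_isos[OF isomorphic_sym[OF that]] card_isos_sym[of A A'] by simp
  then show ?thesis using h assms card_short_exacts[OF assms(3)] by simp
qed

lemma isos_over_aut: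
  assumes "Y \<in> Ob C" "x \<in> Iso C"
  shows "real (card (isos C Y (rep x))) / real (aut_card C (rep x)) = (if x = cls Y then 1 else 0)"
  using isomorphic_rep_iff[OF assms] card_isos card_isos_not rep_Iso[OF assms(2)] aut_card_pos by auto

text \<open>\<open>g\<close> is arbitrary so that one computation serves all three ways of pairing
  two Hall factors, which permute \<open>L\<close>, \<open>I\<close>, \<open>N\<close> in the
  exponent. An arrow contributes to exactly one triple of classes, since by
  \<open>isos_over_aut\<close> the quotients of cardinalities are indicators.\<close>

lemma image_sum:
  fixes g :: "'o \<Rightarrow> 'o \<Rightarrow> 'o \<Rightarrow> real"
  assumes Ob: "A \<in> Ob C" "B \<in> Ob C" "X \<in> Ob C"
    and g: "\<And>L I N L' I' N'. \<lbrakk>isomorphic C L L'; isomorphic C I I'; isomorphic C N N'\<rbrakk> \<Longrightarrow> g L I N = g L' I' N'"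
  shows "((\<lambda>(l, i, n). g (rep l) (rep i) (rep n) *
      (card (short_exacts C (rep i) B (rep l)) * card (short_exacts C (rep n) A (rep i)) * card (short_exacts C (rep l) X (rep n))) /
      (aut_card C (rep l) * aut_card C (rep i) * aut_card C (rep n)))
    has_sum (\<Sum>f\<in>homset C A B. g (cok_ob f) (im_ob f) (ker_ob f) * card (short_exacts C (cok_ob f) X (ker_ob f))))
    (Iso C \<times> Iso C \<times> Iso C)" (is "(?T has_sum _) _")
proof -
  define u where "u f = (\<lambda>(l, i, n). if l = cls (cok_ob f) \<and> i = cls (im_ob f) \<and> n = cls (ker_ob f)
    then g (rep l) (rep i) (rep n) * card (short_exacts C (rep l) X (rep n)) else 0)" for f
  have "(u f has_sum g (cok_ob f) (im_ob f) (ker_ob f) * card (short_exacts C (cok_ob f) X (ker_ob f))) (Iso C \<times> Iso C \<times> Iso C)"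
    if f: "f \<in> homset C A B" for f
  proof -
    have fA: "f \<in> Arr C" using f by simp
    note Ob = ker_cok_ob[OF fA]
    note iso = isomorphic_rep[OF Ob(1)] isomorphic_rep[OF Ob(2)] isomorphic_rep[OF Ob(3)]
    have "g (cok_ob f) (im_ob f) (ker_ob f) * card (short_exacts C (cok_ob f) X (ker_ob f)) = u f (cls (cok_ob f), cls (im_ob f), cls (ker_ob f))"
      using g[OF iso(2,3,1)] card_short_exacts_iso[OF iso(2,1) \<open>X \<in> Ob C\<close>] by (simp add: u_def)
    then show ?thesis
      by (subst has_sum_finite_support[of "{(cls (cok_ob f), cls (im_ob f), cls (ker_ob f))}"])
        (use cls_Iso Ob in \<open>auto simp: u_def split: if_splits\<close>)
  qed
  then have "((\<lambda>t. \<Sum>f\<in>homset C A B. u f t) has_sum (\<Sum>f\<in>homset C A B. g (cok_ob f) (im_ob f) (ker_ob f) * card (short_exacts C (cok_ob f) X (ker_ob f))))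
      (Iso C \<times> Iso C \<times> Iso C)" by (intro has_sum_finite_sum) (auto simp del: hom_iff)
  moreover have "?T t = (\<Sum>f\<in>homset C A B. u f t)" if t: "t \<in> Iso C \<times> Iso C \<times> Iso C" for t
  proof -
    obtain l i n where [simp]: "t = (l, i, n)" and lin: "l \<in> Iso C" "i \<in> Iso C" "n \<in> Iso C" using t by auto
    let ?S = "real (card (short_exacts C (rep l) X (rep n)))" and ?g = "g (rep l) (rep i) (rep n)"
    have "?T t = (\<Sum>f\<in>homset C A B. ?g * ?S * (real (card (isos C (im_ob f) (rep i))) / real (aut_card C (rep i))) *
        (real (card (isos C (cok_ob f) (rep l))) / real (aut_card C (rep l))) * (real (card (isos C (ker_ob f) (rep n))) / real (aut_card C (rep n))))"
    proof -
      let ?a = "real (aut_card C (rep l)) * real (aut_card C (rep i)) * real (aut_card C (rep n))"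
      have P: "real (card (short_exacts C (rep i) B (rep l)) * card (short_exacts C (rep n) A (rep i)))
        = (\<Sum>f\<in>homset C A B. real (card (isos C (im_ob f) (rep i))) * real (card (isos C (cok_ob f) (rep l))) * real (card (isos C (ker_ob f) (rep n))))"
        by (simp add: card_short_exacts_pair del: of_nat_mult hom_iff) simp
      have "?T t = ?g * ?S / ?a * real (card (short_exacts C (rep i) B (rep l)) * card (short_exacts C (rep n) A (rep i)))"
        by simp
      also have "\<dots> = (\<Sum>f\<in>homset C A B. ?g * ?S / ?a *
          (real (card (isos C (im_ob f) (rep i))) * real (card (isos C (cok_ob f) (rep l))) * real (card (isos C (ker_ob f) (rep n)))))"
        unfolding P by (rule sum_distrib_left)
      finally show ?thesis by (simp add: mult_ac)
    qed
    also have "\<dots> = (\<Sum>f\<in>homset C A B. u f t)"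
    proof (rule sum.cong[OF refl])
      fix f assume "f \<in> homset C A B"
      then have fA: "f \<in> Arr C" by simp
      show "?g * ?S * (real (card (isos C (im_ob f) (rep i))) / real (aut_card C (rep i))) *
        (real (card (isos C (cok_ob f) (rep l))) / real (aut_card C (rep l))) * (real (card (isos C (ker_ob f) (rep n))) / real (aut_card C (rep n))) = u f t"
        by (simp add: isos_over_aut lin ker_cok_ob[OF fA] u_def)
    qed
    finally show ?thesis .
  qed
  ultimately show ?thesis by (subst has_sum_cong) auto
qed

end

section \<open>Crosses\<close>

context linear_abelian_category
begin

text \<open>For a pushout of two monics, the second edge is monic as well; its cokernel is induced
  by \<open>e\<close> on one summand and zero on the other.\<close>

lemma pushout_monic_other:
  assumes s: "ses C \<iota> c" and s': "ses C U \<eta>" and \<rho>: "\<rho> \<in> Arr C" "Dom C \<rho> = Cod C \<iota>" "Cod C \<rho> = Cod C U"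
    "Cod C \<eta> = Cod C c" "\<eta> \<cdot> \<rho> = c"
    and \<sigma>: "ses C \<sigma> e" "Dom C \<sigma> = Dom C \<iota>" "Cod C \<sigma> = Dom C U" "U \<cdot> \<sigma> = \<rho> \<cdot> \<iota>"
  shows "\<exists>\<eta>'. ses C \<rho> \<eta>' \<and> Cod C \<eta>' = Cod C e \<and> \<eta>' \<cdot> U = e"
proof -
  note [simp] = sesD[OF s] sesD[OF s'] sesD[OF \<sigma>(1)] \<rho>(1-4) \<sigma>(2,3)
  have De [simp]: "Dom C e = Dom C U" using sesD[OF \<sigma>(1)] by simp
  have \<sigma>A: "\<sigma> \<in> Arr C" by simp
  have g: "e \<in> Arr C" "nul (Cod C \<iota>) (Cod C e) \<in> Arr C" "Dom C e = Dom C U" "Dom C (nul (Cod C \<iota>) (Cod C e)) = Cod C \<iota>"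
    "Cod C e = Cod C (nul (Cod C \<iota>) (Cod C e))" "e \<cdot> \<sigma> = nul (Cod C \<iota>) (Cod C e) \<cdot> \<iota>" by simp_all
  obtain \<eta>' where \<eta>': "\<eta>' \<in> Arr C" "Dom C \<eta>' = Cod C U" "Cod C \<eta>' = Cod C e" "\<eta>' \<cdot> U = e" "\<eta>' \<cdot> \<rho> = nul (Cod C \<iota>) (Cod C e)"
    by (rule pushout_desc[OF s s' \<rho> \<sigma>A \<sigma>(2-4) g])
  note [simp] = \<eta>'(1-3)
  have m: "monic C \<rho>"
  proof (rule monicI)
    fix y assume y: "y \<in> Arr C" "Cod C y = Dom C \<rho>" "\<rho> \<cdot> y = nul (Dom C y) (Cod C \<rho>)"
    have "c \<cdot> y = nul (Dom C y) (Cod C c)" using comp_under[OF \<rho>(5), of y] y by simp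
    then obtain z where z: "z \<in> Arr C" "Dom C z = Dom C y" "Cod C z = Dom C \<iota>" "\<iota> \<cdot> z = y"
      using ses_lift[OF s, of y] y by auto
    have "U \<cdot> \<sigma> \<cdot> z = nul (Dom C y) (Cod C U)" using comp_under[OF \<sigma>(4), of z] z y by simp
    then have "\<sigma> \<cdot> z = nul (Dom C y) (Dom C U)" using monic_zero[OF ses_monic[OF s'], of "\<sigma> \<cdot> z"] z by simp
    then have "z = nul (Dom C z) (Dom C \<iota>)" using monic_zero[OF ses_monic[OF \<sigma>(1)], of z] z by simp
    then have "\<iota> \<cdot> z = \<iota> \<cdot> nul (Dom C z) (Dom C \<iota>)" by simp
    then show "y = nul (Dom C y) (Dom C \<rho>)" using z y by simp
  qed simp
  have "is_cokernel C \<eta>' \<rho>"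
  proof (rule is_cokernelI)
    show "epic C \<eta>'" using epic_left[of \<eta>' U] \<eta>'(4) ses_epic[OF \<sigma>(1)] by simp
    show "\<eta>' \<cdot> \<rho> = nul (Dom C \<rho>) (Cod C \<eta>')" using \<eta>' by simp
    fix g assume g: "g \<in> Arr C" "Dom C g = Cod C \<rho>" "g \<cdot> \<rho> = nul (Dom C \<rho>) (Cod C g)"
    have "g \<cdot> U \<cdot> \<sigma> = nul (Dom C \<sigma>) (Cod C g)" using comp_under[OF g(3), of \<iota>] g \<sigma>(4) by simp
    then obtain h where h: "h \<in> Arr C" "Cod C h = Cod C g" "Dom C h = Cod C e" "h \<cdot> e = g \<cdot> U"
      using ses_desc[OF \<sigma>(1), of "g \<cdot> U"] g by auto
    have "h \<cdot> \<eta>' = g"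
      by (rule pushout_ext[OF s s' \<rho>]) (use h g \<eta>' in simp_all)
    then show "\<exists>u. u \<in> Arr C \<and> Cod C u = Cod C g \<and> Dom C u = Cod C \<eta>' \<and> u \<cdot> \<eta>' = g" using h by auto
  qed simp_all
  then show ?thesis using sesI1[OF m] \<eta>' by blast
qed

text \<open>By the third isomorphism theorem, \<open>X\<close> modulo \<open>a\<close> is the
  pushout of \<open>U\<close> along \<eta>. The five lemma identifies it with
  \<open>Cod \<tau>\<close>, by comparison with the sequence (m, q).\<close>

lemma completion_restrict:
  assumes k: "is_kernel C k \<gamma>" and c: "is_cokernel C c \<gamma>" and UW: "(U, W) \<in> completions C \<gamma> k c X"
    and a: "ses C a \<eta>" "Cod C a = Dom C \<gamma>" and \<tau>: "\<tau> \<in> Arr C" "Dom C \<tau> = Cod C \<gamma>"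
    and m: "ses C m q" "Dom C m = Cod C \<eta>" "Cod C m = Cod C \<tau>" "Cod C q = Cod C c"
    and eq: "\<tau> \<cdot> \<gamma> = m \<cdot> \<eta>" "q \<cdot> \<tau> = c"
  shows "ses C (U \<cdot> a) (\<tau> \<cdot> W)"
proof -
  have UWD: "U \<in> Arr C" "W \<in> Arr C" "Dom C U = Dom C \<gamma>" "Cod C U = X" "Dom C W = X" "Cod C W = Cod C \<gamma>" and WU: "W \<cdot> U = \<gamma>"
    using completionsD[OF UW] by auto
  note sU = completion_ses1[OF k UW c]
  have [simp]: "Dom C q = Cod C \<tau>" "Dom C \<eta> = Dom C \<gamma>" using sesD[OF m(1)] sesD[OF a(1)] m(3) a(2) by simp_all
  note [simp] = kerD[OF k] cokD[OF c] UWD sesD[OF sU] sesD[OF a(1)] sesD[OF m(1)] a(2) \<tau> m(2-4)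
  have \<eta>: "\<eta> \<in> Arr C" "Dom C \<eta> = Dom C U" by simp_all
  obtain \<nu> \<rho> \<zeta> where s0: "ses C \<nu> \<zeta>" and \<nu>: "Dom C \<nu> = Cod C \<eta>" and \<rho>: "\<rho> \<in> Arr C" "Dom C \<rho> = Cod C U" "Cod C \<rho> = Cod C \<nu>"
    "Cod C \<zeta> = Cod C (c \<cdot> W)" and eq0: "\<nu> \<cdot> \<eta> = \<rho> \<cdot> U" and \<zeta>\<rho>: "\<zeta> \<cdot> \<rho> = c \<cdot> W"
    by (rule pushout_exists[OF sU \<eta>])
  have [simp]: "Dom C \<nu> = Cod C \<eta>" "\<rho> \<in> Arr C" "Dom C \<rho> = X" "Cod C \<rho> = Cod C \<nu>" "Cod C \<zeta> = Cod C c" using \<nu> \<rho> by simp_all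
  note [simp] = sesD[OF s0]
  have cok: "is_cokernel C \<rho> (U \<cdot> a)" by (rule pushout_is_cokernel[OF sU a(1) _ s0 \<rho> \<zeta>\<rho> \<nu> eq0]) simp
  have g: "m \<in> Arr C" "\<tau> \<cdot> W \<in> Arr C" "Dom C m = Dom C \<nu>" "Dom C (\<tau> \<cdot> W) = Cod C U" "Cod C m = Cod C (\<tau> \<cdot> W)"
    "m \<cdot> \<eta> = (\<tau> \<cdot> W) \<cdot> U" using eq(1) WU by simp_all
  obtain w where w: "w \<in> Arr C" "Dom C w = Cod C \<nu>" "Cod C w = Cod C m" "w \<cdot> \<nu> = m" "w \<cdot> \<rho> = \<tau> \<cdot> W"
    by (rule pushout_desc[OF sU s0 \<rho> \<zeta>\<rho> \<eta> \<nu>[symmetric] eq0 g])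
  have qw: "q \<cdot> w = \<zeta>"
  proof (rule pushout_ext[OF sU s0 \<rho> \<zeta>\<rho>])
    show "(q \<cdot> w) \<cdot> \<nu> = \<zeta> \<cdot> \<nu>" using w by simp
    show "(q \<cdot> w) \<cdot> \<rho> = \<zeta> \<cdot> \<rho>" using w \<zeta>\<rho> comp_under[OF eq(2), of W] by simp
  qed (use w in simp_all)
  have "w \<in> isos C (Cod C \<nu>) (Cod C m)" using five[OF s0 m(1), of w] w qw by simp
  then have "is_cokernel C (\<tau> \<cdot> W) (U \<cdot> a)" using iso_comp_cokernel[OF cok, of w] w by simp
  then show ?thesis using sesI1 monic_comp[OF ses_monic[OF a(1)] ses_monic[OF sU]] by simp
qed

text \<open>Both kernels, mapped into the middle object, are the intersection of the subobjects
  \<open>u\<close> and \<open>r\<close>.\<close>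

lemma cross_kernel_iso:
  assumes s: "ses C u w" and s': "ses C r s" and eq: "Cod C r = Cod C u" "s \<cdot> u = \<phi>" "w \<cdot> r = \<mu>"
    and k: "is_kernel C k \<phi>" and k': "is_kernel C k' \<mu>"
  shows "\<exists>\<alpha>\<in>isos C (Dom C k) (Dom C k'). u \<cdot> k = r \<cdot> k' \<cdot> \<alpha>"
proof -
  have half: "\<exists>\<alpha>. \<alpha> \<in> Arr C \<and> Dom C \<alpha> = Dom C k \<and> Cod C \<alpha> = Dom C k' \<and> u \<cdot> k = r \<cdot> k' \<cdot> \<alpha>"
    if s: "ses C u w" and s': "ses C r s" and eq: "Cod C r = Cod C u" "s \<cdot> u = \<phi>" "w \<cdot> r = \<mu>"
    and k: "is_kernel C k \<phi>" and k': "is_kernel C k' \<mu>" for u w r s \<phi> \<mu> k k'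
  proof -
    have [simp]: "u \<in> Arr C" "w \<in> Arr C" "r \<in> Arr C" "s \<in> Arr C" "Dom C w = Cod C u" "Dom C s = Cod C u" "Cod C r = Cod C u"
      using sesD[OF s] sesD[OF s'] eq(1) by auto
    have [simp]: "k \<in> Arr C" "Cod C k = Dom C u" "k' \<in> Arr C" "Cod C k' = Dom C r"
      using kerD[OF k] kerD[OF k'] eq(2,3) by auto
    have "s \<cdot> u \<cdot> k = nul (Dom C k) (Cod C s)" using comp_under[OF eq(2), of k] kerD[OF k] eq(2) by auto
    then obtain x where x: "x \<in> Arr C" "Dom C x = Dom C k" "Cod C x = Dom C r" "r \<cdot> x = u \<cdot> k"
      using ses_lift[OF s', of "u \<cdot> k"] by auto
    have "\<mu> \<cdot> x = nul (Dom C x) (Cod C \<mu>)"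
    proof -
      have "(w \<cdot> r) \<cdot> x = nul (Dom C x) (Cod C (w \<cdot> r))" using x ses_comp_zero[OF s, of k] by simp
      then show ?thesis by (simp only: eq(3))
    qed
    moreover have "Cod C x = Dom C \<mu>" using x eq(3) by auto
    ultimately obtain \<alpha> where "\<alpha> \<in> Arr C" "Dom C \<alpha> = Dom C x" "Cod C \<alpha> = Dom C k'" "k' \<cdot> \<alpha> = x"
      using ker_lift[OF k', of x] x(1) by auto
    then show ?thesis using x by (intro exI[of _ \<alpha>]) simp
  qed
  obtain \<alpha> where \<alpha>: "\<alpha> \<in> Arr C" "Dom C \<alpha> = Dom C k" "Cod C \<alpha> = Dom C k'" "u \<cdot> k = r \<cdot> k' \<cdot> \<alpha>"
    using half[OF s s' eq k k'] by blast
  obtain \<beta> where \<beta>: "\<beta> \<in> Arr C" "Dom C \<beta> = Dom C k'" "Cod C \<beta> = Dom C k" "r \<cdot> k' = u \<cdot> k \<cdot> \<beta>"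
    using half[OF s' s eq(1)[symmetric] eq(3,2) k' k] by blast
  have [simp]: "u \<in> Arr C" "r \<in> Arr C" "Cod C r = Cod C u" using sesD[OF s] sesD[OF s'] eq(1) by auto
  have [simp]: "k \<in> Arr C" "Cod C k = Dom C u" "k' \<in> Arr C" "Cod C k' = Dom C r"
    using kerD[OF k] kerD[OF k'] eq(2,3) sesD[OF s] sesD[OF s'] by auto
  have m: "monic C (u \<cdot> k)" "monic C (r \<cdot> k')"
    using monic_comp[OF ker_monic[OF k] ses_monic[OF s]] monic_comp[OF ker_monic[OF k'] ses_monic[OF s']] by simp_all
  have "(u \<cdot> k) \<cdot> \<beta> \<cdot> \<alpha> = (u \<cdot> k) \<cdot> Id C (Dom C k)"
  proof -
    have "(u \<cdot> k) \<cdot> \<beta> \<cdot> \<alpha> = (u \<cdot> k \<cdot> \<beta>) \<cdot> \<alpha>" using \<alpha>(1-3) \<beta>(1-3) by simp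
    also have "\<dots> = u \<cdot> k" unfolding \<beta>(4)[symmetric] using \<alpha> by simp
    finally show ?thesis by simp
  qed
  moreover have "(r \<cdot> k') \<cdot> \<alpha> \<cdot> \<beta> = (r \<cdot> k') \<cdot> Id C (Dom C k')"
  proof -
    have "(r \<cdot> k') \<cdot> \<alpha> \<cdot> \<beta> = (r \<cdot> k' \<cdot> \<alpha>) \<cdot> \<beta>" using \<alpha>(1-3) \<beta>(1-3) by simp
    also have "\<dots> = r \<cdot> k'" unfolding \<alpha>(4)[symmetric] using \<beta> by simp
    finally show ?thesis by simp
  qed
  ultimately have "\<beta> \<cdot> \<alpha> = Id C (Dom C k)" "\<alpha> \<cdot> \<beta> = Id C (Dom C k')"
    using monic_cancel[OF m(1), of "\<beta> \<cdot> \<alpha>" "Id C (Dom C k)"] monic_cancel[OF m(2), of "\<alpha> \<cdot> \<beta>" "Id C (Dom C k')"] \<alpha>(1-3) \<beta>(1-3)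
    by simp_all
  then have "\<alpha> \<in> isos C (Dom C k) (Dom C k')" using \<alpha> \<beta> by (intro isosI[of \<alpha> \<beta>]) simp_all
  then show ?thesis using \<alpha>(4) by blast
qed

lemmas cross_cokernel_iso = linear_abelian_category.cross_kernel_iso[OF opp_lac, unfolded opp_rules]

definition crosses :: "'o \<Rightarrow> 'o \<Rightarrow> 'o \<Rightarrow> 'o \<Rightarrow> 'm \<Rightarrow> 'm \<Rightarrow> 'o \<Rightarrow> (('m \<times> 'm) \<times> ('m \<times> 'm)) set" where
  "crosses L N L' N' \<phi> \<mu> X = {((u, w), (r, s)). (u, w) \<in> short_exacts C L X N \<and> (r, s) \<in> short_exacts C L' X N' \<and>
     s \<cdot> u = \<phi> \<and> w \<cdot> r = \<mu>}"

text \<open>A cross glues \<open>L\<close> and \<open>L'\<close> along an isomorphism \<open>\<alpha>\<close> of \<open>ker \<phi>\<close> with \<open>ker \<mu>\<close>, and likewise \<open>N\<close> and \<open>N'\<close>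
  along \<open>\<beta>\<close>. Crosses with given \<open>\<alpha>\<close> and \<open>\<beta>\<close> are the completions of the induced arrow from the pushout of
  \<open>L\<close> and \<open>L'\<close> to the pullback of \<open>N\<close> and \<open>N'\<close>.\<close>

definition glued_crosses :: "'o \<Rightarrow> 'o \<Rightarrow> 'o \<Rightarrow> 'o \<Rightarrow> 'm \<Rightarrow> 'm \<Rightarrow> 'm \<Rightarrow> 'm \<Rightarrow> 'o \<Rightarrow> (('m \<times> 'm) \<times> ('m \<times> 'm)) set" where
  "glued_crosses L N L' N' \<phi> \<mu> \<alpha> \<beta> X = {((u, w), (r, s)). ((u, w), (r, s)) \<in> crosses L N L' N' \<phi> \<mu> X \<and>
     u \<cdot> ker_of \<phi> = r \<cdot> ker_of \<mu> \<cdot> \<alpha> \<and> cok_of \<phi> \<cdot> s = \<beta> \<cdot> cok_of \<mu> \<cdot> w}"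

text \<open>The two inclusions into \<open>X\<close> amount to one arrow out of the pushout
  \<open>S\<close>, and the two quotients to one arrow into the pullback \<open>T\<close>. Their
  composite \<gamma> is the same for all crosses with the given gluing data.\<close>

lemma glued_crosses_completions:
  assumes \<phi>: "\<phi> \<in> homset C L N'" and \<mu>: "\<mu> \<in> homset C L' N"
    and \<alpha>: "\<alpha> \<in> isos C (ker_ob \<phi>) (ker_ob \<mu>)" and \<beta>: "\<beta> \<in> isos C (cok_ob \<mu>) (cok_ob \<phi>)"
  shows "\<exists>\<gamma> k c. is_kernel C k \<gamma> \<and> is_cokernel C c \<gamma> \<and> Dom C k = ker_ob \<phi> \<and> Cod C c = cok_ob \<phi> \<and>
    (\<forall>X\<in>Ob C. card (glued_crosses L N L' N' \<phi> \<mu> \<alpha> \<beta> X) = card (completions C \<gamma> k c X))"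
proof -
  have \<phi>D [simp]: "\<phi> \<in> Arr C" "Dom C \<phi> = L" "Cod C \<phi> = N'" and \<mu>D [simp]: "\<mu> \<in> Arr C" "Dom C \<mu> = L'" "Cod C \<mu> = N"
    using \<phi> \<mu> by auto
  have Ob [simp]: "L \<in> Ob C" "N \<in> Ob C" "L' \<in> Ob C" "N' \<in> Ob C" using Ob_of_arr \<phi>D \<mu>D by blast+
  note [simp] = isosD[OF \<alpha>] isosD[OF \<beta>]
  obtain i where i: "ses C i (cok_of \<phi>)" "Dom C i = im_ob \<phi>" "i \<cdot> coim_of \<phi> = \<phi>" by (rule image_part[OF \<phi>D(1)])
  obtain j0 where j0: "ses C j0 (cok_of \<mu>)" "Dom C j0 = im_ob \<mu>" "j0 \<cdot> coim_of \<mu> = \<mu>" by (rule image_part[OF \<mu>D(1)])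
  define k1 k2 c1 c2 where "k1 = ker_of \<phi>" and "k2 = ker_of \<mu> \<cdot> \<alpha>" and "c1 = cok_of \<phi>" and "c2 = \<beta> \<cdot> cok_of \<mu>"
  define e1 e2 where "e1 = coim_of \<phi>" and "e2 = coim_of \<mu>"
  define Z Q where "Z = ker_ob \<phi>" and "Q = cok_ob \<phi>"
  have ArrD [simp]: "k1 \<in> Arr C" "Dom C k1 = Z" "Cod C k1 = L" "k2 \<in> Arr C" "Dom C k2 = Z" "Cod C k2 = L'"
    "c1 \<in> Arr C" "Dom C c1 = N'" "Cod C c1 = Q" "c2 \<in> Arr C" "Dom C c2 = N" "Cod C c2 = Q"
    "e1 \<in> Arr C" "Dom C e1 = L" "Cod C e1 = im_ob \<phi>" "e2 \<in> Arr C" "Dom C e2 = L'" "Cod C e2 = im_ob \<mu>"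
    by (simp_all add: k1_def k2_def c1_def c2_def e1_def e2_def Z_def Q_def)
  have [simp]: "Z \<in> Ob C" "Q \<in> Ob C" by (simp_all add: Z_def Q_def)
  have kk: "is_kernel C k1 \<phi>" "is_kernel C k2 \<mu>"
    using ker_of[OF \<phi>D(1)] kernel_comp_iso[OF ker_of[OF \<mu>D(1)], of \<alpha> "ker_ob \<phi>"] \<alpha> by (simp_all add: k1_def k2_def)
  have cc: "is_cokernel C c1 \<phi>" "is_cokernel C c2 \<mu>"
    using cok_of[OF \<phi>D(1)] iso_comp_cokernel[OF cok_of[OF \<mu>D(1)], of \<beta> "cok_ob \<phi>"] \<beta> by (simp_all add: c1_def c2_def)
  have s1: "ses C k1 e1" using coim_of_ses[OF \<phi>D(1)] by (simp add: k1_def e1_def)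
  have epe2: "epic C e2" using ses_epic[OF coim_of_ses[OF \<mu>D(1)]] by (simp add: e2_def)
  have s2: "ses C k2 e2"
    using sesI2[OF epe2] kernel_comp_iso[of "ker_of \<mu>" e2 \<alpha> "ker_ob \<phi>"] coim_of_ses[OF \<mu>D(1)] \<alpha> by (simp add: ses_def k2_def e2_def)
  have t1: "ses C i c1" using i by (simp add: c1_def)
  have [simp]: "i \<in> Arr C" "Dom C i = im_ob \<phi>" "Cod C i = N'" "c1 \<cdot> i = nul (im_ob \<phi>) Q" using sesD[OF t1] i by auto
  have [simp]: "j0 \<in> Arr C" "Dom C j0 = im_ob \<mu>" "Cod C j0 = N" using sesD[OF j0(1)] j0(2) by auto
  have t2: "ses C j0 c2" using sesI1[OF ses_monic[OF j0(1)]] iso_comp_cokernel[of "cok_of \<mu>" j0 \<beta> "cok_ob \<phi>"] j0(1) \<beta>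
    by (simp add: ses_def c2_def)
  have ie: "i \<cdot> e1 = \<phi>" "j0 \<cdot> e2 = \<mu>" using i j0 by (simp_all add: e1_def e2_def)
  have e1k [simp]: "e1 \<cdot> k1 = nul Z (im_ob \<phi>)" "e2 \<cdot> k2 = nul Z (im_ob \<mu>)" "c2 \<cdot> j0 = nul (im_ob \<mu>) Q"
    using sesD[OF s1] sesD[OF s2] sesD[OF t2] by simp_all
  have \<phi>k [simp]: "\<phi> \<cdot> k1 = nul Z N'" "\<mu> \<cdot> k2 = nul Z N" "c1 \<cdot> \<phi> = nul L Q" "c2 \<cdot> \<mu> = nul L' Q"
    using kerD[OF kk(1)] kerD[OF kk(2)] cokD[OF cc(1)] cokD[OF cc(2)] by simp_all
  have k1': "k1 \<in> Arr C" "Dom C k1 = Dom C k2" by simp_all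
  \<comment> \<open>\<open>S\<close> is formed from L and L' by identifying the kernels of \<phi>
    and \<mu> along \<alpha>.\<close>
  obtain a b \<eta> where sa: "ses C a \<eta>" and a0: "Dom C a = Cod C k1" and b0: "b \<in> Arr C" "Dom C b = Cod C k2" "Cod C b = Cod C a"
    "Cod C \<eta> = Cod C e2" and ab: "a \<cdot> k1 = b \<cdot> k2" and \<eta>b: "\<eta> \<cdot> b = e2"
    by (rule pushout_exists[OF s2 k1'])
  define S where "S = Cod C a"
  have [simp]: "a \<in> Arr C" "Dom C a = L" "Cod C a = S" "b \<in> Arr C" "Dom C b = L'" "Cod C b = S" "\<eta> \<in> Arr C" "Dom C \<eta> = S" "Cod C \<eta> = im_ob \<mu>"
    "\<eta> \<cdot> a = nul L (im_ob \<mu>)" using sesD[OF sa] a0 b0 by (simp_all add: S_def)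
  have c2': "Cod C k1 = Dom C a" by simp
  obtain \<eta>' where \<eta>': "ses C b \<eta>'" "Cod C \<eta>' = Cod C e1" "\<eta>' \<cdot> a = e1"
    using pushout_monic_other[OF s2 sa b0 \<eta>b s1 k1'(2) c2' ab] by blast
  have [simp]: "\<eta>' \<in> Arr C" "Dom C \<eta>' = S" "Cod C \<eta>' = im_ob \<phi>" "\<eta>' \<cdot> b = nul L' (im_ob \<phi>)" using sesD[OF \<eta>'(1)] \<eta>'(2) by simp_all
  note S_ext = pushout_ext[OF s2 sa b0 \<eta>b] and S_desc = pushout_desc[OF s2 sa b0 \<eta>b k1' c2' ab]
  have c2'': "c2 \<in> Arr C" "Cod C c2 = Cod C c1" by simp_all
  \<comment> \<open>Dually, \<open>T\<close> is the fibre product of N and N' over the common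
    cokernel \<open>Q\<close>.\<close>
  obtain \<tau>1 \<tau>2 \<theta> where s\<theta>: "ses C \<theta> \<tau>1" and \<tau>1: "Cod C \<tau>1 = Dom C c2" and \<tau>2: "\<tau>2 \<in> Arr C" "Cod C \<tau>2 = Dom C c1" "Dom C \<tau>2 = Dom C \<tau>1"
    "Dom C \<theta> = Dom C i" and c\<tau>: "c2 \<cdot> \<tau>1 = c1 \<cdot> \<tau>2" and \<tau>\<theta>: "\<tau>2 \<cdot> \<theta> = i"
    by (rule pullback_exists[OF t1 c2''])
  define T where "T = Dom C \<tau>1"
  have [simp]: "\<tau>1 \<in> Arr C" "Dom C \<tau>1 = T" "Cod C \<tau>1 = N" "\<tau>2 \<in> Arr C" "Dom C \<tau>2 = T" "Cod C \<tau>2 = N'" "\<theta> \<in> Arr C" "Dom C \<theta> = im_ob \<phi>" "Cod C \<theta> = T"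
    "\<tau>1 \<cdot> \<theta> = nul (im_ob \<phi>) N" using sesD[OF s\<theta>] \<tau>1 \<tau>2 by (simp_all add: T_def)
  have c1': "Dom C c2 = Cod C \<tau>1" by simp
  note T_ext = pullback_ext[OF t1 s\<theta> \<tau>2 \<tau>\<theta>] and T_lift = pullback_lift[OF t1 s\<theta> \<tau>2 \<tau>\<theta> c2'' c1' c\<tau>]
  have [simp]: "S \<in> Ob C" "T \<in> Ob C" using cod_in_Ob[of a] dom_in_Ob[of \<tau>1] by simp_all
  have d: "\<mu> \<in> Arr C" "nul L' N' \<in> Arr C" "Cod C \<mu> = Cod C \<tau>1" "Cod C (nul L' N') = Dom C c1" "Dom C \<mu> = Dom C (nul L' N')"
    "c2 \<cdot> \<mu> = c1 \<cdot> nul L' N'" by simp_all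
  \<comment> \<open>In a cross the composites L -> X -> N and L' -> X -> N' vanish while the other
    two are \<phi> and \<mu>. So \<gamma> must restrict to (0, \<phi>) on L, which is
    \<open>\<theta> \<cdot> e1\<close>, and to (\<mu>, 0) on L', which is \<delta>.\<close>
  obtain \<delta> where \<delta>: "\<delta> \<in> Arr C" "Cod C \<delta> = Dom C \<tau>1" "Dom C \<delta> = Dom C \<mu>" "\<tau>1 \<cdot> \<delta> = \<mu>" "\<tau>2 \<cdot> \<delta> = nul L' N'"
    by (rule T_lift[OF d])
  have [simp]: "\<delta> \<in> Arr C" "Cod C \<delta> = T" "Dom C \<delta> = L'" using \<delta> by simp_all
  have \<delta>k: "\<delta> \<cdot> k2 = nul Z T"
    by (rule T_ext) (use comp_under[OF \<delta>(4), of k2] comp_under[OF \<delta>(5), of k2] in simp_all)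
  have g: "\<theta> \<cdot> e1 \<in> Arr C" "\<delta> \<in> Arr C" "Dom C (\<theta> \<cdot> e1) = Dom C a" "Dom C \<delta> = Cod C k2" "Cod C (\<theta> \<cdot> e1) = Cod C \<delta>"
    "(\<theta> \<cdot> e1) \<cdot> k1 = \<delta> \<cdot> k2" using \<delta>k by simp_all
  obtain \<gamma> where \<gamma>: "\<gamma> \<in> Arr C" "Dom C \<gamma> = Cod C a" "Cod C \<gamma> = Cod C (\<theta> \<cdot> e1)" "\<gamma> \<cdot> a = \<theta> \<cdot> e1" "\<gamma> \<cdot> b = \<delta>"
    by (rule S_desc[OF g])
  have [simp]: "\<gamma> \<in> Arr C" "Dom C \<gamma> = S" "Cod C \<gamma> = T" using \<gamma> by simp_all
  have \<tau>\<gamma>: "\<tau>1 \<cdot> \<gamma> = j0 \<cdot> \<eta>" "\<tau>2 \<cdot> \<gamma> = i \<cdot> \<eta>'"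
    by (rule S_ext; use \<gamma>(4,5) ie \<delta>(4,5) \<eta>b \<eta>'(3) \<tau>\<theta> comp_under[of \<tau>1 \<theta> _ e1] comp_under[OF \<tau>\<theta>, of e1] in simp)+
  define k c where "k = a \<cdot> k1" and "c = c1 \<cdot> \<tau>2"
  have [simp]: "k \<in> Arr C" "Dom C k = Z" "Cod C k = S" "c \<in> Arr C" "Dom C c = T" "Cod C c = Q" by (simp_all add: k_def c_def)
  have K: "is_kernel C k \<gamma>"
  proof (rule is_kernelI)
    show "monic C k" unfolding k_def using monic_comp[OF ses_monic[OF s1] ses_monic[OF sa]] by simp
    show "\<gamma> \<cdot> k = nul (Dom C k) (Cod C \<gamma>)" unfolding k_def using comp_under[OF \<gamma>(4), of k1] by simp
    fix y assume y: "y \<in> Arr C" "Cod C y = Dom C \<gamma>" "\<gamma> \<cdot> y = nul (Dom C y) (Cod C \<gamma>)"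
    have "j0 \<cdot> \<eta> \<cdot> y = nul (Dom C y) N" using comp_under[OF \<tau>\<gamma>(1), of y] y by simp
    then have "\<eta> \<cdot> y = nul (Dom C y) (im_ob \<mu>)" using monic_zero[OF ses_monic[OF t2], of "\<eta> \<cdot> y"] y by simp
    then obtain z where z: "z \<in> Arr C" "Dom C z = Dom C y" "Cod C z = L" "a \<cdot> z = y"
      using ses_lift[OF sa, of y] y by auto
    have "\<theta> \<cdot> e1 \<cdot> z = nul (Dom C y) T" using comp_under[OF \<gamma>(4), of z] z y by simp
    then have "e1 \<cdot> z = nul (Dom C z) (im_ob \<phi>)" using monic_zero[OF ses_monic[OF s\<theta>], of "e1 \<cdot> z"] z by simp
    then obtain x where "x \<in> Arr C" "Dom C x = Dom C z" "Cod C x = Z" "k1 \<cdot> x = z"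
      using ses_lift[OF s1, of z] z by auto
    then show "\<exists>u. u \<in> Arr C \<and> Dom C u = Dom C y \<and> Cod C u = Dom C k \<and> k \<cdot> u = y"
      unfolding k_def using z by (intro exI[of _ x]) simp
  qed simp_all
  have C: "is_cokernel C c \<gamma>"
  proof (rule is_cokernelI)
    have "epic C (c2 \<cdot> \<tau>1)" using epic_comp[OF cok_epic[OF cc(2)] ses_epic[OF s\<theta>]] by simp
    then show "epic C c" unfolding c_def c\<tau> .
    show "c \<cdot> \<gamma> = nul (Dom C \<gamma>) (Cod C c)" unfolding c_def using \<tau>\<gamma>(2) comp_under[of c1 i _ \<eta>'] by simp
    fix g assume g: "g \<in> Arr C" "Dom C g = Cod C \<gamma>" "g \<cdot> \<gamma> = nul (Dom C \<gamma>) (Cod C g)"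
    have "(g \<cdot> \<theta>) \<cdot> e1 = nul L (Cod C g)" using comp_under[OF g(3), of a] g \<gamma>(4) by simp
    then have "g \<cdot> \<theta> = nul (im_ob \<phi>) (Cod C g)" using epic_zero[OF ses_epic[OF s1], of "g \<cdot> \<theta>"] g by simp
    then obtain h where h: "h \<in> Arr C" "Cod C h = Cod C g" "Dom C h = N" "h \<cdot> \<tau>1 = g"
      using ses_desc[OF s\<theta>, of g] g by auto
    have "g \<cdot> \<delta> = nul L' (Cod C g)" using comp_under[OF g(3), of b] g \<gamma>(5) by simp
    then have "h \<cdot> \<mu> = nul L' (Cod C h)" using comp_under[OF h(4), of \<delta>] h \<delta>(4) by simp
    then obtain l where l: "l \<in> Arr C" "Cod C l = Cod C h" "Dom C l = Q" "l \<cdot> c2 = h"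
      using cok_lift[OF cc(2), of h] h by auto
    have "l \<cdot> c = g" unfolding c_def c\<tau>[symmetric] using comp_under[OF l(4), of \<tau>1] h l by simp
    then show "\<exists>u. u \<in> Arr C \<and> Cod C u = Cod C g \<and> Dom C u = Cod C c \<and> u \<cdot> c = g" using l h by auto
  qed simp_all
  let ?R = "\<lambda>d UW. fst UW \<cdot> a = fst (fst d) \<and> fst UW \<cdot> b = fst (snd d) \<and> \<tau>1 \<cdot> snd UW = snd (fst d) \<and> \<tau>2 \<cdot> snd UW = snd (snd d)"
  have "card (glued_crosses L N L' N' \<phi> \<mu> \<alpha> \<beta> X) = card (completions C \<gamma> k c X)" if X: "X \<in> Ob C" for X
  proof (rule card_eq_by_relation[where R = ?R])
    fix d assume dG: "d \<in> glued_crosses L N L' N' \<phi> \<mu> \<alpha> \<beta> X"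
    obtain u w r s where d: "d = ((u, w), (r, s))" by (metis prod.exhaust)
    have uw: "(u, w) \<in> short_exacts C L X N" and rs: "(r, s) \<in> short_exacts C L' X N'"
      and eq: "s \<cdot> u = \<phi>" "w \<cdot> r = \<mu>" and ukr: "u \<cdot> k1 = r \<cdot> k2" and cs0: "c1 \<cdot> s = \<beta> \<cdot> cok_of \<mu> \<cdot> w"
      using dG unfolding d glued_crosses_def crosses_def by (simp_all add: k1_def k2_def c1_def)
    have su: "ses C u w" and sr: "ses C r s" using uw rs by (simp_all add: short_exacts_iff)
    have D: "Dom C u = L" "Cod C u = X" "Cod C w = N" "Dom C r = L'" "Cod C r = X" "Cod C s = N'" using uw rs by (simp_all add: short_exacts_iff)
    have [simp]: "u \<in> Arr C" "w \<in> Arr C" "r \<in> Arr C" "s \<in> Arr C" "Dom C w = X" "Dom C s = X" "w \<cdot> u = nul L N" "s \<cdot> r = nul L' N'"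
      using sesD[OF su] sesD[OF sr] D by auto
    note [simp] = D
    have cs: "c1 \<cdot> s = c2 \<cdot> w" using cs0 by (simp add: c2_def)
    have g: "u \<in> Arr C" "r \<in> Arr C" "Dom C u = Dom C a" "Dom C r = Cod C k2" "Cod C u = Cod C r" by simp_all
    obtain U where U: "U \<in> Arr C" "Dom C U = Cod C a" "Cod C U = Cod C u" "U \<cdot> a = u" "U \<cdot> b = r"
      by (rule S_desc[OF g ukr])
    have h: "w \<in> Arr C" "s \<in> Arr C" "Cod C w = Cod C \<tau>1" "Cod C s = Dom C c1" "Dom C w = Dom C s" by simp_all
    obtain W where W: "W \<in> Arr C" "Cod C W = Dom C \<tau>1" "Dom C W = Dom C w" "\<tau>1 \<cdot> W = w" "\<tau>2 \<cdot> W = s"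
      by (rule T_lift[OF h cs[symmetric]])
    have [simp]: "U \<in> Arr C" "Dom C U = S" "Cod C U = X" "W \<in> Arr C" "Cod C W = T" "Dom C W = X" using U W by simp_all
    have WU: "W \<cdot> U = \<gamma>"
    proof (rule S_ext)
      show "(W \<cdot> U) \<cdot> a = \<gamma> \<cdot> a"
      proof (rule T_ext)
        show "\<tau>1 \<cdot> (W \<cdot> U) \<cdot> a = \<tau>1 \<cdot> \<gamma> \<cdot> a" using U(4) \<gamma>(4) comp_under[OF W(4), of u] comp_under[of \<tau>1 \<theta> _ e1] by simp
        show "\<tau>2 \<cdot> (W \<cdot> U) \<cdot> a = \<tau>2 \<cdot> \<gamma> \<cdot> a" using U(4) \<gamma>(4) comp_under[OF W(5), of u] eq(1) comp_under[OF \<tau>\<theta>, of e1] ie by simp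
      qed simp_all
      show "(W \<cdot> U) \<cdot> b = \<gamma> \<cdot> b"
      proof (rule T_ext)
        show "\<tau>1 \<cdot> (W \<cdot> U) \<cdot> b = \<tau>1 \<cdot> \<gamma> \<cdot> b" using U(5) \<gamma>(5) comp_under[OF W(4), of r] eq(2) \<delta>(4) by simp
        show "\<tau>2 \<cdot> (W \<cdot> U) \<cdot> b = \<tau>2 \<cdot> \<gamma> \<cdot> b" using U(5) \<gamma>(5) comp_under[OF W(5), of r] \<delta>(5) by simp
      qed simp_all
    qed simp_all
    have Uk: "U \<cdot> k = u \<cdot> k1" unfolding k_def using comp_under[OF U(4), of k1] by simp
    have cW: "c \<cdot> W = c1 \<cdot> s" unfolding c_def using W(5) by simp
    \<comment> \<open>An arrow killed by \<open>W\<close> is killed by \<open>w\<close> and by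
      \<open>s\<close>; it therefore factors through \<open>u\<close>, with a factor that \<phi>
      kills.\<close>
    have "is_kernel C (U \<cdot> k) W"
    proof (rule is_kernelI)
      show "monic C (U \<cdot> k)" unfolding Uk using monic_comp[OF ker_monic[OF kk(1)] ses_monic[OF su]] by simp
      show "W \<cdot> U \<cdot> k = nul (Dom C (U \<cdot> k)) (Cod C W)" using comp_under[OF WU, of k] kerD[OF K] by simp
      fix x assume x: "x \<in> Arr C" "Cod C x = Dom C W" "W \<cdot> x = nul (Dom C x) (Cod C W)"
      have wx: "w \<cdot> x = nul (Dom C x) N" "s \<cdot> x = nul (Dom C x) N'"
        using comp_under[OF W(4), of x] comp_under[OF W(5), of x] x by simp_all
      obtain y where y: "y \<in> Arr C" "Dom C y = Dom C x" "Cod C y = L" "u \<cdot> y = x" using ses_lift[OF su, of x] wx x by auto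
      have "\<phi> \<cdot> y = nul (Dom C y) N'" using comp_under[OF eq(1), of y] y wx by simp
      then obtain z where "z \<in> Arr C" "Dom C z = Dom C y" "Cod C z = Z" "k1 \<cdot> z = y" using ker_lift[OF kk(1), of y] y by auto
      then show "\<exists>z. z \<in> Arr C \<and> Dom C z = Dom C x \<and> Cod C z = Dom C (U \<cdot> k) \<and> (U \<cdot> k) \<cdot> z = x"
        unfolding Uk using y by (intro exI[of _ z]) simp
    qed simp_all
    moreover have "is_cokernel C (c \<cdot> W) U"
    proof (rule is_cokernelI)
      show "epic C (c \<cdot> W)" unfolding cW using epic_comp[OF cok_epic[OF cc(1)] ses_epic[OF sr]] by simp
      show "(c \<cdot> W) \<cdot> U = nul (Dom C U) (Cod C (c \<cdot> W))" using WU cokD[OF C] by simp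
      fix x assume x: "x \<in> Arr C" "Dom C x = Cod C U" "x \<cdot> U = nul (Dom C U) (Cod C x)"
      have xu: "x \<cdot> u = nul L (Cod C x)" "x \<cdot> r = nul L' (Cod C x)"
        using comp_under[OF x(3), of a] comp_under[OF x(3), of b] x U(4,5) by simp_all
      obtain y where y: "y \<in> Arr C" "Cod C y = Cod C x" "Dom C y = N" "y \<cdot> w = x" using ses_desc[OF su, of x] xu x by auto
      have "y \<cdot> \<mu> = nul L' (Cod C y)" using comp_under[OF y(4), of r] y xu eq(2) by simp
      then obtain z where z: "z \<in> Arr C" "Cod C z = Cod C y" "Dom C z = Q" "z \<cdot> c2 = y" using cok_lift[OF cc(2), of y] y by auto
      have "z \<cdot> c \<cdot> W = x" unfolding cW cs using comp_under[OF z(4), of w] y z by simp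
      then show "\<exists>z. z \<in> Arr C \<and> Cod C z = Cod C x \<and> Dom C z = Cod C (c \<cdot> W) \<and> z \<cdot> c \<cdot> W = x"
        using y z by (intro exI[of _ z]) simp
    qed simp_all
    ultimately have "(U, W) \<in> completions C \<gamma> k c X" using WU by (simp add: completions_def)
    then show "\<exists>UW\<in>completions C \<gamma> k c X. ?R d UW"
      using U W d by (intro bexI[of _ "(U, W)"]) simp_all
  next
    fix UW assume "UW \<in> completions C \<gamma> k c X"
    then obtain U W where UW_eq: "UW = (U, W)" and UW: "(U, W) \<in> completions C \<gamma> k c X" by (cases UW) simp
    have [simp]: "U \<in> Arr C" "Dom C U = S" "Cod C U = X" "W \<in> Arr C" "Cod C W = T" "Dom C W = X" and WU: "W \<cdot> U = \<gamma>"
      using completionsD[OF UW] by auto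
    have x1: "Cod C a = Dom C \<gamma>" "\<tau>1 \<in> Arr C" "Dom C \<tau>1 = Cod C \<gamma>" "Dom C j0 = Cod C \<eta>" "Cod C j0 = Cod C \<tau>1" "Cod C c2 = Cod C c" "c2 \<cdot> \<tau>1 = c"
      using c\<tau> by (simp_all add: c_def)
    have x2: "Cod C b = Dom C \<gamma>" "\<tau>2 \<in> Arr C" "Dom C \<tau>2 = Cod C \<gamma>" "Dom C i = Cod C \<eta>'" "Cod C i = Cod C \<tau>2" "Cod C c1 = Cod C c" "c1 \<cdot> \<tau>2 = c"
      by (simp_all add: c_def)
    \<comment> \<open>Conversely, each of the two sequences is cut out of a completion by
      \<open>completion_restrict\<close>, applied to L and to L' as subobjects of
      \<open>S\<close>.\<close>
    have "ses C (U \<cdot> a) (\<tau>1 \<cdot> W)" by (rule completion_restrict[OF K C UW sa x1(1-3) t2 x1(4-6) \<tau>\<gamma>(1) x1(7)])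
    moreover have "ses C (U \<cdot> b) (\<tau>2 \<cdot> W)" by (rule completion_restrict[OF K C UW \<eta>'(1) x2(1-3) t1 x2(4-6) \<tau>\<gamma>(2) x2(7)])
    moreover have "(\<tau>2 \<cdot> W) \<cdot> U \<cdot> a = \<phi>"
      using comp_under[OF WU, of a] \<gamma>(4) comp_under[OF \<tau>\<theta>, of e1] ie by simp
    moreover have "(\<tau>1 \<cdot> W) \<cdot> U \<cdot> b = \<mu>" using comp_under[OF WU, of b] \<gamma>(5) \<delta>(4) by simp
    moreover have "(U \<cdot> a) \<cdot> k1 = (U \<cdot> b) \<cdot> k2" using ab by simp
    moreover have "c1 \<cdot> \<tau>2 \<cdot> W = c2 \<cdot> \<tau>1 \<cdot> W" using comp_under[OF c\<tau>, of W] by simp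
    ultimately have "((U \<cdot> a, \<tau>1 \<cdot> W), (U \<cdot> b, \<tau>2 \<cdot> W)) \<in> glued_crosses L N L' N' \<phi> \<mu> \<alpha> \<beta> X"
      unfolding glued_crosses_def crosses_def by (simp add: short_exacts_iff k1_def k2_def c1_def c2_def)
    then show "\<exists>d\<in>glued_crosses L N L' N' \<phi> \<mu> \<alpha> \<beta> X. ?R d UW"
      using UW_eq by (intro bexI[of _ "((U \<cdot> a, \<tau>1 \<cdot> W), (U \<cdot> b, \<tau>2 \<cdot> W))"]) simp_all
  next
    fix d UW UW' assume m: "UW \<in> completions C \<gamma> k c X" "UW' \<in> completions C \<gamma> k c X"
      and R: "?R d UW"
      "?R d UW'"
    obtain U W U' W' where eq: "UW = (U, W)" "UW' = (U', W')" by (cases UW, cases UW')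
    note D = completionsD[OF m(1)[unfolded eq]] completionsD[OF m(2)[unfolded eq]]
    have "U = U'" using S_ext[of U U'] D R eq by simp
    moreover have "W = W'" using T_ext[of W W'] D R eq by simp
    ultimately show "UW = UW'" using eq by simp
  qed (auto simp: prod_eq_iff)
  then show ?thesis using K C by (intro exI[of _ \<gamma>] exI[of _ k] exI[of _ c]) (simp add: Z_def Q_def)
qed

end

context hereditary_counting_category
begin

text \<open>Each cross induces exactly one gluing pair (\<alpha>, \<beta>), since
  \<open>r \<cdot> ker_of \<mu>\<close> is monic and \<open>cok_of \<mu> \<cdot> w\<close> is epic.
  For each pair the glued crosses are completions of an arrow whose kernel and cokernel do not
  depend on the pair, whence a constant factor \<open>chi\<close>.\<close>

theorem count_crosses:
  assumes \<phi>: "\<phi> \<in> homset C L N'" and \<mu>: "\<mu> \<in> homset C L' N"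
  shows "((\<lambda>x. real (card (crosses L N L' N' \<phi> \<mu> (rep x))) / real (aut_card C (rep x))) has_sum
    card (isos C (ker_ob \<phi>) (ker_ob \<mu>)) * card (isos C (cok_ob \<mu>) (cok_ob \<phi>)) * chi (cok_ob \<phi>) (ker_ob \<phi>)) (Iso C)"
proof -
  have \<phi>D [simp]: "\<phi> \<in> Arr C" "Dom C \<phi> = L" "Cod C \<phi> = N'" and \<mu>D [simp]: "\<mu> \<in> Arr C" "Dom C \<mu> = L'" "Cod C \<mu> = N"
    using \<phi> \<mu> by auto
  let ?A = "isos C (ker_ob \<phi>) (ker_ob \<mu>)" and ?B = "isos C (cok_ob \<mu>) (cok_ob \<phi>)"
  let ?Cr = "crosses L N L' N' \<phi> \<mu>" and ?G = "glued_crosses L N L' N' \<phi> \<mu>"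
  have fin: "finite (?Cr X)" for X
    by (rule finite_subset[of _ "short_exacts C L X N \<times> short_exacts C L' X N'"]) (auto simp: crosses_def)
  have ex: "\<exists>\<alpha>\<beta>. \<alpha>\<beta> \<in> ?A \<times> ?B \<and> d \<in> ?G (fst \<alpha>\<beta>) (snd \<alpha>\<beta>) X" if "d \<in> ?Cr X" for d X
  proof -
    obtain u w r s where d: "d = ((u, w), (r, s))" by (metis prod.exhaust)
    have h: "ses C u w" "ses C r s" "Cod C r = Cod C u" "s \<cdot> u = \<phi>" "w \<cdot> r = \<mu>" and D: "Dom C w = Dom C s"
      using that d sesD by (auto simp: crosses_def short_exacts_iff)
    obtain \<alpha> where \<alpha>: "\<alpha> \<in> ?A" "u \<cdot> ker_of \<phi> = r \<cdot> ker_of \<mu> \<cdot> \<alpha>"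
      using cross_kernel_iso[OF h ker_of[OF \<phi>D(1)] ker_of[OF \<mu>D(1)]] by auto
    obtain \<beta> where \<beta>: "\<beta> \<in> ?B" "cok_of \<phi> \<cdot> s = (\<beta> \<cdot> cok_of \<mu>) \<cdot> w"
      using cross_cokernel_iso[OF h(2,1) D h(4,5) cok_of[OF \<phi>D(1)] cok_of[OF \<mu>D(1)]] by auto
    have "Cod C w = N" "w \<in> Arr C" using that d sesD by (auto simp: crosses_def short_exacts_iff)
    then have "d \<in> ?G \<alpha> \<beta> X" using that d \<alpha> \<beta> isosD[OF \<beta>(1)] by (simp add: glued_crosses_def)
    then show ?thesis using \<alpha>(1) \<beta>(1) by (intro exI[of _ "(\<alpha>, \<beta>)"]) simp
  qed
  have uniq: "p = p'" if p: "p \<in> ?A \<times> ?B" "p' \<in> ?A \<times> ?B" and dG: "d \<in> ?G (fst p) (snd p) X" "d \<in> ?G (fst p') (snd p') X" for d p p' X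
  proof -
    obtain u w r s where d: "d = ((u, w), (r, s))" by (metis prod.exhaust)
    obtain \<alpha> \<beta> \<alpha>' \<beta>' where pp: "p = (\<alpha>, \<beta>)" "p' = (\<alpha>', \<beta>')" by (cases p, cases p')
    have iso: "\<alpha> \<in> ?A" "\<beta> \<in> ?B" "\<alpha>' \<in> ?A" "\<beta>' \<in> ?B" using p pp by auto
    note [simp] = isosD[OF iso(1)] isosD[OF iso(2)] isosD[OF iso(3)] isosD[OF iso(4)]
    have s: "ses C u w" "ses C r s" and D: "Dom C r = L'" "Cod C w = N"
      and eq: "r \<cdot> ker_of \<mu> \<cdot> \<alpha> = r \<cdot> ker_of \<mu> \<cdot> \<alpha>'" "\<beta> \<cdot> cok_of \<mu> \<cdot> w = \<beta>' \<cdot> cok_of \<mu> \<cdot> w"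
      using dG d pp by (auto simp: glued_crosses_def crosses_def short_exacts_iff)
    note [simp] = sesD[OF s(1)] sesD[OF s(2)] D
    have "monic C (r \<cdot> ker_of \<mu>)" using monic_comp[OF ker_monic[OF ker_of[OF \<mu>D(1)]] ses_monic[OF s(2)]] by simp
    then have "\<alpha> = \<alpha>'" using monic_cancel[of "r \<cdot> ker_of \<mu>" \<alpha> \<alpha>'] eq by simp
    moreover have "epic C (cok_of \<mu> \<cdot> w)" using epic_comp[OF cok_epic[OF cok_of[OF \<mu>D(1)]] ses_epic[OF s(1)]] by simp
    then have "\<beta> = \<beta>'" using epic_cancel[of "cok_of \<mu> \<cdot> w" \<beta> \<beta>'] eq by simp
    ultimately show ?thesis using pp by simp
  qed
  have sub: "?G \<alpha> \<beta> X \<subseteq> ?Cr X" for \<alpha> \<beta> X by (auto simp: glued_crosses_def)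
  have card: "card (?Cr X) = (\<Sum>p\<in>?A \<times> ?B. card (?G (fst p) (snd p) X))" for X
  proof -
    have "?Cr X = (\<Union>p\<in>?A \<times> ?B. ?G (fst p) (snd p) X)"
    proof
      show "?Cr X \<subseteq> (\<Union>p\<in>?A \<times> ?B. ?G (fst p) (snd p) X)" using ex by blast
    qed (use sub in blast)
    also have "card \<dots> = (\<Sum>p\<in>?A \<times> ?B. card (?G (fst p) (snd p) X))"
    proof (rule card_UN_disjoint)
      show "\<forall>p\<in>?A \<times> ?B. finite (?G (fst p) (snd p) X)" using finite_subset[OF sub fin] by blast
      show "\<forall>p\<in>?A \<times> ?B. \<forall>p'\<in>?A \<times> ?B. p \<noteq> p' \<longrightarrow> ?G (fst p) (snd p) X \<inter> ?G (fst p') (snd p') X = {}"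
        using uniq by blast
    qed simp
    finally show ?thesis .
  qed
  have "((\<lambda>x. \<Sum>p\<in>?A \<times> ?B. real (card (?G (fst p) (snd p) (rep x))) / real (aut_card C (rep x))) has_sum
      (\<Sum>p\<in>?A \<times> ?B. chi (cok_ob \<phi>) (ker_ob \<phi>))) (Iso C)"
  proof (rule has_sum_finite_sum)
    fix p assume "p \<in> ?A \<times> ?B"
    then have p: "fst p \<in> ?A" "snd p \<in> ?B" by auto
    obtain \<gamma> k c where kc: "is_kernel C k \<gamma>" "is_cokernel C c \<gamma>" "Dom C k = ker_ob \<phi>" "Cod C c = cok_ob \<phi>"
      and eq: "\<forall>X\<in>Ob C. card (?G (fst p) (snd p) X) = card (completions C \<gamma> k c X)"
      using glued_crosses_completions[OF \<phi> \<mu> p] by blast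
    show "((\<lambda>x. real (card (?G (fst p) (snd p) (rep x))) / real (aut_card C (rep x))) has_sum chi (cok_ob \<phi>) (ker_ob \<phi>)) (Iso C)"
      using count_completions[OF kc(1,2)] unfolding kc(3,4)
      by (rule has_sum_cong[THEN iffD1, rotated]) (use eq rep_Iso in simp)
  qed simp
  then show ?thesis by (simp add: card sum_divide_distrib card_cartesian_product)
qed

end

section \<open>Associativity\<close>

context linear_abelian_category
begin

lemma image_iso:
  assumes "monic C i" "epic C e" "Dom C i = Cod C e" "i \<cdot> e = f"
  shows "isomorphic C (Cod C e) (im_ob f)"
proof -
  note [simp] = monic_arr[OF assms(1)] epic_arr[OF assms(2)] assms(3)
  have f: "f \<in> Arr C" using assms(4) by auto
  have "is_kernel C (ker_of f) e" using ker_of[OF f] kernel_of_monic_comp[OF assms(1), of e "ker_of f"] assms(4) by simp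
  then have "is_cokernel C e (ker_of f)" using epic_cok_of_ker[OF assms(2)] by blast
  then show ?thesis
    using cokernel_unique[of "coim_of f" "ker_of f" e] coim_of_ses[OF f] f unfolding isomorphic_def ses_def by auto
qed

text \<open>Read \<open>kt\<close> as the inclusion of ker t and \<open>ph\<close> as the quotient
  by im h. The image of their composite is ker t modulo im h, and since \<open>pf\<close> is epic,
  im h is the image of \<open>q\<close> inside ker t.\<close>

lemma cokernel_of_middle:
  assumes kt: "monic C kt" and pf: "epic C pf" and q: "q \<in> Arr C" "Dom C q = Cod C pf" "Dom C kt = Cod C q"
    and ph: "is_cokernel C ph (kt \<cdot> q \<cdot> pf)" and e: "epic C e" and m: "monic C m" and me: "Dom C m = Cod C e" "m \<cdot> e = ph \<cdot> kt"
  shows "is_cokernel C e q"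
proof -
  have phD: "ph \<in> Arr C" "Dom C ph = Cod C kt" "ph \<cdot> kt \<cdot> q \<cdot> pf = nul (Dom C pf) (Cod C ph)"
    using cokD[OF ph] q monic_arr[OF kt] epic_arr[OF pf] by auto
  note [simp] = monic_arr[OF kt] epic_arr[OF pf] q monic_arr[OF m] epic_arr[OF e] me(1) phD(1,2)
  have De: "Dom C e = Cod C q" "Cod C m = Cod C ph" using arg_cong[OF me(2), of "Dom C"] arg_cong[OF me(2), of "Cod C"] by simp_all
  note [simp] = De
  obtain i1 where i1: "ses C i1 (cok_of q)" "Dom C i1 = im_ob q" "i1 \<cdot> coim_of q = q" by (rule image_part[OF q(1)])
  have [simp]: "i1 \<in> Arr C" "Dom C i1 = im_ob q" "Cod C i1 = Cod C q" using sesD[OF i1(1)] i1(2) q(1) by auto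
  have epi: "epic C (coim_of q \<cdot> pf)" using epic_comp[OF ses_epic[OF coim_of_ses[OF q(1)]] pf] by simp
  have mono: "monic C (kt \<cdot> i1)" using monic_comp[OF ses_monic[OF i1(1)] kt] by simp
  have "kt \<cdot> q \<cdot> pf = (kt \<cdot> i1) \<cdot> coim_of q \<cdot> pf" using comp_under[OF i1(3), of pf] by simp
  then have "is_cokernel C ph (kt \<cdot> i1)" using ph cokernel_of_comp_epic[OF epi, of "kt \<cdot> i1" ph] by simp
  then have K: "is_kernel C (kt \<cdot> i1) ph" by (rule monic_ker_of_cok[OF mono])
  obtain \<kappa> where \<kappa>: "ses C \<kappa> e" using ex_ses_epic[OF e] .
  have [simp]: "\<kappa> \<in> Arr C" "Cod C \<kappa> = Cod C q" "e \<cdot> \<kappa> = nul (Dom C \<kappa>) (Cod C e)" using sesD[OF \<kappa>] by auto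
  show ?thesis
  proof (rule is_cokernelI[OF e])
    have "m \<cdot> e \<cdot> q \<cdot> pf = (m \<cdot> e) \<cdot> q \<cdot> pf" by simp
    also have "\<dots> = nul (Dom C pf) (Cod C ph)" unfolding me(2) using phD(3) by simp
    finally have "e \<cdot> q \<cdot> pf = nul (Dom C pf) (Cod C e)" using monic_zero[OF m, of "e \<cdot> q \<cdot> pf"] by simp
    then show "e \<cdot> q = nul (Dom C q) (Cod C e)" using epic_zero[OF pf, of "e \<cdot> q"] by simp
    fix g assume g: "g \<in> Arr C" "Dom C g = Cod C q" "g \<cdot> q = nul (Dom C q) (Cod C g)"
    have "ph \<cdot> kt \<cdot> \<kappa> = (m \<cdot> e) \<cdot> \<kappa>" unfolding me(2) by simp
    then have "ph \<cdot> kt \<cdot> \<kappa> = nul (Dom C \<kappa>) (Cod C ph)" by simp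
    then obtain y where y: "y \<in> Arr C" "Dom C y = Dom C \<kappa>" "Cod C y = im_ob q" "(kt \<cdot> i1) \<cdot> y = kt \<cdot> \<kappa>"
      using ker_lift[OF K, of "kt \<cdot> \<kappa>"] by auto
    then have \<kappa>y: "i1 \<cdot> y = \<kappa>" using monic_cancel[OF kt, of "i1 \<cdot> y" \<kappa>] by simp
    have "(g \<cdot> i1) \<cdot> coim_of q = nul (Dom C q) (Cod C g)" using g i1(3) by simp
    then have "g \<cdot> i1 = nul (im_ob q) (Cod C g)" using epic_zero[OF ses_epic[OF coim_of_ses[OF q(1)]], of "g \<cdot> i1"] g by simp
    then have "g \<cdot> i1 \<cdot> y = nul (Dom C \<kappa>) (Cod C g)" using comp_under[of g i1 _ y] y g by simp
    then obtain u where "u \<in> Arr C" "Cod C u = Cod C g" "Dom C u = Cod C e" "u \<cdot> e = g"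
      using ses_desc[OF \<kappa>, of g] g \<kappa>y by auto
    then show "\<exists>u. u \<in> Arr C \<and> Cod C u = Cod C g \<and> Dom C u = Cod C e \<and> u \<cdot> e = g" by blast
  qed simp_all
qed

lemmas kernel_of_middle = linear_abelian_category.cokernel_of_middle[OF opp_lac, unfolded opp_rules]

text \<open>For \<open>h \<cdot> f = 0\<close> and \<open>t \<cdot> h = 0\<close> the arrow \<open>middle f t h\<close> from the cokernel of \<open>f\<close> to the kernel of \<open>t\<close> is
  the one induced by \<open>h\<close>.\<close>

definition middle :: "'m \<Rightarrow> 'm \<Rightarrow> 'm \<Rightarrow> 'm" where
  "middle f t h = (SOME \<phi>. \<phi> \<in> homset C (cok_ob f) (ker_ob t) \<and> ker_of t \<cdot> \<phi> \<cdot> cok_of f = h)"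

definition between :: "'m \<Rightarrow> 'm \<Rightarrow> 'm set" where
  "between f t = {h \<in> homset C (Cod C f) (Dom C t). h \<cdot> f = nul (Dom C f) (Dom C t) \<and> t \<cdot> h = nul (Cod C f) (Cod C t)}"

lemma middle:
  assumes f: "f \<in> Arr C" and t: "t \<in> Arr C" and h: "h \<in> between f t"
  shows "middle f t h \<in> homset C (cok_ob f) (ker_ob t)" "ker_of t \<cdot> middle f t h \<cdot> cok_of f = h"
proof -
  have [simp]: "h \<in> Arr C" "Dom C h = Cod C f" "Cod C h = Dom C t" and hf: "h \<cdot> f = nul (Dom C f) (Dom C t)" "t \<cdot> h = nul (Cod C f) (Cod C t)"
    using h by (auto simp: between_def)
  note [simp] = f t
  obtain h' where h': "h' \<in> Arr C" "Cod C h' = Dom C t" "Dom C h' = cok_ob f" "h' \<cdot> cok_of f = h"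
    using cok_lift[OF cok_of[OF f], of h] hf(1) by auto
  have "(t \<cdot> h') \<cdot> cok_of f = nul (Cod C f) (Cod C t)" using h' hf(2) by simp
  then have "t \<cdot> h' = nul (cok_ob f) (Cod C t)" using epic_zero[OF cok_epic[OF cok_of[OF f]], of "t \<cdot> h'"] h' by simp
  then obtain \<phi> where \<phi>: "\<phi> \<in> Arr C" "Dom C \<phi> = cok_ob f" "Cod C \<phi> = ker_ob t" "ker_of t \<cdot> \<phi> = h'"
    using ker_lift[OF ker_of[OF t], of h'] h' by auto
  have "ker_of t \<cdot> \<phi> \<cdot> cok_of f = h" using comp_under[OF \<phi>(4), of "cok_of f"] \<phi> h' by simp
  then have "\<exists>\<phi>. \<phi> \<in> homset C (cok_ob f) (ker_ob t) \<and> ker_of t \<cdot> \<phi> \<cdot> cok_of f = h" using \<phi> by auto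
  from someI_ex[OF this] show "middle f t h \<in> homset C (cok_ob f) (ker_ob t)" "ker_of t \<cdot> middle f t h \<cdot> cok_of f = h"
    unfolding middle_def by blast+
qed

text \<open>This lets a sum over arrows from a cokernel to a kernel become a sum over the next arrow
  of a complex.\<close>

lemma middle_bij:
  assumes f: "f \<in> Arr C" and t: "t \<in> Arr C"
  shows "bij_betw (middle f t) (between f t) (homset C (cok_ob f) (ker_ob t))"
proof (rule bij_betwI[where g = "\<lambda>\<phi>. ker_of t \<cdot> \<phi> \<cdot> cok_of f"])
  note [simp] = f t
  show "middle f t \<in> between f t \<rightarrow> homset C (cok_ob f) (ker_ob t)" using middle(1)[OF f t] by blast
  show in_between: "(\<lambda>\<phi>. ker_of t \<cdot> \<phi> \<cdot> cok_of f) \<in> homset C (cok_ob f) (ker_ob t) \<rightarrow> between f t"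
  proof
    fix \<phi> assume "\<phi> \<in> homset C (cok_ob f) (ker_ob t)"
    then have [simp]: "\<phi> \<in> Arr C" "Dom C \<phi> = cok_ob f" "Cod C \<phi> = ker_ob t" by auto
    have "t \<cdot> ker_of t \<cdot> \<phi> \<cdot> cok_of f = nul (Cod C f) (Cod C t)" using comp_under[of t "ker_of t" _ "\<phi> \<cdot> cok_of f"] by simp
    then show "ker_of t \<cdot> \<phi> \<cdot> cok_of f \<in> between f t" by (simp add: between_def)
  qed
  show "ker_of t \<cdot> middle f t h \<cdot> cok_of f = h" if "h \<in> between f t" for h using middle(2)[OF f t that] .
  show "middle f t (ker_of t \<cdot> \<phi> \<cdot> cok_of f) = \<phi>" if "\<phi> \<in> homset C (cok_ob f) (ker_ob t)" for \<phi>
  proof -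
    let ?h = "ker_of t \<cdot> \<phi> \<cdot> cok_of f"
    have h: "?h \<in> between f t" using in_between that by blast
    note m = middle[OF f t h]
    have D [simp]: "\<phi> \<in> Arr C" "Dom C \<phi> = cok_ob f" "Cod C \<phi> = ker_ob t"
      "middle f t ?h \<in> Arr C" "Dom C (middle f t ?h) = cok_ob f" "Cod C (middle f t ?h) = ker_ob t" using that m(1) by auto
    have "middle f t ?h \<cdot> cok_of f = \<phi> \<cdot> cok_of f"
      using monic_cancel[OF ker_monic[OF ker_of[OF t]], of "middle f t ?h \<cdot> cok_of f" "\<phi> \<cdot> cok_of f"] m(2) by simp
    then show ?thesis using epic_cancel[OF cok_epic[OF cok_of[OF f]], of "middle f t ?h" \<phi>] by simp
  qed
qed

text \<open>Both objects are the image of ker t -> cok h, that is, the homology where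
  \<open>h\<close> meets \<open>t\<close>: once as a quotient of ker t, once as a subobject of cok
  h.\<close>

lemma middle_homology:
  assumes f: "f \<in> Arr C" and m: "m \<in> Arr C" and h: "h \<in> between f t" and t: "t \<in> between h m"
  shows "isomorphic C (cok_ob (middle f t h)) (ker_ob (middle h m t))"
proof -
  have hA [simp]: "h \<in> Arr C" and tA [simp]: "t \<in> Arr C" and D [simp]: "Cod C h = Dom C t" "Dom C h = Cod C f" "Cod C t = Dom C m"
    using h t by (auto simp: between_def)
  note [simp] = f m
  note q = middle[OF f tA h] and q' = middle[OF hA m t]
  define x where "x = cok_of h \<cdot> ker_of t"
  have x [simp]: "x \<in> Arr C" "Dom C x = ker_ob t" "Cod C x = cok_ob h" by (simp_all add: x_def)
  obtain e n where en: "epic C e" "monic C n" "Dom C n = Cod C e" "n \<cdot> e = x" using image_factorization[OF x(1)] by blast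
  have ne: "n \<cdot> e = cok_of h \<cdot> ker_of t" using en(4) by (simp add: x_def)
  have qA: "middle f t h \<in> Arr C" "Dom C (middle f t h) = cok_ob f" "Cod C (middle f t h) = ker_ob t" using q(1) by auto
  have qA': "middle h m t \<in> Arr C" "Dom C (middle h m t) = cok_ob h" "Cod C (middle h m t) = ker_ob m" using q'(1) by auto
  have "is_cokernel C (cok_of h) (ker_of t \<cdot> middle f t h \<cdot> cok_of f)" unfolding q(2) by (rule cok_of) simp
  then have "is_cokernel C e (middle f t h)"
    by (intro cokernel_of_middle[OF ker_monic[OF ker_of[OF tA]] cok_epic[OF cok_of[OF f]] _ _ _ _ en(1-3) ne]) (use qA in simp_all)
  then have 1: "isomorphic C (cok_ob (middle f t h)) (Cod C e)"
    using cokernel_unique[of e "middle f t h" "cok_of (middle f t h)"] cok_of[OF qA(1)] qA unfolding isomorphic_def by auto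
  have "(ker_of m \<cdot> middle h m t) \<cdot> cok_of h = t" using q'(2) qA' by simp
  then have "is_kernel C (ker_of t) ((ker_of m \<cdot> middle h m t) \<cdot> cok_of h)" using ker_of[OF tA] by simp
  then have "is_kernel C n (middle h m t)"
    by (intro kernel_of_middle[OF cok_epic[OF cok_of[OF hA]] ker_monic[OF ker_of[OF m]] _ _ _ _ en(2,1) en(3)[symmetric] ne]) (use qA' in simp_all)
  then have "isomorphic C (Dom C n) (ker_ob (middle h m t))"
    using kernel_unique[of n "middle h m t" "ker_of (middle h m t)"] ker_of[OF qA'(1)] qA' unfolding isomorphic_def by auto
  then show ?thesis using 1 en(3) isomorphic_trans by metis
qed

lemma middle_image:
  assumes f: "f \<in> Arr C" and t: "t \<in> Arr C" and h: "h \<in> between f t"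
  shows "isomorphic C (im_ob (middle f t h)) (im_ob h)"
proof -
  note q = middle[OF f t h]
  note [simp] = f t
  have qA [simp]: "middle f t h \<in> Arr C" "Dom C (middle f t h) = cok_ob f" "Cod C (middle f t h) = ker_ob t" using q(1) by auto
  obtain i where i: "ses C i (cok_of (middle f t h))" "Dom C i = im_ob (middle f t h)" "i \<cdot> coim_of (middle f t h) = middle f t h"
    by (rule image_part[OF qA(1)])
  have [simp]: "i \<in> Arr C" "Cod C i = ker_ob t" using sesD[OF i(1)] by auto
  note [simp] = i(2)
  have m: "monic C (ker_of t \<cdot> i)" using monic_comp[OF ses_monic[OF i(1)] ker_monic[OF ker_of[OF t]]] by simp
  have e: "epic C (coim_of (middle f t h) \<cdot> cok_of f)" using epic_comp[OF ses_epic[OF coim_of_ses[OF qA(1)]] cok_epic[OF cok_of[OF f]]] by simp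
  have "(ker_of t \<cdot> i) \<cdot> coim_of (middle f t h) \<cdot> cok_of f = h"
    using comp_under[OF i(3), of "cok_of f"] q(2) by simp
  then show ?thesis using image_iso[OF m e] by simp
qed

end

context hereditary_counting_category
begin

definition cross_weight :: "'m \<Rightarrow> 'm \<Rightarrow> real" where
  "cross_weight \<phi> \<mu> = card (isos C (ker_ob \<phi>) (ker_ob \<mu>)) * card (isos C (cok_ob \<mu>) (cok_ob \<phi>)) * chi (cok_ob \<phi>) (ker_ob \<phi>)"

text \<open>Two short exact sequences with a common middle form a cross; sorting pairs by the two
  diagonal composites reduces the sum to \<open>count_crosses\<close>.\<close>

lemma short_exacts_pair_sum:
  "((\<lambda>x. real (card (short_exacts C L (rep x) N)) * real (card (short_exacts C L' (rep x) N')) / real (aut_card C (rep x))) has_sum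
    (\<Sum>\<phi>\<in>homset C L N'. \<Sum>\<mu>\<in>homset C L' N. cross_weight \<phi> \<mu>)) (Iso C)"
proof -
  let ?H = "homset C L N' \<times> homset C L' N"
  define F where "F = (\<lambda>((u :: 'm, w :: 'm), (r, s)). (s \<cdot> u, w \<cdot> r))"
  have card: "card (short_exacts C L X N) * card (short_exacts C L' X N') = (\<Sum>p\<in>?H. card (crosses L N L' N' (fst p) (snd p) X))" for X
  proof -
    let ?E = "short_exacts C L X N \<times> short_exacts C L' X N'"
    have "F ` ?E \<subseteq> ?H"
    proof
      fix p assume "p \<in> F ` ?E"
      then obtain u w r s where h: "(u, w) \<in> short_exacts C L X N" "(r, s) \<in> short_exacts C L' X N'" "p = (s \<cdot> u, w \<cdot> r)" by (auto simp: F_def)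
      then show "p \<in> ?H" using sesD[of u w] sesD[of r s] by (simp add: short_exacts_iff)
    qed
    then have "card ?E = (\<Sum>p\<in>?H. card {e \<in> ?E. F e = p})" by (intro card_eq_sum_fibers) auto
    moreover have "{e \<in> ?E. F e = p} = crosses L N L' N' (fst p) (snd p) X" for p by (auto simp: F_def crosses_def)
    ultimately show ?thesis by (simp add: card_cartesian_product)
  qed
  have "((\<lambda>x. \<Sum>p\<in>?H. real (card (crosses L N L' N' (fst p) (snd p) (rep x))) / real (aut_card C (rep x))) has_sum
      (\<Sum>p\<in>?H. cross_weight (fst p) (snd p))) (Iso C)"
    unfolding cross_weight_def by (intro has_sum_finite_sum count_crosses) (auto simp del: hom_iff)
  moreover have "real (card (short_exacts C L X N)) * real (card (short_exacts C L' X N')) / real (aut_card C X)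
      = (\<Sum>p\<in>?H. real (card (crosses L N L' N' (fst p) (snd p) X)) / real (aut_card C X))" for X
    by (simp only: of_nat_mult[symmetric] card) (simp add: sum_divide_distrib)
  moreover have "(\<Sum>\<phi>\<in>homset C L N'. \<Sum>\<mu>\<in>homset C L' N. cross_weight \<phi> \<mu>) = (\<Sum>p\<in>?H. cross_weight (fst p) (snd p))"
    by (simp only: sum.cartesian_product split_def)
  ultimately show ?thesis by (simp only:)
qed

lemma sum_middle:
  fixes G :: "'m \<Rightarrow> real"
  assumes "f \<in> Arr C" "t \<in> Arr C"
  shows "(\<Sum>\<phi>\<in>homset C (cok_ob f) (ker_ob t). G \<phi>) = (\<Sum>h\<in>between f t. G (middle f t h))"
  by (rule sum.reindex_bij_betw[OF middle_bij[OF assms], symmetric])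

end

section \<open>Delta-Hall numbers as sums over arrows, and rotation of complexes\<close>

context finitary_hereditary_category
begin

abbreviation v :: real where "v \<equiv> sqrt (real (card (carrier K)))"

abbreviation e3 :: "'o \<Rightarrow> 'o \<Rightarrow> 'o \<Rightarrow> int" where "e3 \<equiv> euler_form3 K C"

lemma euler_form3_iso:
  "\<lbrakk>isomorphic C L L'; isomorphic C I I'; isomorphic C N N'\<rbrakk> \<Longrightarrow> e3 L I N = e3 L' I' N'"
  unfolding euler_form3_def
  using euler_form_iso[of L L' I I'] euler_form_iso[of I I' I I'] euler_form_iso[of I I' N N'] euler_form_iso[of L L' N N'] by simp

text \<open>Each of \<open>L\<close>, \<open>I\<close>, \<open>N\<close> occurs in two of the three
  Hall numbers, so passing to short exact sequences divides by the square of each automorphism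
  number and moves these numbers from the numerator to the denominator.\<close>

lemma delta_hall_short_exacts:
  assumes "A \<in> Ob C" "B \<in> Ob C" "M \<in> Ob C"
  shows "delta_hall K C A B M = (\<Sum>\<^sub>\<infinity>(l, i, n) \<in> Iso C \<times> Iso C \<times> Iso C.
    v powi e3 (rep l) (rep i) (rep n) *
      (card (short_exacts C (rep i) B (rep l)) * card (short_exacts C (rep n) A (rep i)) * card (short_exacts C (rep l) M (rep n))) /
      (aut_card C (rep l) * aut_card C (rep i) * aut_card C (rep n)) / aut_card C M)"
  unfolding delta_hall_def
proof (rule infsum_cong, clarify)
  fix l i n assume lin: "l \<in> Iso C" "i \<in> Iso C" "n \<in> Iso C"
  have a: "real (aut_card C (rep l)) > 0" "real (aut_card C (rep i)) > 0" "real (aut_card C (rep n)) > 0" "real (aut_card C M) > 0"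
    using aut_card_pos rep_Iso lin assms by simp_all
  show "(let L = rep l; I = rep i; N = rep n in v powi e3 L I N *
          (real (aut_card C L) * real (aut_card C I) * real (aut_card C N) / real (aut_card C M)) *
          real (hall C L I B) * real (hall C N L M) * real (hall C I N A)) =
      v powi e3 (rep l) (rep i) (rep n) *
      (card (short_exacts C (rep i) B (rep l)) * card (short_exacts C (rep n) A (rep i)) * card (short_exacts C (rep l) M (rep n))) /
      (aut_card C (rep l) * aut_card C (rep i) * aut_card C (rep n)) / aut_card C M"
    using a by (simp add: Let_def card_short_exacts assms field_simps)
qed

text \<open>The form for a summation object in place of \<open>M\<close>: it becomes the middle of
  the counted sequences and brings the one division by its automorphism number that weighted counts
  require.\<close>

lemma delta_hall_via_AB:
  assumes "A \<in> Ob C" "B \<in> Ob C" "M \<in> Ob C"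
  shows "delta_hall K C A B M = (\<Sum>f\<in>homset C A B. v powi e3 (cok_ob f) (im_ob f) (ker_ob f) *
    card (short_exacts C (cok_ob f) M (ker_ob f))) / aut_card C M"
proof -
  have "((\<lambda>t. (case t of (l, i, n) \<Rightarrow> v powi e3 (rep l) (rep i) (rep n) *
      (card (short_exacts C (rep i) B (rep l)) * card (short_exacts C (rep n) A (rep i)) * card (short_exacts C (rep l) M (rep n))) /
      (aut_card C (rep l) * aut_card C (rep i) * aut_card C (rep n))) / aut_card C M) has_sum
    (\<Sum>f\<in>homset C A B. v powi e3 (cok_ob f) (im_ob f) (ker_ob f) *
    card (short_exacts C (cok_ob f) M (ker_ob f))) / aut_card C M) (Iso C \<times> Iso C \<times> Iso C)"
    by (intro has_sum_divide_const image_sum[OF assms]) (simp add: euler_form3_iso cong: euler_form3_iso)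
  from infsumI[OF this] show ?thesis
    unfolding delta_hall_short_exacts[OF assms] by (simp add: split_def)
qed

text \<open>The form for a summation object in place of \<open>A\<close>. For an arrow t : B -> M,
  the kernel, image and cokernel take the roles of \<open>I\<close>, \<open>L\<close> and
  \<open>N\<close>.\<close>

lemma delta_hall_via_BM:
  assumes "A \<in> Ob C" "B \<in> Ob C" "M \<in> Ob C"
  shows "delta_hall K C A B M = (\<Sum>t\<in>homset C B M. v powi e3 (im_ob t) (ker_ob t) (cok_ob t) *
    card (short_exacts C (cok_ob t) A (ker_ob t))) / aut_card C M"
proof -
  let ?T = "\<lambda>(l, i, n). v powi e3 (rep i) (rep n) (rep l) *
      (card (short_exacts C (rep i) M (rep l)) * card (short_exacts C (rep n) B (rep i)) * card (short_exacts C (rep l) A (rep n))) /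
      (aut_card C (rep l) * aut_card C (rep i) * aut_card C (rep n))"
  have bij: "bij_betw (\<lambda>(l, i, n). (n, l, i)) (Iso C \<times> Iso C \<times> Iso C) (Iso C \<times> Iso C \<times> Iso C)"
    by (rule bij_betwI[where g = "\<lambda>(n, l, i). (l, i, n)"]) auto
  have "(?T has_sum (\<Sum>t\<in>homset C B M. v powi e3 (im_ob t) (ker_ob t) (cok_ob t) *
    card (short_exacts C (cok_ob t) A (ker_ob t)))) (Iso C \<times> Iso C \<times> Iso C)"
    by (rule image_sum[OF assms(2,3,1), where g = "\<lambda>L I N. v powi e3 I N L"]) (simp add: euler_form3_iso cong: euler_form3_iso)
  from has_sum_divide_const[OF has_sum_reindex_bij_betw[OF bij, THEN iffD2, OF this], of "aut_card C M"] infsumI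
  show ?thesis
    unfolding delta_hall_short_exacts[OF assms] by (simp add: split_def mult_ac)
qed

text \<open>The form for a summation object in place of \<open>B\<close>. For an arrow m : M -> A,
  the kernel, image and cokernel take the roles of \<open>L\<close>, \<open>N\<close> and
  \<open>I\<close>.\<close>

lemma delta_hall_via_MA:
  assumes "A \<in> Ob C" "B \<in> Ob C" "M \<in> Ob C"
  shows "delta_hall K C A B M = (\<Sum>m\<in>homset C M A. v powi e3 (ker_ob m) (cok_ob m) (im_ob m) *
    card (short_exacts C (cok_ob m) B (ker_ob m))) / aut_card C M"
proof -
  let ?T = "\<lambda>(l, i, n). v powi e3 (rep n) (rep l) (rep i) *
      (card (short_exacts C (rep i) A (rep l)) * card (short_exacts C (rep n) M (rep i)) * card (short_exacts C (rep l) B (rep n))) /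
      (aut_card C (rep l) * aut_card C (rep i) * aut_card C (rep n))"
  have bij: "bij_betw (\<lambda>(l, i, n). (i, n, l)) (Iso C \<times> Iso C \<times> Iso C) (Iso C \<times> Iso C \<times> Iso C)"
    by (rule bij_betwI[where g = "\<lambda>(i, n, l). (l, i, n)"]) auto
  have "(?T has_sum (\<Sum>m\<in>homset C M A. v powi e3 (ker_ob m) (cok_ob m) (im_ob m) *
    card (short_exacts C (cok_ob m) B (ker_ob m)))) (Iso C \<times> Iso C \<times> Iso C)"
    by (rule image_sum[OF assms(3,1,2), where g = "\<lambda>L I N. v powi e3 N L I"]) (simp add: euler_form3_iso cong: euler_form3_iso)
  from has_sum_divide_const[OF has_sum_reindex_bij_betw[OF bij, THEN iffD2, OF this], of "aut_card C M"] infsumI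
  show ?thesis
    unfolding delta_hall_short_exacts[OF assms] by (simp add: split_def mult_ac)
qed

text \<open>In the Grothendieck group a source is kernel plus image and a target is image plus
  cokernel. The parameter \<open>J\<close> lets the image be replaced by that of the arrow of the
  complex inducing \<open>q\<close>.\<close>

lemma euler_form_arrow:
  assumes q: "q \<in> homset C L N" and im: "isomorphic C (im_ob q) J" and D: "D \<in> Ob C"
  shows "euler_form K C L D = euler_form K C (ker_ob q) D + euler_form K C J D"
    "euler_form K C D L = euler_form K C D (ker_ob q) + euler_form K C D J"
    "euler_form K C N D = euler_form K C J D + euler_form K C (cok_ob q) D"
    "euler_form K C D N = euler_form K C D J + euler_form K C D (cok_ob q)"
proof -
  have qD [simp]: "q \<in> Arr C" "Dom C q = L" "Cod C q = N" using q by auto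
  note s = coim_of_ses[OF qD(1)]
  obtain i where i: "ses C i (cok_of q)" "Dom C i = im_ob q" "i \<cdot> coim_of q = q" by (rule image_part[OF qD(1)])
  have [simp]: "Cod C i = N" using sesD[OF i(1)] by simp
  note J = euler_form_iso[OF im isomorphic_refl[OF D]] euler_form_iso[OF isomorphic_refl[OF D] im]
  show "euler_form K C L D = euler_form K C (ker_ob q) D + euler_form K C J D"
    "euler_form K C D L = euler_form K C D (ker_ob q) + euler_form K C D J"
    using euler_form_ses[OF s D] J by simp_all
  show "euler_form K C N D = euler_form K C J D + euler_form K C (cok_ob q) D"
    "euler_form K C D N = euler_form K C D J + euler_form K C D (cok_ob q)"
    using euler_form_ses[OF i(1) D] J i(2) by simp_all
qed

text \<open>The contribution of the 4-periodic complex \<open>A \<rightarrow> B \<rightarrow> C \<rightarrow> M \<rightarrow> A\<close> with arrows \<open>f\<close>, \<open>h\<close>, \<open>t\<close>, \<open>m\<close> is invariant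
  under rotation.\<close>

lemma rotation_invariance:
  assumes A: "f \<in> Arr C" "h \<in> Arr C" "t \<in> Arr C" "m \<in> Arr C"
    and cx: "h \<in> between f t" "t \<in> between h m" "m \<in> between t f" "f \<in> between m h"
  shows "v powi e3 (cok_ob f) (im_ob f) (ker_ob f) * v powi e3 (im_ob t) (ker_ob t) (cok_ob t) * cross_weight (middle f t h) (middle t f m)
    = v powi e3 (cok_ob h) (im_ob h) (ker_ob h) * v powi e3 (ker_ob m) (cok_ob m) (im_ob m) * cross_weight (middle h m t) (middle m h f)"
proof -
  define q1 q2 q3 q4 where "q1 = middle f t h" and "q2 = middle h m t" and "q3 = middle t f m" and "q4 = middle m h f"
  have q: "q1 \<in> homset C (cok_ob f) (ker_ob t)" "q2 \<in> homset C (cok_ob h) (ker_ob m)"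
    "q3 \<in> homset C (cok_ob t) (ker_ob f)" "q4 \<in> homset C (cok_ob m) (ker_ob h)"
    using middle(1) A cx by (simp_all only: q1_def q2_def q3_def q4_def)
  then have qA: "q1 \<in> Arr C" "q2 \<in> Arr C" "q3 \<in> Arr C" "q4 \<in> Arr C" by auto
  have im: "isomorphic C (im_ob q1) (im_ob h)" "isomorphic C (im_ob q2) (im_ob t)" "isomorphic C (im_ob q3) (im_ob m)" "isomorphic C (im_ob q4) (im_ob f)"
    using middle_image A cx by (simp_all only: q1_def q2_def q3_def q4_def)
  have hom: "isomorphic C (cok_ob q1) (ker_ob q2)" "isomorphic C (cok_ob q2) (ker_ob q3)" "isomorphic C (cok_ob q3) (ker_ob q4)" "isomorphic C (cok_ob q4) (ker_ob q1)"
    using middle_homology A cx by (simp_all only: q1_def q2_def q3_def q4_def)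
  show ?thesis
  proof (cases "isomorphic C (ker_ob q1) (ker_ob q3) \<and> isomorphic C (ker_ob q2) (ker_ob q4)")
    \<comment> \<open>Some pair of opposite homologies is then not isomorphic. That pair enters both
      cross weights, through kernels on one side and cokernels on the other, so both sides
      vanish.\<close>
    case False
    have "card (isos C (ker_ob q1) (ker_ob q3)) = 0 \<or> card (isos C (cok_ob q3) (cok_ob q1)) = 0"
      using False hom isomorphic_sym isomorphic_trans card_isos_not by metis
    moreover have "card (isos C (ker_ob q2) (ker_ob q4)) = 0 \<or> card (isos C (cok_ob q4) (cok_ob q2)) = 0"
      using False hom isomorphic_sym isomorphic_trans card_isos_not by metis
    ultimately show ?thesis unfolding cross_weight_def q1_def[symmetric] q2_def[symmetric] q3_def[symmetric] q4_def[symmetric] by auto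
  next
    case True
    \<comment> \<open>Opposite homologies now agree, so the four of them reduce to two classes that
      alternate around the complex.\<close>
    define Z Q where "Z = ker_ob q1" and "Q = ker_ob q2"
    have Z: "isomorphic C (ker_ob q3) Z" "isomorphic C (cok_ob q4) Z" "isomorphic C (cok_ob q2) Z"
      and Q: "isomorphic C (ker_ob q4) Q" "isomorphic C (cok_ob q1) Q" "isomorphic C (cok_ob q3) Q"
      unfolding Z_def Q_def using True hom isomorphic_sym isomorphic_trans by meson+
    have Ob [simp]: "Z \<in> Ob C" "Q \<in> Ob C" "im_ob f \<in> Ob C" "im_ob h \<in> Ob C" "im_ob t \<in> Ob C" "im_ob m \<in> Ob C"
      "cok_ob f \<in> Ob C" "ker_ob f \<in> Ob C" "cok_ob h \<in> Ob C" "ker_ob h \<in> Ob C" "cok_ob t \<in> Ob C" "ker_ob t \<in> Ob C" "cok_ob m \<in> Ob C" "ker_ob m \<in> Ob C"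
      "ker_ob q3 \<in> Ob C" "cok_ob q4 \<in> Ob C" "cok_ob q2 \<in> Ob C" "ker_ob q4 \<in> Ob C" "cok_ob q1 \<in> Ob C" "cok_ob q3 \<in> Ob C"
      using qA A by (simp_all add: Z_def Q_def)
    have isoE: "euler_form K C X D = euler_form K C Y D" "euler_form K C D X = euler_form K C D Y"
      if "isomorphic C X Y" "D \<in> Ob C" for X Y D
      using euler_form_iso isomorphic_refl that by blast+
    note ZQ = isoE[OF Z(1)] isoE[OF Z(2)] isoE[OF Z(3)] isoE[OF Q(1)] isoE[OF Q(2)] isoE[OF Q(3)]
    note E = euler_form_arrow[OF q(1) im(1), folded Z_def] euler_form_arrow[OF q(2) im(2), folded Q_def] euler_form_arrow[OF q(3) im(3)] euler_form_arrow[OF q(4) im(4)]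
    \<comment> \<open>Every kernel and cokernel of the complex splits into an image and a homology,
      and after expansion both sides are the same combination of Euler forms. The factor 2 arises
      because \<open>chi\<close> is a power of q, the square of \<open>v\<close>.\<close>
    have exps: "e3 (cok_ob f) (im_ob f) (ker_ob f) + e3 (im_ob t) (ker_ob t) (cok_ob t) - 2 * euler_form K C Q Z
      = e3 (cok_ob h) (im_ob h) (ker_ob h) + e3 (ker_ob m) (cok_ob m) (im_ob m) - 2 * euler_form K C Z Q"
      unfolding euler_form3_def by (simp add: E ZQ)
    have q0: "real (card (carrier K)) > 0" using card_field_gt_1 by simp
    then have v0: "v \<noteq> 0" by simp
    have "real (card (carrier K)) = v powi 2" using q0 by simp
    then have chi: "chi X Y = v powi (- 2 * euler_form K C X Y)" if "X \<in> Ob C" "Y \<in> Ob C" for X Y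
      using chi_eq_euler_form[OF that] by (simp add: power_int_mult[symmetric] power_int_minus power_int_mult)
    have "card (isos C (cok_ob q3) (cok_ob q1)) = card (isos C (ker_ob q2) (ker_ob q4))"
      "card (isos C (cok_ob q4) (cok_ob q2)) = card (isos C (ker_ob q1) (ker_ob q3))"
    proof -
      have iso_card: "card (isos C X Y) = card (isos C X' Y')" if "isomorphic C X Y" "isomorphic C X X'" "isomorphic C X' Y'" for X Y X' Y'
      proof -
        have "isomorphic C Y' Y" using that isomorphic_sym isomorphic_trans by meson
        then have "aut_card C Y = aut_card C Y'"
          using card_isos[of Y' Y] card_isos[OF isomorphic_sym, of Y' Y] card_isos_sym[of Y Y'] by simp
        then show ?thesis using card_isos that by simp
      qed
      show "card (isos C (cok_ob q3) (cok_ob q1)) = card (isos C (ker_ob q2) (ker_ob q4))"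
        "card (isos C (cok_ob q4) (cok_ob q2)) = card (isos C (ker_ob q1) (ker_ob q3))"
        using True hom isomorphic_sym isomorphic_trans by (intro iso_card; meson)+
    qed
    moreover have "chi (cok_ob q1) (ker_ob q1) = v powi (- 2 * euler_form K C Q Z)"
      using chi[of "cok_ob q1" Z] ZQ Ob unfolding Z_def[symmetric] by simp
    moreover have "chi (cok_ob q2) (ker_ob q2) = v powi (- 2 * euler_form K C Z Q)"
      using chi[of "cok_ob q2" Q] ZQ Ob unfolding Q_def[symmetric] by simp
    moreover have "v powi e3 (cok_ob f) (im_ob f) (ker_ob f) * v powi e3 (im_ob t) (ker_ob t) (cok_ob t) * v powi (- 2 * euler_form K C Q Z)
      = v powi e3 (cok_ob h) (im_ob h) (ker_ob h) * v powi e3 (ker_ob m) (cok_ob m) (im_ob m) * v powi (- 2 * euler_form K C Z Q)"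
      using exps v0 by (simp flip: power_int_add)
    ultimately show ?thesis
      unfolding cross_weight_def q1_def[symmetric] q2_def[symmetric] q3_def[symmetric] q4_def[symmetric] by simp
  qed
qed

lemma sum_homset_between:
  fixes G :: "'m \<Rightarrow> real"
  shows "(\<Sum>h\<in>between f t. G h) = (\<Sum>h\<in>homset C (Cod C f) (Dom C t). if h \<in> between f t then G h else 0)"
proof -
  have "between f t = {h \<in> homset C (Cod C f) (Dom C t). h \<in> between f t}" by (auto simp: between_def)
  then have "(\<Sum>h\<in>between f t. G h) = sum G {h \<in> homset C (Cod C f) (Dom C t). h \<in> between f t}" by simp
  also have "\<dots> = (\<Sum>h\<in>homset C (Cod C f) (Dom C t). if h \<in> between f t then G h else 0)"
    by (rule sum.inter_filter) simp
  finally show ?thesis .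
qed

text \<open>In suitable forms of the factors, the summation object occurs only as the common middle
  of two short exact sequences, divided once by its automorphism number. Summing over it leaves the
  two arrows that complete a 4-periodic complex.\<close>

theorem delta_hall_assoc:
  assumes Ob: "A \<in> Ob C" "B \<in> Ob C" "D \<in> Ob C" "M \<in> Ob C"
  shows "(\<Sum>\<^sub>\<infinity>x \<in> Iso C. delta_hall K C A B (rep x) * delta_hall K C (rep x) D M)
       = (\<Sum>\<^sub>\<infinity>y \<in> Iso C. delta_hall K C A (rep y) M * delta_hall K C B D (rep y))"
proof -
  let ?cx = "\<lambda>f h t m. h \<in> between f t \<and> t \<in> between h m \<and> m \<in> between t f \<and> f \<in> between m h"
  define P where "P f h t m = v powi e3 (cok_ob f) (im_ob f) (ker_ob f) * v powi e3 (im_ob t) (ker_ob t) (cok_ob t) *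
    cross_weight (middle f t h) (middle t f m)" for f h t m
  define P' where "P' f h t m = v powi e3 (cok_ob h) (im_ob h) (ker_ob h) * v powi e3 (ker_ob m) (cok_ob m) (im_ob m) *
    cross_weight (middle h m t) (middle m h f)" for f h t m
  have sums: "(\<Sum>\<phi>\<in>homset C (cok_ob f) (ker_ob t). \<Sum>\<mu>\<in>homset C (cok_ob t) (ker_ob f). cross_weight \<phi> \<mu>)
      = (\<Sum>h\<in>homset C X Y. \<Sum>m\<in>homset C Z W. if h \<in> between f t \<and> m \<in> between t f then cross_weight (middle f t h) (middle t f m) else 0)"
    if "f \<in> homset C W X" "t \<in> homset C Y Z" for f t X Y Z W
  proof -
    have D: "f \<in> Arr C" "Dom C f = W" "Cod C f = X" "t \<in> Arr C" "Dom C t = Y" "Cod C t = Z" using that by auto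
    show ?thesis
      unfolding sum_middle[OF D(1,4)] sum_middle[OF D(4,1)] sum_homset_between D
      by (intro sum.cong[OF refl]) (auto intro!: sum.cong sum.neutral[symmetric])
  qed
  \<comment> \<open>Either pair of conditions already says that all four consecutive composites of
    the complex vanish.\<close>
  have between4: "(h \<in> between f t \<and> m \<in> between t f) = ?cx f h t m" "(t \<in> between h m \<and> f \<in> between m h) = ?cx f h t m"
    if "f \<in> homset C A B" "h \<in> homset C B D" "t \<in> homset C D M" "m \<in> homset C M A" for f h t m
    using that by (auto simp: between_def)
  have "((\<lambda>x. \<Sum>f\<in>homset C A B. \<Sum>t\<in>homset C D M. (v powi e3 (cok_ob f) (im_ob f) (ker_ob f) * v powi e3 (im_ob t) (ker_ob t) (cok_ob t) / aut_card C M) *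
      (real (card (short_exacts C (cok_ob f) (rep x) (ker_ob f))) * real (card (short_exacts C (cok_ob t) (rep x) (ker_ob t))) / real (aut_card C (rep x)))) has_sum
    (\<Sum>f\<in>homset C A B. \<Sum>t\<in>homset C D M. (v powi e3 (cok_ob f) (im_ob f) (ker_ob f) * v powi e3 (im_ob t) (ker_ob t) (cok_ob t) / aut_card C M) *
      (\<Sum>\<phi>\<in>homset C (cok_ob f) (ker_ob t). \<Sum>\<mu>\<in>homset C (cok_ob t) (ker_ob f). cross_weight \<phi> \<mu>))) (Iso C)"
    (is "(?L has_sum ?l) _")
    by (intro has_sum_finite_sum has_sum_cmult_right short_exacts_pair_sum) auto
  moreover have "?L x = delta_hall K C A B (rep x) * delta_hall K C (rep x) D M" if x: "x \<in> Iso C" for x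
  proof -
    note X = rep_Iso(1)[OF x]
    show ?thesis
      unfolding delta_hall_via_AB[OF Ob(1,2) X] delta_hall_via_BM[OF X Ob(3,4)] sum_divide_distrib sum_product
      by (intro sum.cong[OF refl]) (simp add: mult_ac)
  qed
  ultimately have "((\<lambda>x. delta_hall K C A B (rep x) * delta_hall K C (rep x) D M) has_sum ?l) (Iso C)"
    by (subst has_sum_cong[symmetric]) auto
  then have L: "(\<Sum>\<^sub>\<infinity>x \<in> Iso C. delta_hall K C A B (rep x) * delta_hall K C (rep x) D M) = ?l" by (rule infsumI)
  have "((\<lambda>y. \<Sum>h\<in>homset C B D. \<Sum>m\<in>homset C M A. (v powi e3 (cok_ob h) (im_ob h) (ker_ob h) * v powi e3 (ker_ob m) (cok_ob m) (im_ob m) / aut_card C M) *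
      (real (card (short_exacts C (cok_ob h) (rep y) (ker_ob h))) * real (card (short_exacts C (cok_ob m) (rep y) (ker_ob m))) / real (aut_card C (rep y)))) has_sum
    (\<Sum>h\<in>homset C B D. \<Sum>m\<in>homset C M A. (v powi e3 (cok_ob h) (im_ob h) (ker_ob h) * v powi e3 (ker_ob m) (cok_ob m) (im_ob m) / aut_card C M) *
      (\<Sum>\<phi>\<in>homset C (cok_ob h) (ker_ob m). \<Sum>\<mu>\<in>homset C (cok_ob m) (ker_ob h). cross_weight \<phi> \<mu>))) (Iso C)"
    (is "(?R has_sum ?r) _")
    by (intro has_sum_finite_sum has_sum_cmult_right short_exacts_pair_sum) auto
  moreover have "?R y = delta_hall K C A (rep y) M * delta_hall K C B D (rep y)" if y: "y \<in> Iso C" for y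
  proof -
    note Y = rep_Iso(1)[OF y]
    have "?R y = delta_hall K C B D (rep y) * delta_hall K C A (rep y) M"
      unfolding delta_hall_via_AB[OF Ob(2,3) Y] delta_hall_via_MA[OF Ob(1) Y Ob(4)] sum_divide_distrib sum_product
      by (intro sum.cong[OF refl]) (simp add: mult_ac)
    then show ?thesis by (simp only: mult.commute)
  qed
  ultimately have "((\<lambda>y. delta_hall K C A (rep y) M * delta_hall K C B D (rep y)) has_sum ?r) (Iso C)"
    by (subst has_sum_cong[symmetric]) auto
  then have R: "(\<Sum>\<^sub>\<infinity>y \<in> Iso C. delta_hall K C A (rep y) M * delta_hall K C B D (rep y)) = ?r" by (rule infsumI)
  have "?l = (\<Sum>f\<in>homset C A B. \<Sum>t\<in>homset C D M. \<Sum>h\<in>homset C B D. \<Sum>m\<in>homset C M A. if ?cx f h t m then P f h t m / aut_card C M else 0)"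
    by (intro sum.cong[OF refl], subst sums, assumption+, unfold sum_distrib_left, intro sum.cong[OF refl])
      (simp only: between4(1), simp add: P_def)
  also have "\<dots> = (\<Sum>(f, t, h, m)\<in>homset C A B \<times> homset C D M \<times> homset C B D \<times> homset C M A. if ?cx f h t m then P f h t m / aut_card C M else 0)"
    by (simp only: sum.cartesian_product split_def)
  \<comment> \<open>The rotation: the pair (f, t), summed first on the left, and the pair (h, m)
    exchange their roles, and the summands agree by \<open>rotation_invariance\<close>.\<close>
  also have "\<dots> = (\<Sum>(h, m, t, f)\<in>homset C B D \<times> homset C M A \<times> homset C D M \<times> homset C A B. if ?cx f h t m then P' f h t m / aut_card C M else 0)"
    by (rule sum.reindex_bij_witness[where i = "\<lambda>(h, m, t, f). (f, t, h, m)" and j = "\<lambda>(f, t, h, m). (h, m, t, f)"])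
      (use rotation_invariance in \<open>auto simp: P_def P'_def\<close>)
  also have "\<dots> = (\<Sum>h\<in>homset C B D. \<Sum>m\<in>homset C M A. \<Sum>t\<in>homset C D M. \<Sum>f\<in>homset C A B. if ?cx f h t m then P' f h t m / aut_card C M else 0)"
    by (simp only: sum.cartesian_product split_def)
  also have "\<dots> = ?r"
    by (intro sum.cong[OF refl], subst sums, assumption+, unfold sum_distrib_left, intro sum.cong[OF refl])
      (simp only: between4(2), simp add: P'_def)
  finally show ?thesis using L R by simp
qed

end

theorem proposition2p1:
  fixes K :: "('k, 'r) ring_scheme" and \<A> :: "('o, 'm, 'k, 'z) lin_cat_scheme"
  assumes "finitary_hereditary_category K \<A>"
    and "A \<in> Ob \<A>" "B \<in> Ob \<A>" "C \<in> Ob \<A>" "M \<in> Ob \<A>"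
  shows "(\<Sum>\<^sub>\<infinity>x \<in> Iso \<A>. delta_hall K \<A> A B (rep x) * delta_hall K \<A> (rep x) C M)
       = (\<Sum>\<^sub>\<infinity>y \<in> Iso \<A>. delta_hall K \<A> A (rep y) M * delta_hall K \<A> B C (rep y))"
  using assms by (rule finitary_hereditary_category.delta_hall_assoc)

end
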